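(* Let $F:\mathcal C^{\mathrm{op}}\to\mathcal E$ be a functor from the opposite of a small category $\mathcal C$ to a Grothendieck topos $\mathcal E$ and let $P:\mathcal C\to\mathbf{Set}$ be a functor. Then the following three objects of $\mathcal E$ are naturally isomorphic: (i) the colimit $colim(F\circ\pi^f_P)$; (ii) $colim_{\mathcal E}(\overline F\circ\pi^f_{P_{\mathcal E}})\cong colim_{\mathcal E}(P_{\mathcal E}\circ\pi^f_{\overline F})$; (iii) the $\mathcal E$-indexed colimit $\underline{colim}_{\mathcal E}(\underline{P_{\mathcal E}}_{\mathcal E}\circ\underline{\pi^f_{\overline F}}_{\mathcal E})$, where $P_{\mathcal E}$ is the internal diagram in $[\mathbb C,\mathcal E]$ given by $\overline{\gamma_{\mathcal E}^{\ast}\circ P}$.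
   Context: $\gamma_{\mathcal E}:\mathcal E\to\mathbf{Set}$ is the unique geometric morphism, and $\mathbb C=\gamma_{\mathcal E}^{\ast}(\mathcal C)$ is the internal category in $\mathcal E$ obtained from $\mathcal C$. For an internal category $\mathbb D$ in $\mathcal E$, with object of objects $\mathbb D_0$, object of arrows $\mathbb D_1$ and domain and codomain arrows $d_0^{\mathbb D},d_1^{\mathbb D}:\mathbb D_1\to\mathbb D_0$, $[\mathbb D,\mathcal E]$ is the category of internal diagrams of shape $\mathbb D$ in $\mathcal E$. For a functor $G:\mathcal C\to\mathcal E$ (resp. $G:\mathcal C^{\mathrm{op}}\to\mathcal E$), $\overline G$ is the corresponding internal diagram under the equivalence $[\mathcal C,\mathcal E]\simeq[\mathbb C,\mathcal E]$ (resp. $[\mathcal C^{\mathrm{op}},\mathcal E]\simeq[\mathbb C^{\mathrm{op}},\mathcal E]$). For $D\in[\mathbb D,\mathcal E]$, $\pi^{opf}_D:\int^{opf}D\to\mathbb D$ is the internal discrete opfibration corresponding to $D$ (its internal category of elements), and the internal colimit $colim_{\mathcal E}(D)$ is the coequalizer in $\mathcal E$ of the domain and codomain arrows of the internal category $\int^{opf}D$. For $G\in[\mathbb D^{\mathrm{op}},\mathcal E]$, $\pi^f_G:\int^fG\to\mathbb D$ denotes the internal discrete fibration $(\pi^{opf}_G)^{\mathrm{op}}:(\int^{opf}G)^{\mathrm{op}}\to(\mathbb D^{\mathrm{op}})^{\mathrm{op}}=\mathbb D$. Thus $\pi^f_{\overline F}:\int^f\overline F\to\mathbb C$, $\pi^f_{P_{\mathcal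 E}}:\int^fP_{\mathcal E}\to\mathbb C^{\mathrm{op}}$, and (in the case $\mathcal E=\mathbf{Set}$) $\pi^f_P:\int^fP\to\mathcal C^{\mathrm{op}}$ is the projection functor from the opposite of the usual category of elements of $P$. For an internal functor $H:\mathbb D'\to\mathbb D$ and $D\in[\mathbb D,\mathcal E]$, $D\circ H\in[\mathbb D',\mathcal E]$ is the internal diagram whose discrete opfibration is the pullback of $\pi^{opf}_D$ along $H$. An $\mathcal E$-indexed category assigns a category to each object $E$ of $\mathcal E$ and functors (compatibly) to arrows of $\mathcal E$, contravariantly. The $\mathcal E$-externalization $\underline{\mathbb D}_{\mathcal E}$ of an internal category $\mathbb D$ has as fibre at $E$ the category with objects the arrows $E\to\mathbb D_0$ and morphisms the arrows $E\to\mathbb D_1$ with the appropriate domain and codomain. $\underline{\mathcal E}_{\mathcal E}$ has fibre $\mathcal E/E$ at $E$ and pullback functors as transition functors. $\underline{D}_{\mathcal E}:\underline{\mathbb D}_{\mathcal E}\to\underline{\mathcal E}_{\mathcal E}$ and $\underline H_{\mathcal E}$ denote the $\mathcal E$-indexed functors corresponding to an internal diagram $D$ and an internal functor $H$. The $\mathcal E$-indexed colimit $\underline{colim}_{\mathcal E}(\Gamma)$ of an indexed functor $\Gamma:\underline{\mathcal A}\to\underline{\mathcal E}_{\mathcal E}$ is the vertex $U$ of an indexed cocone $\mu_E:\Gamma_E\to\Delta({!}_E^{\ast}U)$ (compatible with pullback) which is universal and remains universal after localization at every object of $\mathcal E$. *)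

theory Defs
  imports Main "HOL-Library.FuncSet"
begin

unbundle cardinal_syntax

section \<open>Universes\<close>

text \<open>
  The category of sets is taken relative to a Grothendieck universe, represented by a type whose
  cardinality is an infinite regular strong limit: a subset is \<^emph>\<open>small\<close> if it has smaller
  cardinality than the type, and the small subsets are (up to bijection) the sets of the universe.
  Every inaccessible cardinal gives an instance. The cardinal of \<^typ>\<open>nat\<close> is admitted as well
  (the universe of hereditarily finite sets), which shows that the class is inhabited.
\<close>

class universe =
  assumes infinite_universe: "infinite (UNIV :: 'a set)"
    and universe_Pow: "|A :: 'a set| <o |UNIV :: 'a set| \<Longrightarrow> |Pow A| <o |UNIV :: 'a set|"
    and universe_UNION:
      "\<lbrakk> |I :: 'a set| <o |UNIV :: 'a set|; \<And>i. i \<in> I \<Longrightarrow> |X i :: 'a set| <o |UNIV :: 'a set| \<rbrakk>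
        \<Longrightarrow> |\<Union>i\<in>I. X i| <o |UNIV :: 'a set|"

definition small :: "'u::universe set \<Rightarrow> bool" where
  "small A \<longleftrightarrow> |A| <o |UNIV :: 'u set|"

lemma ordLess_UNIV_nat_iff: "|A :: 'b set| <o |UNIV :: nat set| \<longleftrightarrow> finite A"
proof
  assume "|A| <o |UNIV :: nat set|"
  then have "|A| <o natLeq" using card_of_nat by (rule ordLess_ordIso_trans)
  then show "finite A" by (simp add: finite_iff_ordLess_natLeq)
next
  assume "finite A"
  then have "|A| <o natLeq" by (simp add: finite_iff_ordLess_natLeq)
  then show "|A| <o |UNIV :: nat set|"
    using ordIso_symmetric[OF card_of_nat] by (rule ordLess_ordIso_trans)
qed

instance nat :: universe
  by standard (auto simp: ordLess_UNIV_nat_iff)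


section \<open>Categories, functors, natural transformations\<close>

record ('o, 'a) cat =
  Obj :: "'o set"
  Arr :: "'a set"
  Src :: "'a \<Rightarrow> 'o"
  Tgt :: "'a \<Rightarrow> 'o"
  Idn :: "'o \<Rightarrow> 'a"
  Comp :: "'a \<Rightarrow> 'a \<Rightarrow> 'a"  (infixl "\<cdot>\<index>" 70)

definition hom :: "('o, 'a) cat \<Rightarrow> 'o \<Rightarrow> 'o \<Rightarrow> 'a set" where
  "hom C x y = {f \<in> Arr C. Src C f = x \<and> Tgt C f = y}"

locale category =
  fixes C :: "('o, 'a) cat" (structure)
  assumes Src_Obj: "f \<in> Arr C \<Longrightarrow> Src C f \<in> Obj C"
    and Tgt_Obj: "f \<in> Arr C \<Longrightarrow> Tgt C f \<in> Obj C"
    and Idn_hom: "x \<in> Obj C \<Longrightarrow> Idn C x \<in> hom C x x"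
    and Comp_hom: "\<lbrakk>f \<in> hom C x y; g \<in> hom C y z\<rbrakk> \<Longrightarrow> g \<cdot> f \<in> hom C x z"
    and Comp_Idn: "f \<in> Arr C \<Longrightarrow> f \<cdot> Idn C (Src C f) = f"
    and Idn_Comp: "f \<in> Arr C \<Longrightarrow> Idn C (Tgt C f) \<cdot> f = f"
    and Comp_assoc: "\<lbrakk>f \<in> hom C w x; g \<in> hom C x y; h \<in> hom C y z\<rbrakk>
          \<Longrightarrow> (h \<cdot> g) \<cdot> f = h \<cdot> (g \<cdot> f)"

definition small_category :: "('u::universe, 'u) cat \<Rightarrow> bool" where
  "small_category C \<longleftrightarrow> category C \<and> small (Obj C) \<and> small (Arr C)"

definition op_cat :: "('o, 'a) cat \<Rightarrow> ('o, 'a) cat" where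
  "op_cat C = \<lparr>Obj = Obj C, Arr = Arr C, Src = Tgt C, Tgt = Src C, Idn = Idn C,
     Comp = (\<lambda>g f. f \<cdot>\<^bsub>C\<^esub> g)\<rparr>"

definition full_subcat :: "('o, 'a) cat \<Rightarrow> 'o set \<Rightarrow> ('o, 'a) cat" where
  "full_subcat C S = C\<lparr>Obj := Obj C \<inter> S, Arr := {f \<in> Arr C. Src C f \<in> S \<and> Tgt C f \<in> S}\<rparr>"

definition is_iso :: "('o, 'a) cat \<Rightarrow> 'o \<Rightarrow> 'o \<Rightarrow> 'a \<Rightarrow> bool" where
  "is_iso C x y f \<longleftrightarrow> f \<in> hom C x y \<and>
     (\<exists>g \<in> hom C y x. g \<cdot>\<^bsub>C\<^esub> f = Idn C x \<and> f \<cdot>\<^bsub>C\<^esub> g = Idn C y)"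

record ('o, 'a, 'p, 'b) func =
  fOb :: "'o \<Rightarrow> 'p"
  fAr :: "'a \<Rightarrow> 'b"

definition is_functor :: "('o, 'a) cat \<Rightarrow> ('p, 'b) cat \<Rightarrow> ('o, 'a, 'p, 'b) func \<Rightarrow> bool" where
  "is_functor A B F \<longleftrightarrow>
     (\<forall>x \<in> Obj A. fOb F x \<in> Obj B \<and> fAr F (Idn A x) = Idn B (fOb F x)) \<and>
     (\<forall>f \<in> Arr A. fAr F f \<in> hom B (fOb F (Src A f)) (fOb F (Tgt A f))) \<and>
     (\<forall>f \<in> Arr A. \<forall>g \<in> Arr A. Tgt A f = Src A g \<longrightarrow>
        fAr F (g \<cdot>\<^bsub>A\<^esub> f) = fAr F g \<cdot>\<^bsub>B\<^esub> fAr F f)"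

definition id_func :: "('o, 'a, 'o, 'a) func" where
  "id_func = \<lparr>fOb = (\<lambda>x. x), fAr = (\<lambda>f. f)\<rparr>"

definition fcomp :: "('p, 'b, 'q, 'c) func \<Rightarrow> ('o, 'a, 'p, 'b) func \<Rightarrow> ('o, 'a, 'q, 'c) func" where
  "fcomp G F = \<lparr>fOb = (\<lambda>x. fOb G (fOb F x)), fAr = (\<lambda>f. fAr G (fAr F f))\<rparr>"

definition is_nat :: "('o, 'a) cat \<Rightarrow> ('p, 'b) cat \<Rightarrow> ('o, 'a, 'p, 'b) func \<Rightarrow> ('o, 'a, 'p, 'b) func
    \<Rightarrow> ('o \<Rightarrow> 'b) \<Rightarrow> bool" where
  "is_nat A B F G \<alpha> \<longleftrightarrow>
     (\<forall>x \<in> Obj A. \<alpha> x \<in> hom B (fOb F x) (fOb G x)) \<and>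
     (\<forall>f \<in> Arr A. \<alpha> (Tgt A f) \<cdot>\<^bsub>B\<^esub> fAr F f = fAr G f \<cdot>\<^bsub>B\<^esub> \<alpha> (Src A f))"

definition is_nat_iso :: "('o, 'a) cat \<Rightarrow> ('p, 'b) cat \<Rightarrow> ('o, 'a, 'p, 'b) func
    \<Rightarrow> ('o, 'a, 'p, 'b) func \<Rightarrow> ('o \<Rightarrow> 'b) \<Rightarrow> bool" where
  "is_nat_iso A B F G \<alpha> \<longleftrightarrow> is_nat A B F G \<alpha> \<and>
     (\<forall>x \<in> Obj A. is_iso B (fOb F x) (fOb G x) (\<alpha> x))"

definition equivalent :: "('o, 'a) cat \<Rightarrow> ('p, 'b) cat \<Rightarrow> bool" where
  "equivalent A B \<longleftrightarrow> (\<exists>F G \<eta> \<epsilon>. is_functor A B F \<and> is_functor B A G \<and>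
     is_nat_iso A A id_func (fcomp G F) \<eta> \<and> is_nat_iso B B (fcomp F G) id_func \<epsilon>)"

datatype ('o, 'a, 'p, 'b) ntrans =
  NT (nt_src: "('o, 'a, 'p, 'b) func") (nt_at: "'o \<Rightarrow> 'b") (nt_tgt: "('o, 'a, 'p, 'b) func")

text \<open>
  Components of a transformation are normalised outside the objects of the source category, so that
  the category laws hold as equations. Functors need no normalisation: two functors that agree on
  the source category but differ outside it are merely isomorphic objects.
\<close>

definition functor_cat :: "('o, 'a) cat \<Rightarrow> ('p, 'b) cat
    \<Rightarrow> (('o, 'a, 'p, 'b) func, ('o, 'a, 'p, 'b) ntrans) cat" where
  "functor_cat A B = \<lparr>
     Obj = {F. is_functor A B F},
     Arr = {NT F \<alpha> G |F \<alpha> G. is_functor A B F \<and> is_functor A B G \<and> is_nat A B F G \<alpha> \<and>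
              \<alpha> \<in> extensional (Obj A)},
     Src = nt_src, Tgt = nt_tgt,
     Idn = (\<lambda>F. NT F (restrict (\<lambda>x. Idn B (fOb F x)) (Obj A)) F),
     Comp = (\<lambda>t s. NT (nt_src s) (restrict (\<lambda>x. nt_at t x \<cdot>\<^bsub>B\<^esub> nt_at s x) (Obj A)) (nt_tgt t))\<rparr>"


section \<open>Limits and colimits\<close>

definition is_limit :: "('o, 'a) cat \<Rightarrow> ('j, 'k) cat \<Rightarrow> ('j, 'k, 'o, 'a) func \<Rightarrow> 'o
    \<Rightarrow> ('j \<Rightarrow> 'a) \<Rightarrow> bool" where
  "is_limit C J D X \<pi> \<longleftrightarrow>
     (let cone = (\<lambda>Y \<rho>. Y \<in> Obj C \<and> (\<forall>j \<in> Obj J. \<rho> j \<in> hom C Y (fOb D j)) \<and>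
                    (\<forall>k \<in> Arr J. fAr D k \<cdot>\<^bsub>C\<^esub> \<rho> (Src J k) = \<rho> (Tgt J k)))
      in cone X \<pi> \<and>
         (\<forall>Y \<rho>. cone Y \<rho> \<longrightarrow> (\<exists>!h. h \<in> hom C Y X \<and> (\<forall>j \<in> Obj J. \<pi> j \<cdot>\<^bsub>C\<^esub> h = \<rho> j))))"

definition is_colimit :: "('o, 'a) cat \<Rightarrow> ('j, 'k) cat \<Rightarrow> ('j, 'k, 'o, 'a) func \<Rightarrow> 'o
    \<Rightarrow> ('j \<Rightarrow> 'a) \<Rightarrow> bool" where
  "is_colimit C J D X \<iota> \<longleftrightarrow>
     (let cocone = (\<lambda>Y \<rho>. Y \<in> Obj C \<and> (\<forall>j \<in> Obj J. \<rho> j \<in> hom C (fOb D j) Y) \<and>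
                    (\<forall>k \<in> Arr J. \<rho> (Tgt J k) \<cdot>\<^bsub>C\<^esub> fAr D k = \<rho> (Src J k)))
      in cocone X \<iota> \<and>
         (\<forall>Y \<rho>. cocone Y \<rho> \<longrightarrow> (\<exists>!h. h \<in> hom C X Y \<and> (\<forall>j \<in> Obj J. h \<cdot>\<^bsub>C\<^esub> \<iota> j = \<rho> j))))"

text \<open>Every finite category is isomorphic to one carried by natural numbers.\<close>

definition preserves_finite_limits :: "('o, 'a) cat \<Rightarrow> ('p, 'b) cat \<Rightarrow> ('o, 'a, 'p, 'b) func
    \<Rightarrow> bool" where
  "preserves_finite_limits A B F \<longleftrightarrow>
     (\<forall>(J :: (nat, nat) cat) D X \<pi>.
        category J \<and> finite (Obj J) \<and> finite (Arr J) \<and> is_functor J A D \<and> is_limit A J D X \<pi>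
        \<longrightarrow> is_limit B J (fcomp F D) (fOb F X) (\<lambda>j. fAr F (\<pi> j)))"

definition is_terminal :: "('o, 'a) cat \<Rightarrow> 'o \<Rightarrow> bool" where
  "is_terminal C T \<longleftrightarrow> T \<in> Obj C \<and> (\<forall>x \<in> Obj C. \<exists>!f. f \<in> hom C x T)"

definition one :: "('o, 'a) cat \<Rightarrow> 'o" where
  "one C = (SOME T. is_terminal C T)"

definition bang :: "('o, 'a) cat \<Rightarrow> 'o \<Rightarrow> 'a" where
  "bang C x = (THE f. f \<in> hom C x (one C))"

definition is_pullback :: "('o, 'a) cat \<Rightarrow> 'a \<Rightarrow> 'a \<Rightarrow> 'a \<Rightarrow> 'a \<Rightarrow> bool" where
  "is_pullback C f g p q \<longleftrightarrow>
     (let square = (\<lambda>u v. f \<in> Arr C \<and> g \<in> Arr C \<and> u \<in> Arr C \<and> v \<in> Arr C \<and>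
                      Tgt C f = Tgt C g \<and> Src C u = Src C v \<and> Tgt C u = Src C f \<and>
                      Tgt C v = Src C g \<and> f \<cdot>\<^bsub>C\<^esub> u = g \<cdot>\<^bsub>C\<^esub> v)
      in square p q \<and>
         (\<forall>u v. square u v \<longrightarrow>
            (\<exists>!h. h \<in> hom C (Src C u) (Src C p) \<and> p \<cdot>\<^bsub>C\<^esub> h = u \<and> q \<cdot>\<^bsub>C\<^esub> h = v)))"

text \<open>
  \<open>pb1 C f g\<close> and \<open>pb2 C f g\<close> are the legs of a fixed pullback of \<open>f\<close> and \<open>g\<close>, over the sources of
  \<open>f\<close> and of \<open>g\<close> respectively. \<open>into C p q u v\<close> is the arrow induced by \<open>u\<close> and \<open>v\<close> into a pullback
  with legs \<open>p\<close> and \<open>q\<close>.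
\<close>

definition pb :: "('o, 'a) cat \<Rightarrow> 'a \<Rightarrow> 'a \<Rightarrow> 'a \<times> 'a" where
  "pb C f g = (SOME pq. is_pullback C f g (fst pq) (snd pq))"

definition pb1 :: "('o, 'a) cat \<Rightarrow> 'a \<Rightarrow> 'a \<Rightarrow> 'a" where
  "pb1 C f g = fst (pb C f g)"

definition pb2 :: "('o, 'a) cat \<Rightarrow> 'a \<Rightarrow> 'a \<Rightarrow> 'a" where
  "pb2 C f g = snd (pb C f g)"

definition pbOb :: "('o, 'a) cat \<Rightarrow> 'a \<Rightarrow> 'a \<Rightarrow> 'o" where
  "pbOb C f g = Src C (pb1 C f g)"

definition into :: "('o, 'a) cat \<Rightarrow> 'a \<Rightarrow> 'a \<Rightarrow> 'a \<Rightarrow> 'a \<Rightarrow> 'a" where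
  "into C p q u v =
     (THE h. h \<in> hom C (Src C u) (Src C p) \<and> p \<cdot>\<^bsub>C\<^esub> h = u \<and> q \<cdot>\<^bsub>C\<^esub> h = v)"

definition pair :: "('o, 'a) cat \<Rightarrow> 'a \<Rightarrow> 'a \<Rightarrow> 'a \<Rightarrow> 'a \<Rightarrow> 'a" where
  "pair C f g u v = into C (pb1 C f g) (pb2 C f g) u v"

definition is_coequalizer :: "('o, 'a) cat \<Rightarrow> 'a \<Rightarrow> 'a \<Rightarrow> 'o \<Rightarrow> 'a \<Rightarrow> bool" where
  "is_coequalizer C f g Q q \<longleftrightarrow>
     f \<in> Arr C \<and> g \<in> hom C (Src C f) (Tgt C f) \<and>
     q \<in> hom C (Tgt C f) Q \<and> q \<cdot>\<^bsub>C\<^esub> f = q \<cdot>\<^bsub>C\<^esub> g \<and>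
     (\<forall>r \<in> Arr C. Src C r = Tgt C f \<and> r \<cdot>\<^bsub>C\<^esub> f = r \<cdot>\<^bsub>C\<^esub> g \<longrightarrow>
        (\<exists>!h. h \<in> hom C Q (Tgt C r) \<and> h \<cdot>\<^bsub>C\<^esub> q = r))"


section \<open>Sets, sheaves, Grothendieck toposes, geometric morphisms\<close>

datatype 'u fn = Fn (fn_src: "'u set") (app: "'u \<Rightarrow> 'u") (fn_tgt: "'u set")

definition SetC :: "('u::universe set, 'u fn) cat" where
  "SetC = \<lparr>Obj = {A. small A},
     Arr = {Fn A f B |A f B. small A \<and> small B \<and> f \<in> A \<rightarrow>\<^sub>E B},
     Src = fn_src, Tgt = fn_tgt,
     Idn = (\<lambda>A. Fn A (restrict (\<lambda>x. x) A) A),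
     Comp = (\<lambda>g f. Fn (fn_src f) (restrict (\<lambda>x. app g (app f x)) (fn_src f)) (fn_tgt g))\<rparr>"

definition sieve :: "('o, 'a) cat \<Rightarrow> 'o \<Rightarrow> 'a set \<Rightarrow> bool" where
  "sieve D c S \<longleftrightarrow> S \<subseteq> {f \<in> Arr D. Tgt D f = c} \<and>
     (\<forall>f \<in> S. \<forall>g \<in> Arr D. Tgt D g = Src D f \<longrightarrow> f \<cdot>\<^bsub>D\<^esub> g \<in> S)"

definition pull_sieve :: "('o, 'a) cat \<Rightarrow> 'a \<Rightarrow> 'a set \<Rightarrow> 'a set" where
  "pull_sieve D f S = {g \<in> Arr D. Tgt D g = Src D f \<and> f \<cdot>\<^bsub>D\<^esub> g \<in> S}"

definition grothendieck_topology :: "('o, 'a) cat \<Rightarrow> ('o \<Rightarrow> 'a set set) \<Rightarrow> bool" where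
  "grothendieck_topology D J \<longleftrightarrow>
     (\<forall>c \<in> Obj D. \<forall>S \<in> J c. sieve D c S) \<and>
     (\<forall>c \<in> Obj D. {f \<in> Arr D. Tgt D f = c} \<in> J c) \<and>
     (\<forall>f \<in> Arr D. \<forall>S \<in> J (Tgt D f). pull_sieve D f S \<in> J (Src D f)) \<and>
     (\<forall>c \<in> Obj D. \<forall>S \<in> J c. \<forall>R. sieve D c R \<and> (\<forall>f \<in> S. pull_sieve D f R \<in> J (Src D f))
        \<longrightarrow> R \<in> J c)"

definition is_sheaf :: "('o, 'a) cat \<Rightarrow> ('o \<Rightarrow> 'a set set)
    \<Rightarrow> ('o, 'a, 'u::universe set, 'u fn) func \<Rightarrow> bool" where
  "is_sheaf D J P \<longleftrightarrow> is_functor (op_cat D) SetC P \<and>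
     (\<forall>c \<in> Obj D. \<forall>S \<in> J c. \<forall>x.
        (\<forall>f \<in> S. x f \<in> fOb P (Src D f)) \<and>
        (\<forall>f \<in> S. \<forall>g \<in> Arr D. Tgt D g = Src D f \<longrightarrow> app (fAr P g) (x f) = x (f \<cdot>\<^bsub>D\<^esub> g))
        \<longrightarrow> (\<exists>!y. y \<in> fOb P c \<and> (\<forall>f \<in> S. app (fAr P f) y = x f)))"

definition Sh :: "('u::universe, 'u) cat \<Rightarrow> ('u \<Rightarrow> 'u set set)
    \<Rightarrow> (('u, 'u, 'u set, 'u fn) func, ('u, 'u, 'u set, 'u fn) ntrans) cat" where
  "Sh D J = full_subcat (functor_cat (op_cat D) SetC) {P. is_sheaf D J P}"

definition grothendieck_topos :: "'u::universe itself \<Rightarrow> ('o, 'a) cat \<Rightarrow> bool" where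
  "grothendieck_topos _ E \<longleftrightarrow> category E \<and>
     (\<exists>(D :: ('u, 'u) cat) J. small_category D \<and> grothendieck_topology D J \<and>
        equivalent E (Sh D J))"

definition adjoint :: "('o, 'a) cat \<Rightarrow> ('p, 'b) cat \<Rightarrow> ('o, 'a, 'p, 'b) func
    \<Rightarrow> ('p, 'b, 'o, 'a) func \<Rightarrow> bool" where
  "adjoint A B L R \<longleftrightarrow> is_functor A B L \<and> is_functor B A R \<and>
     (\<exists>\<eta> \<epsilon>. is_nat A A id_func (fcomp R L) \<eta> \<and> is_nat B B (fcomp L R) id_func \<epsilon> \<and>
        (\<forall>x \<in> Obj A. \<epsilon> (fOb L x) \<cdot>\<^bsub>B\<^esub> fAr L (\<eta> x) = Idn B (fOb L x)) \<and>
        (\<forall>y \<in> Obj B. fAr R (\<epsilon> y) \<cdot>\<^bsub>A\<^esub> \<eta> (fOb R y) = Idn A (fOb R y)))"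

text \<open>
  A geometric morphism \<open>E \<rightarrow> S\<close>, given by its inverse image \<open>L : S \<rightarrow> E\<close> and its direct image
  \<open>R : E \<rightarrow> S\<close>.
\<close>

definition geometric_morphism :: "('o, 'a) cat \<Rightarrow> ('p, 'b) cat \<Rightarrow> ('p, 'b, 'o, 'a) func
    \<Rightarrow> ('o, 'a, 'p, 'b) func \<Rightarrow> bool" where
  "geometric_morphism E S L R \<longleftrightarrow> adjoint S E L R \<and> preserves_finite_limits S E L"


section \<open>The category of elements of a functor to sets\<close>

text \<open>An arrow \<open>(x, f)\<close> is \<open>f : (c, x) \<rightarrow> (d, P f x)\<close>.\<close>

definition elements :: "('u::universe, 'u) cat \<Rightarrow> ('u, 'u, 'u set, 'u fn) func
    \<Rightarrow> ('u \<times> 'u, 'u \<times> 'u) cat" where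
  "elements C P = \<lparr>Obj = {(c, x). c \<in> Obj C \<and> x \<in> fOb P c},
     Arr = {(x, f). f \<in> Arr C \<and> x \<in> fOb P (Src C f)},
     Src = (\<lambda>(x, f). (Src C f, x)),
     Tgt = (\<lambda>(x, f). (Tgt C f, app (fAr P f) x)),
     Idn = (\<lambda>(c, x). (x, Idn C c)),
     Comp = (\<lambda>(y, g) (x, f). (x, g \<cdot>\<^bsub>C\<^esub> f))\<rparr>"

definition elements_proj :: "('u \<times> 'u, 'u \<times> 'u, 'u, 'u) func" where
  "elements_proj = \<lparr>fOb = fst, fAr = snd\<rparr>"


section \<open>Internal categories and internal diagrams\<close>

text \<open>
  The object \<open>iCp\<close> of composable pairs is part of the data, with projections \<open>ip1\<close> and \<open>ip2\<close> to the
  first and the second arrow of a pair; \<open>icmp\<close> sends a pair \<open>(f, g)\<close> to \<open>g \<circ> f\<close>.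
\<close>

record ('o, 'a) icat =
  iOb :: 'o
  iAr :: 'o
  iCp :: 'o
  d0 :: 'a
  d1 :: 'a
  iid :: 'a
  ip1 :: 'a
  ip2 :: 'a
  icmp :: 'a

definition iop :: "('o, 'a) icat \<Rightarrow> ('o, 'a) icat" where
  "iop \<D> = \<lparr>iOb = iOb \<D>, iAr = iAr \<D>, iCp = iCp \<D>, d0 = d1 \<D>, d1 = d0 \<D>, iid = iid \<D>,
     ip1 = ip2 \<D>, ip2 = ip1 \<D>, icmp = icmp \<D>\<rparr>"

text \<open>Composition of generalized arrows: for \<open>f, g : T \<rightarrow> iAr\<close> with \<open>d1 f = d0 g\<close>.\<close>

definition gcomp :: "('o, 'a) cat \<Rightarrow> ('o, 'a) icat \<Rightarrow> 'a \<Rightarrow> 'a \<Rightarrow> 'a" where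
  "gcomp E \<D> f g = icmp \<D> \<cdot>\<^bsub>E\<^esub> into E (ip1 \<D>) (ip2 \<D>) f g"

definition internal_of :: "('u::universe, 'u) cat \<Rightarrow> ('u set, 'u fn) icat" where
  "internal_of C =
     (let s = Fn (Arr C) (restrict (Src C) (Arr C)) (Obj C);
          t = Fn (Arr C) (restrict (Tgt C) (Arr C)) (Obj C);
          p = pb1 SetC t s; q = pb2 SetC t s; Z = pbOb SetC t s
      in \<lparr>iOb = Obj C, iAr = Arr C, iCp = Z, d0 = s, d1 = t,
          iid = Fn (Obj C) (restrict (Idn C) (Obj C)) (Arr C), ip1 = p, ip2 = q,
          icmp = Fn Z (restrict (\<lambda>z. app q z \<cdot>\<^bsub>C\<^esub> app p z) Z) (Arr C)\<rparr>)"

definition icat_image :: "('o, 'a, 'p, 'b) func \<Rightarrow> ('o, 'a) icat \<Rightarrow> ('p, 'b) icat" where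
  "icat_image L \<D> = \<lparr>iOb = fOb L (iOb \<D>), iAr = fOb L (iAr \<D>), iCp = fOb L (iCp \<D>),
     d0 = fAr L (d0 \<D>), d1 = fAr L (d1 \<D>), iid = fAr L (iid \<D>),
     ip1 = fAr L (ip1 \<D>), ip2 = fAr L (ip2 \<D>), icmp = fAr L (icmp \<D>)\<rparr>"

text \<open>
  An internal diagram of shape \<open>\<D>\<close>: an object \<open>tot\<close> with \<open>anc : tot \<rightarrow> iOb\<close> and an action
  \<open>act\<close> defined on the pullback of \<open>anc\<close> and \<open>d0\<close>. The associativity law is stated for generalized
  elements.
\<close>

record ('o, 'a) idiag =
  tot :: 'o
  anc :: 'a
  act :: 'a

definition act_on :: "('o, 'a) cat \<Rightarrow> ('o, 'a) icat \<Rightarrow> ('o, 'a) idiag \<Rightarrow> 'a \<Rightarrow> 'a \<Rightarrow> 'a" where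
  "act_on E \<D> D x f = act D \<cdot>\<^bsub>E\<^esub> pair E (anc D) (d0 \<D>) x f"

definition is_idiag :: "('o, 'a) cat \<Rightarrow> ('o, 'a) icat \<Rightarrow> ('o, 'a) idiag \<Rightarrow> bool" where
  "is_idiag E \<D> D \<longleftrightarrow>
     tot D \<in> Obj E \<and> anc D \<in> hom E (tot D) (iOb \<D>) \<and>
     act D \<in> hom E (pbOb E (anc D) (d0 \<D>)) (tot D) \<and>
     anc D \<cdot>\<^bsub>E\<^esub> act D = d1 \<D> \<cdot>\<^bsub>E\<^esub> pb2 E (anc D) (d0 \<D>) \<and>
     act_on E \<D> D (Idn E (tot D)) (iid \<D> \<cdot>\<^bsub>E\<^esub> anc D) = Idn E (tot D) \<and>
     (\<forall>T \<in> Obj E. \<forall>x \<in> hom E T (tot D). \<forall>f \<in> hom E T (iAr \<D>). \<forall>g \<in> hom E T (iAr \<D>).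
        anc D \<cdot>\<^bsub>E\<^esub> x = d0 \<D> \<cdot>\<^bsub>E\<^esub> f \<and> d1 \<D> \<cdot>\<^bsub>E\<^esub> f = d0 \<D> \<cdot>\<^bsub>E\<^esub> g \<longrightarrow>
        act_on E \<D> D (act_on E \<D> D x f) g = act_on E \<D> D x (gcomp E \<D> f g))"

definition is_idiag_map :: "('o, 'a) cat \<Rightarrow> ('o, 'a) icat \<Rightarrow> ('o, 'a) idiag \<Rightarrow> ('o, 'a) idiag
    \<Rightarrow> 'a \<Rightarrow> bool" where
  "is_idiag_map E \<D> D D' h \<longleftrightarrow> h \<in> hom E (tot D) (tot D') \<and> anc D' \<cdot>\<^bsub>E\<^esub> h = anc D \<and>
     h \<cdot>\<^bsub>E\<^esub> act D = act_on E \<D> D' (h \<cdot>\<^bsub>E\<^esub> pb1 E (anc D) (d0 \<D>)) (pb2 E (anc D) (d0 \<D>))"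

text \<open>The internal category of elements, source of the discrete opfibration attached to \<open>D\<close>.\<close>

definition int_opf :: "('o, 'a) cat \<Rightarrow> ('o, 'a) icat \<Rightarrow> ('o, 'a) idiag \<Rightarrow> ('o, 'a) icat" where
  "int_opf E \<D> D =
     (let s = pb1 E (anc D) (d0 \<D>); l = pb2 E (anc D) (d0 \<D>); t = act D;
          p = pb1 E t s; q = pb2 E t s
      in \<lparr>iOb = tot D, iAr = pbOb E (anc D) (d0 \<D>), iCp = pbOb E t s, d0 = s, d1 = t,
          iid = pair E (anc D) (d0 \<D>) (Idn E (tot D)) (iid \<D> \<cdot>\<^bsub>E\<^esub> anc D), ip1 = p, ip2 = q,
          icmp = pair E (anc D) (d0 \<D>) (s \<cdot>\<^bsub>E\<^esub> p) (gcomp E \<D> (l \<cdot>\<^bsub>E\<^esub> p) (l \<cdot>\<^bsub>E\<^esub> q))\<rparr>)"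

record 'a ifun =
  if0 :: 'a
  if1 :: 'a

definition proj_opf :: "('o, 'a) cat \<Rightarrow> ('o, 'a) icat \<Rightarrow> ('o, 'a) idiag \<Rightarrow> 'a ifun" where
  "proj_opf E \<D> D = \<lparr>if0 = anc D, if1 = pb2 E (anc D) (d0 \<D>)\<rparr>"

text \<open>
  For a diagram \<open>G\<close> of shape \<open>iop \<D>\<close>: the discrete fibration over \<open>\<D>\<close>, i.e. the opposite of the
  discrete opfibration of \<open>G\<close>. The opposite of an internal functor has the same components.
\<close>

definition int_f :: "('o, 'a) cat \<Rightarrow> ('o, 'a) icat \<Rightarrow> ('o, 'a) idiag \<Rightarrow> ('o, 'a) icat" where
  "int_f E \<D> G = iop (int_opf E (iop \<D>) G)"

definition proj_f :: "('o, 'a) cat \<Rightarrow> ('o, 'a) icat \<Rightarrow> ('o, 'a) idiag \<Rightarrow> 'a ifun" where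
  "proj_f E \<D> G = proj_opf E (iop \<D>) G"

text \<open>
  Reindexing of a diagram \<open>D\<close> of shape \<open>\<D>\<close> along \<open>H : \<D>' \<rightarrow> \<D>\<close>, i.e. the pullback along \<open>H\<close> of its
  discrete opfibration: in terms of elements, \<open>(d', x) \<cdot> f' = (d1 f', x \<cdot> H f')\<close>.
\<close>

definition idiag_comp :: "('o, 'a) cat \<Rightarrow> ('o, 'a) icat \<Rightarrow> ('o, 'a) icat \<Rightarrow> ('o, 'a) idiag
    \<Rightarrow> 'a ifun \<Rightarrow> ('o, 'a) idiag" where
  "idiag_comp E \<D>' \<D> D H =
     (let e = pb1 E (if0 H) (anc D); z = pb2 E (if0 H) (anc D);
          r1 = pb1 E e (d0 \<D>'); r2 = pb2 E e (d0 \<D>')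
      in \<lparr>tot = pbOb E (if0 H) (anc D), anc = e,
          act = pair E (if0 H) (anc D) (d1 \<D>' \<cdot>\<^bsub>E\<^esub> r2)
                  (act_on E \<D> D (z \<cdot>\<^bsub>E\<^esub> r1) (if1 H \<cdot>\<^bsub>E\<^esub> r2))\<rparr>)"

definition is_internal_colim :: "('o, 'a) cat \<Rightarrow> ('o, 'a) icat \<Rightarrow> ('o, 'a) idiag \<Rightarrow> 'o
    \<Rightarrow> 'a \<Rightarrow> bool" where
  "is_internal_colim E \<D> D Q q \<longleftrightarrow>
     is_coequalizer E (d0 (int_opf E \<D> D)) (d1 (int_opf E \<D> D)) Q q"


section \<open>Internal diagrams and external functors\<close>

definition pt :: "'u \<Rightarrow> 'u set \<Rightarrow> 'u fn" where
  "pt c S = Fn {undefined} (restrict (\<lambda>_. c) {undefined}) S"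

definition to_pt :: "('o, 'a) cat \<Rightarrow> ('u set, 'u fn, 'o, 'a) func \<Rightarrow> 'o \<Rightarrow> 'a" where
  "to_pt E L x = (THE f. f \<in> hom E x (fOb L {undefined}))"

text \<open>
  The equivalence between internal diagrams of shape \<open>L C\<close> and functors \<open>C \<rightarrow> E\<close> (\<open>L\<close> the inverse
  image functor) sends an internal diagram \<open>D\<close> to the functor whose value at \<open>c\<close> is the fibre of
  \<open>anc D\<close> over \<open>L \<ulcorner>c\<urcorner> : L 1 \<rightarrow> L (Obj C)\<close>, with an arrow \<open>f\<close> operating through the action of
  \<open>L \<ulcorner>f\<urcorner> : L 1 \<rightarrow> L (Arr C)\<close>. The following says that \<open>D\<close> corresponds to \<open>G\<close> under this equivalence,
  where \<open>\<kappa>\<close> exhibits the values of \<open>G\<close> as the fibres of \<open>D\<close>. It is used for \<open>C\<close> with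
  \<open>\<D> = L C\<close>, and for \<open>op_cat C\<close> with \<open>\<D> = iop (L C)\<close>.
\<close>

definition corresponds :: "('o, 'a) cat \<Rightarrow> ('u set, 'u fn, 'o, 'a) func \<Rightarrow> ('u, 'u) cat
    \<Rightarrow> ('o, 'a) icat \<Rightarrow> ('u, 'u, 'o, 'a) func \<Rightarrow> ('o, 'a) idiag \<Rightarrow> ('u \<Rightarrow> 'a) \<Rightarrow> bool" where
  "corresponds E L C \<D> G D \<kappa> \<longleftrightarrow>
     is_idiag E \<D> D \<and>
     (\<forall>c \<in> Obj C. \<kappa> c \<in> hom E (fOb G c) (tot D) \<and>
        is_pullback E (anc D) (fAr L (pt c (Obj C))) (\<kappa> c) (to_pt E L (fOb G c))) \<and>
     (\<forall>f \<in> Arr C. \<kappa> (Tgt C f) \<cdot>\<^bsub>E\<^esub> fAr G f =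
        act_on E \<D> D (\<kappa> (Src C f)) (fAr L (pt f (Arr C)) \<cdot>\<^bsub>E\<^esub> to_pt E L (fOb G (Src C f))))"


section \<open>Indexed categories and indexed colimits\<close>

text \<open>
  Only the data of an indexed category (fibres \<open>ixfib\<close>, transition functors \<open>ixre\<close>) and of an
  indexed functor (functors \<open>ixf\<close> between the fibres, and for \<open>h : I' \<rightarrow> I\<close> and \<open>x\<close> in the fibre at
  \<open>I\<close> the comparison isomorphism \<open>ixc h x : \<Gamma> (h\<^sup>* x) \<rightarrow> h\<^sup>* (\<Gamma> x)\<close>) are recorded;
  the indexed categories and functors used below are given by explicit formulas.
\<close>

record ('o, 'a, 'x, 'y) ixcat =
  ixfib :: "'o \<Rightarrow> ('x, 'y) cat"
  ixre :: "'a \<Rightarrow> ('x, 'y, 'x, 'y) func"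

record ('o, 'a, 'x, 'y, 'v, 'w) ixfun =
  ixf :: "'o \<Rightarrow> ('x, 'y, 'v, 'w) func"
  ixc :: "'a \<Rightarrow> 'x \<Rightarrow> 'w"

definition ixfun_comp :: "('o, 'a) cat \<Rightarrow> ('o, 'a, 'v, 'w) ixcat \<Rightarrow> ('o, 'a, 'r, 's, 'v, 'w) ixfun
    \<Rightarrow> ('o, 'a, 'x, 'y, 'r, 's) ixfun \<Rightarrow> ('o, 'a, 'x, 'y, 'v, 'w) ixfun" where
  "ixfun_comp E \<B> G H = \<lparr>ixf = (\<lambda>I. fcomp (ixf G I) (ixf H I)),
     ixc = (\<lambda>h x. ixc G h (fOb (ixf H (Tgt E h)) x) \<cdot>\<^bsub>ixfib \<B> (Src E h)\<^esub>
                    fAr (ixf G (Src E h)) (ixc H h x))\<rparr>"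

text \<open>An arrow \<open>(p, h, q)\<close> of the slice is \<open>h : p \<rightarrow> q\<close> with \<open>q \<circ> h = p\<close>.\<close>

definition slice :: "('o, 'a) cat \<Rightarrow> 'o \<Rightarrow> ('a, 'a \<times> 'a \<times> 'a) cat" where
  "slice E I = \<lparr>Obj = {p \<in> Arr E. Tgt E p = I},
     Arr = {(p, h, q). p \<in> Arr E \<and> Tgt E p = I \<and> q \<in> Arr E \<and> Tgt E q = I \<and>
              h \<in> hom E (Src E p) (Src E q) \<and> q \<cdot>\<^bsub>E\<^esub> h = p},
     Src = (\<lambda>(p, h, q). p), Tgt = (\<lambda>(p, h, q). q),
     Idn = (\<lambda>p. (p, Idn E (Src E p), p)),
     Comp = (\<lambda>(p', k, r) (p, h, q). (p, k \<cdot>\<^bsub>E\<^esub> h, r))\<rparr>"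

definition pull :: "('o, 'a) cat \<Rightarrow> 'a \<Rightarrow> ('a, 'a \<times> 'a \<times> 'a, 'a, 'a \<times> 'a \<times> 'a) func" where
  "pull E h = \<lparr>fOb = (\<lambda>p. pb1 E h p),
     fAr = (\<lambda>(p, k, q). (pb1 E h p, pair E h q (pb1 E h p) (k \<cdot>\<^bsub>E\<^esub> pb2 E h p), pb1 E h q))\<rparr>"

definition self_indexing :: "('o, 'a) cat \<Rightarrow> ('o, 'a, 'a, 'a \<times> 'a \<times> 'a) ixcat" where
  "self_indexing E = \<lparr>ixfib = slice E, ixre = pull E\<rparr>"

text \<open>The canonical isomorphism \<open>(f \<circ> h)\<^sup>* p \<rightarrow> h\<^sup>* (f\<^sup>* p)\<close> of the self-indexing.\<close>

definition pull_comp :: "('o, 'a) cat \<Rightarrow> 'a \<Rightarrow> 'a \<Rightarrow> 'a \<Rightarrow> 'a \<times> 'a \<times> 'a" where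
  "pull_comp E f h p =
     (let r1 = pb1 E (f \<cdot>\<^bsub>E\<^esub> h) p; r2 = pb2 E (f \<cdot>\<^bsub>E\<^esub> h) p
      in (r1, pair E h (pb1 E f p) r1 (pair E f p (h \<cdot>\<^bsub>E\<^esub> r1) r2), pb1 E h (pb1 E f p)))"

definition ext_cat :: "('o, 'a) cat \<Rightarrow> ('o, 'a) icat \<Rightarrow> ('o, 'a, 'a, 'a) ixcat" where
  "ext_cat E \<D> = \<lparr>
     ixfib = (\<lambda>I. \<lparr>Obj = hom E I (iOb \<D>), Arr = hom E I (iAr \<D>),
        Src = (\<lambda>f. d0 \<D> \<cdot>\<^bsub>E\<^esub> f), Tgt = (\<lambda>f. d1 \<D> \<cdot>\<^bsub>E\<^esub> f),
        Idn = (\<lambda>x. iid \<D> \<cdot>\<^bsub>E\<^esub> x), Comp = (\<lambda>g f. gcomp E \<D> f g)\<rparr>),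
     ixre = (\<lambda>h. \<lparr>fOb = (\<lambda>x. x \<cdot>\<^bsub>E\<^esub> h), fAr = (\<lambda>f. f \<cdot>\<^bsub>E\<^esub> h)\<rparr>)\<rparr>"

text \<open>For an internal functor to \<open>\<D>\<close>. It commutes strictly with reindexing: the comparisons are identities.\<close>

definition ext_fun :: "('o, 'a) cat \<Rightarrow> ('o, 'a) icat \<Rightarrow> 'a ifun \<Rightarrow> ('o, 'a, 'a, 'a, 'a, 'a) ixfun" where
  "ext_fun E \<D> H = \<lparr>
     ixf = (\<lambda>I. \<lparr>fOb = (\<lambda>x. if0 H \<cdot>\<^bsub>E\<^esub> x), fAr = (\<lambda>f. if1 H \<cdot>\<^bsub>E\<^esub> f)\<rparr>),
     ixc = (\<lambda>h x. iid \<D> \<cdot>\<^bsub>E\<^esub> (if0 H \<cdot>\<^bsub>E\<^esub> x \<cdot>\<^bsub>E\<^esub> h))\<rparr>"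

text \<open>
  The indexed functor of a diagram sends \<open>x : I \<rightarrow> iOb\<close> to \<open>x\<^sup>* (anc D)\<close> and \<open>f : I \<rightarrow> iAr\<close> to the
  map given in terms of elements by \<open>(i, \<xi>) \<mapsto> (i, \<xi> \<cdot> f i)\<close>.
\<close>

definition ext_diag :: "('o, 'a) cat \<Rightarrow> ('o, 'a) icat \<Rightarrow> ('o, 'a) idiag
    \<Rightarrow> ('o, 'a, 'a, 'a, 'a, 'a \<times> 'a \<times> 'a) ixfun" where
  "ext_diag E \<D> D = \<lparr>
     ixf = (\<lambda>I. \<lparr>fOb = (\<lambda>x. pb1 E x (anc D)),
        fAr = (\<lambda>f. let x = d0 \<D> \<cdot>\<^bsub>E\<^esub> f; y = d1 \<D> \<cdot>\<^bsub>E\<^esub> f;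
                       r1 = pb1 E x (anc D); r2 = pb2 E x (anc D)
                   in (r1, pair E y (anc D) r1 (act_on E \<D> D r2 (f \<cdot>\<^bsub>E\<^esub> r1)), pb1 E y (anc D)))\<rparr>),
     ixc = (\<lambda>h x. pull_comp E x h (anc D))\<rparr>"

text \<open>
  A cocone under the localization at \<open>I\<close> of an indexed functor \<open>\<Gamma> : \<A> \<rightarrow> self_indexing E\<close>, with
  vertex an object \<open>V\<close> of the slice over \<open>I\<close>. The localized indexed category has fibre \<open>\<A>\<close> at \<open>J\<close>
  over each object \<open>e : J \<rightarrow> I\<close> of the slice, and the localization of the self-indexing has fibre
  \<open>slice E J\<close> there. The second conjunct is naturality, the third compatibility with pullback along
  \<open>h : J' \<rightarrow> J\<close>.
\<close>

definition is_ixcocone :: "('o, 'a) cat \<Rightarrow> ('o, 'a, 'x, 'y) ixcat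
    \<Rightarrow> ('o, 'a, 'x, 'y, 'a, 'a \<times> 'a \<times> 'a) ixfun \<Rightarrow> 'o \<Rightarrow> 'a
    \<Rightarrow> ('a \<Rightarrow> 'x \<Rightarrow> 'a \<times> 'a \<times> 'a) \<Rightarrow> bool" where
  "is_ixcocone E \<A> \<Gamma> I V \<nu> \<longleftrightarrow> V \<in> Obj (slice E I) \<and>
     (\<forall>e \<in> Obj (slice E I). let J = Src E e in
        (\<forall>x \<in> Obj (ixfib \<A> J). \<nu> e x \<in> hom (slice E J) (fOb (ixf \<Gamma> J) x) (fOb (pull E e) V)) \<and>
        (\<forall>k \<in> Arr (ixfib \<A> J).
           \<nu> e (Tgt (ixfib \<A> J) k) \<cdot>\<^bsub>slice E J\<^esub> fAr (ixf \<Gamma> J) k = \<nu> e (Src (ixfib \<A> J) k)) \<and>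
        (\<forall>h \<in> Arr E. Tgt E h = J \<longrightarrow> (\<forall>x \<in> Obj (ixfib \<A> J).
           fAr (pull E h) (\<nu> e x) \<cdot>\<^bsub>slice E (Src E h)\<^esub> ixc \<Gamma> h x =
           pull_comp E e h V \<cdot>\<^bsub>slice E (Src E h)\<^esub> \<nu> (e \<cdot>\<^bsub>E\<^esub> h) (fOb (ixre \<A> h) x))))"

text \<open>
  The localization of a cocone \<open>\<mu>\<close> with vertex \<open>U\<close> at an object \<open>I\<close> has vertex \<open>!\<^sub>I\<^sup>* U\<close> and at
  \<open>e : J \<rightarrow> I\<close> is \<open>\<mu>\<close> at \<open>J\<close> followed by \<open>!\<^sub>J\<^sup>* U \<cong> e\<^sup>* (!\<^sub>I\<^sup>* U)\<close>. An object of \<open>E\<close> is identified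
  with its arrow \<open>bang\<close> to the terminal object. Universality is required of the localization at
  every \<open>I\<close>; the case \<open>I = one E\<close> is universality of \<open>\<mu>\<close> itself.
\<close>

definition ixcocone_at :: "('o, 'a) cat \<Rightarrow> 'o \<Rightarrow> ('a \<Rightarrow> 'x \<Rightarrow> 'a \<times> 'a \<times> 'a) \<Rightarrow> 'o
    \<Rightarrow> 'a \<Rightarrow> 'x \<Rightarrow> 'a \<times> 'a \<times> 'a" where
  "ixcocone_at E U \<mu> I e x =
     pull_comp E (bang E I) e (bang E U) \<cdot>\<^bsub>slice E (Src E e)\<^esub> \<mu> (bang E I \<cdot>\<^bsub>E\<^esub> e) x"

definition is_indexed_colim :: "('o, 'a) cat \<Rightarrow> ('o, 'a, 'x, 'y) ixcat
    \<Rightarrow> ('o, 'a, 'x, 'y, 'a, 'a \<times> 'a \<times> 'a) ixfun \<Rightarrow> 'o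
    \<Rightarrow> ('a \<Rightarrow> 'x \<Rightarrow> 'a \<times> 'a \<times> 'a) \<Rightarrow> bool" where
  "is_indexed_colim E \<A> \<Gamma> U \<mu> \<longleftrightarrow> U \<in> Obj E \<and>
     is_ixcocone E \<A> \<Gamma> (one E) (bang E U) \<mu> \<and>
     (\<forall>I \<in> Obj E. \<forall>V \<nu>. is_ixcocone E \<A> \<Gamma> I V \<nu> \<longrightarrow>
        (\<exists>!m. m \<in> hom (slice E I) (fOb (pull E (bang E I)) (bang E U)) V \<and>
           (\<forall>e \<in> Obj (slice E I). \<forall>x \<in> Obj (ixfib \<A> (Src E e)).
              \<nu> e x = fAr (pull E e) m \<cdot>\<^bsub>slice E (Src E e)\<^esub> ixcocone_at E U \<mu> I e x)))"


section \<open>The colimits to be compared\<close>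

text \<open>
  For given \<open>F\<close> and \<open>P\<close>: internal diagrams \<open>dF\<close> and \<open>dP\<close> corresponding to \<open>F\<close> and \<open>L \<circ> P\<close> (via
  \<open>kF\<close>, \<open>kP\<close>), and the colimits with their universal cocones. All of them are determined up to
  isomorphism.
\<close>

record ('u, 'o, 'a) colims =
  dF :: "('o, 'a) idiag"
  kF :: "'u \<Rightarrow> 'a"
  dP :: "('o, 'a) idiag"
  kP :: "'u \<Rightarrow> 'a"
  ext_colim :: 'o
  ext_leg :: "'u \<times> 'u \<Rightarrow> 'a"
  intF_colim :: 'o
  intF_leg :: 'a
  intP_colim :: 'o
  intP_leg :: 'a
  ix_colim :: 'o
  ix_leg :: "'a \<Rightarrow> 'a \<Rightarrow> 'a \<times> 'a \<times> 'a"

definition are_colims :: "('o, 'a) cat \<Rightarrow> ('u::universe set, 'u fn, 'o, 'a) func \<Rightarrow> ('u, 'u) cat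
    \<Rightarrow> ('u, 'u, 'o, 'a) func \<Rightarrow> ('u, 'u, 'u set, 'u fn) func \<Rightarrow> ('u, 'o, 'a) colims \<Rightarrow> bool" where
  "are_colims E L C F P s \<longleftrightarrow>
     (let \<C> = icat_image L (internal_of C) in
      corresponds E L (op_cat C) (iop \<C>) F (dF s) (kF s) \<and>
      corresponds E L C \<C> (fcomp L P) (dP s) (kP s) \<and>
      is_colimit E (op_cat (elements C P)) (fcomp F elements_proj) (ext_colim s) (ext_leg s) \<and>
      is_internal_colim E (int_f E (iop \<C>) (dP s))
        (idiag_comp E (int_f E (iop \<C>) (dP s)) (iop \<C>) (dF s) (proj_f E (iop \<C>) (dP s)))
        (intF_colim s) (intF_leg s) \<and>
      is_internal_colim E (int_f E \<C> (dF s))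
        (idiag_comp E (int_f E \<C> (dF s)) \<C> (dP s) (proj_f E \<C> (dF s)))
        (intP_colim s) (intP_leg s) \<and>
      is_indexed_colim E (ext_cat E (int_f E \<C> (dF s)))
        (ixfun_comp E (self_indexing E) (ext_diag E \<C> (dP s)) (ext_fun E \<C> (proj_f E \<C> (dF s))))
        (ix_colim s) (ix_leg s))"

text \<open>
  The arrows induced on the colimits by natural transformations \<open>\<alpha> : F \<rightarrow> F'\<close> and \<open>\<beta> : P \<rightarrow> P'\<close>;
  \<open>a\<close> and \<open>b\<close> are the maps of internal diagrams corresponding to \<open>\<alpha>\<close> and \<open>L \<circ> \<beta>\<close>. Each arrow is
  determined by its compatibility with the universal cocones.
\<close>

definition corresponding_map :: "('o, 'a) cat \<Rightarrow> ('u, 'u) cat \<Rightarrow> ('o, 'a) icat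
    \<Rightarrow> ('u \<Rightarrow> 'a) \<Rightarrow> ('o, 'a) idiag \<Rightarrow> ('u \<Rightarrow> 'a) \<Rightarrow> ('o, 'a) idiag \<Rightarrow> ('u \<Rightarrow> 'a) \<Rightarrow> 'a \<Rightarrow> bool" where
  "corresponding_map E C \<D> \<alpha> D \<kappa> D' \<kappa>' a \<longleftrightarrow> is_idiag_map E \<D> D D' a \<and>
     (\<forall>c \<in> Obj C. a \<cdot>\<^bsub>E\<^esub> \<kappa> c = \<kappa>' c \<cdot>\<^bsub>E\<^esub> \<alpha> c)"

definition pb_map :: "('o, 'a) cat \<Rightarrow> 'a \<Rightarrow> 'a \<Rightarrow> 'a \<Rightarrow> 'a \<Rightarrow> 'a \<Rightarrow> 'a \<Rightarrow> 'a" where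
  "pb_map E f g f' g' h k = pair E f' g' (h \<cdot>\<^bsub>E\<^esub> pb1 E f g) (k \<cdot>\<^bsub>E\<^esub> pb2 E f g)"

definition induced_ext :: "('o, 'a) cat \<Rightarrow> ('u, 'u) cat \<Rightarrow> ('u, 'u, 'u set, 'u fn) func
    \<Rightarrow> ('u \<Rightarrow> 'a) \<Rightarrow> ('u \<Rightarrow> 'u fn)
    \<Rightarrow> ('u::universe, 'o, 'a) colims \<Rightarrow> ('u, 'o, 'a) colims \<Rightarrow> 'a \<Rightarrow> bool" where
  "induced_ext E C P \<alpha> \<beta> s s' m \<longleftrightarrow> m \<in> hom E (ext_colim s) (ext_colim s') \<and>
     (\<forall>(c, x) \<in> Obj (elements C P).
        m \<cdot>\<^bsub>E\<^esub> ext_leg s (c, x) = ext_leg s' (c, app (\<beta> c) x) \<cdot>\<^bsub>E\<^esub> \<alpha> c)"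

definition induced_intF :: "('o, 'a) cat \<Rightarrow> 'a \<Rightarrow> 'a
    \<Rightarrow> ('u, 'o, 'a) colims \<Rightarrow> ('u, 'o, 'a) colims \<Rightarrow> 'a \<Rightarrow> bool" where
  "induced_intF E a b s s' m \<longleftrightarrow> m \<in> hom E (intF_colim s) (intF_colim s') \<and>
     m \<cdot>\<^bsub>E\<^esub> intF_leg s =
     intF_leg s' \<cdot>\<^bsub>E\<^esub> pb_map E (anc (dP s)) (anc (dF s)) (anc (dP s')) (anc (dF s')) b a"

definition induced_intP :: "('o, 'a) cat \<Rightarrow> 'a \<Rightarrow> 'a
    \<Rightarrow> ('u, 'o, 'a) colims \<Rightarrow> ('u, 'o, 'a) colims \<Rightarrow> 'a \<Rightarrow> bool" where
  "induced_intP E a b s s' m \<longleftrightarrow> m \<in> hom E (intP_colim s) (intP_colim s') \<and>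
     m \<cdot>\<^bsub>E\<^esub> intP_leg s =
     intP_leg s' \<cdot>\<^bsub>E\<^esub> pb_map E (anc (dF s)) (anc (dP s)) (anc (dF s')) (anc (dP s')) a b"

text \<open>
  At \<open>x : J \<rightarrow> tot (dF s)\<close>, the indexed functors for \<open>s\<close> and \<open>s'\<close> take the values
  \<open>(anc (dF s) \<circ> x)\<^sup>* (anc (dP s))\<close> and, at \<open>a \<circ> x\<close>,
  \<open>(anc (dF s') \<circ> a \<circ> x)\<^sup>* (anc (dP s'))\<close>; \<open>b\<close> induces a map between these.
\<close>

definition induced_ix :: "('o, 'a) cat \<Rightarrow> 'a \<Rightarrow> 'a
    \<Rightarrow> ('u, 'o, 'a) colims \<Rightarrow> ('u, 'o, 'a) colims \<Rightarrow> 'a \<Rightarrow> bool" where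
  "induced_ix E a b s s' m \<longleftrightarrow> m \<in> hom E (ix_colim s) (ix_colim s') \<and>
     (\<forall>J \<in> Obj E. \<forall>x \<in> hom E J (tot (dF s)).
        let y = anc (dF s) \<cdot>\<^bsub>E\<^esub> x; y' = anc (dF s') \<cdot>\<^bsub>E\<^esub> (a \<cdot>\<^bsub>E\<^esub> x) in
        fAr (pull E (bang E J)) (bang E (ix_colim s), m, bang E (ix_colim s'))
          \<cdot>\<^bsub>slice E J\<^esub> ix_leg s (bang E J) x =
        ix_leg s' (bang E J) (a \<cdot>\<^bsub>E\<^esub> x) \<cdot>\<^bsub>slice E J\<^esub>
          (pb1 E y (anc (dP s)),
           pb_map E y (anc (dP s)) y' (anc (dP s')) (Idn E J) b,
           pb1 E y' (anc (dP s'))))"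

end

theory Submission
  imports Defs
begin

text \<open>
  Let \<open>U\<close> and \<open>V\<close> be internal diagrams corresponding to \<open>L \<circ> P\<close> and \<open>F\<close>, and let \<open>W\<close> be the fibre
  product of their total objects over the object of objects. All the colimits compute one object,
  the tensor product of \<open>U\<close> and \<open>V\<close>: the quotient of \<open>W\<close> by the relation \<open>(x \<cdot> f, y) \<sim> (x, y \<cdot> f)\<close>. A
  universal cocone of each of the four kinds is turned into a quotient map out of \<open>W\<close>. The
  comparison isomorphisms are the unique ones compatible with these quotient maps. They are natural
  because the four induced arrows are all determined by the same map between the objects \<open>W\<close>.

  For the internal colimits, the two arrows to be coequalized form a generic instance of the
  relation (\<open>generic_coequalizer\<close>, \<open>intF_tensor\<close>), and exchanging the factors of \<open>W\<close> passes from one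
  of them to the other (\<open>swap_tensor\<close>).

  For the external colimit, \<open>W\<close> is the coproduct of the objects \<open>F c\<close> over all objects \<open>(c, x)\<close> of the
  category of elements of \<open>P\<close> (\<open>W_epi\<close>, \<open>W_induce\<close>), because \<open>L\<close> preserves coproducts and coproducts
  are stable and disjoint. On this coproduct the relation becomes the cocone condition
  (\<open>balanced_legs\<close>).

  For the indexed colimit, a cocone over the localization at \<open>I\<close> amounts, by the Yoneda lemma, to one
  arrow out of \<open>I \<times> W\<close> that respects the relation (\<open>ixcocone_representable\<close>). The quotient is stable
  under product with \<open>I\<close> (\<open>tensor_stable\<close>), so that universality holds over every \<open>I\<close> as soon as it
  holds over the terminal object.

  Of a Grothendieck topos the argument uses pullbacks, gluings of small families along spans, and
  the stability of gluings under pullback. These are obtained from sections of sheaves on a small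
  site. A cocone is a gluing if and only if its legs are jointly locally surjective and sections with
  the same image are locally connected by a zigzag of spans (\<open>local_gluing_is_gluing\<close>,
  \<open>gluing_is_local\<close>). This condition is inherited by pullbacks (\<open>local_gluing_pullback\<close>), and the
  sheaf of germs of sections modulo zigzags satisfies it (\<open>local_gluing_exists\<close>).
\<close>

section \<open>Pullbacks and gluings\<close>

text \<open>
  Short forms of the operations of a category. The category is the one of the ambient structure
  unless it is given as an index.
\<close>

notation Comp (infixl "$\<index>" 70) and Arr ("arr\<index>") and Src ("src\<index>") and Tgt ("tgt\<index>") and Obj ("obj\<index>")

context category
begin

lemma comp_arr [simp]:
 assumes "f : arr" "g : arr" "tgt f = src g"
 shows "g $ f : arr" "src (g $ f) = src f" "tgt (g $ f) = tgt g"
 using Comp_hom[of f "src f" "src g" g "tgt g"] assms by (auto simp: hom_def)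

lemma idn_arr [simp]:
 assumes "x : obj"
 shows "Idn C x : arr" "src (Idn C x) = x" "tgt (Idn C x) = x"
 using Idn_hom[OF assms] by (auto simp: hom_def)

lemma src_tgt_obj [simp]:
 assumes "f : arr" shows "src f : obj" "tgt f : obj"
 using assms Src_Obj Tgt_Obj by auto

lemma hom_obj: "f : hom C x y ==> x : obj & y : obj"
 by (auto simp: hom_def)

lemma assoc [simp]:
 assumes "f : arr" "g : arr" "h : arr" "tgt f = src g" "tgt g = src h"
 shows "(h $ g) $ f = h $ (g $ f)"
 using Comp_assoc[of f "src f" "src g" g "src h" h "tgt h"] assms by (auto simp: hom_def)

lemma comp_idn [simp]: "f : arr ==> src f = x ==> f $ Idn C x = f"
 using Comp_Idn by auto

lemma idn_comp [simp]: "f : arr ==> tgt f = x ==> Idn C x $ f = f"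
 using Idn_Comp by auto

lemma assoc_eq:
 assumes "g $ f = k" "f : arr" "g : arr" "tgt f = src g" "t : arr" "tgt t = src f"
 shows "g $ (f $ t) = k $ t"
 using assms assoc by metis

lemma is_iso_arr:
 assumes "is_iso C x y m" shows "m : arr" "src m = x" "tgt m = y"
 using assms by (auto simp: is_iso_def hom_def)

lemma pullback_arr:
 assumes "is_pullback C f g p q"
 shows "f : arr" "g : arr" "p : arr" "q : arr" "tgt f = tgt g" "src p = src q"
  "tgt p = src f" "tgt q = src g" "f $ p = g $ q"
 using assms unfolding is_pullback_def Let_def by blast+

lemma pullback_univ:
 assumes "is_pullback C f g p q" "u : arr" "v : arr" "src u = src v" "tgt u = src f"
  "tgt v = src g" "f $ u = g $ v"
 shows "EX! h. h : hom C (src u) (src p) & p $ h = u & q $ h = v"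
proof -
 have "ALL u v. f : arr & g : arr & u : arr & v : arr & tgt f = tgt g & src u = src v &
   tgt u = src f & tgt v = src g & f $ u = g $ v -->
   (EX! h. h : hom C (src u) (src p) & p $ h = u & q $ h = v)"
  using assms(1) unfolding is_pullback_def Let_def by (elim conjE)
 from this[THEN spec, THEN spec, THEN mp, of u v] show ?thesis
  using assms pullback_arr[OF assms(1)] by simp
qed

lemma pullbackI:
 assumes "f : arr" "g : arr" "p : arr" "q : arr" "tgt f = tgt g" "src p = src q"
  "tgt p = src f" "tgt q = src g" "f $ p = g $ q"
  and ex: "!!u v. [| u : arr; v : arr; src u = src v; tgt u = src f; tgt v = src g; f $ u = g $ v |] ==>
   EX h : arr. src h = src u & tgt h = src p & p $ h = u & q $ h = v"
  and un: "!!h k. [| h : arr; k : arr; src h = src k; tgt h = src p; tgt k = src p;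
   p $ h = p $ k; q $ h = q $ k |] ==> h = k"
 shows "is_pullback C f g p q"
proof -
 have "EX! h. h : hom C (src u) (src p) & p $ h = u & q $ h = v"
  if uv: "u : arr" "v : arr" "src u = src v" "tgt u = src f" "tgt v = src g" "f $ u = g $ v" for u v
 proof -
  obtain h where "h : arr" "src h = src u" "tgt h = src p" "p $ h = u" "q $ h = v"
   using ex[OF uv] by blast
  then show ?thesis using un by (intro ex1I[of _ h]) (simp_all add: hom_def)
 qed
 then have "ALL u v. f : arr & g : arr & u : arr & v : arr & tgt f = tgt g & src u = src v &
   tgt u = src f & tgt v = src g & f $ u = g $ v -->
   (EX! h. h : hom C (src u) (src p) & p $ h = u & q $ h = v)" by (intro allI impI) (elim conjE)
 then show ?thesis unfolding is_pullback_def Let_def by (intro conjI assms(1-9))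
qed

lemma pullback_lift:
 assumes "is_pullback C f g p q" "u : arr" "v : arr" "src u = src v" "tgt u = src f"
  "tgt v = src g" "f $ u = g $ v"
 obtains h where "h : arr" "src h = src u" "tgt h = src p" "p $ h = u" "q $ h = v"
 using pullback_univ[OF assms] by (auto simp: hom_def)

lemma pullback_eq:
 assumes "is_pullback C f g p q" "h : arr" "k : arr" "src h = src k" "tgt h = src p" "tgt k = src p"
  "p $ h = p $ k" "q $ h = q $ k"
 shows "h = k"
proof -
 note a = pullback_arr[OF assms(1)]
 have "f $ (p $ h) = g $ (q $ h)" using a assms(2-6) assoc by metis
 then have "EX! l. l : hom C (src (p $ h)) (src p) & p $ l = p $ h & q $ l = q $ h"
  using a assms by (intro pullback_univ[OF assms(1)]) auto
 moreover have "h : hom C (src (p $ h)) (src p)" "k : hom C (src (p $ h)) (src p)"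
  using a assms by (auto simp: hom_def)
 ultimately show ?thesis using assms(7,8) by auto
qed

lemma pullback_sym:
 assumes "is_pullback C f g p q" shows "is_pullback C g f q p"
proof (rule pullbackI)
 fix u v assume "u : arr" "v : arr" "src u = src v" "tgt u = src g" "tgt v = src f" "g $ u = f $ v"
 then show "EX h : arr. src h = src u & tgt h = src q & q $ h = u & p $ h = v"
  
  by (elim pullback_lift[OF assms, of v u]) (use pullback_arr[OF assms] in auto)
qed (use pullback_arr[OF assms] pullback_eq[OF assms] in auto)

lemma pullback_unique_iso:
 assumes "is_pullback C f g p q" "is_pullback C f g p' q'"
 obtains h k where "h : hom C (src p') (src p)" "k : hom C (src p) (src p')"
  "p $ h = p'" "q $ h = q'" "p' $ k = p" "q' $ k = q" "h $ k = Idn C (src p)" "k $ h = Idn C (src p')"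
proof -
 note a = pullback_arr[OF assms(1)] and b = pullback_arr[OF assms(2)]
 obtain h where h: "h : arr" "src h = src p'" "tgt h = src p" "p $ h = p'" "q $ h = q'"
  by (rule pullback_lift[OF assms(1) b(3,4,6-9)])
 obtain k where k: "k : arr" "src k = src p" "tgt k = src p'" "p' $ k = p" "q' $ k = q"
  by (rule pullback_lift[OF assms(2) a(3,4,6-9)])
 have "p $ (h $ k) = p" "q $ (h $ k) = q" "p' $ (k $ h) = p'" "q' $ (k $ h) = q'"
  using h k a b assoc_eq by auto
 note e = this
 have "h $ k = Idn C (src p)" by (rule pullback_eq[OF assms(1)]) (use h k a e in simp_all)
 moreover have "k $ h = Idn C (src p')" by (rule pullback_eq[OF assms(2)]) (use h k b e in simp_all)
 ultimately show thesis using that h k by (simp add: hom_def)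
qed

end

text \<open>
  Colimits enter only through one kind of diagram: a family of objects \<open>X i\<close> together with a class
  \<open>K\<close> of parallel spans, a span \<open>(i, u, j, v)\<close> asking that \<open>u\<close> into \<open>X i\<close> be identified with \<open>v\<close>
  into \<open>X j\<close>. Coproducts have no spans and coequalizers have a single object and a single span.
  The class \<open>K\<close> may be large, so that it can range over all generalized elements.
\<close>

definition glue_spans :: "('o, 'a) cat => 'i set => ('i => 'o) => ('i \<times> 'a \<times> 'i \<times> 'a) set => bool" where
 "glue_spans E I X K \<longleftrightarrow> (ALL i : I. X i : Obj E) & (ALL (i, u, j, v) : K. i : I & j : I & u : Arr E &
   v : Arr E & Src E u = Src E v & Tgt E u = X i & Tgt E v = X j)"

definition glue_cocone :: "('o, 'a) cat => 'i set => ('i => 'o) => ('i \<times> 'a \<times> 'i \<times> 'a) set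
  => 'o => ('i => 'a) => bool" where
 "glue_cocone E I X K Y \<rho> \<longleftrightarrow> Y : Obj E & (ALL i : I. \<rho> i : hom E (X i) Y) &
   (ALL (i, u, j, v) : K. \<rho> i $\<^bsub>E\<^esub> u = \<rho> j $\<^bsub>E\<^esub> v)"

definition is_gluing :: "('o, 'a) cat => 'i set => ('i => 'o) => ('i \<times> 'a \<times> 'i \<times> 'a) set
  => 'o => ('i => 'a) => bool" where
 "is_gluing E I X K Q \<iota> \<longleftrightarrow> glue_cocone E I X K Q \<iota> &
   (ALL Y \<rho>. glue_cocone E I X K Y \<rho> --> (EX! h. h : hom E Q Y & (ALL i : I. h $\<^bsub>E\<^esub> \<iota> i = \<rho> i)))"

text \<open>The spans of a gluing of \<open>\<iota> i\<close>, pulled back along an arrow with pullback legs \<open>\<iota>' i\<close>, \<open>\<pi> i\<close>.\<close>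

definition pull_spans :: "('o, 'a) cat => 'i set => ('i \<times> 'a \<times> 'i \<times> 'a) set => ('i => 'a) => ('i => 'a)
  => ('i \<times> 'a \<times> 'i \<times> 'a) set" where
 "pull_spans E I K \<iota>' \<pi> = {(i, u', j, v') |i u' j v'. i : I & j : I & u' : Arr E & v' : Arr E &
   Src E u' = Src E v' & Tgt E u' = Src E (\<iota>' i) & Tgt E v' = Src E (\<iota>' j) &
   \<iota>' i $\<^bsub>E\<^esub> u' = \<iota>' j $\<^bsub>E\<^esub> v' &
   (EX u v t. (i, u, j, v) : K & t : hom E (Src E u') (Src E u) &
    \<pi> i $\<^bsub>E\<^esub> u' = u $\<^bsub>E\<^esub> t & \<pi> j $\<^bsub>E\<^esub> v' = v $\<^bsub>E\<^esub> t)}"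

lemma pull_spansI:
 assumes "(i, u, j, v) : K" "i : I" "j : I" "u' : Arr E" "v' : Arr E" "Src E u' = Src E v'"
  "Tgt E u' = Src E (\<iota>' i)" "Tgt E v' = Src E (\<iota>' j)" "\<iota>' i $\<^bsub>E\<^esub> u' = \<iota>' j $\<^bsub>E\<^esub> v'"
  "t : hom E (Src E u') (Src E u)" "\<pi> i $\<^bsub>E\<^esub> u' = u $\<^bsub>E\<^esub> t" "\<pi> j $\<^bsub>E\<^esub> v' = v $\<^bsub>E\<^esub> t"
 shows "(i, u', j, v') : pull_spans E I K \<iota>' \<pi>"
 unfolding pull_spans_def mem_Collect_eq
 by (rule exI[of _ i], rule exI[of _ u'], rule exI[of _ j], rule exI[of _ v'], intro conjI refl assms
   exI[of _ u] exI[of _ v] exI[of _ t])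

lemma (in category) gluing_unique_iso:
 assumes "is_gluing C I X K Q \<iota>" "is_gluing C I X K Q' \<iota>'"
 obtains m m' where "m : hom C Q Q'" "m' : hom C Q' Q" "m' $ m = Idn C Q" "m $ m' = Idn C Q'"
  "!!i. i : I ==> m $ \<iota> i = \<iota>' i" "!!i. i : I ==> m' $ \<iota>' i = \<iota> i"
proof -
 have c: "glue_cocone C I X K Q \<iota>" "glue_cocone C I X K Q' \<iota>'" using assms by (auto simp: is_gluing_def)
 then have Q: "Q : obj" "Q' : obj" and i: "!!i. i : I ==> \<iota> i : hom C (X i) Q" "!!i. i : I ==> \<iota>' i : hom C (X i) Q'"
  by (auto simp: glue_cocone_def)
 obtain m where m: "m : hom C Q Q'" "ALL i :I. m $ \<iota> i = \<iota>' i"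
  using assms(1) c(2) unfolding is_gluing_def by blast
 obtain m' where m': "m' : hom C Q' Q" "ALL i :I. m' $ \<iota>' i = \<iota> i"
  using assms(2) c(1) unfolding is_gluing_def by blast
 have "m' $ m : hom C Q Q & (ALL i :I. (m' $ m) $ \<iota> i = \<iota> i)"
  using m m' i by (auto simp: hom_def)
 moreover have "Idn C Q : hom C Q Q & (ALL i :I. Idn C Q $ \<iota> i = \<iota> i)"
  using Q i by (auto simp: hom_def)
 ultimately have 1: "m' $ m = Idn C Q" using assms(1) c(1) unfolding is_gluing_def by blast
 have "m $ m' : hom C Q' Q' & (ALL i :I. (m $ m') $ \<iota>' i = \<iota>' i)"
  using m m' i by (auto simp: hom_def)
 moreover have "Idn C Q' : hom C Q' Q' & (ALL i :I. Idn C Q' $ \<iota>' i = \<iota>' i)"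
  using Q i by (auto simp: hom_def)
 ultimately have 2: "m $ m' = Idn C Q'" using assms(2) c(2) unfolding is_gluing_def by blast
 show thesis using that m m' 1 2 by blast
qed

section \<open>Small sets of arbitrary type\<close>

lemma small_inj: "|A :: 'b set| <o |UNIV :: 'u set| ==> EX f :: 'b => 'u. inj_on f A"
 using card_of_ordLeq[of A "UNIV :: 'u set"] ordLess_imp_ordLeq by blast

lemma small_subset: "[| |A| <o |UNIV :: 'u set|; B \<subseteq> A |] ==> |B| <o |UNIV :: 'u set|"
 using card_of_mono1 ordLeq_ordLess_trans by blast

lemma small_image: "|A| <o |UNIV :: 'u set| ==> |f ` A| <o |UNIV :: 'u set|"
 using card_of_image ordLeq_ordLess_trans by blast

lemma small_inj_image: "[| inj_on f A; |f ` A| <o |UNIV :: 'u set| |] ==> |A| <o |UNIV :: 'u set|"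
 using card_of_ordLeqI[of f A "f ` A"] ordLeq_ordLess_trans by blast

lemma small_Pow:
 assumes "|A :: 'b set| <o |UNIV :: 'u::universe set|"
 shows "|Pow A| <o |UNIV :: 'u set|"
proof -
 obtain f :: "'b => 'u" where f: "inj_on f A" using small_inj[OF assms] by blast
 have "|Pow (f ` A)| <o |UNIV :: 'u set|" using universe_Pow small_image[OF assms] by blast
 moreover have "inj_on (image f) (Pow A)" using f by (rule inj_on_image_Pow)
 moreover have "image f ` Pow A \<subseteq> Pow (f ` A)" by blast
 ultimately show ?thesis using small_inj_image small_subset by metis
qed

text \<open>
  An infinite type is in bijection with its square. A pairing on the type itself keeps sums of
  small sets of other types within reach of the axioms, which only speak of subsets of the type.
\<close>

lemma pairing_exists: "EX p :: 'u::universe \<times> 'u => 'u. inj p"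
proof -
 have "|UNIV \<times> UNIV :: ('u \<times> 'u) set| \<le>o |UNIV :: 'u set|"
  using card_of_Times_same_infinite[OF infinite_universe] ordIso_iff_ordLeq by blast
 then show ?thesis using card_of_ordLeq[of "UNIV \<times> UNIV :: ('u \<times> 'u) set" "UNIV :: 'u set"] by auto
qed

lemma small_Sigma:
 assumes "|I :: 'i set| <o |UNIV :: 'u::universe set|" "!!i. i : I ==> |X i :: 'b set| <o |UNIV :: 'u set|"
 shows "|Sigma I X| <o |UNIV :: 'u set|"
proof -
 obtain f :: "'i => 'u" where f: "inj_on f I" using small_inj[OF assms(1)] by blast
 have "ALL i. EX g :: 'b => 'u. i : I --> inj_on g (X i)" using small_inj assms(2) by blast
 then obtain g :: "'i => 'b => 'u" where g: "!!i. i : I ==> inj_on (g i) (X i)" by metis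
 obtain p :: "'u \<times> 'u => 'u" where p: "inj p" using pairing_exists by blast
 \<comment> \<open>The pairing sends the disjoint sum into the type, whose axiom on unions bounds it there.\<close>
 let ?h = "%(i, x). p (f i, g i x)"
 have inj: "inj_on ?h (Sigma I X)"
 proof (rule inj_onI, clarify)
  fix i x j y assume "i : I" "x : X i" "j : I" "y : X j" "p (f i, g i x) = p (f j, g j y)"
  moreover from this have "f i = f j" "g i x = g j y" using injD[OF p] by blast+
  ultimately show "i = j & x = y" using f g inj_onD by metis
 qed
 have sub: "?h ` Sigma I X \<subseteq> (\<Union>i' \<in> f ` I. (%x. p (i', g (inv_into I f i') x)) ` X (inv_into I f i'))"
 proof (rule image_subsetI)
  fix s assume "s : Sigma I X"
  then obtain i x where s: "s = (i, x)" "i : I" "x : X i" by auto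
  then have "inv_into I f (f i) = i" using f by simp
  then show "?h s : (\<Union>i' \<in> f ` I. (%x. p (i', g (inv_into I f i') x)) ` X (inv_into I f i'))"
   using s by (intro UN_I[of "f i"]) simp_all
 qed
 have sm: "|\<Union>i' \<in> f ` I. (%x. p (i', g (inv_into I f i') x)) ` X (inv_into I f i')| <o |UNIV :: 'u set|"
  by (rule universe_UNION) (simp_all add: small_image assms inv_into_into)
 show ?thesis by (rule small_inj_image[OF inj small_subset[OF sm sub]])
qed

lemma small_UNION:
 assumes "|I :: 'i set| <o |UNIV :: 'u::universe set|" "!!i. i : I ==> |X i :: 'b set| <o |UNIV :: 'u set|"
 shows "|\<Union>i \<in>I. X i| <o |UNIV :: 'u set|"
proof -
 have "(\<Union>i \<in>I. X i) = snd ` Sigma I X" by force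
 moreover have "|Sigma I X| <o |UNIV :: 'u set|" using assms by (rule small_Sigma)
 ultimately show ?thesis using small_image by metis
qed

lemma small_Times:
 assumes "|A :: 'i set| <o |UNIV :: 'u::universe set|" "|B :: 'b set| <o |UNIV :: 'u set|"
 shows "|A \<times> B| <o |UNIV :: 'u set|"
 by (rule small_Sigma) (use assms in auto)

lemma small_singleton: "small {x :: 'u::universe}"
 unfolding small_def
 by (rule finite_ordLess_infinite) (auto simp: infinite_universe card_of_well_order_on Field_card_of)


section \<open>Local truth on a site\<close>

locale site = D: category D for D :: "('u::universe, 'u) cat" (structure) +
 fixes J :: "'u => 'u set set"
 assumes small_D: "small_category D" and topology: "grothendieck_topology D J"
begin

abbreviation compD (infixl "$$" 70) where "g $$ f \<equiv> g $\<^bsub>D\<^esub> f"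

text \<open>
  A property of the arrows into \<open>c\<close> holds locally if it holds on some covering sieve. This makes
  the topology a modality, and the covering axioms become the rules \<open>loc_top\<close>, \<open>loc_conj\<close>,
  \<open>loc_pull\<close> and \<open>loc_trans\<close>.
\<close>

definition loc :: "'u => ('u => bool) => bool" where
 "loc c P \<longleftrightarrow> c : Obj D & (EX S : J c. ALL f : S. P f)"

lemma J_sieve: "c : Obj D ==> S : J c ==> sieve D c S"
 using topology by (auto simp: grothendieck_topology_def)

lemma J_arr: "c : Obj D ==> S : J c ==> f : S ==> f : Arr D & Tgt D f = c"
 using J_sieve by (auto simp: sieve_def)

lemma J_comp: "c : Obj D ==> S : J c ==> f : S ==> g : Arr D ==> Tgt D g = Src D f ==> f $ g : S"
 using J_sieve by (auto simp: sieve_def)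

lemma J_max: "c : Obj D ==> {f : Arr D. Tgt D f = c} : J c"
 using topology by (auto simp: grothendieck_topology_def)

lemma J_pull: "f : Arr D ==> S : J (Tgt D f) ==> pull_sieve D f S : J (Src D f)"
 using topology by (auto simp: grothendieck_topology_def)

lemma J_trans:
 "c : Obj D ==> S : J c ==> sieve D c R ==> (!!f. f : S ==> pull_sieve D f R : J (Src D f)) ==> R : J c"
 using topology unfolding grothendieck_topology_def by blast

lemma J_up:
 assumes "c : Obj D" "S : J c" "sieve D c R" "S \<subseteq> R" shows "R : J c"
proof (rule J_trans[OF assms(1-3)])
 fix f assume f: "f : S"
 then have fa: "f : Arr D" "Tgt D f = c" using J_arr assms by auto
 have "pull_sieve D f R = {g : Arr D. Tgt D g = Src D f}"
  using f assms fa by (auto simp: pull_sieve_def sieve_def)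
 then show "pull_sieve D f R : J (Src D f)" using J_max fa by simp
qed

lemma loc_top: "c : Obj D ==> (!!f. f : Arr D ==> Tgt D f = c ==> P f) ==> loc c P"
 by (auto simp: loc_def intro!: bexI[OF _ J_max])

lemma loc_obj: "loc c P ==> c : Obj D"
 by (simp add: loc_def)

lemma loc_pull:
 assumes "loc c P" "g : Arr D" "Tgt D g = c" shows "loc (Src D g) (%f. P (g $ f))"
proof -
 obtain S where "S : J c" "ALL f :S. P f" using assms by (auto simp: loc_def)
 then show ?thesis unfolding loc_def using assms J_pull[of g S]
  by (auto simp: pull_sieve_def intro!: bexI[of _ "pull_sieve D g S"])
qed

lemma loc_trans:
 assumes "loc c P"
  and "!!f. f : Arr D ==> Tgt D f = c ==> P f ==> loc (Src D f) (%g. Q (f $ g))"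
 shows "loc c Q"
proof -
 obtain S where S: "S : J c" "ALL f :S. P f" and c: "c : Obj D" using assms by (auto simp: loc_def)
 \<comment> \<open>The arrows over which \<open>Q\<close> holds everywhere form a sieve, to which transitivity applies.\<close>
 let ?R = "{h : Arr D. Tgt D h = c & (ALL k : Arr D. Tgt D k = Src D h --> Q (h $ k))}"
 have R: "sieve D c ?R" unfolding sieve_def by auto
 have "?R : J c"
 proof (rule J_trans[OF c S(1) R])
  fix f assume f: "f : S"
  then have fa: "f : Arr D" "Tgt D f = c" "P f" using J_arr S c by auto
  obtain T where T: "T : J (Src D f)" "ALL g :T. Q (f $ g)" using assms(2)[OF fa] by (auto simp: loc_def)
  have s: "Src D f : Obj D" using fa by simp
  have "T \<subseteq> pull_sieve D f ?R"
   using T J_arr[OF s T(1)] J_comp[OF s T(1)] fa by (auto simp: pull_sieve_def)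
  moreover have "sieve D (Src D f) (pull_sieve D f ?R)"
   using fa by (auto simp: sieve_def pull_sieve_def)
  ultimately show "pull_sieve D f ?R : J (Src D f)" using J_up[OF s T(1)] by blast
 qed
 moreover have "ALL f :?R. Q f" 
 proof
  fix f assume "f : ?R"
  then have f: "f : Arr D" and q: "!!k. k : Arr D ==> Tgt D k = Src D f ==> Q (f $ k)" by auto
  show "Q f" using q[of "Idn D (Src D f)"] f by simp
 qed
 ultimately show ?thesis unfolding loc_def by (intro conjI c bexI[of _ ?R])
qed

lemma loc_mono:
 assumes "loc c P" "!!f. f : Arr D ==> Tgt D f = c ==> P f ==> Q f" shows "loc c Q"
 using assms J_arr unfolding loc_def by metis

lemma loc_conj:
 assumes "loc c P" "loc c Q" shows "loc c (%f. P f & Q f)"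
proof -
 obtain S where S: "S : J c" "ALL f :S. P f" and c: "c : Obj D" using assms by (auto simp: loc_def)
 have "loc c (%f. f : S)" using S c by (auto simp: loc_def)
 then show ?thesis
 proof (rule loc_trans)
  fix f assume f: "f : Arr D" "Tgt D f = c" "f : S"
  have "loc (Src D f) (%g. Q (f $ g))" using loc_pull[OF assms(2)] f by auto
  then show "loc (Src D f) (%g. P (f $ g) & Q (f $ g))"
   by (rule loc_mono) (use f S c J_comp in auto)
 qed
qed

text \<open>Sheaves of elements of an arbitrary type.\<close>

definition psh :: "('u => 'x set) => ('u => 'x => 'x) => bool" where
 "psh X r \<longleftrightarrow>
   (ALL f : Arr D. ALL x : X (Tgt D f). r f x : X (Src D f)) &
   (ALL c : Obj D. ALL x : X c. r (Idn D c) x = x) &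
   (ALL f : Arr D. ALL g : Arr D. Tgt D f = Src D g --> (ALL x : X (Tgt D g). r (g $ f) x = r f (r g x)))"

lemma psh_in: "psh X r ==> f : Arr D ==> x : X (Tgt D f) ==> r f x : X (Src D f)"
 by (simp add: psh_def)

definition sheaf_on :: "('u => 'x set) => ('u => 'x => 'x) => bool" where
 "sheaf_on X r \<longleftrightarrow> psh X r &
   (ALL c : Obj D. ALL S : J c. ALL x. (ALL f : S. x f : X (Src D f)) &
    (ALL f : S. ALL g : Arr D. Tgt D g = Src D f --> r g (x f) = x (f $ g)) -->
    (EX! y. y : X c & (ALL f : S. r f y = x f)))"

lemma sheaf_amalgam:
 assumes "sheaf_on X r" "c : Obj D" "S : J c" "!!f. f : S ==> x f : X (Src D f)"
  "!!f g. f : S ==> g : Arr D ==> Tgt D g = Src D f ==> r g (x f) = x (f $ g)"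
 shows "EX! y. y : X c & (ALL f : S. r f y = x f)"
proof -
 have "ALL x. (ALL f : S. x f : X (Src D f)) &
    (ALL f : S. ALL g : Arr D. Tgt D g = Src D f --> r g (x f) = x (f $ g)) -->
    (EX! y. y : X c & (ALL f : S. r f y = x f))"
  using assms(1-3) unfolding sheaf_on_def by (elim conjE) (drule (1) bspec, drule (1) bspec)
 from this[THEN spec[of _ x], THEN mp] show ?thesis using assms(4-5) by simp
qed

lemma sheaf_sep:
 assumes "sheaf_on X r" "x : X c" "y : X c" "loc c (%f. r f x = r f y)"
 shows "x = y"
proof -
 obtain S where S: "S : J c" "ALL f :S. r f x = r f y" and c: "c : Obj D" using assms by (auto simp: loc_def)
 have p: "psh X r" using assms by (auto simp: sheaf_on_def)
 have a: "!!f. f : S ==> f : Arr D & Tgt D f = c" using J_arr c S by blast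
 have "ALL f :S. r f x : X (Src D f)" using p a assms by (auto simp: psh_def)
 moreover have "ALL f : S. ALL g : Arr D. Tgt D g = Src D f --> r g (r f x) = r (f $ g) x"
  using p a assms by (auto simp: psh_def)
 ultimately have "EX! y. y : X c & (ALL f : S. r f y = r f x)"
  by (intro sheaf_amalgam[OF assms(1) c S(1)]) auto
 then show ?thesis using assms S by metis
qed

text \<open>
  Gluing along a relation \<open>G f y\<close>, read as "the restriction along \<open>f\<close> should be \<open>y\<close>", which is
  single-valued and locally total.
\<close>

lemma sheaf_glue:
 assumes sh: "sheaf_on X r"
  and cl: "!!f g y. [| f : Arr D; Tgt D f = c; g : Arr D; Tgt D g = Src D f; y : X (Src D f); G f y |] ==> G (f $ g) (r g y)"
  and fn: "!!f y y'. [| f : Arr D; Tgt D f = c; y : X (Src D f); y' : X (Src D f); G f y; G f y' |] ==> y = y'"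
  and tot: "loc c (%f. EX y : X (Src D f). G f y)"
 shows "EX x : X c. ALL f : Arr D. Tgt D f = c --> (ALL y : X (Src D f). G f y --> r f x = y)"
proof -
 obtain S where S: "S : J c" "ALL f :S. EX y : X (Src D f). G f y" and c: "c : Obj D"
  using tot by (auto simp: loc_def)
 then obtain z where z: "!!f. f : S ==> z f : X (Src D f) & G f (z f)" by metis
 have p: "psh X r" using sh by (auto simp: sheaf_on_def)
 have a: "!!f. f : S ==> f : Arr D & Tgt D f = c" using J_arr c S by blast
 have "r g (z f) = z (f $ g)" if "f : S" "g : Arr D" "Tgt D g = Src D f" for f g
 proof (rule fn)
  have fg: "f $ g : S" using J_comp[OF c S(1)] that by blast
  show "r g (z f) : X (Src D (f $ g))" using p z[of f] a[of f] that by (auto simp: psh_def)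
  show "G (f $ g) (r g (z f))" using cl z a that by auto
  show "z (f $ g) : X (Src D (f $ g))" "G (f $ g) (z (f $ g))" using z[OF fg] by auto
 qed (use a that in auto)
 then obtain x where x: "x : X c" "ALL f :S. r f x = z f"
  using ex1_implies_ex[OF sheaf_amalgam[OF sh c S(1), of z]] z by blast
 have "r f x = y" if f: "f : Arr D" "Tgt D f = c" "y : X (Src D f)" "G f y" for f y
 proof (rule sheaf_sep[OF sh])
  show "r f x : X (Src D f)" using p x f by (auto simp: psh_def)
  have "loc c (%h. h : S)" using S c by (auto simp: loc_def)
  then have "loc (Src D f) (%g. f $ g : S)" using f loc_pull by blast
  then show "loc (Src D f) (%g. r g (r f x) = r g y)"
  proof (rule loc_mono)
   fix g assume g: "g : Arr D" "Tgt D g = Src D f" "f $ g : S"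
   have "r g (r f x) = r (f $ g) x" using p x f g by (auto simp: psh_def)
   also have "\<dots> = z (f $ g)" using x g by blast
   also have "\<dots> = r g y"
   proof (rule fn)
    show "r g y : X (Src D (f $ g))" using p f g by (auto simp: psh_def)
    show "G (f $ g) (r g y)" using cl f g by auto
   qed (use z[OF g(3)] a[OF g(3)] in auto)
   finally show "r g (r f x) = r g y" .
  qed
 qed (use f in auto)
 then show ?thesis using x(1) by blast
qed

lemma sheaf_onI:
 assumes p: "psh X r"
  and sep: "!!c x y. x : X c ==> y : X c ==> loc c (%f. r f x = r f y) ==> x = y"
  and glue: "!!c G. [| !!f g y. [| f : Arr D; Tgt D f = c; g : Arr D; Tgt D g = Src D f; y : X (Src D f); G f y |] ==> G (f $ g) (r g y);
    !!f y y'. [| f : Arr D; Tgt D f = c; y : X (Src D f); y' : X (Src D f); G f y; G f y' |] ==> y = y';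
    loc c (%f. EX y : X (Src D f). G f y) |]
   ==> EX x : X c. ALL f : Arr D. Tgt D f = c --> (ALL y : X (Src D f). G f y --> r f x = y)"
 shows "sheaf_on X r"
 unfolding sheaf_on_def
proof (intro conjI ballI allI impI p; elim conjE)
 fix c S x assume c: "c : Obj D" and S: "S : J c" and x: "ALL f :S. x f : X (Src D f)"
  and m: "ALL f :S. ALL g :Arr D. Tgt D g = Src D f --> r g (x f) = x (f $ g)"
 have "EX y : X c. ALL f : Arr D. Tgt D f = c --> (ALL z : X (Src D f). (f : S & z = x f) --> r f y = z)"
  by (rule glue) (use x m c S J_comp[OF c S] in "auto simp: loc_def")
 then obtain y where y: "y : X c" "ALL f :S. r f y = x f" using J_arr[OF c S] x by metis
 show "EX! y. y : X c & (ALL f :S. r f y = x f)"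
 proof (rule ex1I[of _ y])
  fix y' assume y': "y' : X c & (ALL f :S. r f y' = x f)"
  show "y' = y" by (rule sep[of _ c]) (use y y' c S in "auto simp: loc_def intro!: bexI[of _ S]")
 qed (use y in auto)
qed

end

section \<open>Toposes as categories of sheaves of elements\<close>

text \<open>
  A category whose objects have elements \<open>el e c\<close> at the stages \<open>c\<close> of a site, restricted by \<open>rs\<close>
  and mapped by \<open>ap\<close>, in such a way that arrows are the same as natural maps of elements and that
  the objects are, up to isomorphism, all the small sheaves.
\<close>

locale sheaf_model = category E + site D J
 for E :: "('o, 'a) cat" (structure) and D :: "('u::universe, 'u) cat" and J +
 fixes el :: "'o => 'u => 'u set" and rs :: "'o => 'u => 'u => 'u" and ap :: "'a => 'u => 'u => 'u"
 assumes el_sheaf: "e : Obj E ==> sheaf_on (el e) (rs e)"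
  and el_small: "e : Obj E ==> c : Obj D ==> small (el e c)"
  and ap_in: "m : Arr E ==> c : Obj D ==> x : el (Src E m) c ==> ap m c x : el (Tgt E m) c"
  and ap_rs: "m : Arr E ==> f : Arr D ==> x : el (Src E m) (Tgt D f) ==>
   ap m (Src D f) (rs (Src E m) f x) = rs (Tgt E m) f (ap m (Tgt D f) x)"
  and ap_id: "e : Obj E ==> c : Obj D ==> x : el e c ==> ap (Idn E e) c x = x"
  and ap_comp: "m : Arr E ==> n : Arr E ==> Tgt E m = Src E n ==> c : Obj D ==> x : el (Src E m) c ==>
   ap (n $ m) c x = ap n c (ap m c x)"
  and faithful: "m : hom E e e' ==> n : hom E e e' ==>
   (!!c x. c : Obj D ==> x : el e c ==> ap m c x = ap n c x) ==> m = n"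
  and full: "e : Obj E ==> e' : Obj E ==> (!!c x. c : Obj D ==> x : el e c ==> h c x : el e' c) ==>
   (!!f x. f : Arr D ==> x : el e (Tgt D f) ==> h (Src D f) (rs e f x) = rs e' f (h (Tgt D f) x)) ==>
   EX m : hom E e e'. ALL c : Obj D. ALL x : el e c. ap m c x = h c x"
  and ess_surj: "sheaf_on (X :: 'u => 'u set) r ==> (!!c. c : Obj D ==> small (X c)) ==>
   EX e : Obj E. EX b. (ALL c : Obj D. bij_betw (b c) (X c) (el e c)) &
    (ALL f : Arr D. ALL x : X (Tgt D f). b (Src D f) (r f x) = rs e f (b (Tgt D f) x))"
begin

lemma rs_in: "e : Obj E ==> f : Arr D ==> x : el e (Tgt D f) ==> rs e f x : el e (Src D f)"
 using el_sheaf by (auto simp: sheaf_on_def psh_def)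

lemma rs_id: "e : Obj E ==> c : Obj D ==> x : el e c ==> rs e (Idn D c) x = x"
 using el_sheaf by (auto simp: sheaf_on_def psh_def)

lemma rs_comp: "e : Obj E ==> f : Arr D ==> g : Arr D ==> Tgt D f = Src D g ==> x : el e (Tgt D g) ==>
  rs e (g $$ f) x = rs e f (rs e g x)"
 using el_sheaf by (auto simp: sheaf_on_def psh_def)

lemma sep: "e : Obj E ==> x : el e c ==> y : el e c ==> loc c (%f. rs e f x = rs e f y) ==> x = y"
 using sheaf_sep el_sheaf by metis

text \<open>Small sheaves of any type of elements are recoded in the universe.\<close>

lemma ess_surj_any:
 fixes X :: "'u => 'x set"
 assumes X: "sheaf_on X r" and sm: "!!c. c : Obj D ==> |X c| <o |UNIV :: 'u set|"
 obtains e b where "e : Obj E" "!!c. c : Obj D ==> bij_betw (b c) (X c) (el e c)"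
  "!!f x. f : Arr D ==> x : X (Tgt D f) ==> b (Src D f) (r f x) = rs e f (b (Tgt D f) x)"
proof -
 obtain k :: "'u => 'x => 'u" where k: "!!c. c : Obj D ==> inj_on (k c) (X c)"
 proof -
  have "ALL c. EX k :: 'x => 'u. c : Obj D --> inj_on k (X c)" using small_inj[OF sm] by blast
  then show thesis using that by metis
 qed
 \<comment> \<open>Transport of the structure of \<open>X\<close> along injections \<open>k c\<close> into the universe.\<close>
 define k' where "k' c = inv_into (X c) (k c)" for c
 have kk: "k' c (k c x) = x" if "c : Obj D" "x : X c" for c x using that k by (simp add: k'_def)
 let ?X = "%c. k c ` X c" and ?r = "%f y. k (Src D f) (r f (k' (Tgt D f) y))"
 have p: "psh X r" using X by (simp add: sheaf_on_def)
 have p': "psh ?X ?r" using p kk by (auto simp: psh_def)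
 have "sheaf_on ?X ?r"
 proof (rule sheaf_onI[OF p'])
  fix c x y assume "x : ?X c" "y : ?X c" and l: "loc c (%f. ?r f x = ?r f y)"
  then obtain x' y' where x: "x = k c x'" "x' : X c" "y = k c y'" "y' : X c" by blast
  have c: "c : Obj D" using l loc_obj by blast
  have "loc c (%f. r f x' = r f y')"
  proof (rule loc_mono[OF l])
   fix f assume f: "f : Arr D" "Tgt D f = c" "?r f x = ?r f y"
   then have "k (Src D f) (r f x') = k (Src D f) (r f y')" using x kk c by simp
   moreover have "r f x' : X (Src D f)" "r f y' : X (Src D f)" using p x f by (auto simp: psh_def)
   ultimately show "r f x' = r f y'" using k[of "Src D f"] f inj_onD by fastforce
  qed
  then show "x = y" using sheaf_sep[OF X] x by blast
 next
  fix c G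
  assume cl: "!!f g y. [| f : Arr D; Tgt D f = c; g : Arr D; Tgt D g = Src D f; y : ?X (Src D f); G f y |] ==> G (f $$ g) (?r g y)"
   and fn: "!!f y y'. [| f : Arr D; Tgt D f = c; y : ?X (Src D f); y' : ?X (Src D f); G f y; G f y' |] ==> y = y'"
   and tot: "loc c (%f. EX y : ?X (Src D f). G f y)"
  have c: "c : Obj D" using tot loc_obj by blast
  have "EX x : X c. ALL f : Arr D. Tgt D f = c --> (ALL y : X (Src D f). G f (k (Src D f) y) --> r f x = y)"
  proof (rule sheaf_glue[OF X])
   fix f g y assume f: "f : Arr D" "Tgt D f = c" "g : Arr D" "Tgt D g = Src D f" "y : X (Src D f)" "G f (k (Src D f) y)"
   then have "G (f $$ g) (?r g (k (Src D f) y))" using cl by blast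
   then show "G (f $$ g) (k (Src D (f $$ g)) (r g y))" using f kk by simp
  next
   fix f y y' assume f: "f : Arr D" "Tgt D f = c" "y : X (Src D f)" "y' : X (Src D f)"
    "G f (k (Src D f) y)" "G f (k (Src D f) y')"
   then have "k (Src D f) y = k (Src D f) y'" using fn by blast
   then show "y = y'" using k[of "Src D f"] f inj_onD by fastforce
  next
   show "loc c (%f. EX y :X (Src D f). G f (k (Src D f) y))"
    by (rule loc_mono[OF tot]) blast
  qed
  then obtain x where x: "x : X c"
   "!!f y. f : Arr D ==> Tgt D f = c ==> y : X (Src D f) ==> G f (k (Src D f) y) ==> r f x = y" by blast
  then have "ALL f : Arr D. Tgt D f = c --> (ALL y : ?X (Src D f). G f y --> ?r f (k c x) = y)"
   using kk c by auto
  then show "EX x : ?X c. ALL f : Arr D. Tgt D f = c --> (ALL y : ?X (Src D f). G f y --> ?r f x = y)"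
   using x(1) by blast
 qed
 moreover have "small (?X c)" if "c : Obj D" for c
  unfolding small_def using small_image sm that by blast
 ultimately obtain e b where e: "e : Obj E" and b: "ALL c : Obj D. bij_betw (b c) (?X c) (el e c)"
  "ALL f : Arr D. ALL x : ?X (Tgt D f). b (Src D f) (?r f x) = rs e f (b (Tgt D f) x)"
  using ess_surj by blast
 have "bij_betw (b c \<circ> k c) (X c) (el e c)" if "c : Obj D" for c
  using bij_betw_trans[OF bij_betw_imageI[OF k[OF that] refl]] b(1) that by blast
 moreover have "(b (Src D f) \<circ> k (Src D f)) (r f x) = rs e f ((b (Tgt D f) \<circ> k (Tgt D f)) x)"
  if "f : Arr D" "x : X (Tgt D f)" for f x
  using b(2) kk that by auto
 ultimately show thesis using e by (intro that[of e "%c. b c \<circ> k c"])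
qed


subsection \<open>Pullbacks are computed on elements\<close>

text \<open>
  Arrows between objects are the natural families of functions between sections, so a square that
  is a pullback on sections is a pullback.
\<close>

lemma pullback_of_elements:
 assumes p: "p : Arr E" "q : Arr E" "f : Arr E" "g : Arr E" "Src E p = Src E q" "Tgt E p = Src E f" "Tgt E q = Src E g"
  "Tgt E f = Tgt E g"
  and sq: "!!c z. c : Obj D ==> z : el (Src E p) c ==> ap f c (ap p c z) = ap g c (ap q c z)"
  and un: "!!c x y. c : Obj D ==> x : el (Src E f) c ==> y : el (Src E g) c ==> ap f c x = ap g c y ==>
    EX! z. z : el (Src E p) c & ap p c z = x & ap q c z = y"
 shows "is_pullback E f g p q"
proof -
 have s: "f $ p = g $ q"
  by (rule faithful[of _ "Src E p" "Tgt E f"]) (use p sq in "auto simp: hom_def ap_comp")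
 have "EX! h. h : hom E (Src E u) (Src E p) & p $ h = u & q $ h = v"
  if u: "u : Arr E" "v : Arr E" "Src E u = Src E v" "Tgt E u = Src E f" "Tgt E v = Src E g" "f $ u = g $ v" for u v
 proof -
  \<comment> \<open>On sections the square is a pullback, so there is one choice for the mediating arrow.\<close>
  define h where "h c x = (THE z. z : el (Src E p) c & ap p c z = ap u c x & ap q c z = ap v c x)" for c x
  have ex: "EX! z. z : el (Src E p) c & ap p c z = ap u c x & ap q c z = ap v c x"
   if cx: "c : Obj D" "x : el (Src E u) c" for c x
  proof (rule un)
   have "ap (f $ u) c x = ap (g $ v) c x" using u by simp
   then show "ap f c (ap u c x) = ap g c (ap v c x)" using u p cx ap_comp[of u f c x] ap_comp[of v g c x] by simp
  qed (use cx u ap_in[of u c x] ap_in[of v c x] in auto)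
  have h: "h c x : el (Src E p) c & ap p c (h c x) = ap u c x & ap q c (h c x) = ap v c x"
   if "c : Obj D" "x : el (Src E u) c" for c x
   unfolding h_def by (rule theI') (rule ex[OF that])
  have "EX m : hom E (Src E u) (Src E p). ALL c : Obj D. ALL x : el (Src E u) c. ap m c x = h c x"
  proof (rule full)
   fix k x assume k: "k : Arr D" "x : el (Src E u) (Tgt D k)"
   let ?y = "rs (Src E p) k (h (Tgt D k) x)"
   have x': "rs (Src E u) k x : el (Src E u) (Src D k)" using k u rs_in by simp
   note h0 = h[OF _ k(2)] and h1 = h[OF _ x']
   have "?y : el (Src E p) (Src D k)" using k h0 p rs_in by simp
   moreover have "ap p (Src D k) ?y = ap u (Src D k) (rs (Src E u) k x)"
    using ap_rs[of p k "h (Tgt D k) x"] ap_rs[of u k x] p u k h0 by simp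
   moreover have "ap q (Src D k) ?y = ap v (Src D k) (rs (Src E u) k x)"
    using ap_rs[of q k "h (Tgt D k) x"] ap_rs[of v k x] p u k h0 by simp
   ultimately show "h (Src D k) (rs (Src E u) k x) = ?y"
    using ex[OF _ x'] h1 k by (metis D.src_tgt_obj(1))
  qed (use h p u in auto)
  then obtain m where m: "m : hom E (Src E u) (Src E p)" "!!c x. c : Obj D ==> x : el (Src E u) c ==> ap m c x = h c x"
   by blast
  then have ma: "m : Arr E" "Src E m = Src E u" "Tgt E m = Src E p" by (auto simp: hom_def)
  show ?thesis
  proof (rule ex1I[of _ m])
   have "p $ m = u" by (rule faithful[of _ "Src E u" "Tgt E u"]) (use ma p u m(2) h in "auto simp: hom_def ap_comp")
   moreover have "q $ m = v" by (rule faithful[of _ "Src E v" "Tgt E v"]) (use ma p u m(2) h in "auto simp: hom_def ap_comp")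
   ultimately show "m : hom E (Src E u) (Src E p) & p $ m = u & q $ m = v" using m by blast
  next
   fix n assume n: "n : hom E (Src E u) (Src E p) & p $ n = u & q $ n = v"
   then have na: "n : Arr E" "Src E n = Src E u" "Tgt E n = Src E p" by (auto simp: hom_def)
   show "n = m"
   proof (rule faithful[of _ "Src E u" "Src E p"])
    fix c x assume cx: "c : Obj D" "x : el (Src E u) c"
    have "ap n c x : el (Src E p) c" using ap_in[of n c x] na cx by simp
    moreover have "ap p c (ap n c x) = ap u c x" using ap_comp[of n p c x] n na p cx by simp
    moreover have "ap q c (ap n c x) = ap v c x" using ap_comp[of n q c x] n na p cx by simp
    ultimately show "ap n c x = ap m c x" using ex[OF cx] h[OF cx] m(2)[OF cx] by metis
   qed (use n m in auto)
  qed
 qed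
 then show ?thesis unfolding is_pullback_def Let_def using p s by simp
qed

lemma pullback_exists:
 assumes f: "f : Arr E" "g : Arr E" "Tgt E f = Tgt E g"
 obtains p q where "is_pullback E f g p q"
  "!!c x y. c : Obj D ==> x : el (Src E f) c ==> y : el (Src E g) c ==> ap f c x = ap g c y ==>
    EX! z. z : el (Src E p) c & ap p c z = x & ap q c z = y"
proof -
 \<comment> \<open>The sheaf of compatible pairs of sections; an object that has it as its sections is the pullback.\<close>
 let ?X = "%c. {(x, y). x : el (Src E f) c & y : el (Src E g) c & ap f c x = ap g c y}"
 let ?r = "%k (x, y). (rs (Src E f) k x, rs (Src E g) k y)"
 have o: "Src E f : Obj E" "Src E g : Obj E" using f by auto
 have p: "psh ?X ?r"
  unfolding psh_def using o f ap_rs[of f] ap_rs[of g] by (auto simp: rs_in rs_id rs_comp)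
 have sh: "sheaf_on ?X ?r"
 proof (rule sheaf_onI[OF p])
  fix c s t assume s: "s : ?X c" "t : ?X c" and l: "loc c (%k. ?r k s = ?r k t)"
  obtain x y x' y' where st: "s = (x, y)" "t = (x', y')" by fastforce
  have "x = x'" by (rule sep[OF o(1)]) (use s l st in "auto elim: loc_mono")
  moreover have "y = y'" by (rule sep[OF o(2)]) (use s l st in "auto elim: loc_mono")
  ultimately show "s = t" using st by simp
 next
  fix c G
  assume cl: "!!f g y. [| f : Arr D; Tgt D f = c; g : Arr D; Tgt D g = Src D f; y : ?X (Src D f); G f y |] ==> G (f $$ g) (?r g y)"
   and fn: "!!f y y'. [| f : Arr D; Tgt D f = c; y : ?X (Src D f); y' : ?X (Src D f); G f y; G f y' |] ==> y = y'"
   and tot: "loc c (%f. EX y : ?X (Src D f). G f y)"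
  have c: "c : Obj D" using tot loc_obj by blast
  have "EX x : el (Src E f) c. ALL k : Arr D. Tgt D k = c -->
   (ALL x' : el (Src E f) (Src D k). (EX y. (x', y) : ?X (Src D k) & G k (x', y)) --> rs (Src E f) k x = x')"
  proof (rule sheaf_glue[OF el_sheaf[OF o(1)]])
   fix k l x' assume k: "k : Arr D" "Tgt D k = c" "l : Arr D" "Tgt D l = Src D k" "EX y. (x', y) : ?X (Src D k) & G k (x', y)"
   then obtain y where y: "(x', y) : ?X (Src D k)" "G k (x', y)" by blast
   have "?r l (x', y) : ?X (Src D l)" using psh_in[OF p k(3), of "(x', y)"] y(1) k(4) by simp
   moreover have "G (k $$ l) (?r l (x', y))" by (rule cl[OF k(1-4) y])
   ultimately show "EX y. (rs (Src E f) l x', y) : ?X (Src D (k $$ l)) & G (k $$ l) (rs (Src E f) l x', y)"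
    using k by auto
  next
   fix k x' x'' assume "k : Arr D" "Tgt D k = c" "EX y. (x', y) : ?X (Src D k) & G k (x', y)"
    "EX y. (x'', y) : ?X (Src D k) & G k (x'', y)"
   then show "x' = x''" using fn[of k] by (metis (no_types, lifting) prod.inject)
  next
   show "loc c (%k. EX x' :el (Src E f) (Src D k). EX y. (x', y) : ?X (Src D k) & G k (x', y))"
    by (rule loc_mono[OF tot]) auto
  qed
  then obtain x where x1: "x : el (Src E f) c" and x0: "ALL k : Arr D. Tgt D k = c -->
   (ALL x' : el (Src E f) (Src D k). (EX y. (x', y) : ?X (Src D k) & G k (x', y)) --> rs (Src E f) k x = x')"
   by (elim bexE)
  have x: "x : el (Src E f) c" "!!k x' y'. k : Arr D ==> Tgt D k = c ==>
   (x', y') : ?X (Src D k) ==> G k (x', y') ==> rs (Src E f) k x = x'"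
   by (rule x1, rule x0[THEN bspec, THEN mp, THEN bspec, THEN mp]) auto
  have "EX x : el (Src E g) c. ALL k : Arr D. Tgt D k = c -->
   (ALL x' : el (Src E g) (Src D k). (EX y. (y, x') : ?X (Src D k) & G k (y, x')) --> rs (Src E g) k x = x')"
  proof (rule sheaf_glue[OF el_sheaf[OF o(2)]])
   fix k l x' assume k: "k : Arr D" "Tgt D k = c" "l : Arr D" "Tgt D l = Src D k" "EX y. (y, x') : ?X (Src D k) & G k (y, x')"
   then obtain y where y: "(y, x') : ?X (Src D k)" "G k (y, x')" by blast
   have "?r l (y, x') : ?X (Src D l)" using psh_in[OF p k(3), of "(y, x')"] y(1) k(4) by simp
   moreover have "G (k $$ l) (?r l (y, x'))" by (rule cl[OF k(1-4) y])
   ultimately show "EX y. (y, rs (Src E g) l x') : ?X (Src D (k $$ l)) & G (k $$ l) (y, rs (Src E g) l x')"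
    using k by auto
  next
   fix k x' x'' assume "k : Arr D" "Tgt D k = c" "EX y. (y, x') : ?X (Src D k) & G k (y, x')"
    "EX y. (y, x'') : ?X (Src D k) & G k (y, x'')"
   then show "x' = x''" using fn[of k] by (metis (no_types, lifting) prod.inject)
  next
   show "loc c (%k. EX x' :el (Src E g) (Src D k). EX y. (y, x') : ?X (Src D k) & G k (y, x'))"
    by (rule loc_mono[OF tot]) auto
  qed
  then obtain y where y1: "y : el (Src E g) c" and y0: "ALL k : Arr D. Tgt D k = c -->
   (ALL x' : el (Src E g) (Src D k). (EX y. (y, x') : ?X (Src D k) & G k (y, x')) --> rs (Src E g) k y = x')"
   by (elim bexE)
  have y: "y : el (Src E g) c" "!!k x' y'. k : Arr D ==> Tgt D k = c ==>
   (x', y') : ?X (Src D k) ==> G k (x', y') ==> rs (Src E g) k y = y'"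
   by (rule y1, rule y0[THEN bspec, THEN mp, THEN bspec, THEN mp]) auto
  have "ap f c x = ap g c y"
  proof (rule sep[of "Tgt E f"])
   show "loc c (%k. rs (Tgt E f) k (ap f c x) = rs (Tgt E f) k (ap g c y))"
   proof (rule loc_mono[OF tot])
    fix k assume k: "k : Arr D" "Tgt D k = c" "EX y : ?X (Src D k). G k y"
    then obtain x' y' where "(x', y') : ?X (Src D k)" "G k (x', y')" by blast
    then have "rs (Src E f) k x = x'" "rs (Src E g) k y = y'" "ap f (Src D k) x' = ap g (Src D k) y'"
     using x(2) y(2) k by blast+
    then show "rs (Tgt E f) k (ap f c x) = rs (Tgt E f) k (ap g c y)"
     using ap_rs[of f k x] ap_rs[of g k y] f k x(1) y(1) by simp
   qed
  qed (use x y f c ap_in[of f c x] ap_in[of g c y] in auto)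
  then show "EX s : ?X c. ALL k : Arr D. Tgt D k = c --> (ALL t : ?X (Src D k). G k t --> ?r k s = t)"
   using x y by (intro bexI[of _ "(x, y)"]) auto
 qed
 have sm: "|?X c| <o |UNIV :: 'u set|" if "c : Obj D" for c
  by (rule small_subset[OF small_Times[of "el (Src E f) c" "el (Src E g) c"]])
   (use el_small o that in "auto simp: small_def")
 obtain e b where e: "e : Obj E" and b: "!!c. c : Obj D ==> bij_betw (b c) (?X c) (el e c)"
  "!!k s. k : Arr D ==> s : ?X (Tgt D k) ==> b (Src D k) (?r k s) = rs e k (b (Tgt D k) s)"
  by (rule ess_surj_any[OF sh sm], assumption, rule that)
 define b' where "b' c = inv_into (?X c) (b c)" for c
 have b'1: "b' c z : ?X c" "b c (b' c z) = z" if "c : Obj D" "z : el e c" for c z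
 proof -
  have im: "z : b c ` ?X c" using bij_betw_imp_surj_on[OF b(1)[OF that(1)]] that(2) by simp
  show "b' c z : ?X c" "b c (b' c z) = z" unfolding b'_def by (rule inv_into_into[OF im], rule f_inv_into_f[OF im])
 qed
 have b'2: "b' c (b c s) = s" if "c : Obj D" "s : ?X c" for c s
  unfolding b'_def by (rule inv_into_f_f[OF bij_betw_imp_inj_on[OF b(1)[OF that(1)]] that(2)])
 have b'r: "b' (Src D k) (rs e k z) = ?r k (b' (Tgt D k) z)" if k: "k : Arr D" "z : el e (Tgt D k)" for k z
 proof -
  have t: "Tgt D k : Obj D" "Src D k : Obj D" using k by auto
  have m: "b' (Tgt D k) z : ?X (Tgt D k)" by (rule b'1(1)[OF t(1) k(2)])
  have "rs e k z = b (Src D k) (?r k (b' (Tgt D k) z))"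
   unfolding b(2)[OF k(1) m] b'1(2)[OF t(1) k(2)] ..
  then show ?thesis using b'2[OF t(2) psh_in[OF p k(1) m]] by simp
 qed
 have "EX m : hom E e (Src E f). ALL c : Obj D. ALL x : el e c. ap m c x = fst (b' c x)"
  by (rule full) (use e o b'1(1) b'r in "auto simp: split_beta")
 then obtain pp where pp: "pp : hom E e (Src E f)" "!!c x. c : Obj D ==> x : el e c ==> ap pp c x = fst (b' c x)" by blast
 have "EX m : hom E e (Src E g). ALL c : Obj D. ALL x : el e c. ap m c x = snd (b' c x)"
  by (rule full) (use e o b'1(1) b'r in "auto simp: split_beta")
 then obtain qq where qq: "qq : hom E e (Src E g)" "!!c x. c : Obj D ==> x : el e c ==> ap qq c x = snd (b' c x)" by blast
 have un: "EX! z. z : el (Src E pp) c & ap pp c z = x & ap qq c z = y"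
  if a: "c : Obj D" "x : el (Src E f) c" "y : el (Src E g) c" "ap f c x = ap g c y" for c x y
 proof (rule ex1I[of _ "b c (x, y)"])
  have xy: "(x, y) : ?X c" using a by simp
  then have m: "b c (x, y) : el e c" using b(1)[OF a(1)] by (rule bij_betw_apply[rotated])
  then show "b c (x, y) : el (Src E pp) c & ap pp c (b c (x, y)) = x & ap qq c (b c (x, y)) = y"
   using pp(2)[OF a(1) m] qq(2)[OF a(1) m] b'2[OF a(1) xy] pp(1) by (simp add: hom_def)
  fix z assume z: "z : el (Src E pp) c & ap pp c z = x & ap qq c z = y"
  then have ze: "z : el e c" using pp by (simp add: hom_def)
  then have "b' c z = (x, y)" using z pp(2)[OF a(1) ze] qq(2)[OF a(1) ze] by (simp add: prod_eq_iff)
  then show "z = b c (x, y)" using b'1(2)[OF a(1) ze] by simp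
 qed
 have "is_pullback E f g pp qq"
 proof (rule pullback_of_elements)
  fix c z assume c: "c : Obj D" "z : el (Src E pp) c"
  then have ze: "z : el e c" using pp by (simp add: hom_def)
  show "ap f c (ap pp c z) = ap g c (ap qq c z)"
   using b'1(1)[OF c(1) ze] pp(2)[OF c(1) ze] qq(2)[OF c(1) ze] by auto
 qed (use f pp(1) qq(1) un in "auto simp: hom_def")
 then show thesis using that un by blast
qed

text \<open>
  Pullbacks are unique up to isomorphism, and one of them has the compatible pairs of sections as
  its sections; hence they all do.
\<close>

lemma pullback_elements:
 assumes pb: "is_pullback E f g p q" and c: "c : Obj D" and x: "x : el (Src E f) c" "y : el (Src E g) c" "ap f c x = ap g c y"
 shows "EX! z. z : el (Src E p) c & ap p c z = x & ap q c z = y"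
proof -
 note a = pullback_arr[OF pb]
 obtain p' q' where pb': "is_pullback E f g p' q'" and U': "!!c x y. c : Obj D ==> x : el (Src E f) c ==> y : el (Src E g) c ==> ap f c x = ap g c y ==>
    EX! z. z : el (Src E p') c & ap p' c z = x & ap q' c z = y"
  using pullback_exists[OF a(1,2,5)] by blast
 note a' = pullback_arr[OF pb']
 obtain h k where hk: "h : hom E (Src E p') (Src E p)" "k : hom E (Src E p) (Src E p')"
  and h: "p $ h = p'" "q $ h = q'" and k: "p' $ k = p" "q' $ k = q" and id: "h $ k = Idn E (Src E p)"
  using pullback_unique_iso[OF pb pb'] by metis
 then have ha: "h : Arr E" "Src E h = Src E p'" "Tgt E h = Src E p" and ka: "k : Arr E" "Src E k = Src E p" "Tgt E k = Src E p'"
  by (auto simp: hom_def)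
 obtain z where z: "z : el (Src E p') c" "ap p' c z = x" "ap q' c z = y"
  "!!w. w : el (Src E p') c ==> ap p' c w = x ==> ap q' c w = y ==> w = z"
  using U'[OF c x] by blast
 show ?thesis
 proof (rule ex1I[of _ "ap h c z"])
  show "ap h c z : el (Src E p) c & ap p c (ap h c z) = x & ap q c (ap h c z) = y"
   using ap_in[of h c z] ap_comp[of h p c z] ap_comp[of h q c z] ha a(3,4,6) z(1-3) c h by simp
  fix w assume w: "w : el (Src E p) c & ap p c w = x & ap q c w = y"
  have "ap k c w = z"
  proof (rule z(4))
   show "ap k c w : el (Src E p') c" using ap_in[OF ka(1) c, of w] w ka by simp
   show "ap p' c (ap k c w) = x" using ap_comp[of k p' c w] w ka a'(3) c k(1) by simp
   show "ap q' c (ap k c w) = y" using ap_comp[of k q' c w] w ka a'(4,6) c k(2) by simp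
  qed
  moreover have "ap h c (ap k c w) = w"
   using ap_comp[of k h c w] ha ka c w id ap_id[of "Src E p" c w] a(3) by simp
  ultimately show "w = ap h c z" by simp
 qed
qed

end

context sheaf_model
begin

subsection \<open>Gluings are recognised locally\<close>

definition span_step :: "('i \<times> 'a \<times> 'i \<times> 'a) set => 'u => 'i \<times> 'u => 'i \<times> 'u => bool" where
 "span_step K c s t \<longleftrightarrow> (EX i u j v a. (i, u, j, v) : K & a : el (src u) c &
   s = (i, ap u c a) & t = (j, ap v c a))"

lemma span_stepI: "(i, u, j, v) : K ==> a : el (src u) c ==> span_step K c (i, ap u c a) (j, ap v c a)"
 unfolding span_step_def by blast

abbreviation zigzag :: "('i \<times> 'a \<times> 'i \<times> 'a) set => 'u => 'i \<times> 'u => 'i \<times> 'u => bool" where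
 "zigzag K c \<equiv> equivclp (span_step K c)"

definition local_gluing :: "'i set => ('i => 'o) => ('i \<times> 'a \<times> 'i \<times> 'a) set => 'o => ('i => 'a) => bool" where
 "local_gluing I X K Q \<iota> \<longleftrightarrow> glue_cocone E I X K Q \<iota> &
   (ALL c : Obj D. ALL x : el Q c. loc c (%f. EX i : I. EX a : el (X i) (Src D f). ap (\<iota> i) (Src D f) a = rs Q f x)) &
   (ALL c : Obj D. ALL i : I. ALL j : I. ALL a : el (X i) c. ALL b : el (X j) c. ap (\<iota> i) c a = ap (\<iota> j) c b -->
    loc c (%f. zigzag K (Src D f) (i, rs (X i) f a) (j, rs (X j) f b)))"

lemma zigzag_sym: "zigzag K c s t ==> zigzag K c t s"
 by (rule equivclp_sym)

lemma zigzag_trans: "zigzag K c s t ==> zigzag K c t r ==> zigzag K c s r"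
 by (rule equivclp_trans)

context
 fixes I :: "'i set" and X :: "'i => 'o" and K :: "('i \<times> 'a \<times> 'i \<times> 'a) set"
 assumes spans: "glue_spans E I X K"
begin

lemma X_obj: "i : I ==> X i : obj"
 using spans by (auto simp: glue_spans_def)

lemma K_arr:
 assumes "(i, u, j, v) : K"
 shows "i : I" "j : I" "u : arr" "v : arr" "src v = src u" "tgt u = X i" "tgt v = X j"
 using spans assms unfolding glue_spans_def by fastforce+

lemma span_step_in:
 assumes "span_step K c (i, a) (j, b)" "c : Obj D"
 shows "i : I & j : I & a : el (X i) c & b : el (X j) c"
proof -
 obtain u v x where k: "(i, u, j, v) : K" "x : el (src u) c" "a = ap u c x" "b = ap v c x"
  using assms(1) by (auto simp: span_step_def)
 show ?thesis using K_arr[OF k(1)] k ap_in[of u c x] ap_in[of v c x] assms(2) by simp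
qed

lemma zigzag_in:
 assumes "zigzag K c (i, a) (j, b)" "c : Obj D" "i : I" "a : el (X i) c"
 shows "j : I & b : el (X j) c"
proof -
 have "fst t : I & snd t : el (X (fst t)) c" if "zigzag K c (i, a) t" for t
  using that
 proof (induction rule: equivclp_induct)
  case base then show ?case using assms by simp
 next
  case (step y z)
  then show ?case using span_step_in[of c "fst y" "snd y" "fst z" "snd z"]
    span_step_in[of c "fst z" "snd z" "fst y" "snd y"] assms(2) by auto
 qed
 from this[OF assms(1)] show ?thesis by simp
qed

lemma zigzag_rs:
 assumes "zigzag K (Tgt D f) (i, a) (j, b)" "f : Arr D"
 shows "zigzag K (Src D f) (i, rs (X i) f a) (j, rs (X j) f b)"
proof -
 have st: "span_step K (Src D f) (fst s, rs (X (fst s)) f (snd s)) (fst t, rs (X (fst t)) f (snd t))"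
  if s: "span_step K (Tgt D f) s t" for s t
 proof -
  obtain i u j v x where k: "(i, u, j, v) : K" "x : el (src u) (Tgt D f)"
   "s = (i, ap u (Tgt D f) x)" "t = (j, ap v (Tgt D f) x)"
   using s by (auto simp: span_step_def)
  note ka = K_arr[OF k(1)]
  show ?thesis unfolding span_step_def
  proof (intro exI conjI)
   show "(i, u, j, v) : K" by (rule k)
   show "rs (src u) f x : el (src u) (Src D f)" using ka k assms(2) rs_in by simp
  qed (use ka k assms(2) ap_rs[of u f x] ap_rs[of v f x] in simp_all)
 qed
 have "zigzag K (Src D f) (i, rs (X i) f a) (fst t, rs (X (fst t)) f (snd t))"
  if "zigzag K (Tgt D f) (i, a) t" for t
  using that
 proof (induction rule: equivclp_induct)
  case base then show ?case by simp
 next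
  case (step y z)
  then have "zigzag K (Src D f) (fst y, rs (X (fst y)) f (snd y)) (fst z, rs (X (fst z)) f (snd z))"
   using st[of y z] st[of z y] by (auto intro: r_into_equivclp converse_r_into_equivclp)
  then show ?case using step zigzag_trans by fast
 qed
 from this[OF assms(1)] show ?thesis by simp
qed

lemma cocone_zigzag:
 assumes "glue_cocone E I X K Y \<rho>" "zigzag K c (i, a) (j, b)" "c : Obj D"
 shows "ap (\<rho> i) c a = ap (\<rho> j) c b"
proof -
 have st: "ap (\<rho> (fst s)) c (snd s) = ap (\<rho> (fst t)) c (snd t)" if s: "span_step K c s t" for s t
 proof -
  obtain i u j v x where k: "(i, u, j, v) : K" "x : el (src u) c" "s = (i, ap u c x)" "t = (j, ap v c x)"
   using s by (auto simp: span_step_def)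
  note ka = K_arr[OF k(1)]
  have r: "\<rho> i : hom E (X i) Y" "\<rho> j : hom E (X j) Y" "\<rho> i $ u = \<rho> j $ v"
   using assms(1) k ka by (auto simp: glue_cocone_def)
  then show ?thesis using ap_comp[of u "\<rho> i" c x] ap_comp[of v "\<rho> j" c x] ka k assms(3) by (simp add: hom_def)
 qed
 have "ap (\<rho> i) c a = ap (\<rho> (fst t)) c (snd t)" if "zigzag K c (i, a) t" for t
  using that
 proof (induction rule: equivclp_induct)
  case (step y z)
  then show ?case using st[of y z] st[of z y] by auto
 qed simp
 from this[OF assms(2)] show ?thesis by simp
qed

lemma cocone_arr:
 assumes "glue_cocone E I X K Y \<rho>"
 shows "Y : obj" "i : I ==> \<rho> i : arr" "i : I ==> src (\<rho> i) = X i" "i : I ==> tgt (\<rho> i) = Y"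
 using assms by (auto simp: glue_cocone_def hom_def)

text \<open>
  A cocone assigns values in the target to the preimages that a section has on some cover. Zigzags
  make these values independent of the preimage, so they form a matching family, and the sheaf
  condition glues them.
\<close>

lemma local_gluing_is_gluing:
 assumes lg: "local_gluing I X K Q \<iota>"
 shows "is_gluing E I X K Q \<iota>"
proof -
 have co: "glue_cocone E I X K Q \<iota>" using lg by (simp add: local_gluing_def)
 have surj: "loc c (%f. EX i : I. EX a : el (X i) (Src D f). ap (\<iota> i) (Src D f) a = rs Q f x)"
  if "c : Obj D" "x : el Q c" for c x using lg that by (simp add: local_gluing_def)
 have ker: "loc c (%f. zigzag K (Src D f) (i, rs (X i) f a) (j, rs (X j) f b))"
  if "c : Obj D" "i : I" "j : I" "a : el (X i) c" "b : el (X j) c" "ap (\<iota> i) c a = ap (\<iota> j) c b" for c i j a b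
  using lg that by (simp add: local_gluing_def)
 note i = cocone_arr[OF co]
 have "EX! h. h : hom E Q Y & (ALL i :I. h $ \<iota> i = \<rho> i)" if \<rho>: "glue_cocone E I X K Y \<rho>" for Y \<rho>
 proof -
  note r = cocone_arr[OF \<rho>]
  have wd: "ap (\<rho> i) c a = ap (\<rho> j) c b"
   if h: "c : Obj D" "i : I" "j : I" "a : el (X i) c" "b : el (X j) c" "ap (\<iota> i) c a = ap (\<iota> j) c b" for c i j a b
  proof (rule sep[OF r(1)])
   show "loc c (%f. rs Y f (ap (\<rho> i) c a) = rs Y f (ap (\<rho> j) c b))"
   proof (rule loc_mono[OF ker[OF h]])
    fix f assume f: "f : Arr D" "Tgt D f = c" "zigzag K (Src D f) (i, rs (X i) f a) (j, rs (X j) f b)"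
    have "ap (\<rho> i) (Src D f) (rs (X i) f a) = ap (\<rho> j) (Src D f) (rs (X j) f b)"
     using cocone_zigzag[OF \<rho> f(3)] f by simp
    then show "rs Y f (ap (\<rho> i) c a) = rs Y f (ap (\<rho> j) c b)"
     using ap_rs[of "\<rho> i" f a] ap_rs[of "\<rho> j" f b] r h f by simp
   qed
  qed (use h r ap_in[of "\<rho> i" c a] ap_in[of "\<rho> j" c b] in auto)
  have ex: "EX y : el Y c. ALL f : Arr D. Tgt D f = c --> (ALL z : el Y (Src D f).
    (EX i : I. EX a : el (X i) (Src D f). ap (\<iota> i) (Src D f) a = rs Q f x & z = ap (\<rho> i) (Src D f) a) --> rs Y f y = z)"
   if c: "c : Obj D" and x: "x : el Q c" for c x
  proof (rule sheaf_glue[OF el_sheaf[OF r(1)]])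
   fix f g z assume f: "f : Arr D" "Tgt D f = c" "g : Arr D" "Tgt D g = Src D f"
    "EX i : I. EX a : el (X i) (Src D f). ap (\<iota> i) (Src D f) a = rs Q f x & z = ap (\<rho> i) (Src D f) a"
   then obtain i a where ia: "i : I" "a : el (X i) (Src D f)" "ap (\<iota> i) (Src D f) a = rs Q f x" "z = ap (\<rho> i) (Src D f) a" by blast
   show "EX i : I. EX a : el (X i) (Src D (f $$ g)). ap (\<iota> i) (Src D (f $$ g)) a = rs Q (f $$ g) x &
     rs Y g z = ap (\<rho> i) (Src D (f $$ g)) a"
   proof (intro bexI conjI)
    show "rs (X i) g a : el (X i) (Src D (f $$ g))" using f ia rs_in[of "X i" g a] X_obj by simp
   qed (use f ia i r x ap_rs[of "\<iota> i" g a] ap_rs[of "\<rho> i" g a] rs_comp[of Q g f x] in simp_all)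
  next
   fix f y z assume f: "f : Arr D" and y: "EX i : I. EX a : el (X i) (Src D f). ap (\<iota> i) (Src D f) a = rs Q f x & y = ap (\<rho> i) (Src D f) a"
    and z: "EX i : I. EX a : el (X i) (Src D f). ap (\<iota> i) (Src D f) a = rs Q f x & z = ap (\<rho> i) (Src D f) a"
   obtain i a where ia: "i : I" "a : el (X i) (Src D f)" "ap (\<iota> i) (Src D f) a = rs Q f x" "y = ap (\<rho> i) (Src D f) a" using y by blast
   obtain j b where jb: "j : I" "b : el (X j) (Src D f)" "ap (\<iota> j) (Src D f) b = rs Q f x" "z = ap (\<rho> j) (Src D f) b" using z by blast
   show "y = z" using wd[of "Src D f" i j a b] ia jb f by simp
  next
   show "loc c (%f. EX z :el Y (Src D f). EX i : I. EX a : el (X i) (Src D f). ap (\<iota> i) (Src D f) a = rs Q f x & z = ap (\<rho> i) (Src D f) a)"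
   proof (rule loc_mono[OF surj[OF c x]])
    fix f assume f: "f : Arr D" "EX i : I. EX a : el (X i) (Src D f). ap (\<iota> i) (Src D f) a = rs Q f x"
    then obtain i a where ia: "i : I" "a : el (X i) (Src D f)" "ap (\<iota> i) (Src D f) a = rs Q f x" by blast
    then have "ap (\<rho> i) (Src D f) a : el Y (Src D f)" using ap_in[of "\<rho> i" "Src D f" a] r f by simp
    then show "EX z :el Y (Src D f). EX i : I. EX a : el (X i) (Src D f). ap (\<iota> i) (Src D f) a = rs Q f x & z = ap (\<rho> i) (Src D f) a"
     using ia by blast
   qed
  qed
  \<comment> \<open>The value at \<open>x\<close> is the section of \<open>Y\<close> that is locally the image of the local preimages of \<open>x\<close>.\<close>
  define h where "h c x = (SOME y. y : el Y c & (ALL f : Arr D. Tgt D f = c --> (ALL z : el Y (Src D f).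
    (EX i : I. EX a : el (X i) (Src D f). ap (\<iota> i) (Src D f) a = rs Q f x & z = ap (\<rho> i) (Src D f) a) --> rs Y f y = z)))" for c x
  have h: "h c x : el Y c & (ALL f : Arr D. Tgt D f = c --> (ALL z : el Y (Src D f).
    (EX i : I. EX a : el (X i) (Src D f). ap (\<iota> i) (Src D f) a = rs Q f x & z = ap (\<rho> i) (Src D f) a) --> rs Y f (h c x) = z))"
   if "c : Obj D" "x : el Q c" for c x
   unfolding h_def by (rule someI_ex) (use ex[OF that] in "simp only: Bex_def")
  have h1: "h c x : el Y c" if "c : Obj D" "x : el Q c" for c x using h[OF that] by simp
  have h2: "rs Y f (h (Tgt D f) x) = ap (\<rho> i) (Src D f) a"
   if "f : Arr D" "x : el Q (Tgt D f)" "i : I" "a : el (X i) (Src D f)" "ap (\<iota> i) (Src D f) a = rs Q f x" for f x i a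
  proof (rule h[THEN conjunct2, THEN bspec, THEN mp, THEN bspec, THEN mp])
   show "EX k : I. EX b : el (X k) (Src D f). ap (\<iota> k) (Src D f) b = rs Q f x & ap (\<rho> i) (Src D f) a = ap (\<rho> k) (Src D f) b"
    by (intro bexI[of _ i] bexI[of _ a] conjI that refl)
  qed (use that ap_in[of "\<rho> i" "Src D f" a] r in simp_all)
  have h3: "h c (ap (\<iota> i) c a) = ap (\<rho> i) c a" if "c : Obj D" "i : I" "a : el (X i) c" for c i a
  proof -
   have q: "ap (\<iota> i) c a : el Q c" using ap_in[of "\<iota> i" c a] i that by simp
   then have "rs Y (Idn D c) (h c (ap (\<iota> i) c a)) = ap (\<rho> i) c a"
    using h2[of "Idn D c" "ap (\<iota> i) c a" i a] that rs_id[OF i(1) that(1) q] by simp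
   then show ?thesis using rs_id[OF r(1) that(1)] h1[OF that(1) q] by simp
  qed
  have "EX m : hom E Q Y. ALL c : Obj D. ALL x : el Q c. ap m c x = h c x"
  proof (rule full)
   fix g x assume g: "g : Arr D" "x : el Q (Tgt D g)"
   let ?x = "rs Q g x"
   have xin: "?x : el Q (Src D g)" using g rs_in i by simp
   have s: "Src D g : Obj D" using g by simp
   show "h (Src D g) ?x = rs Y g (h (Tgt D g) x)"
   proof (rule sep[OF r(1)])
    show "loc (Src D g) (%f. rs Y f (h (Src D g) ?x) = rs Y f (rs Y g (h (Tgt D g) x)))"
    proof (rule loc_mono[OF surj[OF s xin]])
     fix f assume f: "f : Arr D" "Tgt D f = Src D g"
      "EX i :I. EX a :el (X i) (Src D f). ap (\<iota> i) (Src D f) a = rs Q f ?x"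
     then obtain i' a where ia: "i' : I" "a : el (X i') (Src D f)" "ap (\<iota> i') (Src D f) a = rs Q f ?x" by blast
     have gf: "rs Q (g $$ f) x = rs Q f ?x" using rs_comp[of Q f g x] i f g by simp
     have "rs Y f (h (Src D g) ?x) = ap (\<rho> i') (Src D f) a"
      using h2[of f ?x i' a] f ia xin by simp
     moreover have "rs Y (g $$ f) (h (Tgt D g) x) = ap (\<rho> i') (Src D f) a"
      using h2[of "g $$ f" x i' a] f g ia gf by simp
     moreover have "rs Y (g $$ f) (h (Tgt D g) x) = rs Y f (rs Y g (h (Tgt D g) x))"
      using rs_comp[of Y f g] f g r h1 by simp
     ultimately show "rs Y f (h (Src D g) ?x) = rs Y f (rs Y g (h (Tgt D g) x))" by simp
    qed
   qed (use g h1 xin rs_in r in auto)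
  qed (use h1 i r in auto)
  then obtain m where m: "m : hom E Q Y" "!!c x. c : Obj D ==> x : el Q c ==> ap m c x = h c x" by blast
  then have ma: "m : arr" "src m = Q" "tgt m = Y" by (auto simp: hom_def)
  show ?thesis
  proof (rule ex1I[of _ m], intro conjI m ballI)
   fix k assume k: "k : I"
   show "m $ \<iota> k = \<rho> k"
   proof (rule faithful)
    fix c a assume c: "c : Obj D" "a : el (X k) c"
    then have "ap (\<iota> k) c a : el Q c" using ap_in[of "\<iota> k" c a] i k by simp
    then show "ap (m $ \<iota> k) c a = ap (\<rho> k) c a" using h3[OF c(1) k c(2)] m(2) ap_comp[of "\<iota> k" m c a] ma i k c by simp
   qed (use ma i r k in "auto simp: hom_def")
  next
   fix n assume n: "n : hom E Q Y & (ALL i :I. n $ \<iota> i = \<rho> i)"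
   then have na: "n : arr" "src n = Q" "tgt n = Y" by (auto simp: hom_def)
   show "n = m"
   proof (rule faithful[of _ Q Y])
    fix c x assume c: "c : Obj D" "x : el Q c"
    show "ap n c x = ap m c x"
    proof (rule sep[OF r(1)])
     show "loc c (%f. rs Y f (ap n c x) = rs Y f (ap m c x))"
     proof (rule loc_mono[OF surj[OF c]])
      fix f assume f: "f : Arr D" "Tgt D f = c"
       "EX i :I. EX a :el (X i) (Src D f). ap (\<iota> i) (Src D f) a = rs Q f x"
      then obtain k a where ia: "k : I" "a : el (X k) (Src D f)" "ap (\<iota> k) (Src D f) a = rs Q f x" by blast
      have fx: "rs Q f x : el Q (Src D f)" using rs_in i c f by simp
      have "rs Y f (ap n c x) = ap n (Src D f) (ap (\<iota> k) (Src D f) a)"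
       using ap_rs[of n f x] na f c ia by simp
      also have "\<dots> = ap (\<rho> k) (Src D f) a"
       using ap_comp[of "\<iota> k" n "Src D f" a] n na i ia f by simp
      also have "\<dots> = ap m (Src D f) (ap (\<iota> k) (Src D f) a)"
       using m(2)[of "Src D f"] h3[of "Src D f" k a] f ia fx by simp
      also have "\<dots> = rs Y f (ap m c x)"
       using ap_rs[of m f x] ma f c ia by simp
      finally show "rs Y f (ap n c x) = rs Y f (ap m c x)" .
     qed
    qed (use c ap_in[of n c x] ap_in[of m c x] na ma in auto)
   qed (use n m in auto)
  qed
 qed
 then show ?thesis using co unfolding is_gluing_def by blast
qed

end

end

context sheaf_model
begin

subsection \<open>Small gluings exist\<close>

definition germ_rs :: "'u => ('u \<times> 'i \<times> 'u) set => ('u \<times> 'i \<times> 'u) set" where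
 "germ_rs h \<sigma> = {(g, i, a). g : Arr D & Tgt D g = Src D h & (h $$ g, i, a) : \<sigma>}"

lemma mem_germ_rs: "(g, i, a) : germ_rs h \<sigma> \<longleftrightarrow> g : Arr D & Tgt D g = Src D h & (h $$ g, i, a) : \<sigma>"
 by (simp add: germ_rs_def)

text \<open>
  The elements at \<open>c\<close> of the gluing of the \<open>X i\<close>, that is of the sheaf generated by \<open>\<Sum>\<^sub>i X i\<close> modulo
  zigzags, in one step and without quotients: an element is the set of all \<open>(f, i, a)\<close>
  with \<open>f\<close> into \<open>c\<close> such that \<open>a\<close> represents its restriction along \<open>f\<close>.
  The conditions say: typing, closure under restriction, uniqueness up to local zigzags, saturation
  under local zigzags, and local existence.
\<close>

definition germ :: "'i set => ('i => 'o) => ('i \<times> 'a \<times> 'i \<times> 'a) set => 'u => ('u \<times> 'i \<times> 'u) set => bool" where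
 "germ I X K c \<sigma> \<longleftrightarrow>
   (ALL f i a. (f, i, a) : \<sigma> --> f : Arr D & Tgt D f = c & i : I & a : el (X i) (Src D f)) &
   (ALL f i a g. (f, i, a) : \<sigma> --> g : Arr D --> Tgt D g = Src D f --> (f $$ g, i, rs (X i) g a) : \<sigma>) &
   (ALL f i a j b. (f, i, a) : \<sigma> --> (f, j, b) : \<sigma> -->
    loc (Src D f) (%g. zigzag K (Src D g) (i, rs (X i) g a) (j, rs (X j) g b))) &
   (ALL f i a. f : Arr D --> Tgt D f = c --> i : I --> a : el (X i) (Src D f) -->
    loc (Src D f) (%g. EX j b. (f $$ g, j, b) : \<sigma> & zigzag K (Src D g) (i, rs (X i) g a) (j, b)) --> (f, i, a) : \<sigma>) &
   loc c (%f. EX i a. (f, i, a) : \<sigma>)"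

context
 fixes I :: "'i set" and X :: "'i => 'o" and K :: "('i \<times> 'a \<times> 'i \<times> 'a) set" and c \<sigma>
 assumes g: "germ I X K c \<sigma>"
begin

lemma germ_typ: "(f, i, a) : \<sigma> ==> f : Arr D & Tgt D f = c & i : I & a : el (X i) (Src D f)"
 by (rule g[unfolded germ_def, THEN conjunct1, rule_format])

lemma germ_comp: "(f, i, a) : \<sigma> ==> g : Arr D ==> Tgt D g = Src D f ==> (f $$ g, i, rs (X i) g a) : \<sigma>"
 by (rule g[unfolded germ_def, THEN conjunct2, THEN conjunct1, rule_format])

lemma germ_uniq: "(f, i, a) : \<sigma> ==> (f, j, b) : \<sigma> ==>
    loc (Src D f) (%g. zigzag K (Src D g) (i, rs (X i) g a) (j, rs (X j) g b))"
 by (rule g[unfolded germ_def, THEN conjunct2, THEN conjunct2, THEN conjunct1, rule_format])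

lemma germ_sat: "f : Arr D ==> Tgt D f = c ==> i : I ==> a : el (X i) (Src D f) ==>
  loc (Src D f) (%g. EX j b. (f $$ g, j, b) : \<sigma> & zigzag K (Src D g) (i, rs (X i) g a) (j, b)) ==> (f, i, a) : \<sigma>"
 by (rule g[unfolded germ_def, THEN conjunct2, THEN conjunct2, THEN conjunct2, THEN conjunct1, rule_format])

lemma germ_ex: "loc c (%f. EX i a. (f, i, a) : \<sigma>)"
 by (rule g[unfolded germ_def, THEN conjunct2, THEN conjunct2, THEN conjunct2, THEN conjunct2])

end

context
 fixes I :: "'i set" and X :: "'i => 'o" and K :: "('i \<times> 'a \<times> 'i \<times> 'a) set"
 assumes spans: "glue_spans E I X K"
begin

lemma rsX_in: "i : I ==> f : Arr D ==> Tgt D f = c ==> a : el (X i) c ==> rs (X i) f a : el (X i) (Src D f)"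
 using rs_in X_obj[OF spans] by blast

lemma rsX_comp: "i : I ==> f : Arr D ==> g : Arr D ==> Tgt D g = Src D f ==> a : el (X i) (Tgt D f) ==>
  rs (X i) (f $$ g) a = rs (X i) g (rs (X i) f a)"
 using rs_comp X_obj[OF spans] by blast

lemma germ_rs_germ:
 assumes s: "germ I X K (Tgt D h) \<sigma>" and h: "h : Arr D"
 shows "germ I X K (Src D h) (germ_rs h \<sigma>)"
 unfolding germ_def
proof (intro conjI allI impI)
 fix f i a assume "(f, i, a) : germ_rs h \<sigma>"
 then have f: "f : Arr D" "Tgt D f = Src D h" "(h $$ f, i, a) : \<sigma>" by (auto simp: mem_germ_rs)
 note t = germ_typ[OF s f(3)]
 show "f : Arr D" "Tgt D f = Src D h" "i : I" "a : el (X i) (Src D f)" using f t h by auto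
 fix g assume g: "g : Arr D" "Tgt D g = Src D f"
 show "(f $$ g, i, rs (X i) g a) : germ_rs h \<sigma>"
  using germ_comp[OF s f(3) g(1)] f g h by (simp add: mem_germ_rs)
next
 fix f i a j b assume a: "(f, i, a) : germ_rs h \<sigma>" "(f, j, b) : germ_rs h \<sigma>"
 then have f: "f : Arr D" "Tgt D f = Src D h" "(h $$ f, i, a) : \<sigma>" "(h $$ f, j, b) : \<sigma>" by (auto simp: mem_germ_rs)
 show "loc (Src D f) (%g. zigzag K (Src D g) (i, rs (X i) g a) (j, rs (X j) g b))"
  using germ_uniq[OF s f(3,4)] f h by simp
next
 fix f i a assume f: "f : Arr D" "Tgt D f = Src D h" "i : I" "a : el (X i) (Src D f)"
  and l: "loc (Src D f) (%g. EX j b. (f $$ g, j, b) : germ_rs h \<sigma> & zigzag K (Src D g) (i, rs (X i) g a) (j, b))"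
 have "(h $$ f, i, a) : \<sigma>"
 proof (rule germ_sat[OF s])
  have "loc (Src D f) (%g. EX j b. ((h $$ f) $$ g, j, b) : \<sigma> & zigzag K (Src D g) (i, rs (X i) g a) (j, b))"
   by (rule loc_mono[OF l]) (use f h in "auto simp: mem_germ_rs")
  then show "loc (Src D (h $$ f)) (%g. EX j b. ((h $$ f) $$ g, j, b) : \<sigma> & zigzag K (Src D g) (i, rs (X i) g a) (j, b))"
   using f h by simp
 qed (use f h in auto)
 then show "(f, i, a) : germ_rs h \<sigma>" using f by (simp add: mem_germ_rs)
next
 have "loc (Src D h) (%f. EX i a. (h $$ f, i, a) : \<sigma>)"
  by (rule loc_pull[OF germ_ex[OF s] h refl])
 then show "loc (Src D h) (%f. EX i a. (f, i, a) : germ_rs h \<sigma>)"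
  by (rule loc_mono) (auto simp: mem_germ_rs)
qed

lemma germ_psh: "psh (%c. {\<sigma>. germ I X K c \<sigma>}) germ_rs"
 unfolding psh_def
proof (intro conjI ballI impI)
 fix f \<sigma> assume "f : Arr D" "\<sigma> : {\<sigma>. germ I X K (Tgt D f) \<sigma>}"
 then show "germ_rs f \<sigma> : {\<sigma>. germ I X K (Src D f) \<sigma>}" using germ_rs_germ by simp
next
 fix c \<sigma> assume c: "c : Obj D" and "\<sigma> : {\<sigma>. germ I X K c \<sigma>}"
 then have s: "germ I X K c \<sigma>" by simp
 show "germ_rs (Idn D c) \<sigma> = \<sigma>"
 proof -
  have "(k, i, a) : germ_rs (Idn D c) \<sigma> \<longleftrightarrow> (k, i, a) : \<sigma>" for k i a
   using germ_typ[OF s, of k i a] c by (cases "k : Arr D & Tgt D k = c") (simp_all add: mem_germ_rs, blast)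
  then show ?thesis by (simp add: set_eq_iff)
 qed
next
 fix f g \<sigma> assume f: "f : Arr D" "g : Arr D" "Tgt D f = Src D g"
 have "(k, i, a) : germ_rs (g $$ f) \<sigma> \<longleftrightarrow> (k, i, a) : germ_rs f (germ_rs g \<sigma>)" for k i a
 proof (cases "k : Arr D & Tgt D k = Src D f")
  case True then show ?thesis using f by (simp add: mem_germ_rs)
 next
  case False then show ?thesis using f by (auto simp: mem_germ_rs simp del: D.assoc)
 qed
 then show "germ_rs (g $$ f) \<sigma> = germ_rs f (germ_rs g \<sigma>)" by (simp add: set_eq_iff)
qed

lemma germ_sheaf: "sheaf_on (%c. {\<sigma>. germ I X K c \<sigma>}) germ_rs"
proof (rule sheaf_onI[OF germ_psh])
 have sub: "\<sigma> \<subseteq> \<tau>" if st: "germ I X K c \<sigma>" "germ I X K c \<tau>" and l: "loc c (%f. germ_rs f \<sigma> = germ_rs f \<tau>)" for c \<sigma> \<tau>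
 proof
  fix s assume "s : \<sigma>"
  then obtain f i a where s: "s = (f, i, a)" "(f, i, a) : \<sigma>" by (cases s) auto
  note t = germ_typ[OF st(1) s(2)]
  have "(f, i, a) : \<tau>"
  proof (rule germ_sat[OF st(2)])
   have "loc (Src D f) (%g. germ_rs (f $$ g) \<sigma> = germ_rs (f $$ g) \<tau>)"
    by (rule loc_pull[OF l]) (use t in auto)
   then show "loc (Src D f) (%g. EX j b. (f $$ g, j, b) : \<tau> & zigzag K (Src D g) (i, rs (X i) g a) (j, b))"
   proof (rule loc_mono)
    fix g assume g: "g : Arr D" "Tgt D g = Src D f" "germ_rs (f $$ g) \<sigma> = germ_rs (f $$ g) \<tau>"
    have "(f $$ g, i, rs (X i) g a) : \<sigma>" by (rule germ_comp[OF st(1) s(2) g(1,2)])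
    then have "(Idn D (Src D g), i, rs (X i) g a) : germ_rs (f $$ g) \<sigma>" using g(1,2) t by (simp add: mem_germ_rs)
    then have "(Idn D (Src D g), i, rs (X i) g a) : germ_rs (f $$ g) \<tau>" using g(3) by simp
    then have "(f $$ g, i, rs (X i) g a) : \<tau>" using g(1,2) t by (simp add: mem_germ_rs)
    then show "EX j b. (f $$ g, j, b) : \<tau> & zigzag K (Src D g) (i, rs (X i) g a) (j, b)"
     by (intro exI[of _ i] exI[of _ "rs (X i) g a"] conjI equivclp_refl)
   qed
  qed (use t in auto)
  then show "s : \<tau>" using s by simp
 qed
 fix c \<sigma> \<tau> assume "\<sigma> : {\<sigma>. germ I X K c \<sigma>}" "\<tau> : {\<sigma>. germ I X K c \<sigma>}" and l: "loc c (%f. germ_rs f \<sigma> = germ_rs f \<tau>)"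
 moreover have "loc c (%f. germ_rs f \<tau> = germ_rs f \<sigma>)" by (rule loc_mono[OF l]) simp
 ultimately show "\<sigma> = \<tau>" using sub by (intro equalityI) simp_all
next
 fix c G
 assume cl0: "!!f g y. [| f : Arr D; Tgt D f = c; g : Arr D; Tgt D g = Src D f; y : {\<sigma>. germ I X K (Src D f) \<sigma>}; G f y |] ==> G (f $$ g) (germ_rs g y)"
  and fn0: "!!f y y'. [| f : Arr D; Tgt D f = c; y : {\<sigma>. germ I X K (Src D f) \<sigma>}; y' : {\<sigma>. germ I X K (Src D f) \<sigma>}; G f y; G f y' |] ==> y = y'"
  and tot0: "loc c (%f. EX y : {\<sigma>. germ I X K (Src D f) \<sigma>}. G f y)"
 have cl: "G (f $$ g) (germ_rs g \<tau>)" if "f : Arr D" "Tgt D f = c" "g : Arr D" "Tgt D g = Src D f" "germ I X K (Src D f) \<tau>" "G f \<tau>" for f g \<tau>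
  using cl0[of f g \<tau>] that by simp
 have fn: "\<tau> = \<tau>'" if "f : Arr D" "Tgt D f = c" "germ I X K (Src D f) \<tau>" "germ I X K (Src D f) \<tau>'" "G f \<tau>" "G f \<tau>'" for f \<tau> \<tau>'
  using fn0[of f \<tau> \<tau>'] that by simp
 have tot: "loc c (%f. EX \<tau>. germ I X K (Src D f) \<tau> & G f \<tau>)" by (rule loc_mono[OF tot0]) auto
 \<comment> \<open>\<open>A f i a\<close>: the prescribed restriction along \<open>f\<close> has the representative \<open>a\<close>.\<close>
 define A where "A f i a \<longleftrightarrow> (EX \<tau>. germ I X K (Src D f) \<tau> & G f \<tau> & (Idn D (Src D f), i, a) : \<tau>)" for f i a
 \<comment> \<open>The amalgamation consists of the representatives that belong locally to the prescribed restrictions.\<close>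
 define \<sigma> where "\<sigma> = {(f, i, a). f : Arr D & Tgt D f = c & i : I & a : el (X i) (Src D f) &
   loc (Src D f) (%g. A (f $$ g) i (rs (X i) g a))}"
 have A\<tau>: "A (f $$ g) i a \<longleftrightarrow> (g, i, a) : \<tau>" if t: "f : Arr D" "Tgt D f = c" "g : Arr D" "Tgt D g = Src D f" "germ I X K (Src D f) \<tau>" "G f \<tau>" for f g i a \<tau>
 proof -
  have r: "germ I X K (Src D g) (germ_rs g \<tau>)" using germ_rs_germ[of g \<tau>] t by simp
  have G: "G (f $$ g) (germ_rs g \<tau>)" by (rule cl[OF t])
  have "A (f $$ g) i a \<longleftrightarrow> (Idn D (Src D g), i, a) : germ_rs g \<tau>"
  proof
   assume "A (f $$ g) i a"
   then obtain \<tau>' where \<tau>': "germ I X K (Src D g) \<tau>'" "G (f $$ g) \<tau>'" "(Idn D (Src D g), i, a) : \<tau>'"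
    using t by (auto simp: A_def)
   have "\<tau>' = germ_rs g \<tau>" by (rule fn[of "f $$ g"]) (use t \<tau>' r G in auto)
   then show "(Idn D (Src D g), i, a) : germ_rs g \<tau>" using \<tau>' by simp
  next
   assume "(Idn D (Src D g), i, a) : germ_rs g \<tau>"
   then show "A (f $$ g) i a" unfolding A_def using r G t by (intro exI[of _ "germ_rs g \<tau>"]) simp
  qed
  then show ?thesis using t by (simp add: mem_germ_rs)
 qed
 have AI: "A f i a" if "f : Arr D" "germ I X K (Src D f) \<tau>" "G f \<tau>" "(Idn D (Src D f), i, a) : \<tau>" for f i a \<tau>
  unfolding A_def using that by blast
 have Ars: "A (f $$ g) i (rs (X i) g a)" if f: "f : Arr D" "Tgt D f = c" "g : Arr D" "Tgt D g = Src D f" and A: "A f i a" for f g i a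
 proof -
  obtain \<tau> where \<tau>: "germ I X K (Src D f) \<tau>" "G f \<tau>" "(Idn D (Src D f), i, a) : \<tau>" using A by (auto simp: A_def)
  have "(Idn D (Src D f) $$ g, i, rs (X i) g a) : \<tau>" by (rule germ_comp[OF \<tau>(1,3)]) (use f in auto)
  then show ?thesis using A\<tau>[OF f \<tau>(1,2)] f by simp
 qed
 have \<sigma>: "germ I X K c \<sigma>"
  unfolding germ_def
 proof (intro conjI allI impI)
  fix f i a assume s: "(f, i, a) : \<sigma>"
  then have f: "f : Arr D" "Tgt D f = c" "i : I" "a : el (X i) (Src D f)" and
   l: "loc (Src D f) (%g. A (f $$ g) i (rs (X i) g a))" by (auto simp: \<sigma>_def)
  show "f : Arr D" "Tgt D f = c" "i : I" "a : el (X i) (Src D f)" by fact+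
  fix g assume g: "g : Arr D" "Tgt D g = Src D f"
  have "loc (Src D g) (%k. A (f $$ (g $$ k)) i (rs (X i) (g $$ k) a))"
   by (rule loc_pull[OF l g])
  then have "loc (Src D g) (%k. A ((f $$ g) $$ k) i (rs (X i) k (rs (X i) g a)))"
   by (rule loc_mono) (use f g in "simp add: rsX_comp")
  then show "(f $$ g, i, rs (X i) g a) : \<sigma>" using f g rsX_in[of i g] by (simp add: \<sigma>_def)
 next
  fix f i a j b assume "(f, i, a) : \<sigma>" "(f, j, b) : \<sigma>"
  then have f: "f : Arr D" "Tgt D f = c" "i : I" "a : el (X i) (Src D f)" "j : I" "b : el (X j) (Src D f)" and
   l: "loc (Src D f) (%g. A (f $$ g) i (rs (X i) g a))" "loc (Src D f) (%g. A (f $$ g) j (rs (X j) g b))"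
   by (auto simp: \<sigma>_def)
  show "loc (Src D f) (%g. zigzag K (Src D g) (i, rs (X i) g a) (j, rs (X j) g b))"
  proof (rule loc_trans[OF loc_conj[OF l]], elim conjE)
   fix g assume g: "g : Arr D" "Tgt D g = Src D f" "A (f $$ g) i (rs (X i) g a)" "A (f $$ g) j (rs (X j) g b)"
   obtain \<tau> where \<tau>: "germ I X K (Src D g) \<tau>" "G (f $$ g) \<tau>" "(Idn D (Src D g), i, rs (X i) g a) : \<tau>"
    using g f by (auto simp: A_def)
   obtain \<tau>' where \<tau>': "germ I X K (Src D g) \<tau>'" "G (f $$ g) \<tau>'" "(Idn D (Src D g), j, rs (X j) g b) : \<tau>'"
    using g f by (auto simp: A_def)
   have "\<tau>' = \<tau>" by (rule fn[of "f $$ g"]) (use f g \<tau> \<tau>' in auto)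
   then have "loc (Src D (Idn D (Src D g))) (%k. zigzag K (Src D k) (i, rs (X i) k (rs (X i) g a)) (j, rs (X j) k (rs (X j) g b)))"
    using germ_uniq[OF \<tau>(1,3)] \<tau>' by simp
   then have "loc (Src D g) (%k. zigzag K (Src D k) (i, rs (X i) k (rs (X i) g a)) (j, rs (X j) k (rs (X j) g b)))"
    using g by simp
   then show "loc (Src D g) (%k. zigzag K (Src D (g $$ k)) (i, rs (X i) (g $$ k) a) (j, rs (X j) (g $$ k) b))"
    by (rule loc_mono) (use f g in "simp add: rsX_comp")
  qed
 next
  fix f i a assume f: "f : Arr D" "Tgt D f = c" "i : I" "a : el (X i) (Src D f)"
   and l: "loc (Src D f) (%g. EX j b. (f $$ g, j, b) : \<sigma> & zigzag K (Src D g) (i, rs (X i) g a) (j, b))"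
  have "loc (Src D f) (%g. A (f $$ g) i (rs (X i) g a))"
  proof (rule loc_trans[OF l])
   fix g assume g: "g : Arr D" "Tgt D g = Src D f"
    "EX j b. (f $$ g, j, b) : \<sigma> & zigzag K (Src D g) (i, rs (X i) g a) (j, b)"
   then obtain j b where jb: "(f $$ g, j, b) : \<sigma>" "zigzag K (Src D g) (i, rs (X i) g a) (j, b)" by blast
   then have l': "loc (Src D g) (%k. A ((f $$ g) $$ k) j (rs (X j) k b))" using f g by (simp add: \<sigma>_def)
   then show "loc (Src D g) (%k. A (f $$ (g $$ k)) i (rs (X i) (g $$ k) a))"
   proof (rule loc_mono)
    fix k assume k: "k : Arr D" "Tgt D k = Src D g" "A ((f $$ g) $$ k) j (rs (X j) k b)"
    have sk: "Src D ((f $$ g) $$ k) = Src D k" using f g k by simp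
    obtain \<tau> where \<tau>: "germ I X K (Src D k) \<tau>" "G ((f $$ g) $$ k) \<tau>" "(Idn D (Src D k), j, rs (X j) k b) : \<tau>"
     using k(3) unfolding A_def sk by blast
    have z: "zigzag K (Src D k) (i, rs (X i) k (rs (X i) g a)) (j, rs (X j) k b)"
     by (rule zigzag_rs[OF spans]) (use jb k in auto)
    have "(Idn D (Src D k), i, rs (X i) k (rs (X i) g a)) : \<tau>"
    proof (rule germ_sat[OF \<tau>(1)])
     have "loc (Src D k) (%l. EX j' b'. (Idn D (Src D k) $$ l, j', b') : \<tau> &
       zigzag K (Src D l) (i, rs (X i) l (rs (X i) k (rs (X i) g a))) (j', b'))"
     proof (rule loc_top)
      fix l assume l: "l : Arr D" "Tgt D l = Src D k"
      have "(Idn D (Src D k) $$ l, j, rs (X j) l (rs (X j) k b)) : \<tau>"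
       by (rule germ_comp[OF \<tau>(1,3)]) (use l k in auto)
      moreover have "zigzag K (Src D l) (i, rs (X i) l (rs (X i) k (rs (X i) g a))) (j, rs (X j) l (rs (X j) k b))"
       by (rule zigzag_rs[OF spans]) (use l z in auto)
      ultimately show "EX j' b'. (Idn D (Src D k) $$ l, j', b') : \<tau> &
       zigzag K (Src D l) (i, rs (X i) l (rs (X i) k (rs (X i) g a))) (j', b')" by blast
     qed (use k in simp)
     then show "loc (Src D (Idn D (Src D k))) (%l. EX j' b'. (Idn D (Src D k) $$ l, j', b') : \<tau> &
       zigzag K (Src D l) (i, rs (X i) l (rs (X i) k (rs (X i) g a))) (j', b'))" using k by simp
    qed (use f g k rsX_in[of i k] rsX_in[of i g] in auto)
    then have "A ((f $$ g) $$ k) i (rs (X i) k (rs (X i) g a))"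
     by (intro AI) (use \<tau> f g k in auto)
    then show "A (f $$ (g $$ k)) i (rs (X i) (g $$ k) a)" using f g k by (simp add: rsX_comp)
   qed
  qed
  then show "(f, i, a) : \<sigma>" using f by (simp add: \<sigma>_def)
 next
  show "loc c (%f. EX i a. (f, i, a) : \<sigma>)"
  proof (rule loc_trans[OF tot])
   fix f assume f: "f : Arr D" "Tgt D f = c" "EX \<tau>. germ I X K (Src D f) \<tau> & G f \<tau>"
   then obtain \<tau> where \<tau>: "germ I X K (Src D f) \<tau>" "G f \<tau>" by blast
   show "loc (Src D f) (%g. EX i a. (f $$ g, i, a) : \<sigma>)"
   proof (rule loc_mono[OF germ_ex[OF \<tau>(1)]])
    fix g assume g: "g : Arr D" "Tgt D g = Src D f" "EX i a. (g, i, a) : \<tau>"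
    then obtain i a where ia: "(g, i, a) : \<tau>" by blast
    note t = germ_typ[OF \<tau>(1) ia]
    have "loc (Src D g) (%k. A ((f $$ g) $$ k) i (rs (X i) k a))"
    proof (rule loc_top)
     fix k assume k: "k : Arr D" "Tgt D k = Src D g"
     have "(g $$ k, i, rs (X i) k a) : \<tau>" by (rule germ_comp[OF \<tau>(1) ia k])
     then show "A ((f $$ g) $$ k) i (rs (X i) k a)" using A\<tau>[of f "g $$ k" \<tau>] f g k \<tau> by simp
    qed (use g in simp)
    then have "(f $$ g, i, a) : \<sigma>" using f g t by (simp add: \<sigma>_def)
    then show "EX i a. (f $$ g, i, a) : \<sigma>" by blast
   qed
  qed
 qed
 have "germ_rs f \<sigma> = \<tau>" if f: "f : Arr D" "Tgt D f = c" and \<tau>: "germ I X K (Src D f) \<tau>" "G f \<tau>" for f \<tau>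
 proof -
  have "(f $$ g, i, a) : \<sigma> \<longleftrightarrow> (g, i, a) : \<tau>" if g: "g : Arr D" "Tgt D g = Src D f" for g i a
  proof
   assume ia: "(g, i, a) : \<tau>"
   note t = germ_typ[OF \<tau>(1) ia]
   have "loc (Src D g) (%k. A ((f $$ g) $$ k) i (rs (X i) k a))"
   proof (rule loc_top)
    fix k assume k: "k : Arr D" "Tgt D k = Src D g"
    have "(g $$ k, i, rs (X i) k a) : \<tau>" by (rule germ_comp[OF \<tau>(1) ia k])
    then show "A ((f $$ g) $$ k) i (rs (X i) k a)" using A\<tau>[of f "g $$ k" \<tau>] f g k \<tau> by simp
   qed (use g in simp)
   then show "(f $$ g, i, a) : \<sigma>" using f g t by (simp add: \<sigma>_def)
  next
   assume "(f $$ g, i, a) : \<sigma>"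
   then have t: "i : I" "a : el (X i) (Src D g)" and l: "loc (Src D g) (%k. A ((f $$ g) $$ k) i (rs (X i) k a))"
    using f g by (auto simp: \<sigma>_def)
   show "(g, i, a) : \<tau>"
   proof (rule germ_sat[OF \<tau>(1) g t])
    show "loc (Src D g) (%k. EX j b. (g $$ k, j, b) : \<tau> & zigzag K (Src D k) (i, rs (X i) k a) (j, b))"
    proof (rule loc_mono[OF l])
     fix k assume k: "k : Arr D" "Tgt D k = Src D g" "A ((f $$ g) $$ k) i (rs (X i) k a)"
     then have "(g $$ k, i, rs (X i) k a) : \<tau>" using A\<tau>[of f "g $$ k" \<tau>] f g \<tau> by simp
     then show "EX j b. (g $$ k, j, b) : \<tau> & zigzag K (Src D k) (i, rs (X i) k a) (j, b)"
      by (intro exI[of _ i] exI[of _ "rs (X i) k a"] conjI equivclp_refl)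
    qed
   qed
  qed
  moreover have "g : Arr D & Tgt D g = Src D f" if "(g, i, a) : \<tau>" for g i a using germ_typ[OF \<tau>(1) that] by simp
  ultimately show ?thesis by (auto simp: mem_germ_rs set_eq_iff)
 qed
 then have "ALL f : Arr D. Tgt D f = c --> (ALL y : {\<sigma>. germ I X K (Src D f) \<sigma>}. G f y --> germ_rs f \<sigma> = y)" by simp
 then show "EX x : {\<sigma>. germ I X K c \<sigma>}. ALL f : Arr D. Tgt D f = c --> (ALL y : {\<sigma>. germ I X K (Src D f) \<sigma>}. G f y --> germ_rs f x = y)"
  using \<sigma> by (intro bexI[of _ \<sigma>]) simp_all
qed

end

end

context sheaf_model
begin

definition point_germ :: "'i set => ('i => 'o) => ('i \<times> 'a \<times> 'i \<times> 'a) set => 'i => 'u => 'u => ('u \<times> 'i \<times> 'u) set" where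
 "point_germ I X K i c a = {(f, j, b). f : Arr D & Tgt D f = c & j : I & b : el (X j) (Src D f) &
   loc (Src D f) (%g. zigzag K (Src D g) (j, rs (X j) g b) (i, rs (X i) (f $$ g) a))}"

lemma mem_point_germ: "(f, j, b) : point_germ I X K i c a \<longleftrightarrow> f : Arr D & Tgt D f = c & j : I & b : el (X j) (Src D f) &
   loc (Src D f) (%g. zigzag K (Src D g) (j, rs (X j) g b) (i, rs (X i) (f $$ g) a))"
 by (simp add: point_germ_def)

context
 fixes I :: "'i set" and X :: "'i => 'o" and K :: "('i \<times> 'a \<times> 'i \<times> 'a) set"
 assumes spans: "glue_spans E I X K"
begin

lemma point_germ_self:
 assumes "i : I" "f : Arr D" "Tgt D f = c" "a : el (X i) c"
 shows "(f, i, rs (X i) f a) : point_germ I X K i c a"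
proof -
 have "loc (Src D f) (%g. zigzag K (Src D g) (i, rs (X i) g (rs (X i) f a)) (i, rs (X i) (f $$ g) a))"
  by (rule loc_top) (use assms rsX_comp[OF spans] in auto)
 then show ?thesis using assms rsX_in[OF spans, of i f c a] by (simp add: mem_point_germ)
qed

lemma point_germ_germ:
 assumes i: "i : I" and c: "c : Obj D" and a: "a : el (X i) c"
 shows "germ I X K c (point_germ I X K i c a)" (is "germ I X K c ?p")
 unfolding germ_def
proof (intro conjI allI impI)
 fix f j b assume "(f, j, b) : ?p"
 then have f: "f : Arr D" "Tgt D f = c" "j : I" "b : el (X j) (Src D f)"
  and l: "loc (Src D f) (%g. zigzag K (Src D g) (j, rs (X j) g b) (i, rs (X i) (f $$ g) a))"
  unfolding mem_point_germ by blast+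
 show "f : Arr D" "Tgt D f = c" "j : I" "b : el (X j) (Src D f)" by fact+
 fix g assume g: "g : Arr D" "Tgt D g = Src D f"
 have "loc (Src D g) (%k. zigzag K (Src D (g $$ k)) (j, rs (X j) (g $$ k) b) (i, rs (X i) (f $$ (g $$ k)) a))"
  by (rule loc_pull[OF l g])
 then have "loc (Src D g) (%k. zigzag K (Src D k) (j, rs (X j) k (rs (X j) g b)) (i, rs (X i) ((f $$ g) $$ k) a))"
  by (rule loc_mono) (use f g rsX_comp[OF spans, of j g _ b] in simp)
 then show "(f $$ g, j, rs (X j) g b) : ?p"
  unfolding mem_point_germ using f g rsX_in[OF spans, of j g "Src D f" b] by simp
next
 fix f j b k d assume a: "(f, j, b) : ?p" "(f, k, d) : ?p"
 have "loc (Src D f) (%g. zigzag K (Src D g) (j, rs (X j) g b) (i, rs (X i) (f $$ g) a) &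
   zigzag K (Src D g) (k, rs (X k) g d) (i, rs (X i) (f $$ g) a))"
  using a unfolding mem_point_germ by (intro loc_conj) (elim conjE, assumption)+
 then show "loc (Src D f) (%g. zigzag K (Src D g) (j, rs (X j) g b) (k, rs (X k) g d))"
  by (rule loc_mono) (elim conjE, erule zigzag_trans, erule zigzag_sym)
next
 fix f j b assume f: "f : Arr D" "Tgt D f = c" "j : I" "b : el (X j) (Src D f)"
  and l: "loc (Src D f) (%g. EX k d. (f $$ g, k, d) : ?p & zigzag K (Src D g) (j, rs (X j) g b) (k, d))"
 have "loc (Src D f) (%g. zigzag K (Src D g) (j, rs (X j) g b) (i, rs (X i) (f $$ g) a))"
 proof (rule loc_trans[OF l], elim exE conjE)
  fix g k d assume g: "g : Arr D" "Tgt D g = Src D f" and kd: "(f $$ g, k, d) : ?p" and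
   z: "zigzag K (Src D g) (j, rs (X j) g b) (k, d)"
  have "loc (Src D (f $$ g)) (%l. zigzag K (Src D l) (k, rs (X k) l d) (i, rs (X i) ((f $$ g) $$ l) a))"
   using kd unfolding mem_point_germ by blast
  then have "loc (Src D g) (%l. zigzag K (Src D l) (k, rs (X k) l d) (i, rs (X i) ((f $$ g) $$ l) a))"
   using f g by simp
  then show "loc (Src D g) (%l. zigzag K (Src D (g $$ l)) (j, rs (X j) (g $$ l) b) (i, rs (X i) (f $$ (g $$ l)) a))"
  proof (rule loc_mono)
   fix l assume m: "l : Arr D" "Tgt D l = Src D g" "zigzag K (Src D l) (k, rs (X k) l d) (i, rs (X i) ((f $$ g) $$ l) a)"
   have "zigzag K (Src D l) (j, rs (X j) l (rs (X j) g b)) (k, rs (X k) l d)"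
    by (rule zigzag_rs[OF spans]) (use m z in simp_all)
   from zigzag_trans[OF this m(3)]
   show "zigzag K (Src D (g $$ l)) (j, rs (X j) (g $$ l) b) (i, rs (X i) (f $$ (g $$ l)) a)"
    using f g m rsX_comp[OF spans, of j g l b] by simp
  qed
 qed
 then show "(f, j, b) : ?p" unfolding mem_point_germ using f by simp
next
 show "loc c (%f. EX j b. (f, j, b) : ?p)"
 proof (rule loc_top[OF c])
  fix f assume "f : Arr D" "Tgt D f = c"
  then show "EX j b. (f, j, b) : ?p" using point_germ_self[OF i _ _ a] by blast
 qed
qed

lemma germ_rs_point_germ:
 assumes "i : I" "h : Arr D" "a : el (X i) (Tgt D h)"
 shows "germ_rs h (point_germ I X K i (Tgt D h) a) = point_germ I X K i (Src D h) (rs (X i) h a)"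
proof -
 have "(f, j, b) : germ_rs h (point_germ I X K i (Tgt D h) a) \<longleftrightarrow> (f, j, b) : point_germ I X K i (Src D h) (rs (X i) h a)" for f j b
 proof (cases "f : Arr D & Tgt D f = Src D h & j : I & b : el (X j) (Src D f)")
  case True
  have "loc (Src D f) (%g. zigzag K (Src D g) (j, rs (X j) g b) (i, rs (X i) ((h $$ f) $$ g) a)) \<longleftrightarrow>
   loc (Src D f) (%g. zigzag K (Src D g) (j, rs (X j) g b) (i, rs (X i) (f $$ g) (rs (X i) h a)))"
   using True assms by (intro iffI; elim loc_mono) (simp_all add: rsX_comp[OF spans])
  then show ?thesis using True assms unfolding mem_germ_rs mem_point_germ by simp
 next
  case False
  then show ?thesis unfolding mem_germ_rs mem_point_germ using assms by (auto simp del: D.assoc)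
 qed
 then show ?thesis by (simp add: set_eq_iff)
qed

lemma germ_rs_eq_point_germ:
 assumes s: "germ I X K c \<sigma>" "(f, i, a) : \<sigma>"
 shows "germ_rs f \<sigma> = point_germ I X K i (Src D f) a"
proof -
 note t = germ_typ[OF s]
 have "(g, j, b) : germ_rs f \<sigma> \<longleftrightarrow> (g, j, b) : point_germ I X K i (Src D f) a" for g j b
 proof
  assume "(g, j, b) : germ_rs f \<sigma>"
  then have g: "g : Arr D" "Tgt D g = Src D f" "(f $$ g, j, b) : \<sigma>" unfolding mem_germ_rs by blast+
  have "(f $$ g, i, rs (X i) g a) : \<sigma>" by (rule germ_comp[OF s g(1,2)])
  from germ_uniq[OF s(1) g(3) this]
  have "loc (Src D g) (%k. zigzag K (Src D k) (j, rs (X j) k b) (i, rs (X i) k (rs (X i) g a)))" using t g by simp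
  then have "loc (Src D g) (%k. zigzag K (Src D k) (j, rs (X j) k b) (i, rs (X i) (g $$ k) a))"
   by (rule loc_mono) (use t g rsX_comp[OF spans] in simp)
  then show "(g, j, b) : point_germ I X K i (Src D f) a"
   unfolding mem_point_germ using g germ_typ[OF s(1) g(3)] t by simp
 next
  assume "(g, j, b) : point_germ I X K i (Src D f) a"
  then have g: "g : Arr D" "Tgt D g = Src D f" "j : I" "b : el (X j) (Src D g)"
   and l: "loc (Src D g) (%k. zigzag K (Src D k) (j, rs (X j) k b) (i, rs (X i) (g $$ k) a))"
   unfolding mem_point_germ by blast+
  have "(f $$ g, j, b) : \<sigma>"
  proof (rule germ_sat[OF s(1)])
   have "loc (Src D g) (%k. EX j' b'. ((f $$ g) $$ k, j', b') : \<sigma> & zigzag K (Src D k) (j, rs (X j) k b) (j', b'))"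
   proof (rule loc_mono[OF l])
    fix k assume k: "k : Arr D" "Tgt D k = Src D g" "zigzag K (Src D k) (j, rs (X j) k b) (i, rs (X i) (g $$ k) a)"
    have "(f $$ (g $$ k), i, rs (X i) (g $$ k) a) : \<sigma>" by (rule germ_comp[OF s]) (use g k in simp_all)
    then have "((f $$ g) $$ k, i, rs (X i) (g $$ k) a) : \<sigma>" using t g k by simp
    then show "EX j' b'. ((f $$ g) $$ k, j', b') : \<sigma> & zigzag K (Src D k) (j, rs (X j) k b) (j', b')"
     using k(3) by (intro exI conjI)
   qed
   then show "loc (Src D (f $$ g)) (%k. EX j' b'. ((f $$ g) $$ k, j', b') : \<sigma> & zigzag K (Src D k) (j, rs (X j) k b) (j', b'))"
    using t g by simp
  qed (use t g in auto)
  then show "(g, j, b) : germ_rs f \<sigma>" unfolding mem_germ_rs using g by simp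
 qed
 then show ?thesis by (simp add: set_eq_iff)
qed

lemma point_germ_eqI:
 assumes l: "loc c (%f. zigzag K (Src D f) (i, rs (X i) f a) (j, rs (X j) f b))"
 shows "point_germ I X K i c a = point_germ I X K j c b"
proof -
 have sub: "(f, k, d) : point_germ I X K j c b"
  if l: "loc c (%f. zigzag K (Src D f) (i, rs (X i) f a) (j, rs (X j) f b))" and s: "(f, k, d) : point_germ I X K i c a" for i j a b f k d
 proof -
  have f: "f : Arr D" "Tgt D f = c" "k : I" "d : el (X k) (Src D f)"
   and l': "loc (Src D f) (%g. zigzag K (Src D g) (k, rs (X k) g d) (i, rs (X i) (f $$ g) a))"
   using s unfolding mem_point_germ by blast+
  have "loc (Src D f) (%g. zigzag K (Src D (f $$ g)) (i, rs (X i) (f $$ g) a) (j, rs (X j) (f $$ g) b))"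
   by (rule loc_pull[OF l f(1,2)])
  from loc_conj[OF l' this]
  have "loc (Src D f) (%g. zigzag K (Src D g) (k, rs (X k) g d) (j, rs (X j) (f $$ g) b))"
   by (rule loc_mono) (use f in "auto elim: zigzag_trans")
  then show ?thesis unfolding mem_point_germ using f by simp
 qed
 have "loc c (%f. zigzag K (Src D f) (j, rs (X j) f b) (i, rs (X i) f a))"
  by (rule loc_mono[OF l]) (rule zigzag_sym)
 then have "s : point_germ I X K i c a \<longleftrightarrow> s : point_germ I X K j c b" for s
  using sub l by (cases s) blast
 then show ?thesis by blast
qed

lemma point_germ_eqD:
 assumes e: "point_germ I X K i c a = point_germ I X K j c b" and "i : I" "j : I" "c : Obj D" "a : el (X i) c"
 shows "loc c (%f. zigzag K (Src D f) (i, rs (X i) f a) (j, rs (X j) f b))"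
proof -
 have "(Idn D c, i, rs (X i) (Idn D c) a) : point_germ I X K i c a" using point_germ_self[of i "Idn D c" c a] assms(2-5) by simp
 then have "(Idn D c, i, a) : point_germ I X K j c b" using e assms rs_id[OF X_obj[OF spans]] by simp
 then have "loc (Src D (Idn D c)) (%f. zigzag K (Src D f) (i, rs (X i) f a) (j, rs (X j) (Idn D c $$ f) b))"
  unfolding mem_point_germ by blast
 then have "loc c (%f. zigzag K (Src D f) (i, rs (X i) f a) (j, rs (X j) (Idn D c $$ f) b))" using assms by simp
 then show ?thesis by (rule loc_mono) simp
qed

lemma local_gluing_exists:
 assumes small: "|I| <o |UNIV :: 'u set|"
 shows "EX Q \<iota>. local_gluing I X K Q \<iota>"
proof -
 let ?G = "%c. {\<sigma>. germ I X K c \<sigma>}"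
 \<comment> \<open>Germs at \<open>c\<close> are subsets of a small set, which makes their sheaf small.\<close>
 let ?A = "\<Union>(i, d) \<in> I \<times> Obj D. el (X i) d"
 have D: "|Obj D| <o |UNIV :: 'u set|" "|Arr D| <o |UNIV :: 'u set|"
  using small_D by (auto simp: small_category_def small_def)
 have "|?A| <o |UNIV :: 'u set|"
  by (rule small_UNION[OF small_Times[OF small D(1)]])
   (use el_small X_obj[OF spans] in "auto simp: small_def")
 then have A: "|Pow (Arr D \<times> I \<times> ?A)| <o |UNIV :: 'u set|" by (intro small_Pow small_Times D small)
 have sm: "|?G c| <o |UNIV :: 'u set|" for c
 proof (rule small_subset[OF A], rule subsetI, rule PowI, rule subsetI)
  fix \<sigma> s assume "\<sigma> : ?G c" "s : \<sigma>"
  then obtain f i a where s: "germ I X K c \<sigma>" "s = (f, i, a)" "(f, i, a) : \<sigma>" by (cases s) auto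
  note t = germ_typ[OF s(1,3)]
  then show "s : Arr D \<times> I \<times> ?A" unfolding s(2) by (intro SigmaI UN_I[of "(i, Src D f)"]) auto
 qed
 obtain Q b where Q: "Q : obj" and b1: "!!c. c : Obj D ==> bij_betw (b c) (?G c) (el Q c)"
  and b2: "!!h s. h : Arr D ==> s : ?G (Tgt D h) ==> b (Src D h) (germ_rs h s) = rs Q h (b (Tgt D h) s)"
  by (rule ess_surj_any[OF germ_sheaf[OF spans] sm], rule that)
 have bin: "b c \<sigma> : el Q c" if "c : Obj D" "germ I X K c \<sigma>" for c \<sigma>
  using bij_betw_apply[OF b1[OF that(1)], of \<sigma>] that(2) by simp
 have "EX m : hom E (X i) Q. ALL c : Obj D. ALL a : el (X i) c. ap m c a = b c (point_germ I X K i c a)" if i: "i : I" for i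
 proof (rule full)
  fix f a assume f: "f : Arr D" "a : el (X i) (Tgt D f)"
  show "b (Src D f) (point_germ I X K i (Src D f) (rs (X i) f a)) = rs Q f (b (Tgt D f) (point_germ I X K i (Tgt D f) a))"
   using b2[OF f(1), of "point_germ I X K i (Tgt D f) a"] point_germ_germ[OF i, of "Tgt D f" a] germ_rs_point_germ[OF i f] f by simp
 qed (use X_obj[OF spans i] Q bin point_germ_germ[OF i] in auto)
 then have "ALL i. EX m. i : I --> m : hom E (X i) Q & (ALL c : Obj D. ALL a : el (X i) c. ap m c a = b c (point_germ I X K i c a))"
  by blast
 then obtain \<iota> where \<iota>0: "ALL i. i : I --> \<iota> i : hom E (X i) Q & (ALL c : Obj D. ALL a : el (X i) c. ap (\<iota> i) c a = b c (point_germ I X K i c a))"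
  by (rule choice[THEN exE])
 then have \<iota>: "!!i. i : I ==> \<iota> i : hom E (X i) Q" and
  \<iota>p: "!!i c a. i : I ==> c : Obj D ==> a : el (X i) c ==> ap (\<iota> i) c a = b c (point_germ I X K i c a)" by auto
 have \<iota>a: "!!i. i : I ==> \<iota> i : arr & src (\<iota> i) = X i & tgt (\<iota> i) = Q" using \<iota> by (auto simp: hom_def)
 have "local_gluing I X K Q \<iota>"
  unfolding local_gluing_def glue_cocone_def
 proof (intro conjI ballI impI Q \<iota>; (elim case_prodE)?; (simp only: prod.case split_paired_all)?)
  fix i u j v assume k: "(i, u, j, v) : K"
  note ka = K_arr[OF spans k]
  show "\<iota> i $ u = \<iota> j $ v"
  proof (rule faithful[of _ "src u" Q])
   fix c x assume c: "c : Obj D" "x : el (src u) c"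
   have e: "ap u c x : el (X i) c" "ap v c x : el (X j) c" using ap_in[of u c x] ap_in[of v c x] ka c by auto
   have "point_germ I X K i c (ap u c x) = point_germ I X K j c (ap v c x)"
   proof (rule point_germ_eqI, rule loc_top[OF c(1)])
    fix f assume f: "f : Arr D" "Tgt D f = c"
    have "zigzag K (Tgt D f) (i, ap u c x) (j, ap v c x)"
     unfolding f by (rule r_into_equivclp) (rule span_stepI[OF k c(2)])
    then show "zigzag K (Src D f) (i, rs (X i) f (ap u c x)) (j, rs (X j) f (ap v c x))"
     using f zigzag_rs[OF spans] by blast
   qed
   then show "ap (\<iota> i $ u) c x = ap (\<iota> j $ v) c x"
    using ap_comp[of u "\<iota> i" c x] ap_comp[of v "\<iota> j" c x] ka \<iota>a c \<iota>p e by simp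
  qed (use ka \<iota>a in "auto simp: hom_def")
 next
  fix c x assume c: "c : Obj D" "x : el Q c"
  then have "x : b c ` ?G c" using bij_betw_imp_surj_on[OF b1] by simp
  then obtain \<sigma> where \<sigma>: "germ I X K c \<sigma>" "x = b c \<sigma>" by auto
  show "loc c (%f. EX i : I. EX a : el (X i) (Src D f). ap (\<iota> i) (Src D f) a = rs Q f x)"
  proof (rule loc_mono[OF germ_ex[OF \<sigma>(1)]], elim exE)
   fix f i a assume f: "f : Arr D" "Tgt D f = c" "(f, i, a) : \<sigma>"
   note t = germ_typ[OF \<sigma>(1) f(3)]
   have "ap (\<iota> i) (Src D f) a = rs Q f x"
    using \<iota>p[of i "Src D f" a] t germ_rs_eq_point_germ[OF \<sigma>(1) f(3)] b2[OF f(1), of \<sigma>] \<sigma> f by simp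
   then show "EX i : I. EX a : el (X i) (Src D f). ap (\<iota> i) (Src D f) a = rs Q f x" using t by blast
  qed
 next
  fix c i j a d assume h: "c : Obj D" "i : I" "j : I" "a : el (X i) c" "d : el (X j) c" "ap (\<iota> i) c a = ap (\<iota> j) c d"
  then have "b c (point_germ I X K i c a) = b c (point_germ I X K j c d)" using \<iota>p by simp
  then have "point_germ I X K i c a = point_germ I X K j c d"
   using inj_onD[OF bij_betw_imp_inj_on[OF b1[OF h(1)]]] point_germ_germ h by simp
  then show "loc c (%f. zigzag K (Src D f) (i, rs (X i) f a) (j, rs (X j) f d))"
   by (rule point_germ_eqD) (use h in auto)
 qed
 then show ?thesis by blast
qed

text \<open>
  A gluing is isomorphic to the one constructed from germs, which satisfies the local condition.
\<close>

lemma gluing_is_local: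
 assumes g: "is_gluing E I X K Q \<iota>" and small: "|I| <o |UNIV :: 'u set|"
 shows "local_gluing I X K Q \<iota>"
proof -
 obtain Q' \<iota>' where l: "local_gluing I X K Q' \<iota>'" using local_gluing_exists[OF small] by blast
 have c: "glue_cocone E I X K Q \<iota>" using g by (simp add: is_gluing_def)
 have c': "glue_cocone E I X K Q' \<iota>'" using l by (simp add: local_gluing_def)
 obtain m m' where m: "m : hom E Q Q'" "m' : hom E Q' Q" "m' $ m = Idn E Q" "m $ m' = Idn E Q'"
  "!!i. i : I ==> m $ \<iota> i = \<iota>' i" "!!i. i : I ==> m' $ \<iota>' i = \<iota> i"
  by (rule gluing_unique_iso[OF g local_gluing_is_gluing[OF spans l]], rule that)
 have ma: "m : arr" "src m = Q" "tgt m = Q'" "m' : arr" "src m' = Q'" "tgt m' = Q"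
  using m by (auto simp: hom_def)
 note i = cocone_arr[OF spans c] and i' = cocone_arr[OF spans c']
 have mm: "ap m' c (ap m c x) = x" if "c : Obj D" "x : el Q c" for c x
  using ap_comp[of m m' c x] ap_id[OF i(1) that] m ma that by simp
 show ?thesis
  unfolding local_gluing_def
 proof (intro conjI ballI impI c)
  fix c x assume c: "c : Obj D" "x : el Q c"
  have mx: "ap m c x : el Q' c" using ap_in[of m c x] ma c by simp
  have "loc c (%f. EX i : I. EX a : el (X i) (Src D f). ap (\<iota>' i) (Src D f) a = rs Q' f (ap m c x))"
   using l c mx by (simp add: local_gluing_def)
  then show "loc c (%f. EX i : I. EX a : el (X i) (Src D f). ap (\<iota> i) (Src D f) a = rs Q f x)"
  proof (rule loc_mono, elim bexE)
   fix f k a assume f: "f : Arr D" "Tgt D f = c" "k : I" "a : el (X k) (Src D f)" "ap (\<iota>' k) (Src D f) a = rs Q' f (ap m c x)"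
   have "ap (\<iota> k) (Src D f) a = ap m' (Src D f) (ap (\<iota>' k) (Src D f) a)"
    using ap_comp[of "\<iota>' k" m' "Src D f" a] m(6)[OF f(3)] i' f ma by simp
   also have "\<dots> = rs Q f x"
    unfolding f(5) using ap_rs[of m' f "ap m c x"] ma f mx mm[OF c] by simp
   finally show "EX i : I. EX a : el (X i) (Src D f). ap (\<iota> i) (Src D f) a = rs Q f x" using f by blast
  qed
 next
  fix c k j a d assume h: "c : Obj D" "k : I" "j : I" "a : el (X k) c" "d : el (X j) c" "ap (\<iota> k) c a = ap (\<iota> j) c d"
  have "ap (\<iota>' k) c a = ap (\<iota>' j) c d"
   using ap_comp[of "\<iota> k" m c a] ap_comp[of "\<iota> j" m c d] m(5) h i ma by simp
  then show "loc c (%f. zigzag K (Src D f) (k, rs (X k) f a) (j, rs (X j) f d))"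
   using l h by (simp add: local_gluing_def)
 qed
qed


subsection \<open>Gluings are stable under pullback\<close>

context
 fixes Y Q g \<iota> \<iota>' \<pi>
 assumes g: "g : hom E Y Q" and co: "glue_cocone E I X K Q \<iota>"
  and pbs: "!!i. i : I ==> is_pullback E g (\<iota> i) (\<iota>' i) (\<pi> i)"
begin

abbreviation "K' \<equiv> pull_spans E I K \<iota>' \<pi>"
abbreviation "X' \<equiv> %i. src (\<iota>' i)"

lemma g_arr: "g : arr" "src g = Y" "tgt g = Q"
 using g by (auto simp: hom_def)

lemma pulled_arr:
 assumes "i : I"
 shows "\<iota>' i : arr" "\<pi> i : arr" "src (\<pi> i) = X' i" "tgt (\<iota>' i) = Y" "tgt (\<pi> i) = X i"
  "g $ \<iota>' i = \<iota> i $ \<pi> i"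
 using pullback_arr[OF pbs[OF assms]] cocone_arr[OF spans co] g_arr assms by auto

lemma pulled_spans: "glue_spans E I X' K'"
 unfolding glue_spans_def using pulled_arr by (auto simp: pull_spans_def)

lemma pulled_cocone: "glue_cocone E I X' K' Y \<iota>'"
 unfolding glue_cocone_def using pulled_arr g_arr by (auto simp: pull_spans_def hom_def)

lemma pulled_el:
 assumes "i : I" "c : Obj D" "y : el Y c" "a : el (X i) c" "ap g c y = ap (\<iota> i) c a"
 shows "EX! a'. a' : el (X' i) c & ap (\<iota>' i) c a' = y & ap (\<pi> i) c a' = a"
 by (rule pullback_elements[OF pbs[OF assms(1)] assms(2)])
  (use assms g_arr cocone_arr[OF spans co] in auto)

text \<open>A span of \<open>K\<close> through an element lying under \<open>y\<close> is the image of a pulled back span.\<close>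

lemma pulled_step:
 assumes s: "span_step K c (i, a) (j, b)" and c: "c : Obj D" and y: "y : el Y c" "ap g c y = ap (\<iota> i) c a"
  and a': "a' : el (X' i) c" "ap (\<iota>' i) c a' = y" "ap (\<pi> i) c a' = a"
  and b': "b' : el (X' j) c" "ap (\<iota>' j) c b' = y" "ap (\<pi> j) c b' = b"
 shows "span_step K' c (i, a') (j, b')"
proof -
 obtain u v x where k: "(i, u, j, v) : K" "x : el (src u) c" "a = ap u c x" "b = ap v c x"
  using s by (auto simp: span_step_def)
 note ka = K_arr[OF spans k(1)]
 note i = cocone_arr[OF spans co]
 have uv: "\<iota> i $ u = \<iota> j $ v" using co k(1) unfolding glue_cocone_def by fastforce
 have iu: "\<iota> i $ u : arr" "src (\<iota> i $ u) = src u" "tgt (\<iota> i $ u) = Q" using ka i by auto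
 obtain \<tau> \<xi> where pb: "is_pullback E g (\<iota> i $ u) \<tau> \<xi>"
  using pullback_exists[OF g_arr(1) iu(1)] g_arr iu by metis
 note t = pullback_arr[OF pb]
 have ts: "src \<xi> = src \<tau>" "tgt \<tau> = Y" "tgt \<xi> = src u" "tgt \<xi> = src v" using t(6-8) g_arr iu ka by simp_all
 obtain u' where u': "u' : arr" "src u' = src \<tau>" "tgt u' = X' i" "\<iota>' i $ u' = \<tau>" "\<pi> i $ u' = u $ \<xi>"
  by (rule pullback_lift[OF pbs[OF ka(1)], of \<tau> "u $ \<xi>"]) (use t(3,4,9) ts(1-3) g_arr ka i in simp_all)
 obtain v' where v': "v' : arr" "src v' = src \<tau>" "tgt v' = X' j" "\<iota>' j $ v' = \<tau>" "\<pi> j $ v' = v $ \<xi>"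
 proof (rule pullback_lift[OF pbs[OF ka(2)], of \<tau> "v $ \<xi>"])
  have "g $ \<tau> = (\<iota> j $ v) $ \<xi>" using t(9) uv by simp
  then show "g $ \<tau> = \<iota> j $ (v $ \<xi>)" using t(3,4) ts(1-3) ka i by simp
 qed (use t(3,4,9) ts(1-3) g_arr ka i in simp_all)
 have K': "(i, u', j, v') : K'"
  by (rule pull_spansI[OF k(1) ka(1,2) u'(1) v'(1), of _ \<xi>]) (use u' v' t(4) ts(1-3) in "simp_all add: hom_def")
 have "ap g c y = ap (\<iota> i $ u) c x" using ap_comp[of u "\<iota> i" c x] ka i c k y by simp
 then obtain z where z: "z : el (src \<tau>) c" "ap \<tau> c z = y" "ap \<xi> c z = x"
  using pullback_elements[OF pb c, of y x] y g_arr iu k by auto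
 have "ap u' c z = a'"
 proof -
  have "ap u' c z : el (X' i) c" using ap_in[of u' c z] u' c z by simp
  moreover have "ap (\<iota>' i) c (ap u' c z) = y" using ap_comp[of u' "\<iota>' i" c z] u' pulled_arr[OF ka(1)] c z by simp
  moreover have "ap (\<pi> i) c (ap u' c z) = a"
   using ap_comp[of u' "\<pi> i" c z] ap_comp[of \<xi> u c z] u' pulled_arr[OF ka(1)] c z t(3,4) ts(1-3) ka k by simp
  moreover have "a : el (X i) c" using ap_in[of u c x] ka k c by simp
  ultimately show ?thesis using pulled_el[OF ka(1) c y(1) _ y(2)] a' by blast
 qed
 moreover have "ap v' c z = b'"
 proof -
  have "ap v' c z : el (X' j) c" using ap_in[of v' c z] v' c z by simp
  moreover have "ap (\<iota>' j) c (ap v' c z) = y" using ap_comp[of v' "\<iota>' j" c z] v' pulled_arr[OF ka(2)] c z by simp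
  moreover have "ap (\<pi> j) c (ap v' c z) = b"
   using ap_comp[of v' "\<pi> j" c z] ap_comp[of \<xi> v c z] v' pulled_arr[OF ka(2)] c z t(3,4) ts(1-3) ka k by simp
  moreover have bj: "b : el (X j) c" using ap_in[of v c x] ka k c by simp
  moreover have "ap g c y = ap (\<iota> j) c b"
   using ap_comp[of v "\<iota> j" c x] ap_comp[of u "\<iota> i" c x] uv ka i c k y by simp
  ultimately show ?thesis using pulled_el[OF ka(2) c y(1) bj] b' by blast
 qed
 moreover have "z : el (src u') c" using z u' by simp
 ultimately show ?thesis using span_stepI[OF K', of z c] by simp
qed

lemma pulled_zigzag:
 assumes z: "zigzag K c (i, a) (j, b)" and c: "c : Obj D" and i: "i : I"
  and y: "y : el Y c" "ap g c y = ap (\<iota> i) c a" and ia: "a : el (X i) c"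
  and a': "a' : el (X' i) c" "ap (\<iota>' i) c a' = y" "ap (\<pi> i) c a' = a"
  and b': "b' : el (X' j) c" "ap (\<iota>' j) c b' = y" "ap (\<pi> j) c b' = b"
 shows "zigzag K' c (i, a') (j, b')"
proof -
 have "ALL b'. b' : el (X' (fst t)) c & ap (\<iota>' (fst t)) c b' = y & ap (\<pi> (fst t)) c b' = snd t --> zigzag K' c (i, a') (fst t, b')"
  if "zigzag K c (i, a) t" for t
  using that
 proof (induction rule: equivclp_induct)
  case base
  show ?case
  proof (intro allI impI, unfold fst_conv snd_conv, elim conjE)
   fix b' assume "b' : el (X' i) c" "ap (\<iota>' i) c b' = y" "ap (\<pi> i) c b' = a"
   then have "a' = b'" using pulled_el[OF i c y(1) ia y(2)] a' by blast
   then show "zigzag K' c (i, a') (i, b')" by simp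
  qed
 next
  case (step s t)
  obtain k p where s: "s = (k, p)" by (cases s)
  obtain l q where t: "t = (l, q)" by (cases t)
  have kp: "k : I" "p : el (X k) c" using zigzag_in[OF spans _ c i ia] step(1) s by auto
  have yk: "ap g c y = ap (\<iota> k) c p" using cocone_zigzag[OF spans co step(1)[unfolded s] c] y by simp
  obtain p' where p': "p' : el (X' k) c" "ap (\<iota>' k) c p' = y" "ap (\<pi> k) c p' = p"
   using pulled_el[OF kp(1) c y(1) kp(2) yk] by blast
  have ih: "zigzag K' c (i, a') (k, p')" using step(3) p' s by simp
  have lq: "zigzag K c (i, a) (l, q)" unfolding t[symmetric] by (rule equivclp_into_equivclp[OF step(1,2)])
  have yl: "ap g c y = ap (\<iota> l) c q" using cocone_zigzag[OF spans co lq c] y by simp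
  show ?case
  proof (intro allI impI, unfold t fst_conv snd_conv, elim conjE)
   fix q' assume q': "q' : el (X' l) c" "ap (\<iota>' l) c q' = y" "ap (\<pi> l) c q' = q"
   have "span_step K' c (k, p') (l, q') \<or> span_step K' c (l, q') (k, p')"
    using step(2) pulled_step[OF _ c y(1) yk p' q'] pulled_step[OF _ c y(1) yl q' p'] s t by blast
   then show "zigzag K' c (i, a') (l, q')" by (rule equivclp_into_equivclp[OF ih])
  qed
 qed
 from this[OF z] show ?thesis using b' by simp
qed

lemma local_gluing_pullback:
 assumes lg: "local_gluing I X K Q \<iota>"
 shows "local_gluing I X' K' Y \<iota>'"
 unfolding local_gluing_def
proof (intro conjI ballI impI pulled_cocone)
 note i = cocone_arr[OF spans co]
 fix c y assume c: "c : Obj D" "y : el Y c"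
 have gy: "ap g c y : el Q c" using ap_in[of g c y] g_arr c by simp
 have "loc c (%f. EX i : I. EX a : el (X i) (Src D f). ap (\<iota> i) (Src D f) a = rs Q f (ap g c y))"
  using lg c gy by (simp add: local_gluing_def)
 then show "loc c (%f. EX i : I. EX a : el (X' i) (Src D f). ap (\<iota>' i) (Src D f) a = rs Y f y)"
 proof (rule loc_mono, elim bexE)
  fix f k a assume f: "f : Arr D" "Tgt D f = c" "k : I" "a : el (X k) (Src D f)" "ap (\<iota> k) (Src D f) a = rs Q f (ap g c y)"
  have y': "rs Y f y : el Y (Src D f)" using rs_in[of Y f y] g_arr c f by auto
  have "ap g (Src D f) (rs Y f y) = ap (\<iota> k) (Src D f) a" using ap_rs[of g f y] g_arr f c by simp
  then show "EX i : I. EX a : el (X' i) (Src D f). ap (\<iota>' i) (Src D f) a = rs Y f y"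
   using pulled_el[OF f(3) _ y' f(4)] f by auto
 qed
next
 note i = cocone_arr[OF spans co]
 fix c k j a' b' assume h: "c : Obj D" "k : I" "j : I" "a' : el (X' k) c" "b' : el (X' j) c" "ap (\<iota>' k) c a' = ap (\<iota>' j) c b'"
 let ?y = "ap (\<iota>' k) c a'" and ?a = "ap (\<pi> k) c a'" and ?b = "ap (\<pi> j) c b'"
 note pk = pulled_arr[OF h(2)] and pj = pulled_arr[OF h(3)]
 have y: "?y : el Y c" and a: "?a : el (X k) c" and b: "?b : el (X j) c"
  using ap_in[of "\<iota>' k" c a'] ap_in[of "\<pi> k" c a'] ap_in[of "\<pi> j" c b'] pk pj h by auto
 have ya: "ap g c ?y = ap (\<iota> k) c ?a"
  using ap_comp[of "\<iota>' k" g c a'] ap_comp[of "\<pi> k" "\<iota> k" c a'] pk i h g_arr by simp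
 have yb: "ap g c ?y = ap (\<iota> j) c ?b"
  using ap_comp[of "\<iota>' j" g c b'] ap_comp[of "\<pi> j" "\<iota> j" c b'] pj i h g_arr by simp
 have "ap (\<iota> k) c ?a = ap (\<iota> j) c ?b" using ya yb by simp
 then have "loc c (%f. zigzag K (Src D f) (k, rs (X k) f ?a) (j, rs (X j) f ?b))"
  using lg h a b unfolding local_gluing_def by simp
 then show "loc c (%f. zigzag K' (Src D f) (k, rs (X' k) f a') (j, rs (X' j) f b'))"
 proof (rule loc_mono)
  fix f assume f: "f : Arr D" "Tgt D f = c" "zigzag K (Src D f) (k, rs (X k) f ?a) (j, rs (X j) f ?b)"
  show "zigzag K' (Src D f) (k, rs (X' k) f a') (j, rs (X' j) f b')"
  proof (rule pulled_zigzag[OF f(3)])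
   show "rs Y f ?y : el Y (Src D f)" using rs_in[of Y f ?y] g_arr y f by auto
   show "ap g (Src D f) (rs Y f ?y) = ap (\<iota> k) (Src D f) (rs (X k) f ?a)"
    using ap_rs[of g f ?y] ap_rs[of "\<iota> k" f ?a] g_arr f y ya a i h by simp
   show "rs (X k) f ?a : el (X k) (Src D f)" using rs_in[of "X k" f ?a] X_obj[OF spans h(2)] a f by simp
   show "rs (X' k) f a' : el (X' k) (Src D f)" using rs_in[of "X' k" f a'] pk h f by simp
   show "ap (\<iota>' k) (Src D f) (rs (X' k) f a') = rs Y f ?y" using ap_rs[of "\<iota>' k" f a'] pk h f by simp
   show "ap (\<pi> k) (Src D f) (rs (X' k) f a') = rs (X k) f ?a" using ap_rs[of "\<pi> k" f a'] pk h f by simp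
   show "rs (X' j) f b' : el (X' j) (Src D f)" using rs_in[of "X' j" f b'] pj h f by simp
   show "ap (\<iota>' j) (Src D f) (rs (X' j) f b') = rs Y f ?y" using ap_rs[of "\<iota>' j" f b'] pj h f by simp
   show "ap (\<pi> j) (Src D f) (rs (X' j) f b') = rs (X j) f ?b" using ap_rs[of "\<pi> j" f b'] pj h f by simp
  qed (use f h in auto)
 qed
qed

end

end

theorem gluing_exists:
 assumes "glue_spans E I X K" "|I| <o |UNIV :: 'u set|"
 shows "EX Q \<iota>. is_gluing E I X K Q \<iota>"
 using local_gluing_exists[OF assms] local_gluing_is_gluing[OF assms(1)] by blast

theorem gluing_stable:
 assumes s: "glue_spans E I X K" "|I| <o |UNIV :: 'u set|" and g: "is_gluing E I X K Q \<iota>" "g : hom E Y Q"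
  and p: "!!i. i : I ==> is_pullback E g (\<iota> i) (\<iota>' i) (\<pi> i)"
 shows "is_gluing E I (%i. src (\<iota>' i)) (pull_spans E I K \<iota>' \<pi>) Y \<iota>'"
proof -
 have c: "glue_cocone E I X K Q \<iota>" using g by (simp add: is_gluing_def)
 show ?thesis
  by (rule local_gluing_is_gluing[OF pulled_spans[OF s(1) g(2) c p] local_gluing_pullback[OF s(1) g(2) c p gluing_is_local[OF s(1) g(1) s(2)]]])
qed

end

section \<open>Grothendieck toposes are categories of sheaves of elements\<close>

subsection \<open>Arrows of sets\<close>

lemma SetC_hom: "m : hom SetC A B \<longleftrightarrow> small A & small B & (EX f : A \<rightarrow>\<^sub>E B. m = Fn A f B)"
 by (auto simp: SetC_def hom_def)

lemma SetC_Obj [simp]: "Obj SetC = {A. small A}"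
 by (simp add: SetC_def)

lemma SetC_Arr: "m : Arr SetC \<longleftrightarrow> m : hom SetC (fn_src m) (fn_tgt m)"
 by (auto simp: SetC_def hom_def)

lemma SetC_sel [simp]: "Src SetC = fn_src" "Tgt SetC = fn_tgt"
 by (simp_all add: SetC_def)

lemma SetC_app_in: "m : hom SetC A B ==> x : A ==> app m x : B"
 by (auto simp: SetC_hom)

lemma SetC_eqI:
 assumes "m : hom SetC A B" "n : hom SetC A B" "!!x. x : A ==> app m x = app n x" shows "m = n"
 using assms by (auto simp: SetC_hom intro!: PiE_ext[of _ A "%_. B"])

lemma SetC_fun: "small A ==> small B ==> (!!x. x : A ==> h x : B) ==> Fn A (restrict h A) B : hom SetC A B"
 by (auto simp: SetC_hom)

lemma SetC_comp: "n $\<^bsub>SetC\<^esub> m = Fn (fn_src m) (restrict (%x. app n (app m x)) (fn_src m)) (fn_tgt n)"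
 by (simp add: SetC_def)

lemma SetC_comp_app: "m : hom SetC A B ==> x : A ==> app (n $\<^bsub>SetC\<^esub> m) x = app n (app m x)"
 by (auto simp: SetC_hom SetC_comp)

lemma SetC_comp_hom: "m : hom SetC A B ==> n : hom SetC B B' ==> n $\<^bsub>SetC\<^esub> m : hom SetC A B'"
 by (auto simp: SetC_hom SetC_comp)

lemma SetC_idn: "Idn SetC A = Fn A (restrict (%x. x) A) A"
 by (simp add: SetC_def)

lemma SetC_idn_app [simp]: "x : A ==> app (Idn SetC A) x = x"
 by (simp add: SetC_idn)

lemma SetC_idn_hom: "small A ==> Idn SetC A : hom SetC A A"
 by (simp add: SetC_idn SetC_fun)

lemma SetC_category: "category (SetC :: ('u::universe set, 'u fn) cat)"
proof
 fix f :: "'u fn" assume "f : Arr SetC"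
 then have f: "f : hom SetC (fn_src f) (fn_tgt f)" by (simp add: SetC_Arr)
 then have s: "small (fn_src f)" "small (fn_tgt f)" by (auto simp: SetC_hom)
 then show "Src SetC f : Obj SetC" "Tgt SetC f : Obj SetC" by simp_all
 show "f $\<^bsub>SetC\<^esub> Idn SetC (Src SetC f) = f"
  unfolding SetC_sel by (rule SetC_eqI[OF SetC_comp_hom[OF SetC_idn_hom] f]) (simp_all add: s f SetC_comp_app[OF SetC_idn_hom])
 show "Idn SetC (Tgt SetC f) $\<^bsub>SetC\<^esub> f = f"
  unfolding SetC_sel by (rule SetC_eqI[OF SetC_comp_hom[OF f SetC_idn_hom] f]) (simp_all add: s SetC_comp_app[OF f] SetC_app_in[OF f])
next
 fix x :: "'u set" assume "x : Obj SetC" then show "Idn SetC x : hom SetC x x" by (simp add: SetC_idn_hom)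
next
 fix f g :: "'u fn" and x y z assume "f : hom SetC x y" "g : hom SetC y z"
 then show "g $\<^bsub>SetC\<^esub> f : hom SetC x z" by (rule SetC_comp_hom)
next
 fix f g h :: "'u fn" and w x y z assume h: "f : hom SetC w x" "g : hom SetC x y" "h : hom SetC y z"
 show "(h $\<^bsub>SetC\<^esub> g) $\<^bsub>SetC\<^esub> f = h $\<^bsub>SetC\<^esub> (g $\<^bsub>SetC\<^esub> f)"
  by (rule SetC_eqI[OF SetC_comp_hom[OF h(1) SetC_comp_hom[OF h(2,3)]] SetC_comp_hom[OF SetC_comp_hom[OF h(1,2)] h(3)]])
   (simp add: SetC_comp_app[OF h(1)] SetC_comp_app[OF h(2)] SetC_comp_app[OF SetC_comp_hom[OF h(1,2)]] SetC_app_in[OF h(1)])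
qed


subsection \<open>Functor categories and equivalences\<close>

lemma op_cat_sel [simp]: "Obj (op_cat C) = Obj C" "Arr (op_cat C) = Arr C" "Src (op_cat C) = Tgt C" "Tgt (op_cat C) = Src C"
 "Idn (op_cat C) = Idn C" "g $\<^bsub>op_cat C\<^esub> f = f $\<^bsub>C\<^esub> g"
 by (simp_all add: op_cat_def)

lemma op_category: "category C ==> category (op_cat C)"
proof -
 assume "category C"
 then interpret category C .
 show ?thesis by standard (auto simp: hom_def)
qed

lemma functorD:
 assumes "is_functor A B F"
 shows "x : Obj A ==> fOb F x : Obj B" "x : Obj A ==> fAr F (Idn A x) = Idn B (fOb F x)"
  "f : Arr A ==> fAr F f : Arr B" "f : Arr A ==> Src B (fAr F f) = fOb F (Src A f)"
  "f : Arr A ==> Tgt B (fAr F f) = fOb F (Tgt A f)"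
  "f : Arr A ==> g : Arr A ==> Tgt A f = Src A g ==> fAr F (g $\<^bsub>A\<^esub> f) = fAr F g $\<^bsub>B\<^esub> fAr F f"
 using assms by (auto simp: is_functor_def hom_def)

lemma functor_cat_category:
 assumes "category A" "category B"
 shows "category (functor_cat A B)"
proof -
 interpret A: category A by fact
 interpret B: category B by fact
 have F: "!!F x. is_functor A B F ==> x : Obj A ==> fOb F x : Obj B" by (simp add: is_functor_def)
 have h: "!!F f. is_functor A B F ==> f : Arr A ==> fAr F f : Arr B & Src B (fAr F f) = fOb F (Src A f) & Tgt B (fAr F f) = fOb F (Tgt A f)"
  by (simp add: is_functor_def hom_def)
 have n: "!!F G \<alpha> x. is_nat A B F G \<alpha> ==> x : Obj A ==> \<alpha> x : Arr B & Src B (\<alpha> x) = fOb F x & Tgt B (\<alpha> x) = fOb G x"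
  by (simp add: is_nat_def hom_def)
 have nn: "!!F G \<alpha> f. is_nat A B F G \<alpha> ==> f : Arr A ==> \<alpha> (Tgt A f) $\<^bsub>B\<^esub> fAr F f = fAr G f $\<^bsub>B\<^esub> \<alpha> (Src A f)"
  by (simp add: is_nat_def)
 have idn: "is_nat A B F F (restrict (%x. Idn B (fOb F x)) (Obj A))" if "is_functor A B F" for F
  using that h[OF that] unfolding is_nat_def by (auto simp: F hom_def)
 have cmp: "is_nat A B F H (restrict (%x. \<beta> x $\<^bsub>B\<^esub> \<alpha> x) (Obj A))"
  if "is_functor A B F" "is_functor A B G" "is_functor A B H" "is_nat A B F G \<alpha>" "is_nat A B G H \<beta>" for F G H \<alpha> \<beta>
  unfolding is_nat_def
 proof (intro conjI ballI)
  fix x assume "x : Obj A"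
  then show "restrict (%x. \<beta> x $\<^bsub>B\<^esub> \<alpha> x) (Obj A) x : hom B (fOb F x) (fOb H x)"
   using n[OF that(4)] n[OF that(5)] by (simp add: hom_def)
 next
  fix f assume f: "f : Arr A"
  have "(\<beta> (Tgt A f) $\<^bsub>B\<^esub> \<alpha> (Tgt A f)) $\<^bsub>B\<^esub> fAr F f = \<beta> (Tgt A f) $\<^bsub>B\<^esub> (fAr G f $\<^bsub>B\<^esub> \<alpha> (Src A f))"
   using n[OF that(4)] n[OF that(5)] h[OF that(1) f] f by (simp add: nn[OF that(4) f])
  also have "\<dots> = (\<beta> (Tgt A f) $\<^bsub>B\<^esub> fAr G f) $\<^bsub>B\<^esub> \<alpha> (Src A f)"
   using n[OF that(4)] n[OF that(5)] h[OF that(2) f] f by simp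
  also have "\<dots> = fAr H f $\<^bsub>B\<^esub> (\<beta> (Src A f) $\<^bsub>B\<^esub> \<alpha> (Src A f))"
   unfolding nn[OF that(5) f] using n[OF that(4)] n[OF that(5)] h[OF that(3) f] f by simp
  finally show "restrict (%x. \<beta> x $\<^bsub>B\<^esub> \<alpha> x) (Obj A) (Tgt A f) $\<^bsub>B\<^esub> fAr F f =
    fAr H f $\<^bsub>B\<^esub> restrict (%x. \<beta> x $\<^bsub>B\<^esub> \<alpha> x) (Obj A) (Src A f)" using f by simp
 qed
 let ?F = "functor_cat A B"
 have arr: "t : hom ?F F G \<longleftrightarrow> is_functor A B F & is_functor A B G & (EX \<alpha>. t = NT F \<alpha> G & is_nat A B F G \<alpha> & \<alpha> : extensional (Obj A))" for t F G
  by (auto simp: functor_cat_def hom_def)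
 have arr': "t : Arr ?F \<longleftrightarrow> t : hom ?F (nt_src t) (nt_tgt t)" for t
  by (auto simp: functor_cat_def hom_def)
 have sel: "Src ?F = nt_src" "Tgt ?F = nt_tgt" by (simp_all add: functor_cat_def)
 show ?thesis
 proof
  fix t assume "t : Arr ?F"
  then have t: "t : hom ?F (nt_src t) (nt_tgt t)" by (simp add: arr')
  then show "Src ?F t : Obj ?F" "Tgt ?F t : Obj ?F" unfolding sel by (simp_all add: arr) (simp_all add: functor_cat_def)
  from t obtain F \<alpha> G where a: "t = NT F \<alpha> G" "is_functor A B F" "is_functor A B G" "is_nat A B F G \<alpha>" "\<alpha> : extensional (Obj A)"
   unfolding arr by (metis ntrans.sel(1,3))
  show "t $\<^bsub>?F\<^esub> Idn ?F (Src ?F t) = t" "Idn ?F (Tgt ?F t) $\<^bsub>?F\<^esub> t = t"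
   using a n[OF a(4)] by (auto simp: functor_cat_def restrict_def extensional_def fun_eq_iff)
 next
  fix F assume "F : Obj ?F"
  then have "is_functor A B F" by (simp add: functor_cat_def)
  then show "Idn ?F F : hom ?F F F" unfolding arr using idn[of F] by (auto simp: functor_cat_def)
 next
  fix s t F G H assume "s : hom ?F F G" "t : hom ?F G H"
  then obtain \<alpha> \<beta> where a: "s = NT F \<alpha> G" "t = NT G \<beta> H" "is_functor A B F" "is_functor A B G" "is_functor A B H"
   "is_nat A B F G \<alpha>" "is_nat A B G H \<beta>" unfolding arr by auto
  show "t $\<^bsub>?F\<^esub> s : hom ?F F H" unfolding arr using cmp[OF a(3-7)] a by (auto simp: functor_cat_def)
 next
  fix s t r F G H L assume "s : hom ?F F G" "t : hom ?F G H" "r : hom ?F H L"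
  then obtain \<alpha> \<beta> \<gamma> where a: "s = NT F \<alpha> G" "t = NT G \<beta> H" "r = NT H \<gamma> L" "is_nat A B F G \<alpha>" "is_nat A B G H \<beta>" "is_nat A B H L \<gamma>"
   unfolding arr by auto
  show "(r $\<^bsub>?F\<^esub> t) $\<^bsub>?F\<^esub> s = r $\<^bsub>?F\<^esub> (t $\<^bsub>?F\<^esub> s)"
   using n[OF a(4)] n[OF a(5)] n[OF a(6)] by (auto simp: functor_cat_def a(1-3) restrict_def fun_eq_iff)
 qed
qed

lemma full_subcat_category:
 assumes "category C" shows "category (full_subcat C S)"
proof -
 interpret category C by fact
 show ?thesis by standard (auto simp: full_subcat_def hom_def)
qed

text \<open>
  Only the consequences of an equivalence for hom-sets and for objects up to isomorphism are needed
  to carry sections over to the objects of a topos.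
\<close>

lemma equivalent_full_faithful:
 assumes E: "category E" and S: "category S" and eq: "equivalent E S"
 obtains \<Phi> where "is_functor E S \<Phi>"
  "!!x y m n. m : hom E x y ==> n : hom E x y ==> fAr \<Phi> m = fAr \<Phi> n ==> m = n"
  "!!x y t. x : Obj E ==> y : Obj E ==> t : hom S (fOb \<Phi> x) (fOb \<Phi> y) ==> EX m : hom E x y. fAr \<Phi> m = t"
  "!!X. X : Obj S ==> EX e : Obj E. EX i. is_iso S (fOb \<Phi> e) X i"
proof -
 interpret E: category E by fact
 interpret S: category S by fact
 obtain F G \<eta> \<epsilon> where F: "is_functor E S F" and G: "is_functor S E G"
  and \<eta>: "is_nat_iso E E id_func (fcomp G F) \<eta>" and \<epsilon>: "is_nat_iso S S (fcomp F G) id_func \<epsilon>"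
  using eq unfolding equivalent_def by (elim exE conjE)
 note Fd = functorD[OF F] and Gd = functorD[OF G]
 have \<eta>iso: "is_iso E x (fOb G (fOb F x)) (\<eta> x)" if "x : Obj E" for x
  using \<eta> that by (simp add: is_nat_iso_def id_func_def fcomp_def)
 have \<eta>nat: "\<eta> (Tgt E m) $\<^bsub>E\<^esub> m = fAr G (fAr F m) $\<^bsub>E\<^esub> \<eta> (Src E m)" if "m : Arr E" for m
  using \<eta> that by (simp add: is_nat_iso_def is_nat_def id_func_def fcomp_def)
 have \<epsilon>iso: "is_iso S (fOb F (fOb G X)) X (\<epsilon> X)" if "X : Obj S" for X
  using \<epsilon> that by (simp add: is_nat_iso_def id_func_def fcomp_def)
 have \<epsilon>nat: "\<epsilon> (Tgt S m) $\<^bsub>S\<^esub> fAr F (fAr G m) = m $\<^bsub>S\<^esub> \<epsilon> (Src S m)" if "m : Arr S" for m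
  using \<epsilon> that by (simp add: is_nat_iso_def is_nat_def id_func_def fcomp_def)
 have Ffaith: "m = n" if h: "m : hom E x y" "n : hom E x y" "fAr F m = fAr F n" for x y m n
 proof -
  have a: "m : Arr E" "Src E m = x" "Tgt E m = y" "n : Arr E" "Src E n = x" "Tgt E n = y" using h by (auto simp: hom_def)
  then obtain k where k: "\<eta> y : Arr E" "Src E (\<eta> y) = y" "Tgt E (\<eta> y) = fOb G (fOb F y)"
   "k : Arr E" "Src E k = fOb G (fOb F y)" "Tgt E k = y" "k $\<^bsub>E\<^esub> \<eta> y = Idn E y"
   using \<eta>iso[of y] by (auto simp: is_iso_def hom_def)
  have "\<eta> y $\<^bsub>E\<^esub> m = \<eta> y $\<^bsub>E\<^esub> n" using \<eta>nat[of m] \<eta>nat[of n] a h(3) by simp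
  then have "k $\<^bsub>E\<^esub> (\<eta> y $\<^bsub>E\<^esub> m) = k $\<^bsub>E\<^esub> (\<eta> y $\<^bsub>E\<^esub> n)" by simp
  then show ?thesis using E.assoc_eq[OF k(7), of m] E.assoc_eq[OF k(7), of n] k a by simp
 qed
 have Gfaith: "m = n" if h: "m : hom S x y" "n : hom S x y" "fAr G m = fAr G n" for x y m n
 proof -
  have a: "m : Arr S" "Src S m = x" "Tgt S m = y" "n : Arr S" "Src S n = x" "Tgt S n = y" using h by (auto simp: hom_def)
  then obtain k where k: "\<epsilon> x : Arr S" "Tgt S (\<epsilon> x) = x" "Src S (\<epsilon> x) = fOb F (fOb G x)"
   "k : Arr S" "Tgt S k = fOb F (fOb G x)" "Src S k = x" "\<epsilon> x $\<^bsub>S\<^esub> k = Idn S x"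
   using \<epsilon>iso[of x] by (auto simp: is_iso_def hom_def)
  have "m $\<^bsub>S\<^esub> \<epsilon> x = n $\<^bsub>S\<^esub> \<epsilon> x" using \<epsilon>nat[of m] \<epsilon>nat[of n] a h(3) by simp
  then have "(m $\<^bsub>S\<^esub> \<epsilon> x) $\<^bsub>S\<^esub> k = (n $\<^bsub>S\<^esub> \<epsilon> x) $\<^bsub>S\<^esub> k" by simp
  then show ?thesis using k a by simp
 qed
 have Ffull: "EX m : hom E x y. fAr F m = t" if h: "x : Obj E" "y : Obj E" "t : hom S (fOb F x) (fOb F y)" for x y t
 proof -
  have a: "t : Arr S" "Src S t = fOb F x" "Tgt S t = fOb F y" using h by (auto simp: hom_def)
  obtain k where k: "\<eta> y : Arr E" "Src E (\<eta> y) = y" "Tgt E (\<eta> y) = fOb G (fOb F y)"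
   "k : Arr E" "Src E k = fOb G (fOb F y)" "Tgt E k = y" "\<eta> y $\<^bsub>E\<^esub> k = Idn E (fOb G (fOb F y))"
   using \<eta>iso[of y] h by (auto simp: is_iso_def hom_def)
  obtain l where l: "\<eta> x : Arr E" "Src E (\<eta> x) = x" "Tgt E (\<eta> x) = fOb G (fOb F x)"
   "l : Arr E" "Src E l = fOb G (fOb F x)" "Tgt E l = x" "\<eta> x $\<^bsub>E\<^esub> l = Idn E (fOb G (fOb F x))"
   using \<eta>iso[of x] h by (auto simp: is_iso_def hom_def)
  have g: "fAr G t : Arr E" "Src E (fAr G t) = fOb G (fOb F x)" "Tgt E (fAr G t) = fOb G (fOb F y)"
   using Gd a by auto
  let ?m = "k $\<^bsub>E\<^esub> (fAr G t $\<^bsub>E\<^esub> \<eta> x)"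
  have m: "?m : Arr E" "Src E ?m = x" "Tgt E ?m = y" using k l g by auto
  have "\<eta> y $\<^bsub>E\<^esub> ?m = fAr G t $\<^bsub>E\<^esub> \<eta> x" using E.assoc_eq[OF k(7)] k l g by simp
  then have "fAr G (fAr F ?m) $\<^bsub>E\<^esub> \<eta> x = fAr G t $\<^bsub>E\<^esub> \<eta> x" using \<eta>nat[OF m(1)] m by simp
  then have "(fAr G (fAr F ?m) $\<^bsub>E\<^esub> \<eta> x) $\<^bsub>E\<^esub> l = (fAr G t $\<^bsub>E\<^esub> \<eta> x) $\<^bsub>E\<^esub> l" by simp
  moreover have gm: "fAr G (fAr F ?m) : Arr E" "Src E (fAr G (fAr F ?m)) = fOb G (fOb F x)"
   using Gd(3-5)[of "fAr F ?m"] Fd(3-5)[OF m(1)] m by simp_all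
  ultimately have "fAr G (fAr F ?m) = fAr G t"
   using E.assoc[OF l(4,1) gm(1)] E.assoc[OF l(4,1) g(1)] l g by simp
  then have "fAr F ?m = t" by (intro Gfaith[of _ "fOb F x" "fOb F y"]) (use h Fd(3-5)[OF m(1)] m in "simp_all add: hom_def")
  then show ?thesis using m by (intro bexI[of _ ?m]) (simp_all add: hom_def)
 qed
 show thesis
 proof (rule that[OF F Ffaith Ffull])
  fix X assume "X : Obj S"
  then show "EX e : Obj E. EX i. is_iso S (fOb F e) X i" using \<epsilon>iso Gd(1) by blast
 qed
qed


subsection \<open>Elements of the sheaf of an object\<close>

lemma sheaf_of_functor:
 assumes "site D J" "is_sheaf D J P"
 shows "site.sheaf_on D J (fOb P) (%f. app (fAr P f))" "c : Obj D ==> small (fOb P c)"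
  "f : Arr D ==> fAr P f : hom SetC (fOb P (Tgt D f)) (fOb P (Src D f))"
proof -
 interpret site D J by fact
 have P: "is_functor (op_cat D) SetC P" using assms by (simp add: is_sheaf_def)
 have hm: "fAr P f : hom SetC (fOb P (Tgt D f)) (fOb P (Src D f))" if "f : Arr D" for f
  using P that by (simp add: is_functor_def)
 have idn: "fAr P (Idn D c) = Idn SetC (fOb P c)" if "c : Obj D" for c
  using P that by (simp add: is_functor_def)
 have cmp: "fAr P (g $\<^bsub>D\<^esub> f) = fAr P f $\<^bsub>SetC\<^esub> fAr P g" if "f : Arr D" "g : Arr D" "Tgt D f = Src D g" for f g
  using P that by (simp add: is_functor_def)
 have "psh (fOb P) (%f. app (fAr P f))"
  unfolding psh_def using SetC_app_in[OF hm] by (auto simp: idn cmp SetC_comp_app[OF hm])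
 then show "sheaf_on (fOb P) (%f. app (fAr P f))" using assms(2) by (simp add: is_sheaf_def sheaf_on_def)
 show "c : Obj D ==> small (fOb P c)" using P by (simp add: is_functor_def)
 show "f : Arr D ==> fAr P f : hom SetC (fOb P (Tgt D f)) (fOb P (Src D f))" by (rule hm)
qed

lemma functor_of_sheaf:
 fixes X :: "'u::universe => 'u set"
 assumes "site D J" "site.sheaf_on D J X r" "!!c. c : Obj D ==> small (X c)"
 shows "is_sheaf D J \<lparr>fOb = X, fAr = (%f. Fn (X (Tgt D f)) (restrict (r f) (X (Tgt D f))) (X (Src D f)))\<rparr>"
  (is "is_sheaf D J ?P")
proof -
 interpret site D J by fact
 have p: "psh X r" using assms(2) by (simp add: sheaf_on_def)
 have hm: "fAr ?P f : hom SetC (X (Tgt D f)) (X (Src D f))" if "f : Arr D" for f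
  using that psh_in[OF p] assms(3) by (auto intro: SetC_fun)
 have r: "app (fAr ?P f) x = r f x" if "x : X (Tgt D f)" for f x using that by simp
 have fn: "is_functor (op_cat D) SetC ?P"
  unfolding is_functor_def
 proof (intro conjI ballI impI)
  fix c assume c: "c : Obj (op_cat D)"
  then show "fOb ?P c : Obj SetC" using assms(3) by simp
  show "fAr ?P (Idn (op_cat D) c) = Idn SetC (fOb ?P c)"
   using c p assms(3)[of c] hm[of "Idn D c"] by (intro SetC_eqI[of _ "X c" "X c"]) (auto simp: SetC_idn_hom psh_def)
 next
  fix f assume "f : Arr (op_cat D)"
  then show "fAr ?P f : hom SetC (fOb ?P (Src (op_cat D) f)) (fOb ?P (Tgt (op_cat D) f))" using hm by simp
 next
  fix f g assume "f : Arr (op_cat D)" "g : Arr (op_cat D)" "Tgt (op_cat D) f = Src (op_cat D) g"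
  then have fg: "f : Arr D" "g : Arr D" "Tgt D g = Src D f" by auto
  note h = hm[OF fg(1)] and h' = hm[OF fg(2)]
  have c: "fAr ?P g $\<^bsub>SetC\<^esub> fAr ?P f : hom SetC (X (Tgt D f)) (X (Src D g))"
   using SetC_comp_hom[OF h, of "fAr ?P g"] h' fg by simp
  have "fAr ?P (f $\<^bsub>D\<^esub> g) = fAr ?P g $\<^bsub>SetC\<^esub> fAr ?P f"
  proof (rule SetC_eqI[OF _ c])
   show "fAr ?P (f $\<^bsub>D\<^esub> g) : hom SetC (X (Tgt D f)) (X (Src D g))" using hm[of "f $\<^bsub>D\<^esub> g"] fg by simp
   fix x assume x: "x : X (Tgt D f)"
   have "r f x : X (Tgt D g)" using psh_in[OF p] x fg by simp
   then show "app (fAr ?P (f $\<^bsub>D\<^esub> g)) x = app (fAr ?P g $\<^bsub>SetC\<^esub> fAr ?P f) x"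
    using SetC_comp_app[OF h x, of "fAr ?P g"] r[OF x] r[of "r f x" g] r[of x "f $\<^bsub>D\<^esub> g"] x fg p by (simp add: psh_def)
  qed
  then show "fAr ?P (g $\<^bsub>op_cat D\<^esub> f) = fAr ?P g $\<^bsub>SetC\<^esub> fAr ?P f" by simp
 qed
 have am: "EX! y. y : fOb ?P c & (ALL f : S. app (fAr ?P f) y = x f)"
  if c: "c : Obj D" "S : J c" and x: "ALL f : S. x f : fOb ?P (Src D f)"
   "ALL f : S. ALL g : Arr D. Tgt D g = Src D f --> app (fAr ?P g) (x f) = x (f $\<^bsub>D\<^esub> g)" for c S x
 proof -
  have "EX! y. y : X c & (ALL f : S. r f y = x f)"
   by (rule sheaf_amalgam[OF assms(2) c]) (use x in auto)
  moreover have "y : fOb ?P c & (ALL f : S. app (fAr ?P f) y = x f) \<longleftrightarrow> y : X c & (ALL f : S. r f y = x f)" for y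
   using J_arr[OF c] by auto
  ultimately show ?thesis by simp
 qed
 show ?thesis
  unfolding is_sheaf_def
 proof (intro conjI ballI allI impI fn; elim conjE)
  fix c S x assume "c : Obj D" "S : J c" "ALL f : S. x f : fOb ?P (Src D f)"
   "ALL f : S. ALL g : Arr D. Tgt D g = Src D f --> app (fAr ?P g) (x f) = x (f $\<^bsub>D\<^esub> g)"
  then show "EX! y. y : fOb ?P c & (ALL f : S. app (fAr ?P f) y = x f)" by (rule am)
 qed
qed

text \<open>
  The sections of an object are those of the sheaf that corresponds to it under an equivalence with
  the sheaves on a small site.
\<close>

theorem topos_sheaf_model:
 assumes "grothendieck_topos TYPE('u::universe) E"
 obtains D :: "('u::universe, 'u) cat" and J el rs ap where "sheaf_model E D J el rs ap"
proof -
 obtain D :: "('u, 'u) cat" and J where D: "small_category D" "grothendieck_topology D J" and eq: "equivalent E (Sh D J)"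
  and E: "category E" using assms by (auto simp: grothendieck_topos_def)
 interpret E: category E by fact
 interpret site D J using D by (auto simp: site_def site_axioms_def small_category_def)
 have site: "site D J" by unfold_locales
 have Sc: "category (Sh D J)"
  unfolding Sh_def by (intro full_subcat_category functor_cat_category op_category D.category_axioms SetC_category)
 interpret S: category "Sh D J" by (rule Sc)
 obtain \<Phi> where \<Phi>: "is_functor E (Sh D J) \<Phi>"
  and faith: "!!x y m n. m : hom E x y ==> n : hom E x y ==> fAr \<Phi> m = fAr \<Phi> n ==> m = n"
  and full: "!!x y t. x : Obj E ==> y : Obj E ==> t : hom (Sh D J) (fOb \<Phi> x) (fOb \<Phi> y) ==> EX m : hom E x y. fAr \<Phi> m = t"
  and eso: "!!X. X : Obj (Sh D J) ==> EX e : Obj E. EX i. is_iso (Sh D J) (fOb \<Phi> e) X i"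
  using equivalent_full_faithful[OF E Sc eq] by blast
 note \<Phi>d = functorD[OF \<Phi>]
 have sf: "is_functor (op_cat D) SetC P" if "is_sheaf D J P" for P using that by (simp add: is_sheaf_def)
 have obj: "P : Obj (Sh D J) \<longleftrightarrow> is_sheaf D J P" for P
  by (auto simp: Sh_def full_subcat_def functor_cat_def is_sheaf_def)
 have homS: "t : hom (Sh D J) P Q \<longleftrightarrow> is_sheaf D J P & is_sheaf D J Q &
   (EX \<alpha>. t = NT P \<alpha> Q & is_nat (op_cat D) SetC P Q \<alpha> & \<alpha> : extensional (Obj D))" for t P Q
  by (auto simp: Sh_def full_subcat_def functor_cat_def hom_def dest: sf)
 have at: "nt_at t c : hom SetC (fOb P c) (fOb Q c)" if "t : hom (Sh D J) P Q" "c : Obj D" for t P Q c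
  using that unfolding homS by (auto simp: is_nat_def)
 have at_nat: "nt_at t (Src D f) $\<^bsub>SetC\<^esub> fAr P f = fAr Q f $\<^bsub>SetC\<^esub> nt_at t (Tgt D f)"
  if "t : hom (Sh D J) P Q" "f : Arr D" for t P Q f
  using that unfolding homS by (auto simp: is_nat_def)
 have at_eqI: "s = t" if st: "s : hom (Sh D J) P Q" "t : hom (Sh D J) P Q"
  "!!c x. c : Obj D ==> x : fOb P c ==> app (nt_at s c) x = app (nt_at t c) x" for s t P Q
 proof -
  obtain \<alpha> \<beta> where a: "s = NT P \<alpha> Q" "t = NT P \<beta> Q" "\<alpha> : extensional (Obj D)" "\<beta> : extensional (Obj D)"
   using st(1,2) unfolding homS by auto
  have "\<alpha> = \<beta>"
  proof (rule extensionalityI[OF a(3,4)])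
   fix c assume c: "c : Obj D"
   show "\<alpha> c = \<beta> c"
    by (rule SetC_eqI[of _ "fOb P c" "fOb Q c"]) (use at[OF st(1) c] at[OF st(2) c] st(3)[OF c] a in auto)
  qed
  then show ?thesis using a by simp
 qed
 have at_comp: "app (nt_at (t $\<^bsub>Sh D J\<^esub> s) c) x = app (nt_at t c) (app (nt_at s c) x)"
  if "s : hom (Sh D J) P Q" "c : Obj D" "x : fOb P c" for s t P Q c x
  using that SetC_comp_app[OF at[OF that(1,2)] that(3), of "nt_at t c"] by (simp add: Sh_def full_subcat_def functor_cat_def)
 have at_idn: "app (nt_at (Idn (Sh D J) P) c) x = x" if "c : Obj D" "x : fOb P c" for P c x
  using that by (simp add: Sh_def full_subcat_def functor_cat_def)
 \<comment> \<open>The equivalence \<open>\<Phi>\<close> to the category of sheaves supplies sections, restrictions and actions.\<close>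
 define el where "el e = fOb (fOb \<Phi> e)" for e
 define rs where "rs e f = app (fAr (fOb \<Phi> e) f)" for e f
 define ap where "ap m c = app (nt_at (fAr \<Phi> m) c)" for m c
 have sh: "is_sheaf D J (fOb \<Phi> e)" if "e : Obj E" for e using \<Phi>d(1)[OF that] by (simp add: obj)
 have \<Phi>h: "fAr \<Phi> m : hom (Sh D J) (fOb \<Phi> (Src E m)) (fOb \<Phi> (Tgt E m))" if "m : Arr E" for m
  using \<Phi>d(3-5)[OF that] by (simp add: hom_def)
 have rsh: "fAr (fOb \<Phi> e) f : hom SetC (el e (Tgt D f)) (el e (Src D f))" if "e : Obj E" "f : Arr D" for e f
  unfolding el_def by (rule sheaf_of_functor(3)[OF site sh[OF that(1)] that(2)])
 have "sheaf_model E D J el rs ap"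
 proof
  fix e assume e: "e : Obj E"
  show "sheaf_on (el e) (rs e)"
   using sheaf_of_functor(1)[OF site sh[OF e]] by (simp add: el_def rs_def[abs_def])
  fix c assume c: "c : Obj D"
  show "small (el e c)" using sheaf_of_functor(2)[OF site sh[OF e] c] by (simp add: el_def)
  fix x assume x: "x : el e c"
  show "ap (Idn E e) c x = x" using \<Phi>d(2)[OF e] at_idn[OF c] x by (simp add: ap_def el_def)
 next
  fix m c x assume h: "m : Arr E" "c : Obj D" "x : el (Src E m) c"
  show "ap m c x : el (Tgt E m) c" using SetC_app_in[OF at[OF \<Phi>h[OF h(1)] h(2)]] h(3) by (simp add: ap_def el_def)
 next
  fix m f x assume h: "m : Arr E" "f : Arr D" "x : el (Src E m) (Tgt D f)"
  have "app (nt_at (fAr \<Phi> m) (Src D f) $\<^bsub>SetC\<^esub> fAr (fOb \<Phi> (Src E m)) f) x =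
    app (fAr (fOb \<Phi> (Tgt E m)) f $\<^bsub>SetC\<^esub> nt_at (fAr \<Phi> m) (Tgt D f)) x"
   using at_nat[OF \<Phi>h[OF h(1)] h(2)] by simp
  then show "ap m (Src D f) (rs (Src E m) f x) = rs (Tgt E m) f (ap m (Tgt D f) x)"
   using SetC_comp_app[OF rsh[OF _ h(2)] h(3)] SetC_comp_app[OF at[OF \<Phi>h[OF h(1)]], of "Tgt D f" x] h
   by (simp add: ap_def rs_def el_def)
 next
  fix m n c x assume h: "m : Arr E" "n : Arr E" "Tgt E m = Src E n" "c : Obj D" "x : el (Src E m) c"
  show "ap (n $\<^bsub>E\<^esub> m) c x = ap n c (ap m c x)"
   using \<Phi>d(6)[OF h(1-3)] at_comp[OF \<Phi>h[OF h(1)] h(4)] h(5) by (simp add: ap_def el_def)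
 next
  fix m n e e' assume h: "m : hom E e e'" "n : hom E e e'" and eq: "!!c x. c : Obj D ==> x : el e c ==> ap m c x = ap n c x"
  have "fAr \<Phi> m : hom (Sh D J) (fOb \<Phi> e) (fOb \<Phi> e')" "fAr \<Phi> n : hom (Sh D J) (fOb \<Phi> e) (fOb \<Phi> e')"
   using \<Phi>h[of m] \<Phi>h[of n] h by (auto simp: hom_def)
  from at_eqI[OF this] have "fAr \<Phi> m = fAr \<Phi> n" using eq by (simp add: ap_def el_def)
  then show "m = n" using faith[OF h] by blast
 next
  fix e e' h assume e: "e : Obj E" "e' : Obj E" and h: "!!c x. c : Obj D ==> x : el e c ==> h c x : el e' c"
   and hn: "!!f x. f : Arr D ==> x : el e (Tgt D f) ==> h (Src D f) (rs e f x) = rs e' f (h (Tgt D f) x)"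
  have sm: "small (el e c)" "small (el e' c)" if "c : Obj D" for c
   using sheaf_of_functor(2)[OF site sh that] e by (auto simp: el_def)
  let ?a = "restrict (%c. Fn (el e c) (restrict (h c) (el e c)) (el e' c)) (Obj D)"
  have ah: "?a c : hom SetC (el e c) (el e' c)" if "c : Obj D" for c
   using SetC_fun[OF sm[OF that], of "h c"] h that by simp
  have "is_nat (op_cat D) SetC (fOb \<Phi> e) (fOb \<Phi> e') ?a"
   unfolding is_nat_def
  proof (intro conjI ballI)
   fix c assume "c : Obj (op_cat D)" then show "?a c : hom SetC (fOb (fOb \<Phi> e) c) (fOb (fOb \<Phi> e') c)"
    using ah[of c] by (simp add: el_def)
  next
   fix f assume "f : Arr (op_cat D)"
   then have f: "f : Arr D" by simp
   then have o: "Src D f : Obj D" "Tgt D f : Obj D" by auto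
   have "?a (Src D f) $\<^bsub>SetC\<^esub> fAr (fOb \<Phi> e) f = fAr (fOb \<Phi> e') f $\<^bsub>SetC\<^esub> ?a (Tgt D f)"
   proof (rule SetC_eqI[OF SetC_comp_hom[OF rsh[OF e(1) f] ah[OF o(1)]] SetC_comp_hom[OF ah[OF o(2)] rsh[OF e(2) f]]])
    fix x assume x: "x : el e (Tgt D f)"
    have "rs e f x : el e (Src D f)" using SetC_app_in[OF rsh[OF e(1) f] x] by (simp add: rs_def)
    then show "app (?a (Src D f) $\<^bsub>SetC\<^esub> fAr (fOb \<Phi> e) f) x = app (fAr (fOb \<Phi> e') f $\<^bsub>SetC\<^esub> ?a (Tgt D f)) x"
     using SetC_comp_app[OF rsh[OF e(1) f] x, of "?a (Src D f)"] SetC_comp_app[OF ah[OF o(2)] x, of "fAr (fOb \<Phi> e') f"] hn[OF f x] x o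
     by (simp add: rs_def)
   qed
   then show "?a (Tgt (op_cat D) f) $\<^bsub>SetC\<^esub> fAr (fOb \<Phi> e) f = fAr (fOb \<Phi> e') f $\<^bsub>SetC\<^esub> ?a (Src (op_cat D) f)" by simp
  qed
  then have "NT (fOb \<Phi> e) ?a (fOb \<Phi> e') : hom (Sh D J) (fOb \<Phi> e) (fOb \<Phi> e')"
   unfolding homS using sh e by auto
  then obtain m where m: "m : hom E e e'" "fAr \<Phi> m = NT (fOb \<Phi> e) ?a (fOb \<Phi> e')" using full[OF e] by blast
  then show "EX m : hom E e e'. ALL c : Obj D. ALL x : el e c. ap m c x = h c x"
   by (intro bexI[of _ m]) (auto simp: ap_def)
 next
  fix X :: "'u => 'u set" and r assume X: "sheaf_on X r" "!!c. c : Obj D ==> small (X c)"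
  let ?P = "\<lparr>fOb = X, fAr = (%f. Fn (X (Tgt D f)) (restrict (r f) (X (Tgt D f))) (X (Src D f)))\<rparr>"
  have P: "is_sheaf D J ?P" by (rule functor_of_sheaf[OF site X])
  then obtain e i where e: "e : Obj E" and i: "is_iso (Sh D J) (fOb \<Phi> e) ?P i" using eso[of ?P] by (auto simp: obj)
  then obtain j where h: "i : hom (Sh D J) (fOb \<Phi> e) ?P" "j : hom (Sh D J) ?P (fOb \<Phi> e)"
   "j $\<^bsub>Sh D J\<^esub> i = Idn (Sh D J) (fOb \<Phi> e)" "i $\<^bsub>Sh D J\<^esub> j = Idn (Sh D J) ?P"
   by (auto simp: is_iso_def)
  let ?b = "%c. app (nt_at j c)"
  have "bij_betw (?b c) (X c) (el e c)" if c: "c : Obj D" for c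
  proof (rule bij_betw_byWitness[where f' = "app (nt_at i c)"])
   show "ALL x : X c. app (nt_at i c) (?b c x) = x"
    using at_comp[OF h(2) c, of _ i] at_idn[OF c, of _ ?P] h(4) by simp
   show "ALL x : el e c. ?b c (app (nt_at i c) x) = x"
    using at_comp[OF h(1) c, of _ j] at_idn[OF c, of _ "fOb \<Phi> e"] h(3) by (simp add: el_def)
   show "?b c ` X c \<subseteq> el e c" using SetC_app_in[OF at[OF h(2) c]] by (auto simp: el_def)
   show "app (nt_at i c) ` el e c \<subseteq> X c" using SetC_app_in[OF at[OF h(1) c]] by (auto simp: el_def)
  qed
  moreover have "?b (Src D f) (r f x) = rs e f (?b (Tgt D f) x)" if f: "f : Arr D" "x : X (Tgt D f)" for f x
  proof -
   have o: "Tgt D f : Obj D" using f by simp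
   have "app (nt_at j (Src D f) $\<^bsub>SetC\<^esub> fAr ?P f) x = app (fAr (fOb \<Phi> e) f $\<^bsub>SetC\<^esub> nt_at j (Tgt D f)) x"
    using at_nat[OF h(2) f(1)] by simp
   then show ?thesis
    using SetC_comp_app[OF sheaf_of_functor(3)[OF site P f(1)], of x "nt_at j (Src D f)"]
     SetC_comp_app[OF at[OF h(2) o], of x "fAr (fOb \<Phi> e) f"] f by (simp add: rs_def)
  qed
  ultimately show "EX e : Obj E. EX b. (ALL c : Obj D. bij_betw (b c) (X c) (el e c)) &
    (ALL f : Arr D. ALL x : X (Tgt D f). b (Src D f) (r f x) = rs e f (b (Tgt D f) x))"
   using e by (intro bexI[of _ e] exI[of _ ?b]) simp_all
 qed
 then show thesis by (rule that)
qed

section \<open>Pullbacks and points\<close>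

lemma pull_spans_empty [simp]: "pull_spans E I {} \<iota>' \<pi> = {}"
 by (simp add: pull_spans_def)

text \<open>
  What is used of a Grothendieck topos and its geometric morphism to sets.
\<close>

locale topos = category E for E :: "('o, 'a) cat" (structure) +
 fixes L :: "('u::universe set, 'u fn, 'o, 'a) func" and R :: "('o, 'a, 'u set, 'u fn) func"
 assumes pullback_ex: "f : Arr E ==> g : Arr E ==> Tgt E f = Tgt E g ==> EX p q. is_pullback E f g p q"
  and gluing_ex: "glue_spans E (I :: 'u set) X K ==> small I ==> EX Q \<iota>. is_gluing E I X K Q \<iota>"
  and gluing_st: "glue_spans E (I :: 'u set) X K ==> small I ==> is_gluing E I X K Q \<iota> ==> g : hom E Y Q ==>
   (!!i. i : I ==> is_pullback E g (\<iota> i) (\<iota>' i) (\<pi> i)) ==>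
   is_gluing E I (%i. Src E (\<iota>' i)) (pull_spans E I K \<iota>' \<pi>) Y \<iota>'"
  and geometric: "geometric_morphism E SetC L R"

lemma topos_of_grothendieck:
 fixes L :: "('u::universe set, 'u fn, 'o, 'a) func" and R :: "('o, 'a, 'u set, 'u fn) func"
 assumes "grothendieck_topos TYPE('u) E" "geometric_morphism E SetC L R"
 shows "topos E L R"
proof -
 obtain D :: "('u, 'u) cat" and J el rs ap where "sheaf_model E D J el rs ap"
  using topos_sheaf_model[OF assms(1)] by blast
 then interpret sheaf_model E D J el rs ap .
 show ?thesis
 proof
  fix f g assume "f : Arr E" "g : Arr E" "Tgt E f = Tgt E g"
  then obtain p q where "is_pullback E f g p q" by (rule pullback_exists)
  then show "EX p q. is_pullback E f g p q" by (intro exI)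
 next
  fix I :: "'u set" and X K assume "glue_spans E I X K" "small I"
  then show "EX Q \<iota>. is_gluing E I X K Q \<iota>" by (intro gluing_exists) (simp_all add: small_def)
 next
  fix I :: "'u set" and X K Q \<iota> g Y \<iota>' \<pi>
  assume "glue_spans E I X K" "small I" "is_gluing E I X K Q \<iota>" "g : hom E Y Q"
   "!!i. i : I ==> is_pullback E g (\<iota> i) (\<iota>' i) (\<pi> i)"
  then show "is_gluing E I (%i. Src E (\<iota>' i)) (pull_spans E I K \<iota>' \<pi>) Y \<iota>'"
   by (intro gluing_stable) (simp_all add: small_def)
 qed (rule assms(2))
qed

context category
begin

lemma into_rules:
 assumes pb: "is_pullback C f g p q"
  and "u : arr" "v : arr" "src u = src v" "tgt u = src f" "tgt v = src g" "f $ u = g $ v"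
 shows "into C p q u v : arr" "src (into C p q u v) = src u" "tgt (into C p q u v) = src p"
  "p $ into C p q u v = u" "q $ into C p q u v = v"
proof -
 have "into C p q u v : hom C (src u) (src p) & p $ into C p q u v = u & q $ into C p q u v = v"
  unfolding into_def by (rule theI', rule pullback_univ[OF assms])
 then show "into C p q u v : arr" "src (into C p q u v) = src u" "tgt (into C p q u v) = src p"
  "p $ into C p q u v = u" "q $ into C p q u v = v" by (auto simp: hom_def)
qed

lemma into_eq:
 assumes pb: "is_pullback C f g p q" and h: "h : arr" "tgt h = src p" "p $ h = u" "q $ h = v"
 shows "into C p q u v = h"
proof -
 note a = pullback_arr[OF pb]
 have uv: "u : arr" "v : arr" "src u = src v" "src u = src h" "tgt u = src f" "tgt v = src g"
  using a(3-8) h by auto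
 have e: "f $ u = g $ v"
  unfolding h(3,4)[symmetric] using assoc_eq[OF a(9), of h] a(1-8) h(1,2) by simp
 note i = into_rules[OF pb uv(1-3,5,6) e]
 show ?thesis by (rule pullback_eq[OF pb i(1) h(1)]) (use h(2-4) uv(4) i in simp_all)
qed

end

context topos
begin

lemma pb_pullback:
 assumes "f : arr" "g : arr" "tgt f = tgt g"
 shows "is_pullback E f g (pb1 E f g) (pb2 E f g)"
proof -
 obtain p q where "is_pullback E f g (fst (p, q)) (snd (p, q))" using pullback_ex[OF assms] by auto
 then show ?thesis unfolding pb1_def pb2_def pb_def by (rule someI)
qed

lemma pb_arr [simp]:
 assumes "f : arr" "g : arr" "tgt f = tgt g"
 shows "pb1 E f g : arr" "pb2 E f g : arr" "src (pb1 E f g) = pbOb E f g" "src (pb2 E f g) = pbOb E f g"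
  "tgt (pb1 E f g) = src f" "tgt (pb2 E f g) = src g" "pbOb E f g : obj"
 using pullback_arr[OF pb_pullback[OF assms]] unfolding pbOb_def by (auto intro: src_tgt_obj)

lemma pb_sq:
 assumes "f : arr" "g : arr" "tgt f = tgt g"
 shows "f $ pb1 E f g = g $ pb2 E f g"
 using pullback_arr[OF pb_pullback[OF assms]] by blast

lemma pb_sq_comp:
 assumes "f : arr" "g : arr" "tgt f = tgt g" "k : arr" "tgt k = pbOb E f g"
 shows "f $ (pb1 E f g $ k) = g $ (pb2 E f g $ k)"
 using assoc_eq[OF pb_sq[OF assms(1-3)], of k] assms by simp

lemma pb_eqI:
 assumes "f : arr" "g : arr" "tgt f = tgt g" "h : arr" "k : arr" "src h = src k"
  "tgt h = pbOb E f g" "tgt k = pbOb E f g" "pb1 E f g $ h = pb1 E f g $ k" "pb2 E f g $ h = pb2 E f g $ k"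
 shows "h = k"
 by (rule pullback_eq[OF pb_pullback[OF assms(1-3)]]) (use assms in "simp_all")

lemma pair_arr [simp]:
 assumes "f : arr" "g : arr" "tgt f = tgt g"
  "u : arr" "v : arr" "src u = src v" "tgt u = src f" "tgt v = src g" "f $ u = g $ v"
 shows "pair E f g u v : arr" "src (pair E f g u v) = src u" "tgt (pair E f g u v) = pbOb E f g"
  "pb1 E f g $ pair E f g u v = u" "pb2 E f g $ pair E f g u v = v"
 using into_rules[OF pb_pullback[OF assms(1-3)] assms(4-9)] assms(1-3) unfolding pair_def by simp_all

lemma pair_comp [simp]:
 assumes "f : arr" "g : arr" "tgt f = tgt g"
  "u : arr" "v : arr" "src u = src v" "tgt u = src f" "tgt v = src g" "f $ u = g $ v"
  "k : arr" "tgt k = src u"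
 shows "pair E f g u v $ k = pair E f g (u $ k) (v $ k)"
  "pb1 E f g $ (pair E f g u v $ k) = u $ k" "pb2 E f g $ (pair E f g u v $ k) = v $ k"
proof -
 note p = pair_arr[OF assms(1-9)]
 show b: "pb1 E f g $ (pair E f g u v $ k) = u $ k" "pb2 E f g $ (pair E f g u v $ k) = v $ k"
  using assoc_eq[OF p(4), of k] assoc_eq[OF p(5), of k] p assms by simp_all
 show "pair E f g u v $ k = pair E f g (u $ k) (v $ k)"
  unfolding pair_def[of _ _ _ "u $ k"]
  by (rule into_eq[OF pb_pullback[OF assms(1-3)], symmetric]) (use p b assms in "simp_all del: assoc")
qed

lemma pair_eqI:
 assumes "f : arr" "g : arr" "tgt f = tgt g" "h : arr" "tgt h = pbOb E f g"
  "pb1 E f g $ h = u" "pb2 E f g $ h = v"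
 shows "h = pair E f g u v"
 unfolding pair_def by (rule into_eq[OF pb_pullback[OF assms(1-3)], symmetric]) (use assms in "simp_all")


subsection \<open>The inverse image functor on points\<close>

lemma L_functor: "is_functor SetC E L" and R_functor: "is_functor E SetC R"
 and L_lex: "preserves_finite_limits SetC E L"
 using geometric by (auto simp: geometric_morphism_def adjoint_def)

lemma L_arr [simp]:
 assumes "m : hom SetC A B" shows "fAr L m : arr" "src (fAr L m) = fOb L A" "tgt (fAr L m) = fOb L B"
 using functorD(3-5)[OF L_functor, of m] assms by (auto simp: hom_def)

lemma L_comp:
 assumes "m : hom SetC A B" "n : hom SetC B B'" shows "fAr L (n $\<^bsub>SetC\<^esub> m) = fAr L n $ fAr L m"
 using functorD(6)[OF L_functor, of m n] assms by (auto simp: hom_def)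

lemma small_unit [simp]: "small {undefined :: 'u}"
 by (rule small_singleton)

lemma pt_hom: "small S ==> s : S ==> pt s S : hom SetC {undefined} S"
 unfolding pt_def by (rule SetC_fun) (auto intro: small_singleton)

lemma pt_app [simp]: "app (pt s S) undefined = s"
 by (simp add: pt_def)

lemma comp_pt: "m : hom SetC S S' ==> s : S ==> m $\<^bsub>SetC\<^esub> pt s S = pt (app m s) S'"
proof -
 assume m: "m : hom SetC S S'" and s: "s : S"
 have S: "small S" "small S'" using m by (auto simp: SetC_hom)
 note p = pt_hom[OF S(1) s]
 show ?thesis
  by (rule SetC_eqI[OF SetC_comp_hom[OF p m] pt_hom[OF S(2) SetC_app_in[OF m s]]])
   (simp add: SetC_comp_app[OF p])
qed

lemma L_terminal: "is_terminal E (fOb L {undefined})"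
proof -
 \<comment> \<open>A terminal object is a limit of the empty diagram.\<close>
 let ?J = "\<lparr>Obj = {}, Arr = {}, Src = (%_. 0), Tgt = (%_. 0), Idn = (%_. 0), Comp = (%_ _. 0)\<rparr> :: (nat, nat) cat"
 let ?D = "\<lparr>fOb = (%_. {}), fAr = (%_. Idn SetC {})\<rparr> :: (nat, nat, 'u set, 'u fn) func"
 have "category ?J" by standard (auto simp: hom_def)
 moreover have "is_functor ?J SetC ?D" by (simp add: is_functor_def)
 moreover have "is_limit SetC ?J ?D {undefined} (%_. undefined)"
 proof -
  have "EX! h. h : hom SetC Y {undefined}" if Y: "small Y" for Y :: "'u set"
  proof (rule ex1I)
   show 1: "Fn Y (restrict (%_. undefined) Y) {undefined} : hom SetC Y {undefined}"
    by (rule SetC_fun) (use Y in auto)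
   fix h :: "'u fn" assume h: "h : hom SetC Y {undefined}"
   show "h = Fn Y (restrict (%_. undefined) Y) {undefined}"
    by (rule SetC_eqI[OF h 1]) (use SetC_app_in[OF h] in auto)
  qed
  then show ?thesis by (simp add: is_limit_def)
 qed
 ultimately have "is_limit E ?J (fcomp L ?D) (fOb L {undefined}) (%j. fAr L undefined)"
  using L_lex unfolding preserves_finite_limits_def by (auto dest!: spec[of _ ?J])
 then show ?thesis by (auto simp: is_limit_def is_terminal_def)
qed

lemma one_terminal: "is_terminal E (one E)"
 unfolding one_def by (rule someI[of "is_terminal E", OF L_terminal])

lemma bang_arr [simp]:
 assumes "x : obj" shows "bang E x : arr" "src (bang E x) = x" "tgt (bang E x) = one E"
proof -
 have "EX! f. f : hom E x (one E)" using one_terminal assms by (simp add: is_terminal_def)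
 from theI'[OF this] show "bang E x : arr" "src (bang E x) = x" "tgt (bang E x) = one E"
  unfolding bang_def by (simp_all add: hom_def)
qed

lemma bang_unique: "f : arr ==> tgt f = one E ==> f = bang E (src f)"
proof -
 assume f: "f : arr" "tgt f = one E"
 then have "EX! g. g : hom E (src f) (one E)" using one_terminal by (simp add: is_terminal_def)
 then show ?thesis using f by (auto simp: hom_def)
qed

lemma bang_comp [simp]: "k : arr ==> tgt k = x ==> bang E x $ k = bang E (src k)"
 using bang_unique[of "bang E x $ k"] by auto

lemma one_obj [simp]: "one E : obj"
 using one_terminal by (simp add: is_terminal_def)

lemma to_pt_arr [simp]:
 assumes "x : obj" shows "to_pt E L x : arr" "src (to_pt E L x) = x" "tgt (to_pt E L x) = fOb L {undefined}"
proof -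
 have "EX! f. f : hom E x (fOb L {undefined})" using L_terminal assms by (simp add: is_terminal_def)
 from theI'[OF this] show "to_pt E L x : arr" "src (to_pt E L x) = x" "tgt (to_pt E L x) = fOb L {undefined}"
  unfolding to_pt_def by (simp_all add: hom_def)
qed

lemma to_pt_unique:
 assumes "f : arr" "tgt f = fOb L {undefined}" shows "f = to_pt E L (src f)"
proof -
 have "EX! g. g : hom E (src f) (fOb L {undefined})" using assms L_terminal by (simp add: is_terminal_def)
 then show ?thesis using assms by (auto simp: hom_def)
qed

lemma to_pt_comp [simp]: "k : arr ==> tgt k = x ==> to_pt E L x $ k = to_pt E L (src k)"
 using to_pt_unique[of "to_pt E L x $ k"] by auto

definition cst :: "'u set => 'u => 'o => 'a" where
 "cst S s T = fAr L (pt s S) $ to_pt E L T"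

lemma cst_arr [simp]:
 assumes "small S" "s : S" "T : obj"
 shows "cst S s T : arr" "src (cst S s T) = T" "tgt (cst S s T) = fOb L S"
 using L_arr[OF pt_hom[OF assms(1,2)]] assms(3) unfolding cst_def by simp_all

lemma cst_comp [simp]:
 assumes "small S" "s : S" "k : arr" "tgt k = T"
 shows "cst S s T $ k = cst S s (src k)"
proof -
 have "T : obj" using assms by auto
 then show ?thesis using L_arr[OF pt_hom[OF assms(1,2)]] assms(3,4) unfolding cst_def by simp
qed

lemma L_cst:
 assumes "m : hom SetC S S'" "s : S" "T : obj"
 shows "fAr L m $ cst S s T = cst S' (app m s) T"
proof -
 have S: "small S" using assms by (auto simp: SetC_hom)
 note p = pt_hom[OF S assms(2)]
 show ?thesis
  unfolding cst_def comp_pt[OF assms(1,2), symmetric] L_comp[OF p assms(1)]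
  using L_arr[OF p] L_arr[OF assms(1)] assms(3) by simp
qed

end

subsection \<open>Pullbacks as limits over the cospan\<close>

definition cospan :: "(nat, nat) cat" where
 "cospan = \<lparr>Obj = {0, 1, 2}, Arr = {0, 1, 2, 3, 4}, Src = (%k. if k = 3 then 0 else if k = 4 then 1 else k),
   Tgt = (%k. if k = 3 \<or> k = 4 then 2 else k), Idn = (%k. k), Comp = (%g f. if g \<le> 2 then f else g)\<rparr>"

definition cospan_diag :: "('o, 'a) cat => 'a => 'a => (nat, nat, 'o, 'a) func" where
 "cospan_diag C f g = \<lparr>fOb = (%k. if k = 0 then Src C f else if k = 1 then Src C g else Tgt C f),
   fAr = (%k. if k = 0 then Idn C (Src C f) else if k = 1 then Idn C (Src C g) else
    if k = 2 then Idn C (Tgt C f) else if k = 3 then f else g)\<rparr>"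

lemma cospan_simps [simp]:
 "Obj cospan = {0, 1, 2}" "Arr cospan = {0, 1, 2, 3, 4}"
 "Src cospan 0 = 0" "Src cospan (Suc 0) = Suc 0" "Src cospan 2 = 2" "Src cospan 3 = 0" "Src cospan 4 = Suc 0"
 "Tgt cospan 0 = 0" "Tgt cospan (Suc 0) = Suc 0" "Tgt cospan 2 = 2" "Tgt cospan 3 = 2" "Tgt cospan 4 = 2"
 "Idn cospan k = k"
 by (simp_all add: cospan_def)

lemma cospan_diag_simps [simp]:
 "fOb (cospan_diag C f g) 0 = Src C f" "fOb (cospan_diag C f g) (Suc 0) = Src C g" "fOb (cospan_diag C f g) 2 = Tgt C f"
 "fAr (cospan_diag C f g) 0 = Idn C (Src C f)" "fAr (cospan_diag C f g) (Suc 0) = Idn C (Src C g)"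
 "fAr (cospan_diag C f g) 2 = Idn C (Tgt C f)" "fAr (cospan_diag C f g) 3 = f" "fAr (cospan_diag C f g) 4 = g"
 by (simp_all add: cospan_diag_def)

lemma cospan_category: "category cospan"
proof
 fix f g x y z assume h: "f : hom cospan x y" "g : hom cospan y z"
 then have "f : {0, 1, 2, 3, 4}" "g : {0, 1, 2, 3, 4}" "Src cospan f = x" "Tgt cospan f = Src cospan g" "z = Tgt cospan g"
  by (auto simp: hom_def)
 then show "g $\<^bsub>cospan\<^esub> f : hom cospan x z"
  by (elim insertE emptyE) (simp_all add: cospan_def hom_def)
next
 fix f g h w x y z assume "f : hom cospan w x" "g : hom cospan x y" "h : hom cospan y z"
 show "h $\<^bsub>cospan\<^esub> g $\<^bsub>cospan\<^esub> f = h $\<^bsub>cospan\<^esub> (g $\<^bsub>cospan\<^esub> f)"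
  by (simp add: cospan_def)
qed (auto simp: cospan_def hom_def)

lemma (in category) cospan_functor:
 assumes "f : arr" "g : arr" "tgt f = tgt g"
 shows "is_functor cospan C (cospan_diag C f g)"
 unfolding is_functor_def using assms by (auto simp: cospan_def cospan_diag_def hom_def)

text \<open>
  Preservation of finite limits speaks of functors on finite categories. A cospan is such a functor.
\<close>

lemma (in category) pullback_is_limit:
 assumes "is_pullback C f g p q"
 shows "is_limit C cospan (cospan_diag C f g) (src p) (%j. if j = 0 then p else if j = 1 then q else f $ p)"
proof -
 note a = pullback_arr[OF assms]
 \<comment> \<open>The leg at the vertex of the cospan is the common composite \<open>f \<cdot> p = g \<cdot> q\<close>.\<close>
 let ?\<pi> = "%j :: nat. if j = 0 then p else if j = 1 then q else f $ p"
 have "EX! h. h : hom C Y (src p) & (ALL j : Obj cospan. ?\<pi> j $ h = \<rho> j)"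
  if Y: "Y : obj" and r: "ALL j : Obj cospan. \<rho> j : hom C Y (fOb (cospan_diag C f g) j)"
   and n: "ALL k : Arr cospan. fAr (cospan_diag C f g) k $ \<rho> (Src cospan k) = \<rho> (Tgt cospan k)" for Y \<rho>
 proof -
  have r': "\<rho> 0 : arr" "\<rho> 1 : arr" "\<rho> 2 : arr" "src (\<rho> 0) = Y" "src (\<rho> 1) = Y" "src (\<rho> 2) = Y"
   "tgt (\<rho> 0) = src f" "tgt (\<rho> 1) = src g" "tgt (\<rho> 2) = tgt f"
   and n': "f $ \<rho> 0 = \<rho> 2" "g $ \<rho> 1 = \<rho> 2"
   using r n by (simp_all add: hom_def)
  obtain h where h: "h : arr" "src h = Y" "tgt h = src p" "p $ h = \<rho> 0" "q $ h = \<rho> 1"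
   using pullback_lift[OF assms r'(1,2)] r' n' by metis
  have pe: "k = h" if "k : hom C Y (src p) & (ALL j : Obj cospan. ?\<pi> j $ k = \<rho> j)" for k
   by (rule pullback_eq[OF assms]) (use that h in "simp_all add: hom_def")
  show ?thesis
   by (rule ex1I[of _ h], use h n' a in \<open>simp add: hom_def\<close>, rule pe)
 qed
 then show ?thesis
  unfolding is_limit_def Let_def using a by (auto simp: hom_def)
qed

lemma (in category) limit_is_pullback:
 assumes "is_limit C cospan D X \<pi>" "f : arr" "g : arr" "tgt f = tgt g"
  and D: "!!j. j : Obj cospan ==> fOb D j = fOb (cospan_diag C f g) j" "!!k. k : Arr cospan ==> fAr D k = fAr (cospan_diag C f g) k"
 shows "is_pullback C f g (\<pi> 0) (\<pi> 1)"
proof -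
 have c: "X : obj" "ALL j : Obj cospan. \<pi> j : hom C X (fOb D j)"
   "ALL k : Arr cospan. fAr D k $ \<pi> (Src cospan k) = \<pi> (Tgt cospan k)"
  and U: "!!Y \<rho>. Y : obj ==> ALL j : Obj cospan. \<rho> j : hom C Y (fOb D j) ==>
   ALL k : Arr cospan. fAr D k $ \<rho> (Src cospan k) = \<rho> (Tgt cospan k) ==>
   EX! h. h : hom C Y X & (ALL j : Obj cospan. \<pi> j $ h = \<rho> j)"
  using assms(1) unfolding is_limit_def Let_def by simp_all
 have p: "\<pi> 0 : arr" "\<pi> 1 : arr" "\<pi> 2 : arr" "src (\<pi> 0) = X" "src (\<pi> 1) = X" "src (\<pi> 2) = X"
  "tgt (\<pi> 0) = src f" "tgt (\<pi> 1) = src g" "f $ \<pi> 0 = \<pi> 2" "g $ \<pi> 1 = \<pi> 2" "tgt (\<pi> 2) = tgt f"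
  using c by (simp_all add: hom_def D)
 show ?thesis
 proof (rule pullbackI)
  fix u v assume u: "u : arr" "v : arr" "src u = src v" "tgt u = src f" "tgt v = src g" "f $ u = g $ v"
  let ?\<rho> = "%j :: nat. if j = 0 then u else if j = 1 then v else f $ u"
  have "EX! h. h : hom C (src u) X & (ALL j : Obj cospan. \<pi> j $ h = ?\<rho> j)"
   by (rule U) (use u assms(2-4) in "simp_all add: hom_def D")
  then obtain h where "h : hom C (src u) X" "ALL j : Obj cospan. \<pi> j $ h = ?\<rho> j" by blast
  then show "EX h : arr. src h = src u & tgt h = src (\<pi> 0) & \<pi> 0 $ h = u & \<pi> 1 $ h = v"
   using p by (intro bexI[of _ h]) (simp_all add: hom_def)
 next
  fix h k assume hk: "h : arr" "k : arr" "src h = src k" "tgt h = src (\<pi> 0)" "tgt k = src (\<pi> 0)"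
   "\<pi> 0 $ h = \<pi> 0 $ k" "\<pi> 1 $ h = \<pi> 1 $ k"
  have two: "\<pi> 2 $ h = \<pi> 2 $ k" unfolding p(9)[symmetric] using hk p(1,4,7) assms(2) by simp
  have "EX! l. l : hom C (src h) X & (ALL j : Obj cospan. \<pi> j $ l = \<pi> j $ h)"
  proof (rule U)
   show "ALL j : Obj cospan. \<pi> j $ h : hom C (src h) (fOb D j)"
    using hk p assms(4) by (simp add: hom_def D)
   show "ALL j : Arr cospan. fAr D j $ (\<pi> (Src cospan j) $ h) = \<pi> (Tgt cospan j) $ h"
    using hk p assms(2-4) assoc_eq[OF p(9), of h] assoc_eq[OF p(10), of h]
    by (simp add: D)
  qed (use hk in simp)
  moreover have "h : hom C (src h) X & (ALL j : Obj cospan. \<pi> j $ h = \<pi> j $ h)" using hk p by (simp add: hom_def)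
  moreover have "k : hom C (src h) X & (ALL j : Obj cospan. \<pi> j $ k = \<pi> j $ h)" using hk p two by (simp add: hom_def)
  ultimately show "h = k" by blast
 qed (use p assms(2-4) in auto)
qed

context topos
begin

lemma L_pullback:
 assumes pb: "is_pullback SetC f g p q"
 shows "is_pullback E (fAr L f) (fAr L g) (fAr L p) (fAr L q)"
proof -
 interpret S: category "SetC :: ('u set, 'u fn) cat" by (rule SetC_category)
 note a = S.pullback_arr[OF pb]
 have "is_limit E cospan (fcomp L (cospan_diag SetC f g)) (fOb L (Src SetC p))
   (%j. fAr L (if j = 0 then p else if j = 1 then q else f $\<^bsub>SetC\<^esub> p))"
  using L_lex S.pullback_is_limit[OF pb] cospan_category S.cospan_functor[OF a(1,2,5)]
  unfolding preserves_finite_limits_def by simp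
 then have "is_pullback E (fAr L f) (fAr L g) (fAr L (if (0::nat) = 0 then p else if (0::nat) = 1 then q else f $\<^bsub>SetC\<^esub> p))
   (fAr L (if (1::nat) = 0 then p else if (1::nat) = 1 then q else f $\<^bsub>SetC\<^esub> p))"
  by (rule limit_is_pullback)
   (use functorD[OF L_functor] a S.src_tgt_obj[OF a(1)] S.src_tgt_obj[OF a(2)] in "auto simp: fcomp_def")
 then show ?thesis by simp
qed

end

section \<open>Coproducts of points\<close>

lemma glue_cocone_coprod: "glue_cocone E I X {} Y \<rho> \<longleftrightarrow> Y : Obj E & (ALL i : I. \<rho> i : hom E (X i) Y)"
 by (simp add: glue_cocone_def)

context topos
begin

text \<open>By adjointness \<open>L S\<close> is the coproduct of copies of the terminal object indexed by \<open>S\<close>.\<close>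

lemma L_coproduct:
 assumes S: "small S"
 shows "is_gluing E S (%_. fOb L {undefined}) {} (fOb L S) (%s. fAr L (pt s S))"
 unfolding is_gluing_def glue_cocone_coprod
proof (intro conjI ballI allI impI; (elim conjE)?)
 let ?one = "fOb L {undefined :: 'u}"
 interpret S: category "SetC :: ('u set, 'u fn) cat" by (rule SetC_category)
 have unit: "{undefined :: 'u} : Obj SetC" "S : Obj SetC" using S by simp_all
 note Ld = functorD[OF L_functor] and Rd = functorD[OF R_functor]
 show LS: "fOb L S : obj" using Ld(1)[OF unit(2)] .
 show Lpt: "fAr L (pt s S) : hom E ?one (fOb L S)" if "s : S" for s using L_arr[OF pt_hom[OF S that]] by (simp add: hom_def)
 obtain \<eta> \<epsilon> where \<eta>: "is_nat SetC SetC id_func (fcomp R L) \<eta>" and \<epsilon>: "is_nat E E (fcomp L R) id_func \<epsilon>"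
  and tri: "!!x. x : Obj SetC ==> \<epsilon> (fOb L x) $ fAr L (\<eta> x) = Idn E (fOb L x)"
  using geometric unfolding geometric_morphism_def adjoint_def by blast
 have \<eta>a: "\<eta> x : hom SetC x (fOb R (fOb L x))" if "x : Obj SetC" for x
  using \<eta> that by (simp add: is_nat_def id_func_def fcomp_def)
 have \<eta>n: "\<eta> (Tgt SetC f) $\<^bsub>SetC\<^esub> f = fAr R (fAr L f) $\<^bsub>SetC\<^esub> \<eta> (Src SetC f)" if "f : Arr SetC" for f
  using \<eta> that by (simp add: is_nat_def id_func_def fcomp_def)
 have \<epsilon>a: "\<epsilon> y : arr" "src (\<epsilon> y) = fOb L (fOb R y)" "tgt (\<epsilon> y) = y" if "y : obj" for y
  using \<epsilon> that by (simp_all add: is_nat_def id_func_def fcomp_def hom_def)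
 have \<epsilon>n: "\<epsilon> (tgt f) $ fAr L (fAr R f) = f $ \<epsilon> (src f)" if "f : arr" for f
  using \<epsilon> that by (simp add: is_nat_def id_func_def fcomp_def)
 have Rh: "fAr R f : hom SetC (fOb R x) (fOb R y)" if "f : hom E x y" for f x y
  using Rd(3-5)[of f] that by (auto simp: hom_def)
 \<comment> \<open>The transpose of \<open>\<rho>\<close> along the adjunction, and its inverse.\<close>
 have tr: "\<epsilon> Y $ fAr L (fAr R h $\<^bsub>SetC\<^esub> \<eta> x) = h" if h: "h : hom E (fOb L x) Y" and x: "x : Obj SetC" for h x Y
 proof -
  have ha: "h : arr" "src h = fOb L x" "tgt h = Y" using h by (auto simp: hom_def)
  then have Y: "Y : obj" "fOb L x : obj" using src_tgt_obj[OF ha(1)] by simp_all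
  note LRh = L_arr[OF Rh[OF h]] and L\<eta> = L_arr[OF \<eta>a[OF x]]
  have "\<epsilon> Y $ fAr L (fAr R h $\<^bsub>SetC\<^esub> \<eta> x) = \<epsilon> Y $ (fAr L (fAr R h) $ fAr L (\<eta> x))"
   using L_comp[OF \<eta>a[OF x] Rh[OF h]] by simp
  also have "\<dots> = (\<epsilon> Y $ fAr L (fAr R h)) $ fAr L (\<eta> x)" using \<epsilon>a[OF Y(1)] LRh L\<eta> by simp
  also have "\<dots> = h $ (\<epsilon> (fOb L x) $ fAr L (\<eta> x))" using \<epsilon>n[OF ha(1)] \<epsilon>a[OF Y(2)] LRh L\<eta> ha by simp
  finally show ?thesis using tri[OF x] ha by simp
 qed
 fix Y \<rho> assume Y: "Y : obj" and \<rho>: "ALL s : S. \<rho> s : hom E ?one Y"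
 let ?g = "%s. app (fAr R (\<rho> s) $\<^bsub>SetC\<^esub> \<eta> {undefined}) undefined"
 have gin: "?g s : fOb R Y" if "s : S" for s
  using SetC_app_in[OF SetC_comp_hom[OF \<eta>a[OF unit(1)] Rh]] \<rho> that by blast
 let ?G = "Fn S (restrict ?g S) (fOb R Y)"
 have RY: "small (fOb R Y)" using Rd(1)[OF Y] by simp
 have G: "?G : hom SetC S (fOb R Y)" by (rule SetC_fun[OF S RY gin])
 let ?h = "\<epsilon> Y $ fAr L ?G"
 have h: "?h : hom E (fOb L S) Y" using \<epsilon>a[OF Y] L_arr[OF G] by (simp add: hom_def)
 have Gpt: "?G $\<^bsub>SetC\<^esub> pt s S = fAr R (\<rho> s) $\<^bsub>SetC\<^esub> \<eta> {undefined}" if s: "s : S" for s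
 proof (rule SetC_eqI[OF SetC_comp_hom[OF pt_hom[OF S s] G] SetC_comp_hom[OF \<eta>a[OF unit(1)] Rh]])
  show "\<rho> s : hom E ?one Y" using \<rho> s by blast
  fix x :: 'u assume "x : {undefined}"
  then show "app (?G $\<^bsub>SetC\<^esub> pt s S) x = app (fAr R (\<rho> s) $\<^bsub>SetC\<^esub> \<eta> {undefined}) x"
   using SetC_comp_app[OF pt_hom[OF S s], of x ?G] s by simp
 qed
 show "EX! h. h : hom E (fOb L S) Y & (ALL s : S. h $ fAr L (pt s S) = \<rho> s)"
 proof (rule ex1I[of _ ?h], intro conjI h ballI)
  fix s assume s: "s : S"
  note p = pt_hom[OF S s]
  have "?h $ fAr L (pt s S) = \<epsilon> Y $ fAr L (?G $\<^bsub>SetC\<^esub> pt s S)"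
   using L_comp[OF p G] \<epsilon>a[OF Y] L_arr[OF G] L_arr[OF p] by simp
  also have "\<dots> = \<rho> s" unfolding Gpt[OF s] using tr[OF _ unit(1)] \<rho> s by blast
  finally show "?h $ fAr L (pt s S) = \<rho> s" .
 next
  fix k assume k: "k : hom E (fOb L S) Y & (ALL s : S. k $ fAr L (pt s S) = \<rho> s)"
  then have kh: "k : hom E (fOb L S) Y" by simp
  have "fAr R k $\<^bsub>SetC\<^esub> \<eta> S = ?G"
  proof (rule SetC_eqI[OF SetC_comp_hom[OF \<eta>a[OF unit(2)] Rh[OF kh]] G])
   fix s assume s: "s : S"
   note p = pt_hom[OF S s]
   have pa: "pt s S : Arr SetC" "Src SetC (pt s S) = {undefined}" "Tgt SetC (pt s S) = S" using p by (auto simp: hom_def)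
   have Lp: "fAr L (pt s S) : hom E ?one (fOb L S)" using L_arr[OF p] by (simp add: hom_def)
   have "(fAr R k $\<^bsub>SetC\<^esub> \<eta> S) $\<^bsub>SetC\<^esub> pt s S = fAr R k $\<^bsub>SetC\<^esub> (\<eta> S $\<^bsub>SetC\<^esub> pt s S)"
    by (rule S.Comp_assoc[OF p \<eta>a[OF unit(2)] Rh[OF kh]])
   also have "\<dots> = fAr R k $\<^bsub>SetC\<^esub> (fAr R (fAr L (pt s S)) $\<^bsub>SetC\<^esub> \<eta> {undefined})" using \<eta>n[OF pa(1)] pa by simp
   also have "\<dots> = (fAr R k $\<^bsub>SetC\<^esub> fAr R (fAr L (pt s S))) $\<^bsub>SetC\<^esub> \<eta> {undefined}"
    by (rule S.Comp_assoc[OF \<eta>a[OF unit(1)] Rh[OF Lp] Rh[OF kh], symmetric])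
   also have "fAr R k $\<^bsub>SetC\<^esub> fAr R (fAr L (pt s S)) = fAr R (\<rho> s)"
    using Rd(6)[of "fAr L (pt s S)" k] k s Lp by (auto simp: hom_def)
   finally have "app ((fAr R k $\<^bsub>SetC\<^esub> \<eta> S) $\<^bsub>SetC\<^esub> pt s S) undefined = ?g s" by simp
   then show "app (fAr R k $\<^bsub>SetC\<^esub> \<eta> S) s = app ?G s"
    using SetC_comp_app[OF p, of undefined "fAr R k $\<^bsub>SetC\<^esub> \<eta> S"] s by simp
  qed
  then show "k = ?h" using tr[OF kh unit(2)] by simp
 qed
qed

lemma coproduct_stable:
 assumes "is_gluing E (S :: 'u set) X {} Q \<iota>" "small S" "g : arr" "tgt g = Q"
  and pb: "!!s. s : S ==> is_pullback E g (\<iota> s) (\<iota>' s) (\<pi> s)"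
 shows "is_gluing E S (%s. src (\<iota>' s)) {} (src g) \<iota>'"
proof -
 have i: "\<iota> s : hom E (X s) Q" if "s : S" for s using assms(1) that by (auto simp: is_gluing_def glue_cocone_def)
 have "glue_spans E S X {}" using i hom_obj by (auto simp: glue_spans_def)
 from gluing_st[OF this assms(2,1) _ pb, of "src g"] assms(3,4) show ?thesis by (simp add: hom_def)
qed

lemma coproduct_induce:
 assumes "is_gluing E S X {} Q \<iota>" "Y : obj" "!!s. s : S ==> \<rho> s : arr" "!!s. s : S ==> src (\<rho> s) = X s" "!!s. s : S ==> tgt (\<rho> s) = Y"
 obtains h where "h : arr" "src h = Q" "tgt h = Y" "!!s. s : S ==> h $ \<iota> s = \<rho> s"
proof -
 have "glue_cocone E S X {} Y \<rho>" using assms by (simp add: glue_cocone_coprod hom_def)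
 then obtain h where "h : hom E Q Y" "ALL s : S. h $ \<iota> s = \<rho> s" using assms(1) unfolding is_gluing_def by blast
 then show thesis by (intro that[of h]) (simp_all add: hom_def)
qed

lemma coproduct_cocone:
 assumes "is_gluing E S X {} Q \<iota>"
 shows "Q : obj" "s : S ==> \<iota> s : arr" "s : S ==> src (\<iota> s) = X s" "s : S ==> tgt (\<iota> s) = Q"
 using assms by (auto simp: is_gluing_def glue_cocone_def hom_def)

lemma coproduct_eq:
 assumes g: "is_gluing E S X {} Q \<iota>" and "v : arr" "w : arr" "src v = Q" "src w = Q" "tgt v = tgt w"
  "!!s. s : S ==> v $ \<iota> s = w $ \<iota> s"
 shows "v = w"
proof -
 note c = coproduct_cocone[OF g]
 have "glue_cocone E S X {} (tgt v) (%s. v $ \<iota> s)" using assms c by (simp add: glue_cocone_coprod hom_def)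
 then have "EX! h. h : hom E Q (tgt v) & (ALL s : S. h $ \<iota> s = v $ \<iota> s)" using g unfolding is_gluing_def by blast
 moreover have "v : hom E Q (tgt v) & (ALL s : S. v $ \<iota> s = v $ \<iota> s)" "w : hom E Q (tgt v) & (ALL s : S. w $ \<iota> s = v $ \<iota> s)"
  using assms by (simp_all add: hom_def)
 ultimately show ?thesis by blast
qed

text \<open>
  The fibres of an arrow to \<open>L S\<close> over the points form a coproduct cocone. Hence arrows can be
  defined on fibres, and to compare two arrows it suffices to do so after composition with
  generalized elements that are constant in \<open>S\<close>.
\<close>

lemma fibres_coproduct:
 assumes "small S" "u : arr" "tgt u = fOb L S" "!!s. s : S ==> is_pullback E u (fAr L (pt s S)) (t s) (w s)"
 shows "is_gluing E S (%s. src (t s)) {} (src u) t"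
 by (rule coproduct_stable[OF L_coproduct[OF assms(1)] assms])

lemma L_cover:
 assumes S: "small S" and u: "u : arr" "tgt u = fOb L S" and v: "v : arr" "w : arr" "src v = src u" "src w = src u"
  "tgt v = tgt w"
  and eq: "!!s t. s : S ==> t : arr ==> tgt t = src u ==> u $ t = cst S s (src t) ==> v $ t = w $ t"
 shows "v = w"
proof -
 let ?t = "%s. pb1 E u (fAr L (pt s S))"
 have a: "fAr L (pt s S) : arr" "tgt u = tgt (fAr L (pt s S))" "src (fAr L (pt s S)) = fOb L {undefined}" if "s : S" for s
  using L_arr[OF pt_hom[OF S that]] u by simp_all
 have g: "is_gluing E S (%s. src (?t s)) {} (src u) ?t"
  by (rule fibres_coproduct[OF S u pb_pullback[OF u(1) a(1,2)]])
 show ?thesis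
 proof (rule coproduct_eq[OF g v])
  fix s assume s: "s : S"
  let ?k = "fAr L (pt s S)"
  have "u $ ?t s = ?k $ pb2 E u ?k" by (rule pb_sq[OF u(1) a(1,2)[OF s]])
  also have "pb2 E u ?k = to_pt E L (pbOb E u ?k)" using to_pt_unique[of "pb2 E u ?k"] a[OF s] u by simp
  finally have "u $ ?t s = cst S s (src (?t s))" using a[OF s] u by (simp add: cst_def)
  then show "v $ ?t s = w $ ?t s" using eq[OF s, of "?t s"] a[OF s] u by simp
 qed
qed

subsection \<open>Disjointness\<close>

text \<open>\<open>L\<close> preserves the empty intersection of two points, and \<open>L {}\<close> is initial and strictly so.\<close>

lemma cst_distinct:
 assumes S: "small S" and s: "s : S" "s' : S" "s \<noteq> s'" and T: "T : obj" and eq: "cst S s T = cst S s' T"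
 obtains k where "k : arr" "src k = T" "tgt k = fOb L {}"
proof -
 let ?e = "Fn {} (restrict (%x. x) {}) {undefined} :: 'u fn"
 interpret S: category "SetC :: ('u set, 'u fn) cat" by (rule SetC_category)
 have sm: "small ({} :: 'u set)" using small_unit unfolding small_def by (rule small_subset) simp
 have e: "?e : hom SetC {} {undefined}" by (rule SetC_fun) (use sm in auto)
 note p = pt_hom[OF S s(1)] and p' = pt_hom[OF S s(2)]
 have ea: "?e : Arr SetC" "Src SetC ?e = {}" "Tgt SetC ?e = {undefined}" and
  pa: "pt s S : Arr SetC" "Src SetC (pt s S) = {undefined}" "Tgt SetC (pt s S) = S" and
  pa': "pt s' S : Arr SetC" "Src SetC (pt s' S) = {undefined}" "Tgt SetC (pt s' S) = S"
  using e p p' unfolding hom_def by blast+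
 have "is_pullback SetC (pt s S) (pt s' S) ?e ?e"
 proof (rule S.pullbackI)
  show "pt s S $\<^bsub>SetC\<^esub> ?e = pt s' S $\<^bsub>SetC\<^esub> ?e"
   by (rule SetC_eqI[OF SetC_comp_hom[OF e p] SetC_comp_hom[OF e p']]) simp
 next
  fix u v :: "'u fn" assume u: "u : Arr SetC" "v : Arr SetC" "Src SetC u = Src SetC v" "Tgt SetC u = Src SetC (pt s S)" "Tgt SetC v = Src SetC (pt s' S)"
   "pt s S $\<^bsub>SetC\<^esub> u = pt s' S $\<^bsub>SetC\<^esub> v"
  have uh: "u : hom SetC (fn_src u) {undefined}" "v : hom SetC (fn_src u) {undefined}"
   using u pa pa' by (simp_all add: hom_def)
  have em: "fn_src u = {}"
  proof (rule ccontr)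
   assume "fn_src u \<noteq> {}"
   then obtain x where x: "x : fn_src u" by blast
   have "app (pt s S) (app u x) = app (pt s' S) (app v x)"
    using SetC_comp_app[OF uh(1) x, of "pt s S"] SetC_comp_app[OF uh(2) x, of "pt s' S"] u(6) by simp
   then have "s = s'" using SetC_app_in[OF uh(1) x] SetC_app_in[OF uh(2) x] by simp
   then show False using s by simp
  qed
  let ?i = "Idn SetC {} :: 'u fn"
  have i: "?i : hom SetC {} {}" by (rule SetC_idn_hom[OF sm])
  have "?e $\<^bsub>SetC\<^esub> ?i = u" "?e $\<^bsub>SetC\<^esub> ?i = v"
   using SetC_eqI[OF SetC_comp_hom[OF i e], of u] SetC_eqI[OF SetC_comp_hom[OF i e], of v] uh em by auto
  then show "EX h : Arr SetC. Src SetC h = Src SetC u & Tgt SetC h = Src SetC ?e & ?e $\<^bsub>SetC\<^esub> h = u & ?e $\<^bsub>SetC\<^esub> h = v"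
   using i em ea by (intro bexI[of _ ?i]) (simp_all add: hom_def)
 next
  fix h k :: "'u fn" assume h: "h : Arr SetC" "k : Arr SetC" "Src SetC h = Src SetC k" "Tgt SetC h = Src SetC ?e" "Tgt SetC k = Src SetC ?e"
  then have hh: "h : hom SetC (fn_src h) {}" "k : hom SetC (fn_src h) {}" by (simp_all add: hom_def)
  show "h = k" by (rule SetC_eqI[OF hh]) (use SetC_app_in[OF hh(1)] in auto)
 qed (use ea pa pa' in simp_all)
 from L_pullback[OF this]
 show thesis by (rule pullback_lift[of _ _ _ _ "to_pt E L T" "to_pt E L T"])
  (use L_arr[OF p] L_arr[OF p'] L_arr[OF e] T eq that in "simp_all add: cst_def")
qed

lemma empty_coproduct:
 assumes "k : arr" "tgt k = fOb L {}"
 shows "is_gluing E ({} :: 'u set) X {} (src k) t"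
proof -
 have sm: "small ({} :: 'u set)" using small_unit unfolding small_def by (rule small_subset) simp
 show ?thesis using fibres_coproduct[OF sm assms, of t undefined]
  by (simp add: is_gluing_def glue_cocone_coprod)
qed

text \<open>
  An object with an arrow to the image of the empty set is the pullback of an empty coproduct, hence
  initial.
\<close>

lemma empty_eq:
 assumes "k : arr" "tgt k = fOb L {}" "v : arr" "w : arr" "src v = src k" "src w = src k" "tgt v = tgt w"
 shows "v = w"
 by (rule coproduct_eq[OF empty_coproduct[OF assms(1,2)] assms(3-7)]) simp

lemma empty_ex:
 assumes "k : arr" "tgt k = fOb L {}" "Y : obj"
 obtains h where "h : arr" "src h = src k" "tgt h = Y"
 by (rule coproduct_induce[OF empty_coproduct[OF assms(1,2)] assms(3)]) (use that in auto)

text \<open>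
  The summands of a coproduct over \<open>S\<close> are the fibres of its projection to \<open>L S\<close>.
\<close>

lemma summand_is_fibre:
 assumes S: "small S" and Q: "is_gluing E S X {} Q \<kappa>" and u: "u : arr" "src u = Q" "tgt u = fOb L S"
  and k: "!!s. s : S ==> u $ \<kappa> s = cst S s (X s)" and c: "c : S"
 shows "is_pullback E u (fAr L (pt c S)) (\<kappa> c) (to_pt E L (X c))"
proof -
 note ka = coproduct_cocone[OF Q]
 have X: "X s : obj" if "s : S" for s using src_tgt_obj(1)[OF ka(2)[OF that]] ka(3)[OF that] by simp
 note p = L_arr[OF pt_hom[OF S c]]
 \<comment> \<open>Over a summand other than \<open>c\<close>, generalized elements over \<open>c\<close> live on empty stages.\<close>
 have away: "EX e : arr. src e = src y & tgt e = fOb L {}"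
  if s: "s : S" "s \<noteq> c" and y: "y : arr" "tgt y = X s" "x : arr" "src x = src y" "tgt x = Q"
   "\<kappa> s $ y = x" "u $ x = cst S c (src y)" for s y x
 proof -
  have "cst S s (src y) = u $ (\<kappa> s $ y)"
   using assoc_eq[OF k[OF s(1)], of y] ka s u y(1,2) S by simp
  then have "cst S c (src y) = cst S s (src y)" using y by simp
  then show ?thesis by (elim cst_distinct[OF S c s(1) s(2)[symmetric], rotated]) (use y(1) in auto)
 qed
 \<comment> \<open>The coproduct pulled back along \<open>\<kappa> c\<close>: all summands but the one of \<open>c\<close> are empty, so the
    projection from the kernel pair of \<open>\<kappa> c\<close> is invertible.\<close>
 let ?p = "%s. pb1 E (\<kappa> c) (\<kappa> s)" and ?q = "%s. pb2 E (\<kappa> c) (\<kappa> s)"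
 have pa: "?p s : arr" "?q s : arr" "src (?p s) = pbOb E (\<kappa> c) (\<kappa> s)" "src (?q s) = pbOb E (\<kappa> c) (\<kappa> s)"
  "tgt (?p s) = X c" "tgt (?q s) = X s" "\<kappa> c $ ?p s = \<kappa> s $ ?q s" if "s : S" for s
  using pb_arr(1-6)[of "\<kappa> c" "\<kappa> s"] pb_sq[of "\<kappa> c" "\<kappa> s"] ka c that by auto
 have Pc: "is_gluing E S (%s. src (?p s)) {} (X c) ?p"
  using coproduct_stable[OF Q S, of "\<kappa> c" ?p ?q] pb_pullback[of "\<kappa> c"] ka c by simp
 have o: "pbOb E (\<kappa> c) (\<kappa> c) : obj" using pb_arr(7)[where f = "\<kappa> c" and g = "\<kappa> c"] ka c by simp
 have "ALL s. EX r. s : S --> r : arr & src r = pbOb E (\<kappa> c) (\<kappa> s) & tgt r = pbOb E (\<kappa> c) (\<kappa> c) &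
   (s = c --> r = Idn E (pbOb E (\<kappa> c) (\<kappa> c)))"
 proof
  fix s
  show "EX r. s : S --> r : arr & src r = pbOb E (\<kappa> c) (\<kappa> s) & tgt r = pbOb E (\<kappa> c) (\<kappa> c) &
   (s = c --> r = Idn E (pbOb E (\<kappa> c) (\<kappa> c)))"
  proof (cases "s : S & s \<noteq> c")
   case True
   have "u $ (\<kappa> c $ ?p s) = cst S c (src (?q s))"
    using assoc_eq[OF k[OF c], of "?p s"] ka c u S pa True by simp
   then have "EX e : arr. src e = src (?q s) & tgt e = fOb L {}"
    by (intro away[of s "?q s" "\<kappa> c $ ?p s"]) (use True pa[of s] ka c in auto)
   then obtain e where e: "e : arr" "src e = src (?q s)" "tgt e = fOb L {}" by blast
   obtain r where "r : arr" "src r = src e" "tgt r = pbOb E (\<kappa> c) (\<kappa> c)" by (rule empty_ex[OF e(1,3) o])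
   then show ?thesis using True pa[of s] e by (intro exI[of _ r]) simp
  next
   case False
   then show ?thesis using o by (intro exI[of _ "Idn E (pbOb E (\<kappa> c) (\<kappa> c))"]) auto
  qed
 qed
 then obtain r0 where r0: "!!s. s : S ==> r0 s : arr & src (r0 s) = pbOb E (\<kappa> c) (\<kappa> s) & tgt (r0 s) = pbOb E (\<kappa> c) (\<kappa> c)"
  "r0 c = Idn E (pbOb E (\<kappa> c) (\<kappa> c))" using c by metis
 obtain r where r: "r : arr" "src r = X c" "tgt r = pbOb E (\<kappa> c) (\<kappa> c)" "r $ ?p c = Idn E (pbOb E (\<kappa> c) (\<kappa> c))"
  by (rule coproduct_induce[OF Pc o, of r0]) (use r0 pa c in auto)
 have diag: "?p c = ?q c"
 proof -
  have kc: "\<kappa> c : arr" "src (\<kappa> c) = X c" using ka c by auto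
  let ?d = "pair E (\<kappa> c) (\<kappa> c) (Idn E (X c)) (Idn E (X c))"
  have d: "?d : arr" "src ?d = X c" "tgt ?d = pbOb E (\<kappa> c) (\<kappa> c)" "?p c $ ?d = Idn E (X c)" "?q c $ ?d = Idn E (X c)"
   using pair_arr[where f = "\<kappa> c" and g = "\<kappa> c" and u = "Idn E (X c)" and v = "Idn E (X c)"] kc X[OF c] by simp_all
  note pc = pa[OF c]
  have "r = r $ (?p c $ ?d)" using r d by simp
  also have "\<dots> = ?d" using assoc_eq[OF r(4), of ?d] r d pc by simp
  finally have "?d $ ?p c = Idn E (pbOb E (\<kappa> c) (\<kappa> c))" using r by simp
  then have "?q c = ?q c $ (?d $ ?p c)" using pc by simp
  also have "\<dots> = ?p c" using assoc_eq[OF d(5), of "?p c"] d pc by simp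
  finally show ?thesis by simp
 qed
 show ?thesis
 proof (rule pullbackI)
  show "u $ \<kappa> c = fAr L (pt c S) $ to_pt E L (X c)" using k[OF c] by (simp add: cst_def)
 next
  fix x v assume x: "x : arr" "v : arr" "src x = src v" "tgt x = src u" "tgt v = src (fAr L (pt c S))"
   "u $ x = fAr L (pt c S) $ v"
  have v: "v = to_pt E L (src x)" using to_pt_unique[OF x(2)] x p by simp
  then have ux: "u $ x = cst S c (src x)" using x by (simp add: cst_def)
  let ?t = "%s. pb1 E x (\<kappa> s)" and ?y = "%s. pb2 E x (\<kappa> s)"
  have ta: "?t s : arr" "?y s : arr" "src (?t s) = pbOb E x (\<kappa> s)" "src (?y s) = pbOb E x (\<kappa> s)"
   "tgt (?t s) = src x" "tgt (?y s) = X s" "x $ ?t s = \<kappa> s $ ?y s" "pbOb E x (\<kappa> s) : obj" if "s : S" for s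
   using pb_arr[of x "\<kappa> s"] pb_sq[of x "\<kappa> s"] ka x(1,4) u that by simp_all
  have Tc: "is_gluing E S (%s. src (?t s)) {} (src x) ?t"
   using coproduct_stable[OF Q S, of x ?t ?y] pb_pullback[of x] ka x(1,4) u by simp
  have emp: "EX e : arr. src e = pbOb E x (\<kappa> s) & tgt e = fOb L {}" if s: "s : S" "s \<noteq> c" for s
  proof -
   have "u $ (x $ ?t s) = cst S c (src (?y s))"
    using assoc_eq[OF ux, of "?t s"] x(1,4) u S c ta[OF s(1)] by simp
   then have "EX e : arr. src e = src (?y s) & tgt e = fOb L {}"
    by (intro away[of s "?y s" "x $ ?t s"]) (use s ta[OF s(1)] x(1,4) u ka in simp_all)
   then show ?thesis using ta[OF s(1)] by simp
  qed
  have "ALL s. EX r. s : S --> r : arr & src r = pbOb E x (\<kappa> s) & tgt r = X c & (s = c --> r = ?y c)"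
  proof
   fix s
   show "EX r. s : S --> r : arr & src r = pbOb E x (\<kappa> s) & tgt r = X c & (s = c --> r = ?y c)"
   proof (cases "s : S & s \<noteq> c")
    case True
    then obtain e where e: "e : arr" "src e = pbOb E x (\<kappa> s)" "tgt e = fOb L {}" using emp[of s] by blast
    obtain r where "r : arr" "src r = src e" "tgt r = X c" by (rule empty_ex[OF e(1,3) X[OF c]])
    then show ?thesis using True e by (intro exI[of _ r]) simp
   next
    case False
    then show ?thesis using ta[OF c] by (intro exI[of _ "?y c"]) auto
   qed
  qed
  then obtain h0 where h0: "!!s. s : S ==> h0 s : arr & src (h0 s) = pbOb E x (\<kappa> s) & tgt (h0 s) = X c" "h0 c = ?y c"
   using c by metis
  obtain h where h: "h : arr" "src h = src x" "tgt h = X c" "!!s. s : S ==> h $ ?t s = h0 s"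
   by (rule coproduct_induce[OF Tc X[OF c], of h0]) (use h0 ta in auto)
  have "\<kappa> c $ h = x"
  proof (rule coproduct_eq[OF Tc])
   fix s assume s: "s : S"
   show "(\<kappa> c $ h) $ ?t s = x $ ?t s"
   proof (cases "s = c")
    case True
    then show ?thesis using h h0 ka c ta[OF c] by simp
   next
    case False
    then obtain e where "e : arr" "src e = pbOb E x (\<kappa> s)" "tgt e = fOb L {}" using emp[OF s] by blast
    then show ?thesis by (intro empty_eq[of e]) (use h(1-3) ka c s ta[OF s] x(1,4) u in simp_all)
   qed
  qed (use h ka c x(1,4) u in simp_all)
  then show "EX h : arr. src h = src x & tgt h = src (\<kappa> c) & \<kappa> c $ h = x & to_pt E L (X c) $ h = v"
   using h v ka c by (intro bexI[of _ h]) simp_all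
 next
  fix h l assume h: "h : arr" "l : arr" "src h = src l" "tgt h = src (\<kappa> c)" "tgt l = src (\<kappa> c)" "\<kappa> c $ h = \<kappa> c $ l"
  have kc: "\<kappa> c : arr" using ka c by blast
  have "?p c $ pair E (\<kappa> c) (\<kappa> c) h l = ?q c $ pair E (\<kappa> c) (\<kappa> c) h l" by (simp only: diag)
  then show "h = l" using pair_arr(4,5)[OF kc kc refl h(1-6)] by simp
 qed (use ka c X[OF c] u p in simp_all)
qed

end

section \<open>Internal diagrams and their constant elements\<close>

lemma iop_sel [simp]: "iOb (iop \<D>) = iOb \<D>" "iAr (iop \<D>) = iAr \<D>" "iCp (iop \<D>) = iCp \<D>" "d0 (iop \<D>) = d1 \<D>"
 "d1 (iop \<D>) = d0 \<D>" "iid (iop \<D>) = iid \<D>" "ip1 (iop \<D>) = ip2 \<D>" "ip2 (iop \<D>) = ip1 \<D>" "icmp (iop \<D>) = icmp \<D>"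
 "iop (iop \<D>) = (\<D> :: ('o, 'a) icat)"
 by (simp_all add: iop_def)

text \<open>
  \<open>\<D>\<close> is the image of the small category \<open>C\<close> under \<open>L\<close>, as far as its structure is seen by
  constant generalized elements. The description is stable under passing to opposites.
\<close>

locale internal_image = topos E L R + C: category C
 for E :: "('o, 'a) cat" (structure) and L :: "('u::universe set, 'u fn, 'o, 'a) func" and R and C :: "('u, 'u) cat" +
 fixes \<D> :: "('o, 'a) icat"
 assumes small_C: "small (Obj C)" "small (Arr C)"
  and carriers: "iOb \<D> = fOb L (Obj C)" "iAr \<D> = fOb L (Arr C)"
  and d_hom: "d0 \<D> : hom E (iAr \<D>) (iOb \<D>)" "d1 \<D> : hom E (iAr \<D>) (iOb \<D>)" "iid \<D> : hom E (iOb \<D>) (iAr \<D>)"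
  and cmp_pullback: "is_pullback E (d1 \<D>) (d0 \<D>) (ip1 \<D>) (ip2 \<D>)"
  and cmp_hom: "icmp \<D> : hom E (Src E (ip1 \<D>)) (iAr \<D>)"
  and cst_d: "f : Arr C ==> T : Obj E ==> d0 \<D> $ cst (Arr C) f T = cst (Obj C) (Src C f) T"
   "f : Arr C ==> T : Obj E ==> d1 \<D> $ cst (Arr C) f T = cst (Obj C) (Tgt C f) T"
  and cst_id: "c : Obj C ==> T : Obj E ==> iid \<D> $ cst (Obj C) c T = cst (Arr C) (Idn C c) T"
  and cst_gcomp: "f : Arr C ==> g : Arr C ==> Tgt C f = Src C g ==> T : Obj E ==>
   gcomp E \<D> (cst (Arr C) f T) (cst (Arr C) g T) = cst (Arr C) (g $\<^bsub>C\<^esub> f) T"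
begin

lemma d_arr [simp]:
 "d0 \<D> : Arr E" "d1 \<D> : Arr E" "iid \<D> : Arr E" "Src E (d0 \<D>) = fOb L (Arr C)" "Src E (d1 \<D>) = fOb L (Arr C)"
 "Tgt E (d0 \<D>) = fOb L (Obj C)" "Tgt E (d1 \<D>) = fOb L (Obj C)" "Src E (iid \<D>) = fOb L (Obj C)" "Tgt E (iid \<D>) = fOb L (Arr C)"
 using d_hom by (auto simp: hom_def carriers)

lemma cst_C [simp]:
 "f : Arr C ==> T : Obj E ==> cst (Arr C) f T : Arr E"
 "f : Arr C ==> T : Obj E ==> Src E (cst (Arr C) f T) = T"
 "f : Arr C ==> T : Obj E ==> Tgt E (cst (Arr C) f T) = fOb L (Arr C)"
 "c : Obj C ==> T : Obj E ==> cst (Obj C) c T : Arr E"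
 "c : Obj C ==> T : Obj E ==> Src E (cst (Obj C) c T) = T"
 "c : Obj C ==> T : Obj E ==> Tgt E (cst (Obj C) c T) = fOb L (Obj C)"
 "f : Arr C ==> k : Arr E ==> Tgt E k = T ==> cst (Arr C) f T $ k = cst (Arr C) f (Src E k)"
 "c : Obj C ==> k : Arr E ==> Tgt E k = T ==> cst (Obj C) c T $ k = cst (Obj C) c (Src E k)"
 using cst_arr[OF small_C(2)] cst_arr[OF small_C(1)] cst_comp[OF small_C(2)] cst_comp[OF small_C(1)] by auto

lemma gcomp_arr:
 assumes "f : Arr E" "g : Arr E" "Src E f = Src E g" "Tgt E f = fOb L (Arr C)" "Tgt E g = fOb L (Arr C)" "d1 \<D> $ f = d0 \<D> $ g"
 shows "gcomp E \<D> f g : Arr E" "Src E (gcomp E \<D> f g) = Src E f" "Tgt E (gcomp E \<D> f g) = fOb L (Arr C)"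
  "k : Arr E ==> Tgt E k = Src E f ==> gcomp E \<D> f g $ k = gcomp E \<D> (f $ k) (g $ k)"
proof -
 have a: "Tgt E f = Src E (d1 \<D>)" "Tgt E g = Src E (d0 \<D>)" using assms by simp_all
 note i = into_rules[OF cmp_pullback assms(1-3) a assms(6)]
 have c: "icmp \<D> : Arr E" "Src E (icmp \<D>) = Src E (ip1 \<D>)" "Tgt E (icmp \<D>) = fOb L (Arr C)"
  using cmp_hom by (auto simp: hom_def carriers)
 show "gcomp E \<D> f g : Arr E" "Src E (gcomp E \<D> f g) = Src E f" "Tgt E (gcomp E \<D> f g) = fOb L (Arr C)"
  using i c unfolding gcomp_def by simp_all
 assume k: "k : Arr E" "Tgt E k = Src E f"
 note pa = pullback_arr[OF cmp_pullback]
 have "into E (ip1 \<D>) (ip2 \<D>) (f $ k) (g $ k) = into E (ip1 \<D>) (ip2 \<D>) f g $ k"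
 proof (rule into_eq[OF cmp_pullback])
  show "ip1 \<D> $ (into E (ip1 \<D>) (ip2 \<D>) f g $ k) = f $ k" "ip2 \<D> $ (into E (ip1 \<D>) (ip2 \<D>) f g $ k) = g $ k"
   using assoc_eq[OF i(4), of k] assoc_eq[OF i(5), of k] i k pa(3,4,6) by simp_all
 qed (use i k in simp_all)
 then show "gcomp E \<D> f g $ k = gcomp E \<D> (f $ k) (g $ k)" unfolding gcomp_def using c i k by simp
qed

end

lemma (in internal_image) internal_image_op: "internal_image E L R (op_cat C) (iop \<D>)"
proof -
 interpret op: category "op_cat C" by (rule op_category) unfold_locales
 show ?thesis
 proof
  show "is_pullback E (d1 (iop \<D>)) (d0 (iop \<D>)) (ip1 (iop \<D>)) (ip2 (iop \<D>))"
   using pullback_sym[OF cmp_pullback] by simp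
  show "icmp (iop \<D>) : hom E (src (ip1 (iop \<D>))) (iAr (iop \<D>))"
   using cmp_hom pullback_arr(6)[OF cmp_pullback] by simp
 next
  fix f g T assume h: "f : Arr (op_cat C)" "g : Arr (op_cat C)" "Tgt (op_cat C) f = Src (op_cat C) g" "T : obj"
  have "into E (ip2 \<D>) (ip1 \<D>) u v = into E (ip1 \<D>) (ip2 \<D>) v u" if "u : arr" "v : arr" "src u = src v" for u v
   unfolding into_def using that pullback_arr(6)[OF cmp_pullback] by (auto intro!: arg_cong[where f = The])
  then have "gcomp E (iop \<D>) (cst (Arr C) f T) (cst (Arr C) g T) = gcomp E \<D> (cst (Arr C) g T) (cst (Arr C) f T)"
   unfolding gcomp_def using h by simp
  then show "gcomp E (iop \<D>) (cst (Arr (op_cat C)) f T) (cst (Arr (op_cat C)) g T) = cst (Arr (op_cat C)) (g $\<^bsub>op_cat C\<^esub> f) T"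
   using cst_gcomp[of g f T] h by simp
 qed (use small_C carriers d_hom cst_d cst_id in simp_all)
qed

lemma SetC_pullback_ex:
 fixes f :: "'u::universe fn"
 assumes f: "f : hom SetC A S" "g : hom SetC B S"
 shows "EX p q. is_pullback SetC f g p q"
proof -
 interpret S: category "SetC :: ('u set, 'u fn) cat" by (rule SetC_category)
 obtain pr :: "'u \<times> 'u => 'u" where pr: "inj pr" using pairing_exists by blast
 have sm: "small A" "small B" using f by (auto simp: SetC_hom)
 \<comment> \<open>Pairs are coded in the universe by the injection \<open>pr\<close>.\<close>
 let ?Z = "pr ` {(a, b). a : A & b : B & app f a = app g b}"
 have Z: "small ?Z"
  unfolding small_def by (rule small_image, rule small_subset[OF small_Times[of A B]]) (use sm in "auto simp: small_def")
 have inv: "inv pr (pr x) = x" for x using pr by simp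
 let ?p = "Fn ?Z (restrict (%z. fst (inv pr z)) ?Z) A" and ?q = "Fn ?Z (restrict (%z. snd (inv pr z)) ?Z) B"
 have p: "?p : hom SetC ?Z A" by (rule SetC_fun[OF Z sm(1)]) (auto simp: inv)
 have q: "?q : hom SetC ?Z B" by (rule SetC_fun[OF Z sm(2)]) (auto simp: inv)
 note a = f[unfolded hom_def, simplified] and pa = p[unfolded hom_def, simplified] and qa = q[unfolded hom_def, simplified]
 have "is_pullback SetC f g ?p ?q"
 proof (rule S.pullbackI)
  show "f $\<^bsub>SetC\<^esub> ?p = g $\<^bsub>SetC\<^esub> ?q"
   by (rule SetC_eqI[OF SetC_comp_hom[OF p f(1)] SetC_comp_hom[OF q f(2)]])
    (auto simp: SetC_comp_app[OF p] SetC_comp_app[OF q] inv)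
 next
  fix u v :: "'u fn" assume u: "u : Arr SetC" "v : Arr SetC" "Src SetC u = Src SetC v" "Tgt SetC u = Src SetC f" "Tgt SetC v = Src SetC g" "f $\<^bsub>SetC\<^esub> u = g $\<^bsub>SetC\<^esub> v"
  have uh: "u : hom SetC (fn_src u) A" "v : hom SetC (fn_src u) B" using u a by (simp_all add: hom_def)
  have s: "small (fn_src u)" using uh by (auto simp: SetC_hom)
  have e: "app f (app u x) = app g (app v x)" if x: "x : fn_src u" for x
   using SetC_comp_app[OF uh(1) x, of f] SetC_comp_app[OF uh(2) x, of g] u(6) by simp
  let ?h = "Fn (fn_src u) (restrict (%x. pr (app u x, app v x)) (fn_src u)) ?Z"
  have hin: "pr (app u x, app v x) : ?Z" if x: "x : fn_src u" for x
   using e[OF x] SetC_app_in[OF uh(1) x] SetC_app_in[OF uh(2) x] by blast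
  have h: "?h : hom SetC (fn_src u) ?Z" by (rule SetC_fun[OF s Z hin])
  have "?p $\<^bsub>SetC\<^esub> ?h = u"
   by (rule SetC_eqI[OF SetC_comp_hom[OF h p] uh(1)]) (use hin in "simp add: SetC_comp_app[OF h] inv")
  moreover have "?q $\<^bsub>SetC\<^esub> ?h = v"
   by (rule SetC_eqI[OF SetC_comp_hom[OF h q] uh(2)]) (use hin in "simp add: SetC_comp_app[OF h] inv")
  ultimately show "EX h : Arr SetC. Src SetC h = Src SetC u & Tgt SetC h = Src SetC ?p & ?p $\<^bsub>SetC\<^esub> h = u & ?q $\<^bsub>SetC\<^esub> h = v"
   using h by (intro bexI[of _ ?h]) (simp_all add: hom_def)
 next
  fix h k :: "'u fn" assume h: "h : Arr SetC" "k : Arr SetC" "Src SetC h = Src SetC k" "Tgt SetC h = Src SetC ?p" "Tgt SetC k = Src SetC ?p"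
   and e: "?p $\<^bsub>SetC\<^esub> h = ?p $\<^bsub>SetC\<^esub> k" "?q $\<^bsub>SetC\<^esub> h = ?q $\<^bsub>SetC\<^esub> k"
  then have hh: "h : hom SetC (fn_src h) ?Z" "k : hom SetC (fn_src h) ?Z" by (simp_all add: hom_def)
  show "h = k"
  proof (rule SetC_eqI[OF hh])
   fix x assume x: "x : fn_src h"
   have z: "app h x : ?Z" "app k x : ?Z" using SetC_app_in[OF hh(1) x] SetC_app_in[OF hh(2) x] by blast+
   have "fst (inv pr (app h x)) = fst (inv pr (app k x))"
    using SetC_comp_app[OF hh(1) x, of ?p] SetC_comp_app[OF hh(2) x, of ?p] e(1) z by simp
   moreover have "snd (inv pr (app h x)) = snd (inv pr (app k x))"
    using SetC_comp_app[OF hh(1) x, of ?q] SetC_comp_app[OF hh(2) x, of ?q] e(2) z by simp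
   ultimately have "inv pr (app h x) = inv pr (app k x)" by (rule prod_eqI)
   then show "app h x = app k x" using z by (auto simp: inv)
  qed
 qed (use a pa qa in simp_all)
 then show ?thesis by blast
qed

lemma SetC_pb:
 assumes "f : hom SetC A S" "g : hom SetC B S"
 shows "is_pullback SetC f g (pb1 SetC f g) (pb2 SetC f g)"
proof -
 obtain p q where "is_pullback SetC f g (fst (p, q)) (snd (p, q))" using SetC_pullback_ex[OF assms] by auto
 then show ?thesis unfolding pb1_def pb2_def pb_def by (rule someI)
qed

text \<open>
  The object of composable pairs is a pullback, which the inverse image functor preserves; the
  arrows of the internal category are evaluated on the points of the object of arrows.
\<close>

lemma (in topos) internal_image_of:
 assumes C: "small_category C"
 shows "internal_image E L R C (icat_image L (internal_of C))"
proof -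
 interpret C: category C using C by (simp add: small_category_def)
 interpret S: category "SetC :: ('u set, 'u fn) cat" by (rule SetC_category)
 have sm: "small (Obj C)" "small (Arr C)" using C by (auto simp: small_category_def)
 let ?s = "Fn (Arr C) (restrict (Src C) (Arr C)) (Obj C)" and ?t = "Fn (Arr C) (restrict (Tgt C) (Arr C)) (Obj C)"
 let ?p = "pb1 SetC ?t ?s" and ?q = "pb2 SetC ?t ?s" and ?Z = "pbOb SetC ?t ?s"
 let ?i = "Fn (Obj C) (restrict (Idn C) (Obj C)) (Arr C)"
 let ?m = "Fn ?Z (restrict (%z. app ?q z $\<^bsub>C\<^esub> app ?p z) ?Z) (Arr C)"
 have s: "?s : hom SetC (Arr C) (Obj C)" by (rule SetC_fun[OF sm(2,1)]) simp
 have t: "?t : hom SetC (Arr C) (Obj C)" by (rule SetC_fun[OF sm(2,1)]) simp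
 have i: "?i : hom SetC (Obj C) (Arr C)" by (rule SetC_fun[OF sm]) simp
 have pb: "is_pullback SetC ?t ?s ?p ?q" by (rule SetC_pb[OF t s])
 note a = S.pullback_arr[OF pb]
 have st: "Src SetC ?s = Arr C" "Src SetC ?t = Arr C" by simp_all
 have p: "?p : hom SetC ?Z (Arr C)" and q: "?q : hom SetC ?Z (Arr C)"
  using a(3,4,6-8) unfolding st by (simp_all only: hom_def pbOb_def mem_Collect_eq)
 have Z: "small ?Z" using p unfolding SetC_hom by blast
 have z: "Tgt C (app ?p z) = Src C (app ?q z)" if "z : ?Z" for z
 proof -
  have "app ?t (app ?p z) = app ?s (app ?q z)"
   using arg_cong[OF a(9), of "%m. app m z"] by (simp only: SetC_comp_app[OF p that] SetC_comp_app[OF q that])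
  moreover have "app ?t x = Tgt C x" "app ?s x = Src C x" if "x : Arr C" for x using that by simp_all
  ultimately show ?thesis using SetC_app_in[OF p that] SetC_app_in[OF q that] by (simp only: )
 qed
 have m: "?m : hom SetC ?Z (Arr C)"
 proof (rule SetC_fun[OF Z sm(2)])
  fix x assume x: "x : ?Z"
  show "app ?q x $\<^bsub>C\<^esub> app ?p x : Arr C"
   by (rule C.comp_arr(1)[OF SetC_app_in[OF p x] SetC_app_in[OF q x] z[OF x]])
 qed
 let ?D = "icat_image L (internal_of C)"
 have sel: "iOb ?D = fOb L (Obj C)" "iAr ?D = fOb L (Arr C)" "d0 ?D = fAr L ?s" "d1 ?D = fAr L ?t" "iid ?D = fAr L ?i"
  "ip1 ?D = fAr L ?p" "ip2 ?D = fAr L ?q" "icmp ?D = fAr L ?m"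
  by (simp_all add: icat_image_def internal_of_def Let_def)
 have Lpb: "is_pullback E (fAr L ?t) (fAr L ?s) (fAr L ?p) (fAr L ?q)" by (rule L_pullback[OF pb])
 show ?thesis
 proof
  show "is_pullback E (d1 ?D) (d0 ?D) (ip1 ?D) (ip2 ?D)" unfolding sel by (rule Lpb)
  show "icmp ?D : hom E (src (ip1 ?D)) (iAr ?D)" unfolding sel using L_arr[OF m] L_arr[OF p] by (simp add: hom_def)
 next
  fix f T assume f: "f : Arr C" "T : obj"
  show "d0 ?D $ cst (Arr C) f T = cst (Obj C) (Src C f) T" "d1 ?D $ cst (Arr C) f T = cst (Obj C) (Tgt C f) T"
   unfolding sel L_cst[OF s f] L_cst[OF t f] using f by simp_all
 next
  fix c T assume c: "c : Obj C" "T : obj"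
  show "iid ?D $ cst (Obj C) c T = cst (Arr C) (Idn C c) T" unfolding sel L_cst[OF i c] using c by simp
 next
  fix f g T assume h: "f : Arr C" "g : Arr C" "Tgt C f = Src C g" "T : obj"
  note pf = pt_hom[OF sm(2) h(1)] and pg = pt_hom[OF sm(2) h(2)]
  \<comment> \<open>The composable pair \<open>(f, g)\<close>, as an element of the pullback.\<close>
  have "?t $\<^bsub>SetC\<^esub> pt f (Arr C) = ?s $\<^bsub>SetC\<^esub> pt g (Arr C)"
   unfolding comp_pt[OF t h(1)] comp_pt[OF s h(2)] using h by simp
  moreover have "pt f (Arr C) : Arr SetC" "pt g (Arr C) : Arr SetC" "Src SetC (pt f (Arr C)) = Src SetC (pt g (Arr C))"
   "Tgt SetC (pt f (Arr C)) = Src SetC ?t" "Tgt SetC (pt g (Arr C)) = Src SetC ?s"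
   using pf pg by (simp_all add: hom_def)
  ultimately obtain k where k: "k : Arr SetC" "Src SetC k = Src SetC (pt f (Arr C))" "Tgt SetC k = Src SetC ?p"
   "?p $\<^bsub>SetC\<^esub> k = pt f (Arr C)" "?q $\<^bsub>SetC\<^esub> k = pt g (Arr C)"
   by (elim S.pullback_lift[OF pb, rotated 5])
  have kh: "k : hom SetC {undefined} ?Z" using k pf by (simp add: hom_def pbOb_def)
  let ?z = "app k undefined"
  have zZ: "?z : ?Z" using SetC_app_in[OF kh] by simp
  have zp: "app ?p ?z = f" "app ?q ?z = g"
   using SetC_comp_app[OF kh, of undefined ?p] SetC_comp_app[OF kh, of undefined ?q] k by simp_all
  have "into E (fAr L ?p) (fAr L ?q) (cst (Arr C) f T) (cst (Arr C) g T) = cst ?Z ?z T"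
  proof (rule into_eq[OF Lpb])
   show "fAr L ?p $ cst ?Z ?z T = cst (Arr C) f T" "fAr L ?q $ cst ?Z ?z T = cst (Arr C) g T"
    unfolding L_cst[OF p zZ h(4)] L_cst[OF q zZ h(4)] zp by simp_all
  qed (use cst_arr[OF Z zZ h(4)] L_arr[OF p] in simp_all)
  then show "gcomp E ?D (cst (Arr C) f T) (cst (Arr C) g T) = cst (Arr C) (g $\<^bsub>C\<^esub> f) T"
   unfolding gcomp_def sel using L_cst[OF m zZ h(4)] zp zZ by simp
 qed (use sm L_arr[OF s] L_arr[OF t] L_arr[OF i] in "simp_all add: sel hom_def")
qed


subsection \<open>Actions\<close>

context internal_image
begin

lemma act_on_arr:
 assumes D: "anc D : hom E (tot D) (iOb \<D>)" "act D : hom E (pbOb E (anc D) (d0 \<D>)) (tot D)"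
  and x: "x : arr" "f : arr" "src x = src f" "tgt x = tot D" "tgt f = fOb L (Arr C)" "anc D $ x = d0 \<D> $ f"
 shows "act_on E \<D> D x f : arr" "src (act_on E \<D> D x f) = src x" "tgt (act_on E \<D> D x f) = tot D"
  "k : arr ==> tgt k = src x ==> act_on E \<D> D x f $ k = act_on E \<D> D (x $ k) (f $ k)"
proof -
 have a: "anc D : arr" "src (anc D) = tot D" "tgt (anc D) = fOb L (Obj C)"
  "act D : arr" "src (act D) = pbOb E (anc D) (d0 \<D>)" "tgt (act D) = tot D"
  using D by (auto simp: hom_def carriers)
 have p: "pair E (anc D) (d0 \<D>) x f : arr" "src (pair E (anc D) (d0 \<D>) x f) = src x"
  "tgt (pair E (anc D) (d0 \<D>) x f) = pbOb E (anc D) (d0 \<D>)"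
  using pair_arr[of "anc D" "d0 \<D>" x f] a x by simp_all
 show "act_on E \<D> D x f : arr" "src (act_on E \<D> D x f) = src x" "tgt (act_on E \<D> D x f) = tot D"
  unfolding act_on_def using a p by simp_all
 assume k: "k : arr" "tgt k = src x"
 then have pk: "pair E (anc D) (d0 \<D>) x f $ k = pair E (anc D) (d0 \<D>) (x $ k) (f $ k)"
  by (intro pair_comp) (use a x in simp_all)
 show "act_on E \<D> D x f $ k = act_on E \<D> D (x $ k) (f $ k)"
  unfolding act_on_def pk[symmetric] using a p k by (intro assoc) simp_all
qed

text \<open>A diagram of fibres \<open>G c\<close> over the points, before the laws of an action are known.\<close>

definition prediagram :: "('u, 'u, 'o, 'a) func => ('o, 'a) idiag => ('u => 'a) => bool" where
 "prediagram G D \<kappa> \<longleftrightarrow> anc D : hom E (tot D) (iOb \<D>) & act D : hom E (pbOb E (anc D) (d0 \<D>)) (tot D) &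
   (ALL c : Obj C. \<kappa> c : hom E (fOb G c) (tot D) & is_pullback E (anc D) (fAr L (pt c (Obj C))) (\<kappa> c) (to_pt E L (fOb G c))) &
   (ALL f : Arr C. \<kappa> (Tgt C f) $ fAr G f = act_on E \<D> D (\<kappa> (Src C f)) (fAr L (pt f (Arr C)) $ to_pt E L (fOb G (Src C f))))"

lemma corresponds_prediagram: "corresponds E L C \<D> G D \<kappa> \<longleftrightarrow> prediagram G D \<kappa> & is_idiag E \<D> D"
 unfolding corresponds_def prediagram_def is_idiag_def by blast

context
 fixes G D \<kappa>
 assumes G: "is_functor C E G" and D: "prediagram G D \<kappa>"
begin

lemma D_hom: "anc D : hom E (tot D) (iOb \<D>)" "act D : hom E (pbOb E (anc D) (d0 \<D>)) (tot D)"
 using D by (auto simp: prediagram_def)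

lemma D_arr:
 "anc D : arr" "src (anc D) = tot D" "tgt (anc D) = fOb L (Obj C)"
 "act D : arr" "src (act D) = pbOb E (anc D) (d0 \<D>)" "tgt (act D) = tot D" "tot D : obj"
 "c : Obj C ==> \<kappa> c : arr" "c : Obj C ==> src (\<kappa> c) = fOb G c" "c : Obj C ==> tgt (\<kappa> c) = tot D"
 using D hom_obj[OF D_hom(1)] by (auto simp: prediagram_def hom_def carriers)

lemma D_fibre: "c : Obj C ==> is_pullback E (anc D) (fAr L (pt c (Obj C))) (\<kappa> c) (to_pt E L (fOb G c))"
 using D by (auto simp: prediagram_def)

lemma anc_\<kappa>: "c : Obj C ==> anc D $ \<kappa> c = cst (Obj C) c (fOb G c)"
 using pullback_arr(9)[OF D_fibre] by (simp add: cst_def)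

lemma fibre_lift:
 assumes c: "c : Obj C" and x: "x : arr" "tgt x = tot D" "anc D $ x = cst (Obj C) c (src x)"
 obtains h where "h : arr" "src h = src x" "tgt h = fOb G c" "\<kappa> c $ h = x"
proof -
 have X: "src x : obj" using x by simp
 show thesis
  by (rule pullback_lift[OF D_fibre[OF c], of x "to_pt E L (src x)"])
   (use x X D_arr c L_arr[OF pt_hom[OF small_C(1) c]] that in "simp_all add: cst_def")
qed

lemma fibre_mono:
 assumes c: "c : Obj C" and h: "h : arr" "k : arr" "src h = src k" "tgt h = fOb G c" "tgt k = fOb G c" "\<kappa> c $ h = \<kappa> c $ k"
 shows "h = k"
proof -
 have "fOb G c : obj" using h by (metis src_tgt_obj(2))
 then show ?thesis by (intro pullback_eq[OF D_fibre[OF c] h(1-3)]) (use h D_arr c in simp_all)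
qed

lemma act_cst:
 assumes f: "f : Arr C" and h: "h : arr" "tgt h = fOb G (Src C f)"
 shows "act_on E \<D> D (\<kappa> (Src C f) $ h) (cst (Arr C) f (src h)) = \<kappa> (Tgt C f) $ (fAr G f $ h)"
proof -
 have o: "Src C f : Obj C" "Tgt C f : Obj C" "fOb G (Src C f) : obj" using f functorD(1)[OF G] by auto
 note Gf = functorD(3-5)[OF G f]
 have e: "anc D $ \<kappa> (Src C f) = d0 \<D> $ cst (Arr C) f (fOb G (Src C f))" using anc_\<kappa> cst_d f o by simp
 have "\<kappa> (Tgt C f) $ fAr G f = act_on E \<D> D (\<kappa> (Src C f)) (cst (Arr C) f (fOb G (Src C f)))"
  using D f by (simp add: prediagram_def cst_def)
 moreover have "act_on E \<D> D (\<kappa> (Src C f)) (cst (Arr C) f (fOb G (Src C f))) $ h =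
   act_on E \<D> D (\<kappa> (Src C f) $ h) (cst (Arr C) f (fOb G (Src C f)) $ h)"
  by (rule act_on_arr(4)[OF D_hom _ _ _ _ _ e]) (use D_arr o f h in simp_all)
 ultimately have "(\<kappa> (Tgt C f) $ fAr G f) $ h = act_on E \<D> D (\<kappa> (Src C f) $ h) (cst (Arr C) f (src h))" using f h o by simp
 then show ?thesis using D_arr o Gf h by simp
qed

text \<open>An element \<open>x\<close> and an arrow that is constantly \<open>f\<close> with matching domain: \<open>x\<close> lies in a fibre.\<close>

lemma anc_act:
 assumes x: "x : arr" "f : arr" "src x = src f" "tgt x = tot D" "tgt f = fOb L (Arr C)" "anc D $ x = d0 \<D> $ f"
 shows "anc D $ act_on E \<D> D x f = d1 \<D> $ f"
proof (rule L_cover[OF small_C(2), of f])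
 note a = act_on_arr[OF D_hom x]
 fix \<phi> t assume p: "\<phi> : Arr C" and t: "t : arr" "tgt t = src f" and ft: "f $ t = cst (Arr C) \<phi> (src t)"
 have s: "Src C \<phi> : Obj C" "Tgt C \<phi> : Obj C" using p by auto
 have T: "src t : obj" using t by simp
 have "anc D $ (x $ t) = d0 \<D> $ (f $ t)" using assoc_eq[OF x(6), of t] D_arr x t by simp
 then have "anc D $ (x $ t) = cst (Obj C) (Src C \<phi>) (src (x $ t))" using ft cst_d p T x t by simp
 then obtain h where h: "h : arr" "src h = src (x $ t)" "tgt h = fOb G (Src C \<phi>)" "\<kappa> (Src C \<phi>) $ h = x $ t"
  by (rule fibre_lift[OF s(1), rotated 2]) (use x t in simp_all)
 have "act_on E \<D> D x f $ t = \<kappa> (Tgt C \<phi>) $ (fAr G \<phi> $ h)"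
  using a(4)[OF t(1)] t x h ft act_cst[OF p h(1,3)] by simp
 then have "anc D $ (act_on E \<D> D x f $ t) = cst (Obj C) (Tgt C \<phi>) (src t)"
  using assoc_eq[OF anc_\<kappa>[OF s(2)], of "fAr G \<phi> $ h"] functorD(1,3-5)[OF G] p s h t x D_arr by simp
 also have "\<dots> = d1 \<D> $ (f $ t)" using ft cst_d p T by simp
 finally show "(anc D $ act_on E \<D> D x f) $ t = (d1 \<D> $ f) $ t" using a x t D_arr by simp
qed (use x D_arr act_on_arr[OF D_hom x] in simp_all)

lemma prediagram_is_idiag: "is_idiag E \<D> D"
 unfolding is_idiag_def
proof (intro conjI D_hom ballI impI)
 show "tot D : obj" by (rule D_arr)
 have e: "anc D : arr" "d0 \<D> : arr" "tgt (anc D) = tgt (d0 \<D>)" using D_arr by simp_all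
 have "pair E (anc D) (d0 \<D>) (pb1 E (anc D) (d0 \<D>)) (pb2 E (anc D) (d0 \<D>)) = Idn E (pbOb E (anc D) (d0 \<D>))"
  by (rule pair_eqI[OF e, symmetric]) (use pb_arr[OF e] in simp_all)
 then have "act_on E \<D> D (pb1 E (anc D) (d0 \<D>)) (pb2 E (anc D) (d0 \<D>)) = act D"
  unfolding act_on_def using D_arr by simp
 then show "anc D $ act D = d1 \<D> $ pb2 E (anc D) (d0 \<D>)"
  using anc_act[of "pb1 E (anc D) (d0 \<D>)" "pb2 E (anc D) (d0 \<D>)"] pb_arr[OF e] pb_sq[OF e] D_arr by simp
 \<comment> \<open>The unit law, over a point \<open>c\<close>.\<close>
 have ix: "anc D $ Idn E (tot D) = d0 \<D> $ (iid \<D> $ anc D)"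
 proof (rule L_cover[OF small_C(1), of "anc D"])
  fix c t assume c: "c : Obj C" and t: "t : arr" "tgt t = src (anc D)" and ct: "anc D $ t = cst (Obj C) c (src t)"
  have T: "src t : obj" using t by simp
  show "(anc D $ Idn E (tot D)) $ t = (d0 \<D> $ (iid \<D> $ anc D)) $ t"
   using ct c t T D_arr cst_id cst_d[of "Idn C c"] by simp
 qed (use D_arr in simp_all)
 show "act_on E \<D> D (Idn E (tot D)) (iid \<D> $ anc D) = Idn E (tot D)"
 proof (rule L_cover[OF small_C(1), of "anc D"])
  note a = act_on_arr[OF D_hom _ _ _ _ _ ix]
  fix c t assume c: "c : Obj C" and t: "t : arr" "tgt t = src (anc D)" and ct: "anc D $ t = cst (Obj C) c (src t)"
  have T: "src t : obj" using t by simp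
  obtain h where h: "h : arr" "src h = src t" "tgt h = fOb G c" "\<kappa> c $ h = t"
   by (rule fibre_lift[OF c t(1) _ ct]) (use t D_arr in simp_all)
  have "act_on E \<D> D (Idn E (tot D)) (iid \<D> $ anc D) $ t = act_on E \<D> D t (cst (Arr C) (Idn C c) (src t))"
   using a(4)[of t] t ct c T D_arr cst_id by simp
  also have "\<dots> = \<kappa> c $ (fAr G (Idn C c) $ h)" using act_cst[of "Idn C c" h] h c by simp
  also have "\<dots> = t" using functorD(2)[OF G c] h by simp
  finally show "act_on E \<D> D (Idn E (tot D)) (iid \<D> $ anc D) $ t = Idn E (tot D) $ t" using t D_arr by simp
 qed (use D_arr act_on_arr[OF D_hom _ _ _ _ _ ix] in simp_all)
 fix T x f g
 assume "T : obj" "x : hom E T (tot D)" "f : hom E T (iAr \<D>)" "g : hom E T (iAr \<D>)"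
  and eq: "anc D $ x = d0 \<D> $ f & d1 \<D> $ f = d0 \<D> $ g"
 then have x: "x : arr" "src x = T" "tgt x = tot D" and f: "f : arr" "src f = T" "tgt f = fOb L (Arr C)"
  and g: "g : arr" "src g = T" "tgt g = fOb L (Arr C)" by (auto simp: hom_def carriers)
 have xf: "anc D $ x = d0 \<D> $ f" and fg: "d1 \<D> $ f = d0 \<D> $ g" using eq by auto
 have a: "act_on E \<D> D x f : arr" "src (act_on E \<D> D x f) = T" "tgt (act_on E \<D> D x f) = tot D"
  "!!k. k : arr ==> tgt k = T ==> act_on E \<D> D x f $ k = act_on E \<D> D (x $ k) (f $ k)"
  using act_on_arr[OF D_hom x(1) f(1) _ x(3) f(3) xf] x f by simp_all
 have ag: "anc D $ act_on E \<D> D x f = d0 \<D> $ g" using anc_act[OF x(1) f(1) _ x(3) f(3) xf] x f fg by simp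
 have b: "act_on E \<D> D (act_on E \<D> D x f) g : arr" "src (act_on E \<D> D (act_on E \<D> D x f) g) = T" "tgt (act_on E \<D> D (act_on E \<D> D x f) g) = tot D"
  "!!k. k : arr ==> tgt k = T ==> act_on E \<D> D (act_on E \<D> D x f) g $ k = act_on E \<D> D (act_on E \<D> D x f $ k) (g $ k)"
  using act_on_arr[OF D_hom a(1) g(1) _ a(3) g(3) ag] a g by simp_all
 note gc = gcomp_arr[OF f(1) g(1) _ f(3) g(3) fg]
 have gc': "gcomp E \<D> f g : arr" "src (gcomp E \<D> f g) = T" "tgt (gcomp E \<D> f g) = fOb L (Arr C)"
  "!!k. k : arr ==> tgt k = T ==> gcomp E \<D> f g $ k = gcomp E \<D> (f $ k) (g $ k)"
  using gc f g by simp_all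
 \<comment> \<open>Over constants \<open>f = \<phi>\<close> and \<open>g = \<gamma>\<close> which are not composable the stage is empty.\<close>
 have cover: "v = w" if v: "v : arr" "w : arr" "src v = T" "src w = T" "tgt v = tgt w"
  and eq: "!!\<phi> \<gamma> t. \<phi> : Arr C ==> \<gamma> : Arr C ==> Tgt C \<phi> = Src C \<gamma> ==> t : arr ==> tgt t = T ==>
   f $ t = cst (Arr C) \<phi> (src t) ==> g $ t = cst (Arr C) \<gamma> (src t) ==> v $ t = w $ t" for v w
 proof (rule L_cover[OF small_C(2) f(1,3)])
  fix \<phi> t assume p: "\<phi> : Arr C" and t: "t : arr" "tgt t = src f" and ft: "f $ t = cst (Arr C) \<phi> (src t)"
  show "v $ t = w $ t"
  proof (rule L_cover[OF small_C(2), of "g $ t"])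
   fix \<gamma> s assume q: "\<gamma> : Arr C" and s: "s : arr" "tgt s = src (g $ t)" and gs: "(g $ t) $ s = cst (Arr C) \<gamma> (src s)"
   have st: "tgt s = src t" using s t g f by simp
   have S: "src s : obj" using s by simp
   have fts: "f $ (t $ s) = cst (Arr C) \<phi> (src s)" using assoc_eq[OF ft, of s] f t s st p by simp
   have gts: "g $ (t $ s) = cst (Arr C) \<gamma> (src s)" using gs g t f s st by simp
   have "v $ (t $ s) = w $ (t $ s)"
   proof (cases "Tgt C \<phi> = Src C \<gamma>")
    case True
    then show ?thesis by (rule eq[OF p q]) (use t s st f fts gts in simp_all)
   next
    case False
    have "d1 \<D> $ (f $ (t $ s)) = d0 \<D> $ (g $ (t $ s))" using assoc_eq[OF fg, of "t $ s"] f g t s st by simp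
    then have "cst (Obj C) (Tgt C \<phi>) (src s) = cst (Obj C) (Src C \<gamma>) (src s)"
     unfolding fts gts using cst_d p q S by simp
    then obtain e where e: "e : arr" "src e = src s" "tgt e = fOb L {}"
     by (rule cst_distinct[OF small_C(1) _ _ False S, rotated 2]) (use p q in auto)
    show ?thesis by (rule empty_eq[OF e(1,3)]) (use e v t s st f in simp_all)
   qed
   then show "(v $ t) $ s = (w $ t) $ s" using v t s st f by simp
  qed (use v t f g in simp_all)
 qed (use v f in simp_all)
 have xgc: "anc D $ x = d0 \<D> $ gcomp E \<D> f g"
 proof (rule cover)
  fix \<phi> \<gamma> t assume h: "\<phi> : Arr C" "\<gamma> : Arr C" "Tgt C \<phi> = Src C \<gamma>" "t : arr" "tgt t = T"
   "f $ t = cst (Arr C) \<phi> (src t)" "g $ t = cst (Arr C) \<gamma> (src t)"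
  then have T: "src t : obj" by simp
  have "gcomp E \<D> f g $ t = cst (Arr C) (\<gamma> $\<^bsub>C\<^esub> \<phi>) (src t)" using gc'(4)[OF h(4,5)] h cst_gcomp[OF h(1-3) T] by simp
  then have "d0 \<D> $ (gcomp E \<D> f g $ t) = cst (Obj C) (Src C \<phi>) (src t)" using cst_d[of "\<gamma> $\<^bsub>C\<^esub> \<phi>"] h T by simp
  moreover have "anc D $ (x $ t) = cst (Obj C) (Src C \<phi>) (src t)"
   using assoc_eq[OF xf, of t] D_arr x h cst_d T f by simp
  ultimately show "(anc D $ x) $ t = (d0 \<D> $ gcomp E \<D> f g) $ t" using gc' x D_arr h by simp
 qed (use x gc' D_arr in simp_all)
 have c: "act_on E \<D> D x (gcomp E \<D> f g) : arr" "src (act_on E \<D> D x (gcomp E \<D> f g)) = T" "tgt (act_on E \<D> D x (gcomp E \<D> f g)) = tot D"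
  "!!k. k : arr ==> tgt k = T ==> act_on E \<D> D x (gcomp E \<D> f g) $ k = act_on E \<D> D (x $ k) (gcomp E \<D> f g $ k)"
  using act_on_arr[OF D_hom x(1) gc'(1) _ x(3) gc'(3) xgc] x gc' by simp_all
 show "act_on E \<D> D (act_on E \<D> D x f) g = act_on E \<D> D x (gcomp E \<D> f g)"
 proof (rule cover)
  fix \<phi> \<gamma> t assume h: "\<phi> : Arr C" "\<gamma> : Arr C" "Tgt C \<phi> = Src C \<gamma>" "t : arr" "tgt t = T"
   "f $ t = cst (Arr C) \<phi> (src t)" "g $ t = cst (Arr C) \<gamma> (src t)"
  have T: "src t : obj" using h by simp
  have s: "Src C \<phi> : Obj C" using h by simp
  have "anc D $ (x $ t) = cst (Obj C) (Src C \<phi>) (src (x $ t))"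
   using assoc_eq[OF xf, of t] D_arr x h cst_d T f by simp
  then obtain y where y: "y : arr" "src y = src (x $ t)" "tgt y = fOb G (Src C \<phi>)" "\<kappa> (Src C \<phi>) $ y = x $ t"
   by (rule fibre_lift[OF s, rotated 2]) (use x h in simp_all)
  note Gf = functorD(3-5)[OF G h(1)] and Gg = functorD(3-5)[OF G h(2)]
  have yt: "src y = src t" using y x h by simp
  have 1: "act_on E \<D> D x f $ t = \<kappa> (Src C \<gamma>) $ (fAr G \<phi> $ y)"
   using a(4)[OF h(4,5)] h(6) act_cst[OF h(1) y(1,3)] y(4) yt h(3) by simp
  have "act_on E \<D> D (act_on E \<D> D x f) g $ t = \<kappa> (Tgt C \<gamma>) $ (fAr G \<gamma> $ (fAr G \<phi> $ y))"
   unfolding b(4)[OF h(4,5)] 1 h(7) using act_cst[OF h(2), of "fAr G \<phi> $ y"] Gf y yt h(3) by simp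
  moreover have "gcomp E \<D> f g $ t = cst (Arr C) (\<gamma> $\<^bsub>C\<^esub> \<phi>) (src t)" using gc'(4)[OF h(4,5)] h cst_gcomp[OF h(1-3) T] by simp
  then have "act_on E \<D> D x (gcomp E \<D> f g) $ t = \<kappa> (Tgt C \<gamma>) $ (fAr G (\<gamma> $\<^bsub>C\<^esub> \<phi>) $ y)"
   unfolding c(4)[OF h(4,5)] using act_cst[of "\<gamma> $\<^bsub>C\<^esub> \<phi>" y] y yt h(1-3) by simp
  moreover have "fAr G (\<gamma> $\<^bsub>C\<^esub> \<phi>) $ y = fAr G \<gamma> $ (fAr G \<phi> $ y)"
   using functorD(6)[OF G h(1-3)] Gf Gg y h(3) by simp
  ultimately show "act_on E \<D> D (act_on E \<D> D x f) g $ t = act_on E \<D> D x (gcomp E \<D> f g) $ t" by simp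
 qed (use b c in simp_all)
qed

end

text \<open>The diagram of a functor \<open>G\<close> is \<open>\<Sum>\<^sub>c G c\<close>, with the action assembled from the \<open>G f\<close>.\<close>

lemma diagram_exists:
 assumes G: "is_functor C E G"
 shows "EX D \<kappa>. corresponds E L C \<D> G D \<kappa>"
proof -
 have Go: "fOb G c : obj" if "c : Obj C" for c using functorD(1)[OF G that] .
 have "glue_spans E (Obj C) (fOb G) {}" using Go by (simp add: glue_spans_def)
 then obtain Q \<kappa> where Q: "is_gluing E (Obj C) (fOb G) {} Q \<kappa>" using gluing_ex small_C(1) by blast
 note k = coproduct_cocone[OF Q]
 obtain p where p: "p : arr" "src p = Q" "tgt p = fOb L (Obj C)" "!!c. c : Obj C ==> p $ \<kappa> c = cst (Obj C) c (fOb G c)"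
  by (rule coproduct_induce[OF Q, of "fOb L (Obj C)" "%c. cst (Obj C) c (fOb G c)"])
   (use Go src_tgt_obj[OF d_arr(1)] in simp_all)
 have fib: "is_pullback E p (fAr L (pt c (Obj C))) (\<kappa> c) (to_pt E L (fOb G c))" if "c : Obj C" for c
  by (rule summand_is_fibre[OF small_C(1) Q p that])
 let ?A = "pbOb E p (d0 \<D>)" and ?p1 = "pb1 E p (d0 \<D>)" and ?p2 = "pb2 E p (d0 \<D>)"
 have pd: "p : arr" "d0 \<D> : arr" "tgt p = tgt (d0 \<D>)" using p by simp_all
 note A = pb_arr[OF pd]
 \<comment> \<open>The object on which the action is to be defined is the coproduct over all arrows \<open>f\<close> of \<open>G (Src f)\<close>.\<close>
 let ?e = "%f. pair E p (d0 \<D>) (\<kappa> (Src C f)) (cst (Arr C) f (fOb G (Src C f)))"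
 have e: "?e f : arr" "src (?e f) = fOb G (Src C f)" "tgt (?e f) = ?A"
   "?p1 $ ?e f = \<kappa> (Src C f)" "?p2 $ ?e f = cst (Arr C) f (fOb G (Src C f))" if f: "f : Arr C" for f
  using pair_arr[OF pd, of "\<kappa> (Src C f)" "cst (Arr C) f (fOb G (Src C f))"] k p f Go cst_d by simp_all
 have sq: "is_pullback E ?p2 (fAr L (pt f (Arr C))) (?e f) (to_pt E L (fOb G (Src C f)))" if f: "f : Arr C" for f
 proof -
  note Lf = L_arr[OF pt_hom[OF small_C(2) f]]
  have s: "Src C f : Obj C" using f by simp
  note F = fib[OF s] and ks = k(2-4)[OF s]
  show ?thesis
  proof (rule pullbackI)
   show "?p2 $ ?e f = fAr L (pt f (Arr C)) $ to_pt E L (fOb G (Src C f))" using e[OF f] by (simp add: cst_def)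
  next
   fix u v assume u: "u : arr" "v : arr" "src u = src v" "tgt u = src ?p2" "tgt v = src (fAr L (pt f (Arr C)))"
    "?p2 $ u = fAr L (pt f (Arr C)) $ v"
   have T: "src u : obj" using u by simp
   have v: "v = to_pt E L (src u)" using to_pt_unique[OF u(2)] u Lf by simp
   then have pu: "?p2 $ u = cst (Arr C) f (src u)" using u by (simp add: cst_def)
   have "p $ (?p1 $ u) = d0 \<D> $ (?p2 $ u)" by (rule pb_sq_comp[OF pd u(1)]) (use u(4) A in simp)
   then have pp: "p $ (?p1 $ u) = cst (Obj C) (Src C f) (src u)" unfolding pu using cst_d f T by simp
   obtain h where h: "h : arr" "src h = src (?p1 $ u)" "tgt h = src (\<kappa> (Src C f))" "\<kappa> (Src C f) $ h = ?p1 $ u"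
    by (rule pullback_lift[OF F, of "?p1 $ u" "to_pt E L (src u)"])
     (use u(1,4) pp A p T L_arr[OF pt_hom[OF small_C(1) s]] in "simp_all add: cst_def")
   then have h: "h : arr" "src h = src u" "tgt h = fOb G (Src C f)" "\<kappa> (Src C f) $ h = ?p1 $ u"
    using u(1,4) A ks by simp_all
   have "?e f $ h = u"
    by (rule pb_eqI[OF pd]) (use e[OF f] h u(1,4) A pu f Go s assoc_eq[OF e(4)[OF f], of h] assoc_eq[OF e(5)[OF f], of h] in simp_all)
   then show "EX h :arr. src h = src u & tgt h = src (?e f) & ?e f $ h = u & to_pt E L (fOb G (Src C f)) $ h = v"
    using h v e[OF f] by (intro bexI[of _ h]) simp_all
  next
   fix h l assume h: "h : arr" "l : arr" "src h = src l" "tgt h = src (?e f)" "tgt l = src (?e f)" "?e f $ h = ?e f $ l"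
   have hl: "tgt h = fOb G (Src C f)" "tgt l = fOb G (Src C f)" using h e[OF f] by simp_all
   have "?p1 $ (?e f $ h) = ?p1 $ (?e f $ l)" using h(6) by simp
   then have "\<kappa> (Src C f) $ h = \<kappa> (Src C f) $ l"
    using assoc_eq[OF e(4)[OF f], of h] assoc_eq[OF e(4)[OF f], of l] h hl e[OF f] A by simp
   then show "h = l" by (intro pullback_eq[OF F h(1-3)]) (use hl ks h Go s in simp_all)
  qed (use e[OF f] A f Go Lf s in simp_all)
 qed
 have coA: "is_gluing E (Arr C) (%f. src (?e f)) {} (src ?p2) ?e"
  by (rule fibres_coproduct[OF small_C(2) _ _ sq]) (use A in simp_all)
 obtain a where a: "a : arr" "src a = src ?p2" "tgt a = Q" "!!f. f : Arr C ==> a $ ?e f = \<kappa> (Tgt C f) $ fAr G f"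
  by (rule coproduct_induce[OF coA k(1), of "%f. \<kappa> (Tgt C f) $ fAr G f"]) (use k functorD(3-5)[OF G] e in simp_all)
 let ?D = "\<lparr>tot = Q, anc = p, act = a\<rparr>"
 have "prediagram G ?D \<kappa>"
  unfolding prediagram_def act_on_def idiag.simps
 proof (intro conjI ballI)
  show "p : hom E Q (iOb \<D>)" using p by (simp add: hom_def carriers)
  show "a : hom E ?A Q" using a A by (simp add: hom_def)
  fix c assume c: "c : Obj C"
  show "\<kappa> c : hom E (fOb G c) Q" using k c by (simp add: hom_def)
  show "is_pullback E p (fAr L (pt c (Obj C))) (\<kappa> c) (to_pt E L (fOb G c))" by (rule fib[OF c])
 next
  fix f assume f: "f : Arr C"
  show "\<kappa> (Tgt C f) $ fAr G f = a $ pair E p (d0 \<D>) (\<kappa> (Src C f)) (fAr L (pt f (Arr C)) $ to_pt E L (fOb G (Src C f)))"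
   using a(4)[OF f] unfolding cst_def by (rule sym)
 qed
 then have "corresponds E L C \<D> G ?D \<kappa>" using prediagram_is_idiag[OF G] corresponds_prediagram by simp
 then show ?thesis by (intro exI)
qed


text \<open>Natural transformations induce maps of diagrams, fibrewise.\<close>

lemma diagram_map_exists:
 assumes G: "is_functor C E G" "is_functor C E G'" and D: "corresponds E L C \<D> G D \<kappa>" "corresponds E L C \<D> G' D' \<kappa>'"
  and \<alpha>: "is_nat C E G G' \<alpha>"
 shows "EX a. corresponding_map E C \<D> \<alpha> D \<kappa> D' \<kappa>' a"
proof -
 have P: "prediagram G D \<kappa>" "prediagram G' D' \<kappa>'" using D corresponds_prediagram by auto
 note A = D_arr[OF G(1) P(1)] and B = D_arr[OF G(2) P(2)]
 have Q: "is_gluing E (Obj C) (%c. src (\<kappa> c)) {} (src (anc D)) \<kappa>"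
  by (rule fibres_coproduct[OF small_C(1) A(1,3) D_fibre[OF G(1) P(1)]])
 have \<alpha>a: "\<alpha> c : arr" "src (\<alpha> c) = fOb G c" "tgt (\<alpha> c) = fOb G' c" if "c : Obj C" for c
  using \<alpha> that by (auto simp: is_nat_def hom_def)
 have \<alpha>n: "\<alpha> (Tgt C f) $ fAr G f = fAr G' f $ \<alpha> (Src C f)" if "f : Arr C" for f
  using \<alpha> that by (auto simp: is_nat_def)
 obtain a where a: "a : arr" "src a = src (anc D)" "tgt a = tot D'" "!!c. c : Obj C ==> a $ \<kappa> c = \<kappa>' c $ \<alpha> c"
  by (rule coproduct_induce[OF Q B(7), of "%c. \<kappa>' c $ \<alpha> c"]) (use A B \<alpha>a in simp_all)
 have anc: "anc D' $ a = anc D"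
 proof (rule coproduct_eq[OF Q])
  fix c assume c: "c : Obj C"
  show "(anc D' $ a) $ \<kappa> c = anc D $ \<kappa> c"
   using a c A B \<alpha>a assoc_eq[OF anc_\<kappa>[OF G(2) P(2) c], of "\<alpha> c"] anc_\<kappa>[OF G(1) P(1) c] functorD(1)[OF G(2) c] by simp
 qed (use a A B in simp_all)
 let ?p1 = "pb1 E (anc D) (d0 \<D>)" and ?p2 = "pb2 E (anc D) (d0 \<D>)"
 have pd: "anc D : arr" "d0 \<D> : arr" "tgt (anc D) = tgt (d0 \<D>)" using A by simp_all
 note pa = pb_arr[OF pd]
 have ap: "anc D' $ (a $ ?p1) = d0 \<D> $ ?p2"
  using assoc_eq[OF anc, of ?p1] a A B pa pb_sq[OF pd] by simp
 have ao: "act_on E \<D> D' (a $ ?p1) ?p2 : arr" "src (act_on E \<D> D' (a $ ?p1) ?p2) = pbOb E (anc D) (d0 \<D>)"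
  "tgt (act_on E \<D> D' (a $ ?p1) ?p2) = tot D'"
  "!!k. k : arr ==> tgt k = pbOb E (anc D) (d0 \<D>) ==> act_on E \<D> D' (a $ ?p1) ?p2 $ k = act_on E \<D> D' ((a $ ?p1) $ k) (?p2 $ k)"
  using act_on_arr[OF D_hom[OF G(2) P(2)] _ _ _ _ _ ap] a A pa by simp_all
 have "a $ act D = act_on E \<D> D' (a $ ?p1) ?p2"
 proof (rule L_cover[OF small_C(2), of ?p2])
  fix f t assume f: "f : Arr C" and t: "t : arr" "tgt t = src ?p2" and ft: "?p2 $ t = cst (Arr C) f (src t)"
  have T: "src t : obj" using t by simp
  have s: "Src C f : Obj C" "Tgt C f : Obj C" using f by auto
  note Gf = functorD(3-5)[OF G(1) f] and Gf' = functorD(3-5)[OF G(2) f]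
  have "anc D $ (?p1 $ t) = cst (Obj C) (Src C f) (src (?p1 $ t))"
   using pb_sq_comp[OF pd, of t] t pa ft cst_d f T by simp
  then obtain h where h: "h : arr" "src h = src (?p1 $ t)" "tgt h = fOb G (Src C f)" "\<kappa> (Src C f) $ h = ?p1 $ t"
   by (rule fibre_lift[OF G(1) P(1) s(1), rotated 2]) (use t pa A in simp_all)
  have ht: "src h = src t" using h t pa by simp
  have "act D $ t = act_on E \<D> D (\<kappa> (Src C f) $ h) (cst (Arr C) f (src h))"
   unfolding act_on_def ht h(4) ft[symmetric] using pair_eqI[OF pd t(1), of "?p1 $ t" "?p2 $ t"] t pa by simp
  also have "\<dots> = \<kappa> (Tgt C f) $ (fAr G f $ h)" by (rule act_cst[OF G(1) P(1) f h(1,3)])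
  finally have "a $ (act D $ t) = \<kappa>' (Tgt C f) $ (\<alpha> (Tgt C f) $ (fAr G f $ h))"
   using assoc_eq[OF a(4)[OF s(2)], of "fAr G f $ h"] a A B \<alpha>a Gf h s by simp
  also have "\<dots> = \<kappa>' (Tgt C f) $ (fAr G' f $ (\<alpha> (Src C f) $ h))"
   using assoc_eq[OF \<alpha>n[OF f], of h] \<alpha>a Gf Gf' h s by simp
  also have "\<dots> = act_on E \<D> D' (\<kappa>' (Src C f) $ (\<alpha> (Src C f) $ h)) (cst (Arr C) f (src (\<alpha> (Src C f) $ h)))"
   by (rule act_cst[OF G(2) P(2) f, symmetric]) (use \<alpha>a s h in simp_all)
  also have "\<kappa>' (Src C f) $ (\<alpha> (Src C f) $ h) = a $ (?p1 $ t)"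
   unfolding h(4)[symmetric] using assoc_eq[OF a(4)[OF s(1)], of h] a A B \<alpha>a h s by simp
  finally show "(a $ act D) $ t = act_on E \<D> D' (a $ ?p1) ?p2 $ t"
   using ao(4)[OF t(1)] t pa a A \<alpha>a s h ht ft by simp
 qed (use a A ao pa in simp_all)
 then show ?thesis
  unfolding corresponding_map_def is_idiag_map_def using a anc A by (intro exI[of _ a]) (simp add: hom_def)
qed

end

section \<open>The tensor product of two diagrams\<close>

lemma (in internal_image) idiag_act:
 assumes D: "is_idiag E \<D> D"
  and x: "x : arr" "f : arr" "src x = src f" "tgt x = tot D" "tgt f = fOb L (Arr C)" "anc D $ x = d0 \<D> $ f"
 shows "act_on E \<D> D x f : arr" "src (act_on E \<D> D x f) = src f" "tgt (act_on E \<D> D x f) = tot D"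
  "anc D $ act_on E \<D> D x f = d1 \<D> $ f"
  "k : arr ==> tgt k = src f ==> act_on E \<D> D x f $ k = act_on E \<D> D (x $ k) (f $ k)"
proof -
 have h: "anc D : hom E (tot D) (iOb \<D>)" "act D : hom E (pbOb E (anc D) (d0 \<D>)) (tot D)"
  and e: "anc D $ act D = d1 \<D> $ pb2 E (anc D) (d0 \<D>)" using D by (simp_all add: is_idiag_def)
 note a = act_on_arr[OF h x]
 show "act_on E \<D> D x f : arr" "src (act_on E \<D> D x f) = src f" "tgt (act_on E \<D> D x f) = tot D"
  "k : arr ==> tgt k = src f ==> act_on E \<D> D x f $ k = act_on E \<D> D (x $ k) (f $ k)" using a x(3) by simp_all
 have A: "anc D : arr" "src (anc D) = tot D" "tgt (anc D) = fOb L (Obj C)"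
  "act D : arr" "src (act D) = pbOb E (anc D) (d0 \<D>)" "tgt (act D) = tot D"
  using h by (auto simp: hom_def carriers)
 have pd: "anc D : arr" "d0 \<D> : arr" "tgt (anc D) = tgt (d0 \<D>)" using A by simp_all
 show "anc D $ act_on E \<D> D x f = d1 \<D> $ f"
  unfolding act_on_def using assoc_eq[OF e, of "pair E (anc D) (d0 \<D>) x f"] A x pb_arr[OF pd] pair_arr[OF pd x(1,2,3) _ _ x(6)] by simp
qed

text \<open>
  A covariant diagram \<open>U\<close> and a contravariant diagram \<open>V\<close> over \<open>\<D>\<close>. In terms of generalized
  elements, their tensor product is the quotient of the fibre product of \<open>U\<close> and \<open>V\<close> over the
  object of objects by the relation \<open>(x \<cdot> f, y) \<sim> (x, y \<cdot> f)\<close>.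
\<close>

locale tensor = internal_image E L R C \<D>
 for E :: "('o, 'a) cat" (structure) and L :: "('u::universe set, 'u fn, 'o, 'a) func" and R and C :: "('u, 'u) cat" and \<D> +
 fixes U V :: "('o, 'a) idiag"
 assumes U: "is_idiag E \<D> U" and V: "is_idiag E (iop \<D>) V"

sublocale tensor \<subseteq> op: internal_image E L R "op_cat C" "iop \<D>"
 by (rule internal_image_op)

context tensor
begin

lemma UV_arr [simp]:
 "anc U : arr" "src (anc U) = tot U" "tgt (anc U) = fOb L (Obj C)" "tot U : obj"
 "act U : arr" "src (act U) = pbOb E (anc U) (d0 \<D>)" "tgt (act U) = tot U"
 "anc V : arr" "src (anc V) = tot V" "tgt (anc V) = fOb L (Obj C)" "tot V : obj"
 "act V : arr" "src (act V) = pbOb E (anc V) (d1 \<D>)" "tgt (act V) = tot V"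
 using U V by (auto simp: is_idiag_def hom_def carriers)

abbreviation W :: 'o where "W \<equiv> pbOb E (anc U) (anc V)"
abbreviation prU :: 'a where "prU \<equiv> pb1 E (anc U) (anc V)"
abbreviation prV :: 'a where "prV \<equiv> pb2 E (anc U) (anc V)"
abbreviation pairW :: "'a => 'a => 'a" where "pairW \<equiv> pair E (anc U) (anc V)"
abbreviation actU :: "'a => 'a => 'a" where "actU \<equiv> act_on E \<D> U"
abbreviation actV :: "'a => 'a => 'a" where "actV \<equiv> act_on E (iop \<D>) V"

definition triple :: "'a => 'a => 'a => bool" where
 "triple x f y \<longleftrightarrow> x : arr & f : arr & y : arr & src x = src f & src y = src f &
   tgt x = tot U & tgt f = fOb L (Arr C) & tgt y = tot V & anc U $ x = d0 \<D> $ f & anc V $ y = d1 \<D> $ f"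

definition actL :: "'a => 'a => 'a => 'a" where
 "actL x f y = pairW (actU x f) y"

definition actR :: "'a => 'a => 'a => 'a" where
 "actR x f y = pairW x (actV y f)"

definition balanced :: "'o => 'a => bool" where
 "balanced Y r \<longleftrightarrow> r : hom E W Y & (ALL x f y. triple x f y --> r $ actL x f y = r $ actR x f y)"

definition is_tensor :: "'o => 'a => bool" where
 "is_tensor Q q \<longleftrightarrow> balanced Q q & (ALL Y r. balanced Y r --> (EX! h. h : hom E Q Y & h $ q = r))"

lemma tripleD:
 assumes "triple x f y"
 shows "x : arr" "f : arr" "y : arr" "src x = src f" "src y = src f"
   "tgt x = tot U" "tgt f = fOb L (Arr C)" "tgt y = tot V" "anc U $ x = d0 \<D> $ f" "anc V $ y = d1 \<D> $ f"
 using assms by (auto simp: triple_def)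

lemma actU_arr:
 assumes "triple x f y"
 shows "actU x f : arr" "src (actU x f) = src f" "tgt (actU x f) = tot U" "anc U $ actU x f = d1 \<D> $ f"
  "k : arr ==> tgt k = src f ==> actU x f $ k = actU (x $ k) (f $ k)"
 using idiag_act[OF U tripleD(1,2,4,6,7,9)[OF assms]] by simp_all

lemma actV_arr:
 assumes "triple x f y"
 shows "actV y f : arr" "src (actV y f) = src f" "tgt (actV y f) = tot V" "anc V $ actV y f = d0 \<D> $ f"
  "k : arr ==> tgt k = src f ==> actV y f $ k = actV (y $ k) (f $ k)"
 using op.idiag_act[OF V, of y f] tripleD[OF assms] by simp_all

lemma W_sq: "anc U : arr" "anc V : arr" "tgt (anc U) = tgt (anc V)"
 by simp_all

lemma W_arr [simp]: "prU : arr" "prV : arr" "src prU = W" "src prV = W" "tgt prU = tot U" "tgt prV = tot V" "W : obj"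
 using pb_arr[OF W_sq] by simp_all

lemma actL_arr:
 assumes t: "triple x f y"
 shows "actL x f y : arr" "src (actL x f y) = src f" "tgt (actL x f y) = W"
  "prU $ actL x f y = actU x f" "prV $ actL x f y = y"
  "k : arr ==> tgt k = src f ==> actL x f y $ k = actL (x $ k) (f $ k) (y $ k)"
proof -
 note a = actU_arr[OF t] and t = tripleD[OF t]
 have e: "anc U $ actU x f = anc V $ y" using a t by simp
 note p = pair_arr[OF W_sq a(1) t(3) _ _ _ e] and c = pair_comp[OF W_sq a(1) t(3) _ _ _ e]
 show "actL x f y : arr" "src (actL x f y) = src f" "tgt (actL x f y) = W"
  "prU $ actL x f y = actU x f" "prV $ actL x f y = y"
  using p a t unfolding actL_def by simp_all
 assume "k : arr" "tgt k = src f"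
 then show "actL x f y $ k = actL (x $ k) (f $ k) (y $ k)"
  using c(1)[of k] a t unfolding actL_def by simp
qed

lemma actR_arr:
 assumes t: "triple x f y"
 shows "actR x f y : arr" "src (actR x f y) = src f" "tgt (actR x f y) = W"
  "prU $ actR x f y = x" "prV $ actR x f y = actV y f"
  "k : arr ==> tgt k = src f ==> actR x f y $ k = actR (x $ k) (f $ k) (y $ k)"
proof -
 note a = actV_arr[OF t] and t = tripleD[OF t]
 have e: "anc U $ x = anc V $ actV y f" using a t by simp
 note p = pair_arr[OF W_sq t(1) a(1) _ _ _ e] and c = pair_comp[OF W_sq t(1) a(1) _ _ _ e]
 show "actR x f y : arr" "src (actR x f y) = src f" "tgt (actR x f y) = W"
  "prU $ actR x f y = x" "prV $ actR x f y = actV y f"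
  using p a t unfolding actR_def by simp_all
 assume "k : arr" "tgt k = src f"
 then show "actR x f y $ k = actR (x $ k) (f $ k) (y $ k)"
  using c(1)[of k] a t unfolding actR_def by simp
qed

lemma triple_comp:
 assumes t: "triple x f y" and k: "k : arr" "tgt k = src f"
 shows "triple (x $ k) (f $ k) (y $ k)"
 using tripleD[OF t] assoc_eq[OF tripleD(9)[OF t], of k] assoc_eq[OF tripleD(10)[OF t], of k] k
 unfolding triple_def by simp

lemma balanced_arr: "balanced Y r ==> r : arr & src r = W & tgt r = Y & Y : obj"
 by (auto simp: balanced_def hom_def)

lemma balancedD: "balanced Y r ==> triple x f y ==> r $ actL x f y = r $ actR x f y"
 by (simp add: balanced_def)

lemma balanced_comp: "balanced Y r ==> h : hom E Y Z ==> balanced Z (h $ r)"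
 using actL_arr actR_arr by (auto simp: balanced_def hom_def)

definition tensor_spans :: "('u \<times> 'a \<times> 'u \<times> 'a) set" where
 "tensor_spans = {(undefined, actL x f y, undefined, actR x f y) |x f y. triple x f y}"

lemma tensor_glue_spans: "glue_spans E {undefined} (%_. W) tensor_spans"
 unfolding glue_spans_def tensor_spans_def using actL_arr actR_arr by auto

lemma balanced_glue_cocone: "glue_cocone E {undefined} (%_. W) tensor_spans Y \<rho> \<longleftrightarrow> balanced Y (\<rho> undefined)"
 unfolding glue_cocone_def balanced_def tensor_spans_def using hom_obj by fastforce

text \<open>
  The relation is generated by all generalized triples, so the quotient is a gluing of the single
  object \<open>W\<close>. It inherits existence and stability from gluings.
\<close>

lemma is_tensor_gluing: "is_tensor Q q \<longleftrightarrow> is_gluing E {undefined} (%_. W) tensor_spans Q (%_. q)"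
proof
 assume "is_tensor Q q"
 then show "is_gluing E {undefined} (%_. W) tensor_spans Q (%_. q)"
  unfolding is_gluing_def is_tensor_def balanced_glue_cocone by simp
next
 assume g: "is_gluing E {undefined} (%_. W) tensor_spans Q (%_. q)"
 have "EX! h. h : hom E Q Y & h $ q = r" if "balanced Y r" for Y r
 proof -
  have "glue_cocone E {undefined} (%_. W) tensor_spans Y (%_. r)" using that by (simp add: balanced_glue_cocone)
  then have "EX! h. h : hom E Q Y & (ALL i : {undefined :: 'u}. h $ q = r)" using g unfolding is_gluing_def by blast
  then show ?thesis by simp
 qed
 then show "is_tensor Q q" using g unfolding is_gluing_def is_tensor_def balanced_glue_cocone by simp
qed

lemma tensor_exists: "EX Q q. is_tensor Q q"
proof -
 obtain Q \<iota> where g: "is_gluing E {undefined :: 'u} (%_. W) tensor_spans Q \<iota>"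
  using gluing_ex[OF tensor_glue_spans] by auto
 have "is_gluing E {undefined :: 'u} (%_. W) tensor_spans Q (%_. \<iota> undefined)"
  using g unfolding is_gluing_def balanced_glue_cocone by simp
 then show ?thesis using is_tensor_gluing by blast
qed

lemma tensor_factor:
 assumes q: "is_tensor Q q" and r: "balanced Y r"
 obtains h where "h : hom E Q Y" "h $ q = r"
 using q r unfolding is_tensor_def by blast

lemma tensor_epi:
 assumes q: "is_tensor Q q" and h: "h : hom E Q Y" "k : hom E Q Y" "h $ q = k $ q"
 shows "h = k"
proof -
 have "balanced Q q" using q by (simp add: is_tensor_def)
 then have "balanced Y (h $ q)" using h(1) by (rule balanced_comp)
 then have "EX! l. l : hom E Q Y & l $ q = h $ q" using q unfolding is_tensor_def by blast
 then show ?thesis using h by auto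
qed

lemma tensor_unique:
 assumes q: "is_tensor Q q" and q': "is_tensor Q' q'"
 obtains m where "is_iso E Q Q' m" "m $ q = q'"
proof -
 have b: "balanced Q q" "balanced Q' q'" using q q' by (auto simp: is_tensor_def)
 note a = balanced_arr[OF b(1)] balanced_arr[OF b(2)]
 obtain m where m: "m : hom E Q Q'" "m $ q = q'" using tensor_factor[OF q b(2)] .
 obtain n where n: "n : hom E Q' Q" "n $ q' = q" using tensor_factor[OF q' b(1)] .
 have "n $ m = Idn E Q"
  by (rule tensor_epi[OF q, of _ Q]) (use m n a in "simp_all add: hom_def")
 moreover have "m $ n = Idn E Q'"
  by (rule tensor_epi[OF q', of _ Q']) (use m n a in "simp_all add: hom_def")
 ultimately show thesis using that m n unfolding is_iso_def by blast
qed


subsection \<open>Internal colimits\<close>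

text \<open>
  The tensor product is the coequalizer of any pair of arrows that is a generic instance of the
  relation.
\<close>

lemma generic_coequalizer:
 assumes t: "triple x f y"
  and gen: "!!x' f' y'. triple x' f' y' ==> EX k : arr. tgt k = src f & x $ k = x' & f $ k = f' & y $ k = y'"
 shows "is_coequalizer E (actL x f y) (actR x f y) Q q \<longleftrightarrow> is_tensor Q q"
proof -
 note l = actL_arr[OF t] and r = actR_arr[OF t]
 have bal: "balanced Y h \<longleftrightarrow> h : hom E W Y & h $ actL x f y = h $ actR x f y" for Y h
 proof
  assume "balanced Y h"
  then show "h : hom E W Y & h $ actL x f y = h $ actR x f y" using t by (simp add: balanced_def)
 next
  assume h: "h : hom E W Y & h $ actL x f y = h $ actR x f y"
  then have ha: "h : arr" "src h = W" and e: "h $ actL x f y = h $ actR x f y" by (auto simp: hom_def)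
  have "h $ actL x' f' y' = h $ actR x' f' y'" if t': "triple x' f' y'" for x' f' y'
  proof -
   obtain k where k: "k : arr" "tgt k = src f" "x $ k = x'" "f $ k = f'" "y $ k = y'" using gen[OF t'] by blast
   have "(h $ actL x f y) $ k = (h $ actR x f y) $ k" using e by simp
   then show ?thesis using l r k ha by simp
  qed
  then show "balanced Y h" using h by (simp add: balanced_def)
 qed
 have ob: "h : hom E W Y ==> tgt h = Y & src h = W & h : arr" for h Y by (simp add: hom_def)
 show ?thesis
 proof
  assume c: "is_coequalizer E (actL x f y) (actR x f y) Q q"
  have U: "EX! k. k : hom E Q Y & k $ q = h" if "balanced Y h" for Y h
  proof -
   have "h : arr & src h = tgt (actL x f y) & h $ actL x f y = h $ actR x f y" and Y: "tgt h = Y"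
    using that bal[of Y h] ob[of h Y] l by auto
   then have "EX! k. k : hom E Q (tgt h) & k $ q = h" using c unfolding is_coequalizer_def by blast
   then show ?thesis using Y by simp
  qed
  have "balanced Q q" unfolding bal using c l by (simp add: is_coequalizer_def)
  then show "is_tensor Q q" unfolding is_tensor_def using U by simp
 next
  assume q: "is_tensor Q q"
  have U: "EX! k. k : hom E Q (tgt h) & k $ q = h"
   if "h : arr" "src h = tgt (actL x f y)" "h $ actL x f y = h $ actR x f y" for h
  proof -
   have "balanced (tgt h) h" unfolding bal using that l by (simp add: hom_def)
   then show ?thesis using q unfolding is_tensor_def by blast
  qed
  have "balanced Q q" using q by (simp add: is_tensor_def)
  then show "is_coequalizer E (actL x f y) (actR x f y) Q q"
   unfolding is_coequalizer_def bal using l r U by (simp add: hom_def)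
 qed
qed

text \<open>
  The arrows of the category of elements of the composite diagram are pairs of an element of \<open>W\<close> and
  an arrow of the category of elements of \<open>U\<close> into its first component, which is the generic triple.
\<close>

lemma intF_tensor:
 "is_internal_colim E (int_f E (iop \<D>) U)
   (idiag_comp E (int_f E (iop \<D>) U) (iop \<D>) V (proj_f E (iop \<D>) U)) Q q \<longleftrightarrow> is_tensor Q q"
proof -
 let ?A = "pbOb E (anc U) (d0 \<D>)" and ?p1 = "pb1 E (anc U) (d0 \<D>)" and ?p2 = "pb2 E (anc U) (d0 \<D>)"
 let ?r1 = "pb1 E prU (act U)" and ?r2 = "pb2 E prU (act U)"
 have pd: "anc U : arr" "d0 \<D> : arr" "tgt (anc U) = tgt (d0 \<D>)" by simp_all
 note A = pb_arr[OF pd]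
 have rd: "prU : arr" "act U : arr" "tgt prU = tgt (act U)" by simp_all
 note r = pb_arr[OF rd]
 have anc_act: "anc U $ act U = d1 \<D> $ ?p2" using U by (simp add: is_idiag_def)
 have sel: "anc (idiag_comp E (int_f E (iop \<D>) U) (iop \<D>) V (proj_f E (iop \<D>) U)) = prU"
  "d0 (int_f E (iop \<D>) U) = act U"
  "act (idiag_comp E (int_f E (iop \<D>) U) (iop \<D>) V (proj_f E (iop \<D>) U)) =
    pairW (?p1 $ ?r2) (actV (prV $ ?r1) (?p2 $ ?r2))"
  by (simp_all add: idiag_comp_def int_f_def proj_f_def proj_opf_def int_opf_def Let_def)
 let ?x = "?p1 $ ?r2" and ?f = "?p2 $ ?r2" and ?y = "prV $ ?r1"
 have t: "triple ?x ?f ?y"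
 proof -
  have "anc V $ (prV $ ?r1) = anc U $ (prU $ ?r1)" using pb_sq_comp[OF W_sq, of ?r1] r by simp
  also have "\<dots> = anc U $ (act U $ ?r2)" using pb_sq[OF rd] by simp
  also have "\<dots> = d1 \<D> $ (?p2 $ ?r2)" using assoc_eq[OF anc_act, of ?r2] r A by simp
  finally show ?thesis unfolding triple_def using pb_sq_comp[OF pd, of ?r2] r A by simp
 qed
 have "actU ?x ?f = act U $ ?r2"
  unfolding act_on_def using pair_eqI[OF pd r(2), of ?x ?f] r by simp
 then have aL: "actL ?x ?f ?y = ?r1"
  unfolding actL_def using pair_eqI[OF W_sq r(1), of "act U $ ?r2" ?y] r pb_sq[OF rd] by simp
 have aR: "actR ?x ?f ?y = pairW (?p1 $ ?r2) (actV (prV $ ?r1) (?p2 $ ?r2))" by (simp add: actR_def)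
 have "EX k : arr. tgt k = src ?f & ?x $ k = x & ?f $ k = f & ?y $ k = y" if t': "triple x f y" for x f y
 proof -
  note l = actL_arr[OF t'] and td = tripleD[OF t']
  have p: "pair E (anc U) (d0 \<D>) x f : arr" "src (pair E (anc U) (d0 \<D>) x f) = src f"
   "tgt (pair E (anc U) (d0 \<D>) x f) = pbOb E (anc U) (d0 \<D>)"
   "?p1 $ pair E (anc U) (d0 \<D>) x f = x" "?p2 $ pair E (anc U) (d0 \<D>) x f = f"
   using pair_arr[OF pd td(1,2,4) _ _ td(9)] td(4,6,7) by simp_all
  let ?k = "pair E prU (act U) (actL x f y) (pair E (anc U) (d0 \<D>) x f)"
  have e: "prU $ actL x f y = act U $ pair E (anc U) (d0 \<D>) x f" using l by (simp add: act_on_def)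
  have k: "?k : arr" "tgt ?k = pbOb E prU (act U)" "?r1 $ ?k = actL x f y" "?r2 $ ?k = pair E (anc U) (d0 \<D>) x f"
   using pair_arr[OF rd l(1) p(1) _ _ _ e] l(2,3) p(2,3) by simp_all
  have "?x $ ?k = ?p1 $ (?r2 $ ?k)" "?f $ ?k = ?p2 $ (?r2 $ ?k)" "?y $ ?k = prV $ (?r1 $ ?k)"
   by (rule assoc; simp add: k(1,2) r A)+
  then have "?x $ ?k = x" "?f $ ?k = f" "?y $ ?k = y" unfolding k(3,4) by (simp_all only: p(4,5) l(5))
  moreover have "tgt ?k = src ?f" using k(2) r A by simp
  ultimately show ?thesis using k(1) by blast
 qed
 from generic_coequalizer[OF t this, of Q q] show ?thesis
  unfolding is_internal_colim_def aL aR by (simp add: int_opf_def[of E "int_f E (iop \<D>) U"] Let_def sel)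
qed

end


text \<open>Exchanging the two factors, and passing to opposites, gives the same tensor product.\<close>

lemma (in tensor) tensor_op: "tensor E L R (op_cat C) (iop \<D>) V U"
 by unfold_locales (use U V in simp_all)

context tensor
begin

definition swap :: 'a where
 "swap = pair E (anc V) (anc U) prV prU"

lemma swap_arr:
 "swap : arr" "src swap = W" "tgt swap = pbOb E (anc V) (anc U)"
 "pb1 E (anc V) (anc U) $ swap = prV" "pb2 E (anc V) (anc U) $ swap = prU"
 unfolding swap_def using pair_arr[of "anc V" "anc U" prV prU] pb_sq[OF W_sq] by simp_all

lemma swap_tensor:
 "q : hom E (pbOb E (anc V) (anc U)) Q ==> tensor.is_tensor E L (op_cat C) (iop \<D>) V U Q q \<longleftrightarrow> is_tensor Q (q $ swap)"
proof -
 interpret T: tensor E L R "op_cat C" "iop \<D>" V U by (rule tensor_op)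
 note s = swap_arr and s' = T.swap_arr
 have WT: "T.W = pbOb E (anc V) (anc U)" ..
 have ss: "T.swap $ swap = Idn E W"
  by (rule pb_eqI[OF W_sq]) (use s s' assoc_eq[OF s'(4), of swap] assoc_eq[OF s'(5), of swap] in simp_all)
 have ss': "swap $ T.swap = Idn E T.W"
  by (rule pb_eqI[OF T.W_sq]) (use s s' assoc_eq[OF s(4), of T.swap] assoc_eq[OF s(5), of T.swap] in simp_all)
 have tr: "T.triple y f x \<longleftrightarrow> triple x f y" for x f y
  unfolding T.triple_def triple_def by auto
 have l: "T.actL y f x = swap $ actR x f y" if t: "triple x f y" for x f y
 proof -
  note r = actR_arr[OF t]
  show ?thesis unfolding T.actL_def
   by (rule pair_eqI[symmetric]) (use r s assoc_eq[OF s(4), of "actR x f y"] assoc_eq[OF s(5), of "actR x f y"] in simp_all)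
 qed
 have r: "T.actR y f x = swap $ actL x f y" if t: "triple x f y" for x f y
 proof -
  note r = actL_arr[OF t]
  show ?thesis unfolding T.actR_def
   by (rule pair_eqI[symmetric]) (use r s assoc_eq[OF s(4), of "actL x f y"] assoc_eq[OF s(5), of "actL x f y"] in simp_all)
 qed
 have bal: "T.balanced Y r \<longleftrightarrow> balanced Y (r $ swap)" if "r : hom E T.W Y" for Y r
  unfolding T.balanced_def balanced_def tr using that l r s actL_arr actR_arr by (auto simp: hom_def)
 have un: "r = (r $ T.swap) $ swap" if "r : hom E W Y" for r Y
  using that ss s s' by (simp add: hom_def)
 have un': "r = (r $ swap) $ T.swap" if "r : hom E T.W Y" for r Y
  using that ss' s s' by (simp add: hom_def)
 assume q: "q : hom E (pbOb E (anc V) (anc U)) Q"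
 show ?thesis
 proof
  assume t: "T.is_tensor Q q"
  have "EX! h. h : hom E Q Y & h $ (q $ swap) = r" if b: "balanced Y r" for Y r
  proof -
   have rh: "r : hom E W Y" using b by (simp add: balanced_def)
   have rs: "r $ T.swap : hom E T.W Y" using rh s' by (simp add: hom_def)
   then have "T.balanced Y (r $ T.swap)" using bal[OF rs] un[OF rh] b by simp
   then have "EX! h. h : hom E Q Y & h $ q = r $ T.swap" using t unfolding T.is_tensor_def by blast
   moreover have "h $ q = r $ T.swap \<longleftrightarrow> h $ (q $ swap) = r" if h: "h : hom E Q Y" for h
   proof
    assume "h $ q = r $ T.swap"
    then have "(h $ q) $ swap = r" using un[OF rh] by simp
    then show "h $ (q $ swap) = r" using h q s by (simp add: hom_def)
   next
    assume e: "h $ (q $ swap) = r"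
    have "h $ q = ((h $ q) $ swap) $ T.swap" using un'[of "h $ q" Y] h q by (simp add: hom_def)
    then show "h $ q = r $ T.swap" using e h q s by (simp add: hom_def)
   qed
   ultimately show ?thesis by (metis (no_types, lifting))
  qed
  then show "is_tensor Q (q $ swap)" using t bal[OF q] unfolding is_tensor_def T.is_tensor_def by blast
 next
  assume t: "is_tensor Q (q $ swap)"
  have "EX! h. h : hom E Q Y & h $ q = r" if b: "T.balanced Y r" for Y r
  proof -
   have rh: "r : hom E T.W Y" using b by (simp add: T.balanced_def)
   have "EX! h. h : hom E Q Y & h $ (q $ swap) = r $ swap" using t bal[OF rh] b unfolding is_tensor_def by blast
   moreover have "h $ q = r \<longleftrightarrow> h $ (q $ swap) = r $ swap" if h: "h : hom E Q Y" for h
   proof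
    assume "h $ q = r"
    then show "h $ (q $ swap) = r $ swap" using h q s by (auto simp: hom_def)
   next
    assume e: "h $ (q $ swap) = r $ swap"
    have "h $ q = ((h $ q) $ swap) $ T.swap" using un'[of "h $ q" Y] h q by (simp add: hom_def)
    also have "(h $ q) $ swap = r $ swap" using e h q s by (simp add: hom_def)
    finally show "h $ q = r" using un'[OF rh] by simp
   qed
   ultimately show ?thesis by (metis (no_types, lifting))
  qed
  then show "T.is_tensor Q q" using t bal[OF q] unfolding is_tensor_def T.is_tensor_def by blast
 qed
qed

lemma intP_tensor:
 assumes "q : hom E (pbOb E (anc V) (anc U)) Q"
 shows "is_internal_colim E (int_f E \<D> V) (idiag_comp E (int_f E \<D> V) \<D> U (proj_f E \<D> V)) Q q \<longleftrightarrow> is_tensor Q (q $ swap)"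
 using tensor.intF_tensor[OF tensor_op, of Q q] swap_tensor[OF assms] by simp

lemma intP_hom:
 assumes "is_internal_colim E (int_f E \<D> V) (idiag_comp E (int_f E \<D> V) \<D> U (proj_f E \<D> V)) Q q"
 shows "q : hom E (pbOb E (anc V) (anc U)) Q"
proof -
 interpret T: tensor E L R "op_cat C" "iop \<D>" V U by (rule tensor_op)
 have "T.is_tensor Q q" using T.intF_tensor[of Q q] assms by simp
 then show ?thesis by (simp add: T.is_tensor_def T.balanced_def)
qed

end

section \<open>The colimit over the category of elements\<close>

lemma (in topos) fcomp_L_functor:
 assumes P: "is_functor C SetC P"
 shows "is_functor C E (fcomp L P)"
proof -
 have s: "fAr P f : hom SetC (fOb P (Src C f)) (fOb P (Tgt C f))" if "f : Arr C" for f
  using P that by (simp add: is_functor_def)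
 show ?thesis
  unfolding is_functor_def fcomp_def func.simps
 proof (intro conjI ballI impI)
  fix x assume x: "x : Obj C"
  then have "fOb P x : Obj SetC" by (rule functorD(1)[OF P])
  then show "fOb L (fOb P x) : obj" "fAr L (fAr P (Idn C x)) = Idn E (fOb L (fOb P x))"
   using functorD(1,2)[OF L_functor] functorD(2)[OF P x] by simp_all
 next
  fix f assume "f : Arr C"
  then show "fAr L (fAr P f) : hom E (fOb L (fOb P (Src C f))) (fOb L (fOb P (Tgt C f)))"
   using L_arr[OF s] by (simp add: hom_def)
 next
  fix f g assume h: "f : Arr C" "g : Arr C" "Tgt C f = Src C g"
  then show "fAr L (fAr P (g $\<^bsub>C\<^esub> f)) = fAr L (fAr P g) $ fAr L (fAr P f)"
   using functorD(6)[OF P h] L_comp[OF s[OF h(1)], of "fAr P g"] s[OF h(2)] by simp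
 qed
qed

locale functor_tensor = internal_image E L R C \<D>
 for E :: "('o, 'a) cat" (structure) and L :: "('u::universe set, 'u fn, 'o, 'a) func" and R and C :: "('u, 'u) cat" and \<D> +
 fixes F :: "('u, 'u, 'o, 'a) func" and P :: "('u, 'u, 'u set, 'u fn) func"
  and U V :: "('o, 'a) idiag" and \<kappa>U \<kappa>V :: "'u => 'a"
 assumes F: "is_functor (op_cat C) E F" and P: "is_functor C SetC P"
  and corrU: "corresponds E L C \<D> (fcomp L P) U \<kappa>U" and corrV: "corresponds E L (op_cat C) (iop \<D>) F V \<kappa>V"

sublocale functor_tensor \<subseteq> tensor
 by unfold_locales (use corrU corrV in "simp_all add: corresponds_def")

context functor_tensor
begin

lemma LP: "is_functor C E (fcomp L P)"
 by (rule fcomp_L_functor[OF P])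

lemma preU: "prediagram (fcomp L P) U \<kappa>U" and preV: "op.prediagram F V \<kappa>V"
 using corrU corrV corresponds_prediagram op.corresponds_prediagram by auto

lemma P_small: "c : Obj C ==> small (fOb P c)"
 using functorD(1)[OF P] by simp

lemma P_hom: "f : Arr C ==> fAr P f : hom SetC (fOb P (Src C f)) (fOb P (Tgt C f))"
 using P by (simp add: is_functor_def)

lemma P_in: "f : Arr C ==> x : fOb P (Src C f) ==> app (fAr P f) x : fOb P (Tgt C f)"
 using SetC_app_in[OF P_hom] .

lemma F_arr [simp]:
 "c : Obj C ==> fOb F c : obj" "f : Arr C ==> fAr F f : arr"
 "f : Arr C ==> src (fAr F f) = fOb F (Tgt C f)" "f : Arr C ==> tgt (fAr F f) = fOb F (Src C f)"
 using functorD(1,3-5)[OF F] by simp_all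

lemma \<kappa>U_arr [simp]: "c : Obj C ==> \<kappa>U c : arr" "c : Obj C ==> src (\<kappa>U c) = fOb L (fOb P c)" "c : Obj C ==> tgt (\<kappa>U c) = tot U"
 using D_arr(8-10)[OF LP preU] by (simp_all add: fcomp_def)

lemma \<kappa>V_arr [simp]: "c : Obj C ==> \<kappa>V c : arr" "c : Obj C ==> src (\<kappa>V c) = fOb F c" "c : Obj C ==> tgt (\<kappa>V c) = tot V"
 using op.D_arr(8-10)[OF F preV] by simp_all

lemma anc_\<kappa>U: "c : Obj C ==> anc U $ \<kappa>U c = cst (Obj C) c (fOb L (fOb P c))"
 using anc_\<kappa>[OF LP preU] by (simp add: fcomp_def)

lemma anc_\<kappa>V: "c : Obj C ==> anc V $ \<kappa>V c = cst (Obj C) c (fOb F c)"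
 using op.anc_\<kappa>[OF F preV] by simp

lemma cstP [simp]:
 "c : Obj C ==> x : fOb P c ==> T : obj ==> cst (fOb P c) x T : arr"
 "c : Obj C ==> x : fOb P c ==> T : obj ==> src (cst (fOb P c) x T) = T"
 "c : Obj C ==> x : fOb P c ==> T : obj ==> tgt (cst (fOb P c) x T) = fOb L (fOb P c)"
 "c : Obj C ==> x : fOb P c ==> k : arr ==> tgt k = T ==> cst (fOb P c) x T $ k = cst (fOb P c) x (src k)"
 using cst_arr[OF P_small] cst_comp[OF P_small] by auto

text \<open>
  The element of \<open>U\<close> given by \<open>x \<in> P c\<close>, and the summand \<open>F c\<close> of the fibre product that is
  indexed by the object \<open>(c, x)\<close> of the category of elements.
\<close>

definition point :: "'u => 'u => 'o => 'a" where
 "point c x T = \<kappa>U c $ cst (fOb P c) x T"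

definition leg :: "'u => 'u => 'a" where
 "leg c x = pairW (point c x (fOb F c)) (\<kappa>V c)"

lemma point_arr [simp]:
 assumes "c : Obj C" "x : fOb P c" "T : obj"
 shows "point c x T : arr" "src (point c x T) = T" "tgt (point c x T) = tot U" "anc U $ point c x T = cst (Obj C) c T"
 using assms assoc_eq[OF anc_\<kappa>U[OF assms(1)], of "cst (fOb P c) x T"] functorD(1)[OF LP assms(1)]
 unfolding point_def by (simp_all add: fcomp_def)

lemma point_comp [simp]:
 assumes "c : Obj C" "x : fOb P c" "k : arr" "tgt k = T"
 shows "point c x T $ k = point c x (src k)"
 using assms src_tgt_obj(2)[OF assms(3)] unfolding point_def by simp

lemma point_act:
 assumes f: "f : Arr C" and x: "x : fOb P (Src C f)" and T: "T : obj"
 shows "actU (point (Src C f) x T) (cst (Arr C) f T) = point (Tgt C f) (app (fAr P f) x) T"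
proof -
 have s: "Src C f : Obj C" using f by simp
 note c = cstP(1-3)[OF s x T]
 have "actU (\<kappa>U (Src C f) $ cst (fOb P (Src C f)) x T) (cst (Arr C) f T) = \<kappa>U (Tgt C f) $ (fAr L (fAr P f) $ cst (fOb P (Src C f)) x T)"
  using act_cst[OF LP preU f c(1)] c by (simp add: fcomp_def)
 then show ?thesis unfolding point_def L_cst[OF P_hom[OF f] x T] .
qed

lemma leg_arr:
 assumes "c : Obj C" "x : fOb P c"
 shows "leg c x : arr" "src (leg c x) = fOb F c" "tgt (leg c x) = W"
  "prU $ leg c x = point c x (fOb F c)" "prV $ leg c x = \<kappa>V c"
  "k : arr ==> tgt k = fOb F c ==> leg c x $ k = pairW (point c x (src k)) (\<kappa>V c $ k)"
proof -
 have e: "anc U $ point c x (fOb F c) = anc V $ \<kappa>V c" using assms anc_\<kappa>V by simp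
 have h: "point c x (fOb F c) : arr" "\<kappa>V c : arr" "src (point c x (fOb F c)) = src (\<kappa>V c)"
  "tgt (point c x (fOb F c)) = src (anc U)" "tgt (\<kappa>V c) = src (anc V)" "src (point c x (fOb F c)) = fOb F c"
  using assms by simp_all
 show "leg c x : arr" "src (leg c x) = fOb F c" "tgt (leg c x) = W"
  "prU $ leg c x = point c x (fOb F c)" "prV $ leg c x = \<kappa>V c"
  unfolding leg_def using pair_arr[OF W_sq h(1-5) e] h(6) by simp_all
 show "leg c x $ k = pairW (point c x (src k)) (\<kappa>V c $ k)" if k: "k : arr" "tgt k = fOb F c"
  unfolding leg_def using pair_comp(1)[OF W_sq h(1-5) e k(1)] point_comp[OF assms k] h(6) k(2) by simp
qed

text \<open>
  The total object of \<open>U\<close> is covered by the objects \<open>L (P c)\<close> and these by their points, so that arrows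
  are determined by what they do over the elements of \<open>P\<close>.
\<close>

lemma elements_cover:
 assumes v: "v : arr" "w : arr" "src v = src t" "src w = src t" "tgt v = tgt w"
  and t: "t : arr" "tgt t = tot U"
  and eq: "!!c x s. c : Obj C ==> x : fOb P c ==> s : arr ==> tgt s = src t ==> t $ s = point c x (src s) ==> v $ s = w $ s"
 shows "v = w"
proof (rule L_cover[OF small_C(1), of "anc U $ t"])
 fix c s assume c: "c : Obj C" and s: "s : arr" "tgt s = src (anc U $ t)" "(anc U $ t) $ s = cst (Obj C) c (src s)"
 have st: "tgt s = src t" using s t by simp
 have "anc U $ (t $ s) = cst (Obj C) c (src (t $ s))" using s t st by simp
 then obtain a where a: "a : arr" "src a = src (t $ s)" "tgt a = fOb (fcomp L P) c" "\<kappa>U c $ a = t $ s"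
  by (rule fibre_lift[OF LP preU c, rotated 2]) (use s t st in simp_all)
 have aP: "tgt a = fOb L (fOb P c)" "src a = src s" using a s t st by (simp_all add: fcomp_def)
 show "v $ s = w $ s"
 proof (rule L_cover[OF P_small[OF c] a(1) aP(1)])
  fix x l assume x: "x : fOb P c" and l: "l : arr" "tgt l = src a" "a $ l = cst (fOb P c) x (src l)"
  have "t $ (s $ l) = \<kappa>U c $ (a $ l)" using assoc_eq[OF a(4), of l] a aP l s t st c by simp
  then have "t $ (s $ l) = point c x (src (s $ l))" unfolding point_def l(3) using s l aP by simp
  then have "v $ (s $ l) = w $ (s $ l)" by (intro eq[OF c x]) (use s l aP st in simp_all)
  then show "(v $ s) $ l = (w $ s) $ l" using v s l aP st by simp
 qed (use v s st aP t in simp_all)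
qed (use v t in simp_all)

lemma V_factor:
 assumes c: "c : Obj C" and y: "y : arr" "tgt y = tot V" "anc V $ y = cst (Obj C) c (src y)"
 obtains b where "b : arr" "src b = src y" "tgt b = fOb F c" "\<kappa>V c $ b = y"
 using op.fibre_lift[OF F preV, of c y] c y by auto

text \<open>
  The fibre of \<open>W\<close> over an element \<open>x \<in> P c\<close> is the fibre of \<open>V\<close> over \<open>c\<close>, which is \<open>F c\<close>.
\<close>

lemma W_epi:
 assumes v: "v : arr" "w : arr" "src v = W" "src w = W" "tgt v = tgt w"
  and eq: "!!c x. c : Obj C ==> x : fOb P c ==> v $ leg c x = w $ leg c x"
 shows "v = w"
proof (rule elements_cover[of _ _ prU])
 fix c x s assume c: "c : Obj C" and x: "x : fOb P c" and s: "s : arr" "tgt s = src prU" "prU $ s = point c x (src s)"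
 have S: "src s : obj" using s by simp
 have "anc V $ (prV $ s) = anc U $ (prU $ s)" using pb_sq_comp[OF W_sq s(1)] s by simp
 then have "anc V $ (prV $ s) = cst (Obj C) c (src (prV $ s))" using s c x S by simp
 then obtain b where b: "b : arr" "src b = src (prV $ s)" "tgt b = fOb F c" "\<kappa>V c $ b = prV $ s"
  by (rule V_factor[OF c, rotated 2]) (use s in simp_all)
 have "s = leg c x $ b"
  unfolding leg_arr(6)[OF c x b(1,3)]
  by (rule pair_eqI[OF W_sq s(1)]) (use s b in simp_all)
 moreover have "v $ (leg c x $ b) = w $ (leg c x $ b)"
  using assoc_eq[OF eq[OF c x], of b] leg_arr[OF c x] b v by simp
 ultimately show "v $ s = w $ s" by simp
qed (use v in simp_all)

lemma W_induce:
 assumes Y: "Y : obj" and r: "!!c x. c : Obj C ==> x : fOb P c ==> \<rho> c x : hom E (fOb F c) Y"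
 obtains h where "h : hom E W Y" "!!c x. c : Obj C ==> x : fOb P c ==> h $ leg c x = \<rho> c x"
proof -
 let ?u = "anc U $ prU"
 \<comment> \<open>First the fibre product is decomposed over the objects \<open>c\<close>, then each part over \<open>P c\<close>.\<close>
 let ?t = "%c. pb1 E ?u (fAr L (pt c (Obj C)))"
 have u: "?u : arr" "src ?u = W" "tgt ?u = fOb L (Obj C)" by simp_all
 have ptc: "fAr L (pt c (Obj C)) : arr" "src (fAr L (pt c (Obj C))) = fOb L {undefined}" "tgt ?u = tgt (fAr L (pt c (Obj C)))"
  if "c : Obj C" for c
  using L_arr[OF pt_hom[OF small_C(1) that]] u by simp_all
 have pbc: "is_pullback E ?u (fAr L (pt c (Obj C))) (?t c) (pb2 E ?u (fAr L (pt c (Obj C))))" if "c : Obj C" for c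
  by (rule pb_pullback[OF u(1) ptc(1,3)[OF that]])
 have t: "?t c : arr" "tgt (?t c) = W" if "c : Obj C" for c using pb_arr[OF u(1) ptc(1,3)[OF that]] by simp_all
 have ut: "?u $ ?t c = cst (Obj C) c (src (?t c))" if c: "c : Obj C" for c
 proof -
  have "pb2 E ?u (fAr L (pt c (Obj C))) = to_pt E L (src (?t c))"
   using to_pt_unique[of "pb2 E ?u (fAr L (pt c (Obj C)))"] pb_arr[OF u(1) ptc(1,3)[OF c]] ptc[OF c] by simp
  then show ?thesis using pb_sq[OF u(1) ptc(1,3)[OF c]] by (simp only: cst_def)
 qed
 have Wc: "is_gluing E (Obj C) (%c. src (?t c)) {} W ?t"
  using fibres_coproduct[OF small_C(1) u(1,3) pbc] by simp
 \<comment> \<open>Over \<open>c\<close> the fibre product is \<open>L (P c) \<times> F c\<close>, which is glued from the \<open>F c\<close> indexed by \<open>P c\<close>.\<close>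
 have "EX h. h : hom E (src (?t c)) Y &
   (ALL x : fOb P c. ALL l. l : hom E (fOb F c) (src (?t c)) & ?t c $ l = leg c x --> h $ l = \<rho> c x)" if c: "c : Obj C" for c
 proof -
  let ?T = "src (?t c)"
  note tc = t[OF c]
  have T: "?T : obj" using tc by simp
  have aU: "anc U $ (prU $ ?t c) = cst (Obj C) c (src (prU $ ?t c))" using ut[OF c] tc by simp
  obtain a where a: "a : arr" "src a = src (prU $ ?t c)" "tgt a = fOb (fcomp L P) c" "\<kappa>U c $ a = prU $ ?t c"
   by (rule fibre_lift[OF LP preU c _ _ aU]) (use tc in simp_all)
  have aP: "tgt a = fOb L (fOb P c)" "src a = ?T" using a tc by (simp_all add: fcomp_def)
  have aV: "anc V $ (prV $ ?t c) = cst (Obj C) c (src (prV $ ?t c))"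
   using aU pb_sq_comp[OF W_sq tc] tc by simp
  obtain b where b: "b : arr" "src b = src (prV $ ?t c)" "tgt b = fOb F c" "\<kappa>V c $ b = prV $ ?t c"
   by (rule V_factor[OF c _ _ aV]) (use tc in simp_all)
  have bT: "src b = ?T" using b tc by simp
  let ?pt = "%x. fAr L (pt x (fOb P c))"
  let ?s = "%x. pb1 E a (?pt x)"
  have ptx: "?pt x : arr" "src (?pt x) = fOb L {undefined}" "tgt a = tgt (?pt x)" if "x : fOb P c" for x
   using L_arr[OF pt_hom[OF P_small[OF c] that]] aP by simp_all
  have pbx: "is_pullback E a (?pt x) (?s x) (pb2 E a (?pt x))" if "x : fOb P c" for x
   by (rule pb_pullback[OF a(1) ptx(1,3)[OF that]])
  have s: "?s x : arr" "tgt (?s x) = ?T" if "x : fOb P c" for x using pb_arr[OF a(1) ptx(1,3)[OF that]] aP by simp_all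
  have Tx: "is_gluing E (fOb P c) (%x. src (?s x)) {} ?T ?s"
   using fibres_coproduct[OF P_small[OF c] a(1) aP(1) pbx] aP by simp
  obtain h where h: "h : arr" "src h = ?T" "tgt h = Y" "!!x. x : fOb P c ==> h $ ?s x = \<rho> c x $ (b $ ?s x)"
   by (rule coproduct_induce[OF Tx Y, of "%x. \<rho> c x $ (b $ ?s x)"]) (use r[OF c] b bT s in "simp_all add: hom_def")
  have "h $ l = \<rho> c x" if x: "x : fOb P c" and l: "l : hom E (fOb F c) ?T" "?t c $ l = leg c x" for x l
  proof -
   have la: "l : arr" "src l = fOb F c" "tgt l = ?T" using l by (auto simp: hom_def)
   note lg = leg_arr[OF c x]
   have "\<kappa>U c $ (a $ l) = prU $ (?t c $ l)" using assoc_eq[OF a(4), of l] a(1) aP la tc c by simp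
   also have "\<dots> = \<kappa>U c $ cst (fOb P c) x (fOb F c)" unfolding l(2) lg(4) by (rule point_def)
   finally have ue: "\<kappa>U c $ (a $ l) = \<kappa>U c $ cst (fOb P c) x (fOb F c)" .
   have al: "a $ l = cst (fOb P c) x (fOb F c)"
    by (rule fibre_mono[OF LP preU c _ _ _ _ _ ue]) (use a(1) aP la c x in "simp_all add: fcomp_def")
   have "\<kappa>V c $ (b $ l) = prV $ (?t c $ l)" using assoc_eq[OF b(4), of l] b(1,3) bT la tc c by simp
   also have "\<dots> = \<kappa>V c $ Idn E (fOb F c)" unfolding l(2) lg(5) using c by simp
   finally have ve: "\<kappa>V c $ (b $ l) = \<kappa>V c $ Idn E (fOb F c)" .
   have bl: "b $ l = Idn E (fOb F c)"
    by (rule op.fibre_mono[OF F preV _ _ _ _ _ _ ve]) (use b(1,3) bT la c in simp_all)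
   have e: "a $ l = ?pt x $ to_pt E L (fOb F c)" using al by (simp add: cst_def)
   obtain l' where l': "l' : arr" "src l' = src l" "tgt l' = src (?s x)" "?s x $ l' = l"
    by (rule pullback_lift[OF pbx[OF x] la(1) _ _ _ _ e]) (use la aP c ptx[OF x] in simp_all)
   have "h $ l = (h $ ?s x) $ l'" using h(1-3) l' s[OF x] by simp
   also have "\<dots> = (\<rho> c x $ (b $ ?s x)) $ l'" unfolding h(4)[OF x] ..
   also have "\<dots> = \<rho> c x $ (b $ (?s x $ l'))" using r[OF c x] b(1,3) bT s[OF x] l'(1-3) by (simp add: hom_def)
   also have "\<dots> = \<rho> c x" unfolding l'(4) bl using r[OF c x] by (simp add: hom_def)
   finally show ?thesis .
  qed
  then show ?thesis using h by (intro exI[of _ h]) (simp add: hom_def)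
 qed
 then have "ALL c. EX h. c : Obj C --> h : hom E (src (?t c)) Y &
   (ALL x : fOb P c. ALL l. l : hom E (fOb F c) (src (?t c)) & ?t c $ l = leg c x --> h $ l = \<rho> c x)" by blast
 then obtain g where g0: "ALL c. c : Obj C --> g c : hom E (src (?t c)) Y &
   (ALL x : fOb P c. ALL l. l : hom E (fOb F c) (src (?t c)) & ?t c $ l = leg c x --> g c $ l = \<rho> c x)"
  by (rule choice[THEN exE])
 have g: "g c : arr" "src (g c) = src (?t c)" "tgt (g c) = Y" if "c : Obj C" for c
  using g0 that by (auto simp: hom_def)
 have gl: "g c $ l = \<rho> c x" if "c : Obj C" "x : fOb P c" "l : hom E (fOb F c) (src (?t c))" "?t c $ l = leg c x" for c x l
  using g0 that by blast
 obtain h where h: "h : arr" "src h = W" "tgt h = Y" "!!c. c : Obj C ==> h $ ?t c = g c"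
  by (rule coproduct_induce[OF Wc Y, of g]) (use g in auto)
 have "h $ leg c x = \<rho> c x" if c: "c : Obj C" and x: "x : fOb P c" for c x
 proof -
  note lg = leg_arr[OF c x]
  have e: "?u $ leg c x = fAr L (pt c (Obj C)) $ to_pt E L (fOb F c)"
   using lg c x unfolding cst_def[symmetric] by simp
  obtain l where l: "l : arr" "src l = src (leg c x)" "tgt l = src (?t c)" "?t c $ l = leg c x"
   by (rule pullback_lift[OF pbc[OF c] lg(1) _ _ _ _ e]) (use lg c ptc[OF c] in simp_all)
  have "h $ leg c x = g c $ l" unfolding l(4)[symmetric] using assoc_eq[OF h(4)[OF c], of l] h(1-3) t[OF c] l by simp
  also have "\<dots> = \<rho> c x" by (rule gl[OF c x _ l(4)]) (use l lg in "simp add: hom_def")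
  finally show ?thesis .
 qed
 then show thesis using that[of h] h by (simp add: hom_def)
qed

text \<open>
  On the summands, the relation of the tensor product is that of a cocone over the category of
  elements.
\<close>

lemma balanced_legs:
 assumes r: "r : hom E W Y"
 shows "balanced Y r \<longleftrightarrow> (ALL f : Arr C. ALL x : fOb P (Src C f).
   (r $ leg (Src C f) x) $ fAr F f = r $ leg (Tgt C f) (app (fAr P f) x))"
proof -
 have ra: "r : arr" "src r = W" "tgt r = Y" using r by (auto simp: hom_def)
 have V: "actV (\<kappa>V (Tgt C f) $ b) (cst (Arr C) f (src b)) = \<kappa>V (Src C f) $ (fAr F f $ b)"
  if "f : Arr C" "b : arr" "tgt b = fOb F (Tgt C f)" for f b
  using op.act_cst[OF F preV, of f b] that by simp
 \<comment> \<open>The relation at \<open>x \<in> P c\<close>, an arrow \<open>f\<close> and a generalized element \<open>b\<close> of \<open>F d\<close>.\<close>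
 have inst: "triple (point (Src C f) x T) (cst (Arr C) f T) (\<kappa>V (Tgt C f) $ b)"
   "actL (point (Src C f) x T) (cst (Arr C) f T) (\<kappa>V (Tgt C f) $ b) = leg (Tgt C f) (app (fAr P f) x) $ b"
   "actR (point (Src C f) x T) (cst (Arr C) f T) (\<kappa>V (Tgt C f) $ b) = leg (Src C f) x $ (fAr F f $ b)"
  if f: "f : Arr C" and x: "x : fOb P (Src C f)" and b: "b : arr" "tgt b = fOb F (Tgt C f)" and T: "T = src b" for f x b T
 proof -
  have s: "Src C f : Obj C" "Tgt C f : Obj C" "T : obj" using f b T by simp_all
  have y: "anc V $ (\<kappa>V (Tgt C f) $ b) = cst (Obj C) (Tgt C f) T"
   using assoc_eq[OF anc_\<kappa>V[OF s(2)], of b] s b T by simp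
  show "triple (point (Src C f) x T) (cst (Arr C) f T) (\<kappa>V (Tgt C f) $ b)"
   unfolding triple_def using y s x f b T cst_d by simp
  show "actL (point (Src C f) x T) (cst (Arr C) f T) (\<kappa>V (Tgt C f) $ b) = leg (Tgt C f) (app (fAr P f) x) $ b"
   by (simp only: actL_def point_act[OF f x s(3)] leg_arr(6)[OF s(2) P_in[OF f x] b] T[symmetric])
  have "leg (Src C f) x $ (fAr F f $ b) = pairW (point (Src C f) x T) (\<kappa>V (Src C f) $ (fAr F f $ b))"
   using leg_arr(6)[OF s(1) x, of "fAr F f $ b"] f b T by simp
  then show "actR (point (Src C f) x T) (cst (Arr C) f T) (\<kappa>V (Tgt C f) $ b) = leg (Src C f) x $ (fAr F f $ b)"
   unfolding actR_def T V[OF f b] by simp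
 qed
 show ?thesis
 proof (intro iffI ballI)
  fix f x assume b: "balanced Y r" and f: "f : Arr C" and x: "x : fOb P (Src C f)"
  have s: "Src C f : Obj C" "Tgt C f : Obj C" using f by simp_all
  let ?b = "Idn E (fOb F (Tgt C f))"
  have i: "?b : arr" "tgt ?b = fOb F (Tgt C f)" "fOb F (Tgt C f) = src ?b" using s by simp_all
  show "(r $ leg (Src C f) x) $ fAr F f = r $ leg (Tgt C f) (app (fAr P f) x)"
   using balancedD[OF b inst(1)[OF f x i]] unfolding inst(2,3)[OF f x i]
   using leg_arr[OF s(1) x] leg_arr[OF s(2) P_in[OF f x]] ra f s by simp
 next
  assume e: "ALL f : Arr C. ALL x : fOb P (Src C f). (r $ leg (Src C f) x) $ fAr F f = r $ leg (Tgt C f) (app (fAr P f) x)"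
  have "r $ actL x f y = r $ actR x f y" if t: "triple x f y" for x f y
  proof (rule L_cover[OF small_C(2) tripleD(2,7)[OF t]])
   note td = tripleD[OF t] and l = actL_arr[OF t] and rr = actR_arr[OF t]
   fix \<phi> s assume p: "\<phi> : Arr C" and s: "s : arr" "tgt s = src f" "f $ s = cst (Arr C) \<phi> (src s)"
   note ts = triple_comp[OF t s(1,2)] and ls = l(6)[OF s(1,2)] and rs = rr(6)[OF s(1,2)]
   have "r $ actL (x $ s) (f $ s) (y $ s) = r $ actR (x $ s) (f $ s) (y $ s)"
   proof (rule elements_cover[of _ _ "x $ s"])
    note l' = actL_arr[OF ts] and rr' = actR_arr[OF ts] and td' = tripleD[OF ts]
    fix c a k assume c: "c : Obj C" and a: "a : fOb P c" and k: "k : arr" "tgt k = src (x $ s)" "(x $ s) $ k = point c a (src k)"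
    have kf: "tgt k = src (f $ s)" using k td' by simp
    have ks: "tgt k = src s" using k td s by simp
    have K: "src k : obj" using k by simp
    note tk = triple_comp[OF ts k(1) kf]
    have fk: "(f $ s) $ k = cst (Arr C) \<phi> (src k)" unfolding s(3) using p k ks by simp
    have sp: "Src C \<phi> : Obj C" "Tgt C \<phi> : Obj C" using p by simp_all
    have "r $ actL ((x $ s) $ k) ((f $ s) $ k) ((y $ s) $ k) = r $ actR ((x $ s) $ k) ((f $ s) $ k) ((y $ s) $ k)"
    proof (cases "c = Src C \<phi>")
     case False
     have "cst (Obj C) c (src k) = cst (Obj C) (Src C \<phi>) (src k)"
      using tripleD(9)[OF tk] unfolding k(3) fk using c a p K cst_d by simp
     then obtain e where e: "e : arr" "src e = src k" "tgt e = fOb L {}"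
      by (rule cst_distinct[OF small_C(1) c sp(1) False K])
     show ?thesis by (rule empty_eq[OF e(1,3)]) (use actL_arr[OF tk] actR_arr[OF tk] ra e ks k fk p K td s in simp_all)
    next
     case True
     have "anc V $ ((y $ s) $ k) = cst (Obj C) (Tgt C \<phi>) (src ((y $ s) $ k))"
      using tripleD(10)[OF tk] unfolding fk using cst_d[OF p K] tripleD(3,5)[OF tk] k ks td s by simp
     then obtain b where b: "b : arr" "src b = src ((y $ s) $ k)" "tgt b = fOb F (Tgt C \<phi>)" "\<kappa>V (Tgt C \<phi>) $ b = (y $ s) $ k"
      by (rule V_factor[OF sp(2) tripleD(3,8)[OF tk]])
     have bk: "src b = src k" using b(2) k(1) ks td s by simp
     have a': "a : fOb P (Src C \<phi>)" using a True by simp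
     note i = inst[OF p a' b(1,3) refl, unfolded bk]
     show ?thesis
      unfolding k(3) fk b(4)[symmetric] True i(2,3)
      using bspec[OF bspec[OF e p] a'] leg_arr[OF sp(1) a'] leg_arr[OF sp(2) P_in[OF p a']] ra b(1,3) p
       assoc_eq[of "r $ leg (Src C \<phi>) a" "fAr F \<phi>" _ b] by simp
    qed
    then show "(r $ actL (x $ s) (f $ s) (y $ s)) $ k = (r $ actR (x $ s) (f $ s) (y $ s)) $ k"
     using l'(1-3) rr'(1-3) l'(6)[OF k(1) kf] rr'(6)[OF k(1) kf] ra k(1) kf by simp
   qed (use actL_arr[OF ts] actR_arr[OF ts] tripleD[OF ts] ra in simp_all)
   then show "(r $ actL x f y) $ s = (r $ actR x f y) $ s" using ls rs l(1-3) rr(1-3) ra s by simp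
  qed (use actL_arr[OF t] actR_arr[OF t] ra in simp_all)
  then show "balanced Y r" using r by (simp add: balanced_def)
 qed
qed

definition ext_cocone :: "'o => ('u \<times> 'u => 'a) => bool" where
 "ext_cocone Y \<rho> \<longleftrightarrow> Y : obj & (ALL c : Obj C. ALL x : fOb P c. \<rho> (c, x) : hom E (fOb F c) Y) &
   (ALL f : Arr C. ALL x : fOb P (Src C f). \<rho> (Src C f, x) $ fAr F f = \<rho> (Tgt C f, app (fAr P f) x))"

lemma ext_colimit_iff:
 "is_colimit E (op_cat (elements C P)) (fcomp F elements_proj) X \<iota> \<longleftrightarrow> ext_cocone X \<iota> &
   (ALL Y \<rho>. ext_cocone Y \<rho> --> (EX! h. h : hom E X Y & (ALL c : Obj C. ALL x : fOb P c. h $ \<iota> (c, x) = \<rho> (c, x))))"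
proof -
 have c: "(Y : obj & (ALL j : Obj (op_cat (elements C P)). \<rho> j : hom E (fOb (fcomp F elements_proj) j) Y) &
   (ALL k : Arr (op_cat (elements C P)). \<rho> (Tgt (op_cat (elements C P)) k) $ fAr (fcomp F elements_proj) k = \<rho> (Src (op_cat (elements C P)) k)))
  \<longleftrightarrow> ext_cocone Y \<rho>" for Y \<rho>
  by (auto simp: ext_cocone_def elements_def fcomp_def elements_proj_def)
 have o: "(ALL j : Obj (op_cat (elements C P)). A j) \<longleftrightarrow> (ALL c : Obj C. ALL x : fOb P c. A (c, x))" for A
  by (auto simp: elements_def)
 show ?thesis unfolding is_colimit_def Let_def c by (simp only: o)
qed

lemma balanced_ext_cocone:
 assumes "r : hom E W Y" and e: "!!c x. c : Obj C ==> x : fOb P c ==> \<rho> (c, x) = r $ leg c x"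
 shows "ext_cocone Y \<rho> \<longleftrightarrow> balanced Y r"
proof -
 have "r : arr" "src r = W" "tgt r = Y" "Y : obj" using assms(1) by (auto simp: hom_def)
 then show ?thesis
  unfolding balanced_legs[OF assms(1)] ext_cocone_def using leg_arr by (auto simp: e P_in hom_def simp del: assoc)
qed

lemma ext_cocone_factor:
 assumes "ext_cocone Y \<rho>"
 obtains r where "balanced Y r" "!!c x. c : Obj C ==> x : fOb P c ==> r $ leg c x = \<rho> (c, x)"
proof -
 have "Y : obj" "!!c x. c : Obj C ==> x : fOb P c ==> \<rho> (c, x) : hom E (fOb F c) Y"
  using assms by (auto simp: ext_cocone_def)
 then obtain r where r: "r : hom E W Y" "!!c x. c : Obj C ==> x : fOb P c ==> r $ leg c x = \<rho> (c, x)"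
  using W_induce[of Y "%c x. \<rho> (c, x)"] by blast
 then show thesis using that balanced_ext_cocone[OF r(1), of \<rho>] assms by simp
qed

lemma legs_eq_iff:
 assumes "r : hom E W Y" "r' : hom E W Y"
 shows "(ALL c : Obj C. ALL x : fOb P c. r $ leg c x = r' $ leg c x) \<longleftrightarrow> r = r'"
 using W_epi[of r r'] assms by (auto simp: hom_def)

lemma tensor_is_ext_colimit:
 assumes q: "is_tensor Q q"
 shows "is_colimit E (op_cat (elements C P)) (fcomp F elements_proj) Q (%(c, x). q $ leg c x)"
proof -
 have b: "balanced Q q" using q by (simp add: is_tensor_def)
 have qh: "q : hom E W Q" using b by (simp add: balanced_def)
 have qa: "q : arr" "src q = W" "tgt q = Q" using qh by (auto simp: hom_def)
 have "EX! h. h : hom E Q Y & (ALL c : Obj C. ALL x : fOb P c. h $ (q $ leg c x) = \<rho> (c, x))" if \<rho>: "ext_cocone Y \<rho>" for Y \<rho>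
 proof -
  obtain r where r: "balanced Y r" "!!c x. c : Obj C ==> x : fOb P c ==> r $ leg c x = \<rho> (c, x)"
   using ext_cocone_factor[OF \<rho>] by blast
  have rh: "r : hom E W Y" using r by (simp add: balanced_def)
  have "(ALL c : Obj C. ALL x : fOb P c. h $ (q $ leg c x) = \<rho> (c, x)) \<longleftrightarrow> h $ q = r" if h: "h : hom E Q Y" for h
  proof -
   have ha: "h : arr" "src h = Q" "tgt h = Y" using h by (auto simp: hom_def)
   have "h $ q : hom E W Y" using ha qa by (simp add: hom_def)
   from legs_eq_iff[OF this rh] show ?thesis using ha qa leg_arr r(2) by simp
  qed
  moreover have "EX! h. h : hom E Q Y & h $ q = r" using q r(1) by (simp add: is_tensor_def)
  ultimately show ?thesis by (metis (no_types, lifting))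
 qed
 moreover have "ext_cocone Q (%(c, x). q $ leg c x)" using balanced_ext_cocone[OF qh, of "%(c, x). q $ leg c x"] b by simp
 ultimately show ?thesis unfolding ext_colimit_iff by simp
qed

lemma ext_colimit_is_tensor:
 assumes X: "is_colimit E (op_cat (elements C P)) (fcomp F elements_proj) X \<iota>"
 obtains q where "is_tensor X q" "!!c x. c : Obj C ==> x : fOb P c ==> q $ leg c x = \<iota> (c, x)"
proof -
 have c: "ext_cocone X \<iota>" and Un: "!!Y \<rho>. ext_cocone Y \<rho> ==>
   EX! h. h : hom E X Y & (ALL c : Obj C. ALL x : fOb P c. h $ \<iota> (c, x) = \<rho> (c, x))"
  using X unfolding ext_colimit_iff by auto
 obtain q where q: "balanced X q" "!!c x. c : Obj C ==> x : fOb P c ==> q $ leg c x = \<iota> (c, x)"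
  using ext_cocone_factor[OF c] by blast
 have qa: "q : arr" "src q = W" "tgt q = X" using balanced_arr[OF q(1)] by auto
 have "EX! h. h : hom E X Y & h $ q = r" if r: "balanced Y r" for Y r
 proof -
  have rh: "r : hom E W Y" using r by (simp add: balanced_def)
  have "ext_cocone Y (%(c, x). r $ leg c x)" using balanced_ext_cocone[OF rh, of "%(c, x). r $ leg c x"] r by simp
  from Un[OF this] have "EX! h. h : hom E X Y & (ALL c : Obj C. ALL x : fOb P c. h $ \<iota> (c, x) = r $ leg c x)" by simp
  moreover have "(ALL c : Obj C. ALL x : fOb P c. h $ \<iota> (c, x) = r $ leg c x) \<longleftrightarrow> h $ q = r" if h: "h : hom E X Y" for h
  proof -
   have ha: "h : arr" "src h = X" "tgt h = Y" using h by (auto simp: hom_def)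
   have "h $ q : hom E W Y" using ha qa by (simp add: hom_def)
   moreover have "(h $ q) $ leg c x = h $ \<iota> (c, x)" if "c : Obj C" "x : fOb P c" for c x
    using ha qa leg_arr[OF that] q(2)[OF that] by simp
   ultimately show ?thesis using legs_eq_iff[of "h $ q" Y r] rh by simp
  qed
  ultimately show ?thesis by (metis (no_types, lifting))
 qed
 then have "is_tensor X q" using q(1) by (simp add: is_tensor_def)
 then show thesis using that q(2) by blast
qed

end

section \<open>Indexed colimits\<close>

context topos
begin

abbreviation prod :: "'o => 'o => 'o" where "prod I X \<equiv> pbOb E (bang E I) (bang E X)"
abbreviation fst' :: "'o => 'o => 'a" where "fst' I X \<equiv> pb1 E (bang E I) (bang E X)"
abbreviation snd' :: "'o => 'o => 'a" where "snd' I X \<equiv> pb2 E (bang E I) (bang E X)"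
abbreviation gp :: "'o => 'o => 'a => 'a => 'a" where "gp I X \<equiv> pair E (bang E I) (bang E X)"

lemma prod_arr:
 assumes "I : obj" "X : obj"
 shows "fst' I X : arr" "snd' I X : arr" "src (fst' I X) = prod I X" "src (snd' I X) = prod I X"
  "tgt (fst' I X) = I" "tgt (snd' I X) = X" "prod I X : obj"
 using assms by simp_all

lemma gp_arr:
 assumes "I : obj" "X : obj" "u : arr" "v : arr" "src u = src v" "tgt u = I" "tgt v = X"
 shows "gp I X u v : arr" "src (gp I X u v) = src v" "tgt (gp I X u v) = prod I X"
  "fst' I X $ gp I X u v = u" "snd' I X $ gp I X u v = v"
  "k : arr ==> tgt k = src v ==> gp I X u v $ k = gp I X (u $ k) (v $ k)"
  "k : arr ==> tgt k = src v ==> fst' I X $ (gp I X u v $ k) = u $ k"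
  "k : arr ==> tgt k = src v ==> snd' I X $ (gp I X u v $ k) = v $ k"
 using assms by simp_all

lemma gp_eqI:
 assumes "I : obj" "X : obj" "h : arr" "tgt h = prod I X" "fst' I X $ h = u" "snd' I X $ h = v"
 shows "h = gp I X u v"
 by (rule pair_eqI) (use assms in simp_all)

end

lemma slice_hom: "(p, h, q) : hom (slice E I) p' q' \<longleftrightarrow> p = p' & q = q' & p : Arr E & Tgt E p = I & q : Arr E & Tgt E q = I &
  h : hom E (Src E p) (Src E q) & q $\<^bsub>E\<^esub> h = p"
 by (auto simp: slice_def hom_def)

lemma slice_comp [simp]: "(p', k, r) $\<^bsub>slice E I\<^esub> (p, h, q) = (p, k $\<^bsub>E\<^esub> h, r)"
 by (simp add: slice_def)

lemma slice_Obj: "p : Obj (slice E I) \<longleftrightarrow> p : Arr E & Tgt E p = I"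
 by (simp add: slice_def)

lemma slice_homE:
 assumes "t : hom (slice E I) p q"
 obtains h where "t = (p, h, q)" "h : hom E (Src E p) (Src E q)" "q $\<^bsub>E\<^esub> h = p"
 using assms by (cases t) (auto simp: slice_hom)

context tensor
begin

abbreviation \<A> :: "('o, 'a, 'a, 'a) ixcat" where "\<A> \<equiv> ext_cat E (int_f E \<D> V)"
abbreviation \<Gamma> :: "('o, 'a, 'a, 'a, 'a, 'a \<times> 'a \<times> 'a) ixfun" where
 "\<Gamma> \<equiv> ixfun_comp E (self_indexing E) (ext_diag E \<D> U) (ext_fun E \<D> (proj_f E \<D> V))"

text \<open>The value of \<open>\<Gamma>\<close> at a generalized object \<open>x\<close> is the pullback of \<open>U\<close> along \<open>anc V \<cdot> x\<close>.\<close>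

abbreviation fibO :: "'a => 'o" where "fibO x \<equiv> pbOb E (anc V $ x) (anc U)"
abbreviation fib1 :: "'a => 'a" where "fib1 x \<equiv> pb1 E (anc V $ x) (anc U)"
abbreviation fib2 :: "'a => 'a" where "fib2 x \<equiv> pb2 E (anc V $ x) (anc U)"
abbreviation fibpair :: "'a => 'a => 'a => 'a" where "fibpair x \<equiv> pair E (anc V $ x) (anc U)"

lemma fib_arr:
 assumes "x : arr" "tgt x = tot V"
 shows "fib1 x : arr" "fib2 x : arr" "src (fib1 x) = fibO x" "src (fib2 x) = fibO x" "tgt (fib1 x) = src x"
  "tgt (fib2 x) = tot U" "anc U $ fib2 x = anc V $ (x $ fib1 x)" "fibO x : obj"
 using pb_arr[of "anc V $ x" "anc U"] pb_sq[of "anc V $ x" "anc U"] assms by simp_all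

lemma fibpair_arr:
 assumes x: "x : arr" "tgt x = tot V" and j: "j : arr" "\<xi> : arr" "src j = src \<xi>" "tgt j = src x" "tgt \<xi> = tot U"
  "anc V $ (x $ j) = anc U $ \<xi>"
 shows "fibpair x j \<xi> : arr" "src (fibpair x j \<xi>) = src \<xi>" "tgt (fibpair x j \<xi>) = fibO x"
  "fib1 x $ fibpair x j \<xi> = j" "fib2 x $ fibpair x j \<xi> = \<xi>"
  "k : arr ==> tgt k = src \<xi> ==> fibpair x j \<xi> $ k = fibpair x (j $ k) (\<xi> $ k)"
 using pair_arr[of "anc V $ x" "anc U" j \<xi>] pair_comp(1)[of "anc V $ x" "anc U" j \<xi> k] assms by simp_all

text \<open>The element of the fibre product over a generic element of the value of \<open>\<Gamma>\<close> at \<open>x\<close>.\<close>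

definition fibW :: "'a => 'a" where
 "fibW x = pairW (fib2 x) (x $ fib1 x)"

lemma fibW_arr:
 assumes x: "x : arr" "tgt x = tot V"
 shows "fibW x : arr" "src (fibW x) = fibO x" "tgt (fibW x) = W"
  "k : arr ==> tgt k = fibO x ==> fibW x $ k = pairW (fib2 x $ k) (x $ (fib1 x $ k))"
proof -
 note f = fib_arr[OF x]
 have h: "fib2 x : arr" "x $ fib1 x : arr" "src (fib2 x) = src (x $ fib1 x)" "tgt (fib2 x) = src (anc U)"
  "tgt (x $ fib1 x) = src (anc V)" using f(1-6) x by simp_all
 note p = pair_arr[OF W_sq h f(7)] and c = pair_comp(1)[OF W_sq h f(7)]
 show "fibW x : arr" "src (fibW x) = fibO x" "tgt (fibW x) = W" unfolding fibW_def using p(1-3) f(4) by simp_all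
 show "fibW x $ k = pairW (fib2 x $ k) (x $ (fib1 x $ k))" if "k : arr" "tgt k = fibO x"
 proof -
  have "pairW (fib2 x) (x $ fib1 x) $ k = pairW (fib2 x $ k) ((x $ fib1 x) $ k)"
   by (rule c) (use that f(4) in simp_all)
  moreover have "(x $ fib1 x) $ k = x $ (fib1 x $ k)" using that f(1,3,5) x by simp
  ultimately show ?thesis by (simp only: fibW_def)
 qed
qed

text \<open>
  An arrow \<open>w\<close> from the product of \<open>I\<close> with the fibre product, over \<open>I\<close>, amounts by the Yoneda
  lemma to a family of arrows indexed by the generalized objects; this is the indexed cocone that
  corresponds to it.
\<close>

definition ix_of :: "'o => 'a => 'a => 'a => 'a => 'a \<times> 'a \<times> 'a" where
 "ix_of I v w e x = (fib1 x, pair E e v (fib1 x) (w $ gp I W (e $ fib1 x) (fibW x)), pb1 E e v)"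

definition slice_balanced :: "'o => 'a => 'a => bool" where
 "slice_balanced I v w \<longleftrightarrow> I : obj & v : arr & tgt v = I & w : hom E (prod I W) (src v) & v $ w = fst' I W &
   (ALL i x f y. i : arr & tgt i = I & src i = src f & triple x f y -->
    w $ gp I W i (actL x f y) = w $ gp I W i (actR x f y))"

lemma slice_balancedD:
 assumes "slice_balanced I v w"
 shows "I : obj" "v : arr" "tgt v = I" "w : arr" "src w = prod I W" "tgt w = src v" "v $ w = fst' I W"
  "i : arr ==> tgt i = I ==> src i = src f ==> triple x f y ==> w $ gp I W i (actL x f y) = w $ gp I W i (actR x f y)"
 using assms by (auto simp: slice_balanced_def hom_def)

text \<open>The arguments of a cocone over \<open>I\<close>: generalized elements of \<open>I\<close> and of \<open>tot V\<close> at the same stage.\<close>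

definition at_stage :: "'o => 'a => 'a => bool" where
 "at_stage I e x \<longleftrightarrow> e : arr & tgt e = I & x : arr & src x = src e & tgt x = tot V"

lemma at_stageD:
 assumes "at_stage I e x" shows "e : arr" "tgt e = I" "x : arr" "src x = src e" "tgt x = tot V"
 using assms by (auto simp: at_stage_def)

lemma stage_el:
 assumes I: "I : obj" and s: "at_stage I e x"
 shows "gp I W (e $ fib1 x) (fibW x) : arr" "src (gp I W (e $ fib1 x) (fibW x)) = fibO x"
  "tgt (gp I W (e $ fib1 x) (fibW x)) = prod I W" "fst' I W $ gp I W (e $ fib1 x) (fibW x) = e $ fib1 x"
  "snd' I W $ gp I W (e $ fib1 x) (fibW x) = fibW x"
  "k : arr ==> tgt k = fibO x ==> gp I W (e $ fib1 x) (fibW x) $ k = gp I W (e $ (fib1 x $ k)) (pairW (fib2 x $ k) (x $ (fib1 x $ k)))"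
proof -
 note s = at_stageD[OF s]
 note f = fib_arr[OF s(3,5)] and fw = fibW_arr[OF s(3,5)]
 have h: "e $ fib1 x : arr" "fibW x : arr" "src (e $ fib1 x) = src (fibW x)" "tgt (e $ fib1 x) = I" "tgt (fibW x) = W"
  using f fw s by simp_all
 note g = gp_arr[OF I W_arr(7) h]
 show "gp I W (e $ fib1 x) (fibW x) : arr" "src (gp I W (e $ fib1 x) (fibW x)) = fibO x"
  "tgt (gp I W (e $ fib1 x) (fibW x)) = prod I W" "fst' I W $ gp I W (e $ fib1 x) (fibW x) = e $ fib1 x"
  "snd' I W $ gp I W (e $ fib1 x) (fibW x) = fibW x"
  using g(1-5) fw(2) by simp_all
 show "gp I W (e $ fib1 x) (fibW x) $ k = gp I W (e $ (fib1 x $ k)) (pairW (fib2 x $ k) (x $ (fib1 x $ k)))"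
  if k: "k : arr" "tgt k = fibO x"
  using g(6)[of k] fw(2) fw(4)[OF k] k f(1,3,5) s by simp
qed

lemma ix_of_mid:
 assumes w: "I : obj" "v : arr" "tgt v = I" "w : arr" "src w = prod I W" "tgt w = src v" "v $ w = fst' I W"
  and s: "at_stage I e x"
 defines "m \<equiv> pair E e v (fib1 x) (w $ gp I W (e $ fib1 x) (fibW x))"
 shows "m : arr" "src m = fibO x" "tgt m = pbOb E e v" "pb1 E e v $ m = fib1 x"
  "pb2 E e v $ m = w $ gp I W (e $ fib1 x) (fibW x)"
  "k : arr ==> tgt k = fibO x ==>
    m $ k = pair E e v (fib1 x $ k) (w $ gp I W (e $ (fib1 x $ k)) (pairW (fib2 x $ k) (x $ (fib1 x $ k))))"
proof -
 note sd = at_stageD[OF s] and g = stage_el[OF w(1) s]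
 note f = fib_arr[OF sd(3,5)]
 have ev: "e : arr" "v : arr" "tgt e = tgt v" using sd w by simp_all
 have h: "fib1 x : arr" "w $ gp I W (e $ fib1 x) (fibW x) : arr"
  "src (fib1 x) = src (w $ gp I W (e $ fib1 x) (fibW x))" "tgt (fib1 x) = src e"
  "tgt (w $ gp I W (e $ fib1 x) (fibW x)) = src v"
  "e $ fib1 x = v $ (w $ gp I W (e $ fib1 x) (fibW x))"
  using f(1,3,5) g(1-4) w(2-6) sd assoc_eq[OF w(7) w(4,2) w(6) g(1)] by simp_all
 show "m : arr" "src m = fibO x" "tgt m = pbOb E e v" "pb1 E e v $ m = fib1 x"
  "pb2 E e v $ m = w $ gp I W (e $ fib1 x) (fibW x)"
  unfolding m_def using pair_arr[OF ev h] f(3) by simp_all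
 show "m $ k = pair E e v (fib1 x $ k) (w $ gp I W (e $ (fib1 x $ k)) (pairW (fib2 x $ k) (x $ (fib1 x $ k))))"
  if k: "k : arr" "tgt k = fibO x"
  unfolding m_def using pair_comp(1)[OF ev h k(1)] f(3) k g(1-3) g(6)[OF k] w(4,5) by simp
qed

lemma ix_fib_sel:
 "Obj (ixfib \<A> J) = hom E J (tot V)" "Arr (ixfib \<A> J) = hom E J (pbOb E (anc V) (d1 \<D>))"
 "Src (ixfib \<A> J) k = act V $ k" "Tgt (ixfib \<A> J) k = pb1 E (anc V) (d1 \<D>) $ k" "fOb (ixre \<A> h) x = x $ h"
 "fOb (ixf \<Gamma> J) x = fib1 x"
 by (simp_all add: ext_cat_def int_f_def int_opf_def Let_def ixfun_comp_def ext_diag_def ext_fun_def fcomp_def proj_f_def proj_opf_def)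

lemma \<Gamma>_arr:
 "fAr (ixf \<Gamma> J) k = (let f = pb2 E (anc V) (d1 \<D>) $ k; r1 = pb1 E (d0 \<D> $ f) (anc U); r2 = pb2 E (d0 \<D> $ f) (anc U)
   in (r1, pair E (d1 \<D> $ f) (anc U) r1 (actU r2 (f $ r1)), pb1 E (d1 \<D> $ f) (anc U)))"
 by (simp add: ixfun_comp_def ext_diag_def ext_fun_def fcomp_def proj_f_def proj_opf_def Let_def)

lemma d_iid: "d0 \<D> $ iid \<D> = Idn E (fOb L (Obj C))" "d1 \<D> $ iid \<D> = Idn E (fOb L (Obj C))"
proof -
 have o: "fOb L (Obj C) : obj" using src_tgt_obj(2)[OF UV_arr(1)] by simp
 have "d $ iid \<D> = Idn E (fOb L (Obj C))" if d: "d : arr" "src d = fOb L (Arr C)" "tgt d = fOb L (Obj C)"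
  "!!c T. c : Obj C ==> T : obj ==> d $ cst (Arr C) (Idn C c) T = cst (Obj C) c T" for d
 proof (rule L_cover[OF small_C(1), of "Idn E (fOb L (Obj C))"])
  fix c t assume c: "c : Obj C" and t: "t : arr" "tgt t = src (Idn E (fOb L (Obj C)))"
   "Idn E (fOb L (Obj C)) $ t = cst (Obj C) c (src t)"
  have T: "src t : obj" using t by simp
  have tc: "t = cst (Obj C) c (src t)" using t o by simp
  have "d $ (iid \<D> $ cst (Obj C) c (src t)) = cst (Obj C) c (src t)" using d cst_id[OF c T] c T by simp
  then have "d $ (iid \<D> $ t) = t" by (simp only: tc[symmetric])
  then show "(d $ iid \<D>) $ t = Idn E (fOb L (Obj C)) $ t" using d t o by simp
 qed (use d o in simp_all)
 then show "d0 \<D> $ iid \<D> = Idn E (fOb L (Obj C))" "d1 \<D> $ iid \<D> = Idn E (fOb L (Obj C))"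
  using cst_d[of "Idn C _"] by simp_all
qed

lemma actU_unit:
 assumes "x : arr" "tgt x = tot U"
 shows "actU x (iid \<D> $ (anc U $ x)) = x"
proof -
 have e: "anc U $ Idn E (tot U) = d0 \<D> $ (iid \<D> $ anc U)" using assoc_eq[OF d_iid(1), of "anc U"] by simp
 have "actU (Idn E (tot U)) (iid \<D> $ anc U) = Idn E (tot U)" using U by (simp add: is_idiag_def)
 moreover have "actU (Idn E (tot U)) (iid \<D> $ anc U) $ x = actU (Idn E (tot U) $ x) ((iid \<D> $ anc U) $ x)"
  by (rule idiag_act(5)[OF U _ _ _ _ _ e]) (use assms in simp_all)
 ultimately show ?thesis using assms by simp
qed

lemma \<Gamma>_ixc:
 assumes h: "h : arr" and x: "x : arr" "tgt x = tot V" "src x = tgt h"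
 shows "ixc \<Gamma> h x = (fib1 (x $ h), pair E h (fib1 x) (fib1 (x $ h)) (fibpair x (h $ fib1 (x $ h)) (fib2 (x $ h))), pb1 E h (fib1 x))"
proof -
 let ?y = "anc V $ (x $ h)"
 have y: "?y : arr" "tgt ?y = fOb L (Obj C)" using h x by simp_all
 have xh: "x $ h : arr" "tgt (x $ h) = tot V" using h x by simp_all
 note f = fib_arr[OF xh]
 have dy: "d0 \<D> $ (iid \<D> $ ?y) = ?y" "d1 \<D> $ (iid \<D> $ ?y) = ?y"
  using assoc_eq[OF d_iid(1), of ?y] assoc_eq[OF d_iid(2), of ?y] y by simp_all
 have "(iid \<D> $ ?y) $ fib1 (x $ h) = iid \<D> $ (anc U $ fib2 (x $ h))"
  unfolding f(7) using f(1,5) xh h x by simp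
 then have a: "actU (fib2 (x $ h)) ((iid \<D> $ ?y) $ fib1 (x $ h)) = fib2 (x $ h)" using actU_unit[OF f(2,6)] by simp
 have p: "fibpair (x $ h) (fib1 (x $ h)) (fib2 (x $ h)) = Idn E (fibO (x $ h))"
  by (rule pair_eqI[symmetric]) (use f y in simp_all)
 have "fAr (ixf (ext_diag E \<D> U) (src h)) (iid \<D> $ ?y) = (fib1 (x $ h), Idn E (fibO (x $ h)), fib1 (x $ h))"
  unfolding ext_diag_def Let_def ixfun.simps func.simps dy a p ..
 moreover have "(anc V $ x) $ h = ?y" using h x by simp
 moreover have "pull_comp E (anc V $ x) h (anc U) =
   (fib1 (x $ h), pair E h (fib1 x) (fib1 (x $ h)) (fibpair x (h $ fib1 (x $ h)) (fib2 (x $ h))), pb1 E h (fib1 x))"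
  unfolding pull_comp_def Let_def \<open>(anc V $ x) $ h = ?y\<close> ..
 moreover have "pair E h (fib1 x) (fib1 (x $ h)) (fibpair x (h $ fib1 (x $ h)) (fib2 (x $ h))) $ Idn E (fibO (x $ h)) =
   pair E h (fib1 x) (fib1 (x $ h)) (fibpair x (h $ fib1 (x $ h)) (fib2 (x $ h)))"
 proof -
  note fx = fib_arr[OF x(1,2)]
  have e: "anc V $ (x $ (h $ fib1 (x $ h))) = anc U $ fib2 (x $ h)" using f h x by simp
  note fp = fibpair_arr[OF x(1,2), of "h $ fib1 (x $ h)" "fib2 (x $ h)", OF _ f(2) _ _ f(6) e]
  have "h $ fib1 (x $ h) : arr" "src (h $ fib1 (x $ h)) = src (fib2 (x $ h))" "tgt (h $ fib1 (x $ h)) = src x" using f h x by simp_all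
  note fp = fp[OF this]
  note pp = pair_arr[of h "fib1 x" "fib1 (x $ h)" "fibpair x (h $ fib1 (x $ h)) (fib2 (x $ h))"]
  show ?thesis using pp f fp(1-4) fx h x by simp
 qed
 ultimately show ?thesis
  by (simp add: ixfun_comp_def self_indexing_def ext_fun_def proj_f_def proj_opf_def ext_diag_def[of E \<D> U])
qed

end

context topos
begin

lemma pull_mid:
 assumes h: "h : arr" "p : arr" "q : arr" "tgt h = tgt p" "tgt h = tgt q"
  and m: "m : arr" "src m = src p" "tgt m = src q" "q $ m = p"
  and ab: "a : arr" "b : arr" "src a = src b" "tgt a = src h" "tgt b = src p" "h $ a = p $ b"
 shows "pair E h q (pb1 E h p) (m $ pb2 E h p) $ pair E h p a b = pair E h q a (m $ b)"
proof -
 note p = pb_arr[OF h(1,2,4)] and sq = pb_sq[OF h(1,2,4)]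
 note ab' = pair_arr[OF h(1,2,4) ab]
 have e: "h $ pb1 E h p = q $ (m $ pb2 E h p)" using sq assoc_eq[OF m(4), of "pb2 E h p"] p m h by simp
 have u: "m $ pb2 E h p : arr" "src (pb1 E h p) = src (m $ pb2 E h p)" "tgt (m $ pb2 E h p) = src q"
  using p m by simp_all
 have "pair E h q (pb1 E h p) (m $ pb2 E h p) $ pair E h p a b =
   pair E h q (pb1 E h p $ pair E h p a b) ((m $ pb2 E h p) $ pair E h p a b)"
  by (rule pair_comp(1)[OF h(1,3,5) p(1) u(1,2) p(5) u(3) e ab'(1)]) (use ab' p in simp)
 moreover have "(m $ pb2 E h p) $ pair E h p a b = m $ b"
  using assoc_eq[OF _ ab'(1) p(2) _ _ _] ab' p m ab by simp
 ultimately show ?thesis using ab'(4) by simp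
qed

lemma pull_comp_mid:
 assumes e: "e : arr" "v : arr" "tgt e = tgt v" and h: "h : arr" "tgt h = src e"
  and z: "z : arr" "tgt z = pbOb E (e $ h) v"
 shows "pull_comp E e h v = (pb1 E (e $ h) v,
   pair E h (pb1 E e v) (pb1 E (e $ h) v) (pair E e v (h $ pb1 E (e $ h) v) (pb2 E (e $ h) v)), pb1 E h (pb1 E e v))"
  "pair E h (pb1 E e v) (pb1 E (e $ h) v) (pair E e v (h $ pb1 E (e $ h) v) (pb2 E (e $ h) v)) $ z =
   pair E h (pb1 E e v) (pb1 E (e $ h) v $ z) (pair E e v (h $ (pb1 E (e $ h) v $ z)) (pb2 E (e $ h) v $ z))"
proof -
 show "pull_comp E e h v = (pb1 E (e $ h) v,
   pair E h (pb1 E e v) (pb1 E (e $ h) v) (pair E e v (h $ pb1 E (e $ h) v) (pb2 E (e $ h) v)), pb1 E h (pb1 E e v))"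
  by (simp add: pull_comp_def Let_def)
 have eh: "e $ h : arr" "v : arr" "tgt (e $ h) = tgt v" using e h by simp_all
 note p = pb_arr[OF eh] and pe = pb_arr[OF e]
 let ?r1 = "pb1 E (e $ h) v" and ?r2 = "pb2 E (e $ h) v"
 have sq: "e $ (h $ ?r1) = v $ ?r2" using pb_sq[OF eh] p e h by simp
 have u: "h $ ?r1 : arr" "src (h $ ?r1) = src ?r2" "tgt (h $ ?r1) = src e" using p h e by simp_all
 note i = pair_arr[OF e u(1) p(2) u(2,3) p(6) sq] and ic = pair_comp(1)[OF e u(1) p(2) u(2,3) p(6) sq z(1)]
 have hp: "h : arr" "pb1 E e v : arr" "tgt h = tgt (pb1 E e v)" using h pe by simp_all
 have o: "?r1 : arr" "pair E e v (h $ ?r1) ?r2 : arr" "src ?r1 = src (pair E e v (h $ ?r1) ?r2)"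
  "tgt ?r1 = src h" "tgt (pair E e v (h $ ?r1) ?r2) = src (pb1 E e v)" "h $ ?r1 = pb1 E e v $ pair E e v (h $ ?r1) ?r2"
  proof -
  show "?r1 : arr" "pair E e v (h $ ?r1) ?r2 : arr" "h $ ?r1 = pb1 E e v $ pair E e v (h $ ?r1) ?r2"
   by (fact p(1) i(1) i(4)[symmetric])+
  show "src ?r1 = src (pair E e v (h $ ?r1) ?r2)" "tgt (pair E e v (h $ ?r1) ?r2) = src (pb1 E e v)"
   unfolding i(2,3) p(3,4) pe(3) by (use u(2) p(4) in simp_all)
  show "tgt ?r1 = src h" unfolding p(5) by (rule comp_arr(2)) (use e h in simp_all)
 qed
 have "pair E h (pb1 E e v) ?r1 (pair E e v (h $ ?r1) ?r2) $ z = pair E h (pb1 E e v) (?r1 $ z) (pair E e v (h $ ?r1) ?r2 $ z)"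
  by (rule pair_comp(1)[OF hp o z(1)]) (use z p in simp)
 also have "pair E e v (h $ ?r1) ?r2 $ z = pair E e v ((h $ ?r1) $ z) (?r2 $ z)"
  by (rule ic) (use z u p in simp)
 also have "(h $ ?r1) $ z = h $ (?r1 $ z)" using h p e z by simp
 finally show "pair E h (pb1 E e v) ?r1 (pair E e v (h $ ?r1) ?r2) $ z =
   pair E h (pb1 E e v) (?r1 $ z) (pair E e v (h $ (?r1 $ z)) (?r2 $ z))" .
qed

end

context tensor
begin

text \<open>
  Restriction of generalized objects in coordinates: both sides of the compatibility of an
  indexed family with pullback along \<open>h\<close>.
\<close>

lemma compat_sides:
 assumes ex: "at_stage I e x" and v: "v : arr" "tgt v = I" and h: "h : arr" "tgt h = src e"
  and m: "m : hom E (fibO x) (pbOb E e v)" "pb1 E e v $ m = fib1 x"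
  and m': "m' : hom E (fibO (x $ h)) (pbOb E (e $ h) v)" "pb1 E (e $ h) v $ m' = fib1 (x $ h)"
 defines "z \<equiv> fibpair x (h $ fib1 (x $ h)) (fib2 (x $ h))"
 shows "fAr (pull E h) (fib1 x, m, pb1 E e v) $\<^bsub>slice E (src h)\<^esub> ixc \<Gamma> h x =
   (fib1 (x $ h), pair E h (pb1 E e v) (fib1 (x $ h)) (m $ z), pb1 E h (pb1 E e v))"
  "pull_comp E e h v $\<^bsub>slice E (src h)\<^esub> (fib1 (x $ h), m', pb1 E (e $ h) v) =
   (fib1 (x $ h), pair E h (pb1 E e v) (fib1 (x $ h)) (pair E e v (h $ fib1 (x $ h)) (pb2 E (e $ h) v $ m')), pb1 E h (pb1 E e v))"
  "z : arr" "src z = fibO (x $ h)" "tgt z = fibO x" "fib1 x $ z = h $ fib1 (x $ h)" "fib2 x $ z = fib2 (x $ h)"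
  "pb2 E h (pb1 E e v) $ pair E h (pb1 E e v) (fib1 (x $ h)) (m $ z) = m $ z"
  "pb2 E h (pb1 E e v) $ pair E h (pb1 E e v) (fib1 (x $ h)) (pair E e v (h $ fib1 (x $ h)) (pb2 E (e $ h) v $ m')) =
   pair E e v (h $ fib1 (x $ h)) (pb2 E (e $ h) v $ m')"
  "pb2 E e v $ pair E e v (h $ fib1 (x $ h)) (pb2 E (e $ h) v $ m') = pb2 E (e $ h) v $ m'"
proof -
 note s = at_stageD[OF ex]
 have xh: "x $ h : arr" "tgt (x $ h) = tot V" using s h by simp_all
 note f = fib_arr[OF s(3,5)] and g = fib_arr[OF xh]
 have ma: "m : arr" "src m = fibO x" "tgt m = pbOb E e v" and ma': "m' : arr" "src m' = fibO (x $ h)" "tgt m' = pbOb E (e $ h) v"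
  using m m' by (auto simp: hom_def)
 have ev: "e : arr" "v : arr" "tgt e = tgt v" using s v by simp_all
 have ehv: "e $ h : arr" "v : arr" "tgt (e $ h) = tgt v" using s v h by simp_all
 note p = pb_arr[OF ev] and p' = pb_arr[OF ehv]
 have hf: "h $ fib1 (x $ h) : arr" "src (h $ fib1 (x $ h)) = src (fib2 (x $ h))" "tgt (h $ fib1 (x $ h)) = src x"
  using h s g(1-6) by simp_all
 have ve: "anc V $ (x $ (h $ fib1 (x $ h))) = anc U $ fib2 (x $ h)" unfolding g(7) using g(1,3,5) h s by simp
 note z = fibpair_arr[OF s(3,5) hf(1) g(2) hf(2,3) g(6) ve, folded z_def]
 show z1: "z : arr" and z2: "src z = fibO (x $ h)" and z3: "tgt z = fibO x" and z4: "fib1 x $ z = h $ fib1 (x $ h)" and "fib2 x $ z = fib2 (x $ h)"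
  using z g(4) by simp_all
 have hp: "h : arr" "fib1 x : arr" "pb1 E e v : arr" "tgt h = tgt (fib1 x)" "tgt h = tgt (pb1 E e v)"
  using h s f p by simp_all
 have mp: "src m = src (fib1 x)" "tgt m = src (pb1 E e v)" using ma f p by simp_all
 have zz: "src (fib1 (x $ h)) = src z" "tgt (fib1 (x $ h)) = src h" "tgt z = src (fib1 x)" "h $ fib1 (x $ h) = fib1 x $ z"
  using z2 z3 z4 g f s h by simp_all
 have "pair E h (pb1 E e v) (pb1 E h (fib1 x)) (m $ pb2 E h (fib1 x)) $ pair E h (fib1 x) (fib1 (x $ h)) z =
   pair E h (pb1 E e v) (fib1 (x $ h)) (m $ z)"
  by (rule pull_mid[OF hp ma(1) mp m(2) g(1) z1 zz])
 moreover have "ixc \<Gamma> h x = (fib1 (x $ h), pair E h (fib1 x) (fib1 (x $ h)) z, pb1 E h (fib1 x))"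
  unfolding z_def by (rule \<Gamma>_ixc) (use h s in simp_all)
 ultimately show "fAr (pull E h) (fib1 x, m, pb1 E e v) $\<^bsub>slice E (src h)\<^esub> ixc \<Gamma> h x =
   (fib1 (x $ h), pair E h (pb1 E e v) (fib1 (x $ h)) (m $ z), pb1 E h (pb1 E e v))"
  by (simp only: pull_def func.simps prod.case slice_comp)
 show "pull_comp E e h v $\<^bsub>slice E (src h)\<^esub> (fib1 (x $ h), m', pb1 E (e $ h) v) =
   (fib1 (x $ h), pair E h (pb1 E e v) (fib1 (x $ h)) (pair E e v (h $ fib1 (x $ h)) (pb2 E (e $ h) v $ m')), pb1 E h (pb1 E e v))"
  unfolding pull_comp_mid(1)[OF ev h ma'(1,3)] slice_comp pull_comp_mid(2)[OF ev h ma'(1,3)] m'(2) ..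
 have hv: "h : arr" "pb1 E e v : arr" "tgt h = tgt (pb1 E e v)" using hp by simp_all
 have mz: "m $ z : arr" "src (m $ z) = fibO (x $ h)" "tgt (m $ z) = src (pb1 E e v)" using ma z1 z2 z3 p by simp_all
 have mz4: "h $ fib1 (x $ h) = pb1 E e v $ (m $ z)" using assoc_eq[OF m(2), of z] ma p z1 z3 z4 by simp
 show "pb2 E h (pb1 E e v) $ pair E h (pb1 E e v) (fib1 (x $ h)) (m $ z) = m $ z"
  by (rule pair_arr(5)[OF hv g(1) mz(1) _ _ mz(3) mz4]) (use mz g s h in simp_all)
 have r2m: "pb2 E (e $ h) v $ m' : arr" "src (h $ fib1 (x $ h)) = src (pb2 E (e $ h) v $ m')" "tgt (h $ fib1 (x $ h)) = src e"
  "tgt (pb2 E (e $ h) v $ m') = src v"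
  using p' ma' hf s g h by simp_all
 have r2e: "e $ (h $ fib1 (x $ h)) = v $ (pb2 E (e $ h) v $ m')"
  using pb_sq_comp[OF ehv ma'(1,3)] unfolding m'(2) using g s h by simp
 note pe = pair_arr[OF ev hf(1) r2m(1,2,3,4) r2e]
 show "pb2 E e v $ pair E e v (h $ fib1 (x $ h)) (pb2 E (e $ h) v $ m') = pb2 E (e $ h) v $ m'" by (rule pe(5))
 show "pb2 E h (pb1 E e v) $ pair E h (pb1 E e v) (fib1 (x $ h)) (pair E e v (h $ fib1 (x $ h)) (pb2 E (e $ h) v $ m')) =
   pair E e v (h $ fib1 (x $ h)) (pb2 E (e $ h) v $ m')"
  by (rule pair_arr(5)[OF hv g(1) pe(1) _ _ _ pe(4)[symmetric]]) (use pe(2,3) hf(2) p g s h in simp_all)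
qed

text \<open>A generalized arrow \<open>k\<close> of the category of elements of \<open>V\<close>: an element and an arrow to its position.\<close>

lemma k_arr:
 assumes k: "k : arr" "tgt k = pbOb E (anc V) (d1 \<D>)"
 defines "y \<equiv> pb1 E (anc V) (d1 \<D>) $ k" and "f \<equiv> pb2 E (anc V) (d1 \<D>) $ k"
 shows "y : arr" "f : arr" "src y = src k" "src f = src k" "tgt y = tot V" "tgt f = fOb L (Arr C)"
  "anc V $ y = d1 \<D> $ f" "act V $ k = actV y f" "anc V $ (act V $ k) = d0 \<D> $ f"
  "act V $ k : arr" "src (act V $ k) = src k" "tgt (act V $ k) = tot V"
proof -
 have pd: "anc V : arr" "d1 \<D> : arr" "tgt (anc V) = tgt (d1 \<D>)" by simp_all
 note p = pb_arr[OF pd]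
 show "y : arr" "f : arr" "src y = src k" "src f = src k" "tgt y = tot V" "tgt f = fOb L (Arr C)"
  unfolding y_def f_def using p k by simp_all
 show "anc V $ y = d1 \<D> $ f" unfolding y_def f_def by (rule pb_sq_comp[OF pd k])
 show "act V $ k = actV y f" unfolding act_on_def y_def f_def iop_sel using pair_eqI[OF pd k(1,2) refl refl] by simp
 have "anc V $ act V = d0 \<D> $ pb2 E (anc V) (d1 \<D>)" using V by (simp add: is_idiag_def)
 then show "anc V $ (act V $ k) = d0 \<D> $ f" unfolding f_def using assoc_eq[of "anc V" "act V" _ k] p k by simp
 show "act V $ k : arr" "src (act V $ k) = src k" "tgt (act V $ k) = tot V" using k by simp_all
qed

text \<open>In coordinates \<open>\<Gamma>\<close> lets the arrow part of \<open>k\<close> act on the elements of \<open>U\<close>. The generic triple over \<open>k\<close> thus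
turns naturality at \<open>k\<close> into an instance of the relation.\<close>

lemma \<Gamma>_k:
 assumes k: "k : arr" "tgt k = pbOb E (anc V) (d1 \<D>)"
 defines "y \<equiv> pb1 E (anc V) (d1 \<D>) $ k" and "f \<equiv> pb2 E (anc V) (d1 \<D>) $ k" and "x' \<equiv> act V $ k"
 defines "t \<equiv> fibpair y (fib1 x') (actU (fib2 x') (f $ fib1 x'))"
 shows "fAr (ixf \<Gamma> J) k = (fib1 x', t, fib1 y)"
  "triple (fib2 x') (f $ fib1 x') (y $ fib1 x')"
  "t : arr" "src t = fibO x'" "tgt t = fibO y" "fib1 y $ t = fib1 x'" "fib2 y $ t = actU (fib2 x') (f $ fib1 x')"
  "fibW x' = actR (fib2 x') (f $ fib1 x') (y $ fib1 x')"
  "pairW (fib2 y $ t) (y $ (fib1 y $ t)) = actL (fib2 x') (f $ fib1 x') (y $ fib1 x')"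
  "l : arr ==> tgt l = fibO x' ==> t $ l = fibpair y (fib1 x' $ l) (actU (fib2 x' $ l) (f $ (fib1 x' $ l)))"
proof -
 note ka = k_arr[OF k, folded y_def f_def x'_def]
 note g = fib_arr[OF ka(10,12)]
 show "fAr (ixf \<Gamma> J) k = (fib1 x', t, fib1 y)"
  unfolding \<Gamma>_arr Let_def f_def[symmetric] t_def ka(7,9) ..
 have u: "anc U $ fib2 x' = d0 \<D> $ (f $ fib1 x')" unfolding g(7) using assoc_eq[OF ka(9), of "fib1 x'"] g(1,5) ka by simp
 have v: "anc V $ (y $ fib1 x') = d1 \<D> $ (f $ fib1 x')" using assoc_eq[OF ka(7), of "fib1 x'"] g(1,5) ka by simp
 show tr: "triple (fib2 x') (f $ fib1 x') (y $ fib1 x')" unfolding triple_def using u v g(1-6) ka by simp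
 note a = actU_arr[OF tr] and td = tripleD[OF tr]
 have y: "y : arr" "tgt y = tot V" by (rule ka)+
 have e: "anc V $ (y $ fib1 x') = anc U $ actU (fib2 x') (f $ fib1 x')" using a(4) v by simp
 have s: "src (fib1 x') = src (actU (fib2 x') (f $ fib1 x'))" "tgt (fib1 x') = src y" using a(2) g(1-5) ka by simp_all
 note t = fibpair_arr[OF y g(1) a(1) s a(3) e, folded t_def]
 show t1: "t : arr" "src t = fibO x'" "tgt t = fibO y" "fib1 y $ t = fib1 x'" "fib2 y $ t = actU (fib2 x') (f $ fib1 x')"
  using t(1-5) s g(3) by simp_all
 show "pairW (fib2 y $ t) (y $ (fib1 y $ t)) = actL (fib2 x') (f $ fib1 x') (y $ fib1 x')"
  unfolding t1(4,5) actL_def ..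
 have pd: "anc V : arr" "d1 \<D> : arr" "tgt (anc V) = tgt (d1 \<D>)" by simp_all
 note p = pb_arr[OF pd]
 have "x' $ fib1 x' = act V $ (k $ fib1 x')" unfolding x'_def using k g(1,3,5) by (simp add: x'_def)
 also have "\<dots> = actV (pb1 E (anc V) (d1 \<D>) $ (k $ fib1 x')) (pb2 E (anc V) (d1 \<D>) $ (k $ fib1 x'))"
  by (rule k_arr(8)) (use k g(1,5) ka in simp_all)
 also have "\<dots> = actV (y $ fib1 x') (f $ fib1 x')" unfolding y_def f_def using k g(1,5) p ka by simp
 finally show "fibW x' = actR (fib2 x') (f $ fib1 x') (y $ fib1 x')" unfolding fibW_def actR_def by simp
 show "t $ l = fibpair y (fib1 x' $ l) (actU (fib2 x' $ l) (f $ (fib1 x' $ l)))" if l: "l : arr" "tgt l = fibO x'"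
 proof -
  have lt: "tgt l = src (actU (fib2 x') (f $ fib1 x'))" "tgt l = src (f $ fib1 x')" using l a(2) g(1,3,5) ka by simp_all
  have "(f $ fib1 x') $ l = f $ (fib1 x' $ l)" using l g(1,3,5) ka by simp
  then show ?thesis unfolding t(6)[OF l(1) lt(1)] a(5)[OF l(1) lt(2)] by simp
 qed
qed

lemma ix_of_cocone:
 assumes sb: "slice_balanced I v w"
 shows "is_ixcocone E \<A> \<Gamma> I v (ix_of I v w)"
 unfolding is_ixcocone_def Let_def ix_fib_sel
proof (intro conjI ballI impI)
 note w = slice_balancedD[OF sb]
 show "v : Obj (slice E I)" using w by (simp add: slice_Obj)
 fix e assume "e : Obj (slice E I)"
 then have e: "e : arr" "tgt e = I" by (simp_all add: slice_Obj)
 have ev: "e : arr" "v : arr" "tgt e = tgt v" using e w by simp_all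
 note p = pb_arr[OF ev]
 { fix x assume "x : hom E (src e) (tot V)"
  then have s: "at_stage I e x" using e by (simp add: at_stage_def hom_def)
  note f = fib_arr[OF at_stageD(3,5)[OF s]] and m = ix_of_mid[OF w(1-7) s]
  show "ix_of I v w e x : hom (slice E (src e)) (fib1 x) (fOb (pull E e) v)"
   unfolding ix_of_def slice_hom pull_def using m f p e at_stageD[OF s] by (simp add: hom_def) }
 { fix k assume "k : hom E (src e) (pbOb E (anc V) (d1 \<D>))"
  then have k: "k : arr" "tgt k = pbOb E (anc V) (d1 \<D>)" "src k = src e" by (simp_all add: hom_def)
  let ?y = "pb1 E (anc V) (d1 \<D>) $ k" and ?f = "pb2 E (anc V) (d1 \<D>) $ k" and ?x = "act V $ k"
  note ka = k_arr[OF k(1,2)] and gk = \<Gamma>_k[OF k(1,2)]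
  have sy: "at_stage I e ?y" and sx: "at_stage I e ?x" using e ka k by (simp_all add: at_stage_def)
  note m = ix_of_mid[OF w(1-7) sy]
  let ?t = "fibpair ?y (fib1 ?x) (actU (fib2 ?x) (?f $ fib1 ?x))"
  note g = fib_arr[OF ka(10,12)]
  have "w $ gp I W (e $ fib1 ?x) (actL (fib2 ?x) (?f $ fib1 ?x) (?y $ fib1 ?x)) =
    w $ gp I W (e $ fib1 ?x) (actR (fib2 ?x) (?f $ fib1 ?x) (?y $ fib1 ?x))"
   by (rule w(8)[OF _ _ _ gk(2)]) (use e g(1,3,5) ka k in simp_all)
  then have "pair E e v (fib1 ?y) (w $ gp I W (e $ fib1 ?y) (fibW ?y)) $ ?t = pair E e v (fib1 ?x) (w $ gp I W (e $ fib1 ?x) (fibW ?x))"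
   unfolding m(6)[OF gk(3,5)] gk(9) unfolding gk(6,8) by simp
  then show "ix_of I v w e ?y $\<^bsub>slice E (src e)\<^esub> fAr (ixf \<Gamma> (src e)) k = ix_of I v w e ?x"
   unfolding ix_of_def gk(1) slice_comp by simp }
 { fix h x assume h: "h : arr" "tgt h = src e" and "x : hom E (src e) (tot V)"
  then have s: "at_stage I e x" using e by (simp add: at_stage_def hom_def)
  note sd = at_stageD[OF s]
  have s': "at_stage I (e $ h) (x $ h)" using sd h by (simp add: at_stage_def)
  note m = ix_of_mid[OF w(1-7) s] and m' = ix_of_mid[OF w(1-7) s']
  let ?m = "pair E e v (fib1 x) (w $ gp I W (e $ fib1 x) (fibW x))"
  let ?m' = "pair E (e $ h) v (fib1 (x $ h)) (w $ gp I W ((e $ h) $ fib1 (x $ h)) (fibW (x $ h)))"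
  have mh: "?m : hom E (fibO x) (pbOb E e v)" "?m' : hom E (fibO (x $ h)) (pbOb E (e $ h) v)"
   using m(1-3) m'(1-3) by (simp_all add: hom_def)
  note c = compat_sides[OF s w(2,3) h mh(1) m(4) mh(2) m'(4)]
  have xh: "x $ h : arr" "tgt (x $ h) = tot V" using sd h by simp_all
  note g = fib_arr[OF xh]
  have a: "x $ (h $ fib1 (x $ h)) = (x $ h) $ fib1 (x $ h)" "e $ (h $ fib1 (x $ h)) = (e $ h) $ fib1 (x $ h)"
   using sd h g(1,5) by simp_all
  have "?m $ fibpair x (h $ fib1 (x $ h)) (fib2 (x $ h)) = pair E e v (h $ fib1 (x $ h)) (pb2 E (e $ h) v $ ?m')"
   unfolding m(6)[OF c(3,5)] c(6,7) m'(5) a unfolding fibW_def ..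
  then show "fAr (pull E h) (ix_of I v w e x) $\<^bsub>slice E (src h)\<^esub> ixc \<Gamma> h x =
    pull_comp E e h v $\<^bsub>slice E (src h)\<^esub> ix_of I v w (e $ h) (x $ h)"
   unfolding ix_of_def c(1,2) by simp }
qed

text \<open>
  The universal stage is the product of \<open>I\<close> with the object of elements of \<open>V\<close>, and the value of
  \<open>\<Gamma>\<close> at the generic object there is the product of \<open>I\<close> with the fibre product.
\<close>

context
 fixes I assumes I: "I : Obj E"
begin

abbreviation "e0 \<equiv> fst' I (tot V)"
abbreviation "x0 \<equiv> snd' I (tot V)"

definition generic_el :: 'a where
 "generic_el = fibpair x0 (gp I (tot V) (fst' I W) (prV $ snd' I W)) (prU $ snd' I W)"

lemma stage0: "at_stage I e0 x0"
 using I by (simp add: at_stage_def)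

lemma generic_el_arr:
 "generic_el : arr" "src generic_el = prod I W" "tgt generic_el = fibO x0"
 "fib1 x0 $ generic_el = gp I (tot V) (fst' I W) (prV $ snd' I W)" "fib2 x0 $ generic_el = prU $ snd' I W"
 "k : arr ==> tgt k = prod I W ==>
   generic_el $ k = fibpair x0 (gp I (tot V) (fst' I W $ k) (prV $ (snd' I W $ k))) (prU $ (snd' I W $ k))"
proof -
 note s = at_stageD[OF stage0]
 note q = prod_arr[OF I W_arr(7)]
 have h: "fst' I W : arr" "prV $ snd' I W : arr" "src (fst' I W) = src (prV $ snd' I W)" "tgt (fst' I W) = I"
  "tgt (prV $ snd' I W) = tot V" "src (prV $ snd' I W) = prod I W"
  using q by simp_all
 note g = gp_arr[OF I UV_arr(11) h(1-5)]
 have e: "anc V $ (x0 $ gp I (tot V) (fst' I W) (prV $ snd' I W)) = anc U $ (prU $ snd' I W)"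
  unfolding g(5) using pb_sq_comp[OF W_sq q(2)] q by simp
 have o: "src (gp I (tot V) (fst' I W) (prV $ snd' I W)) = src (prU $ snd' I W)"
  "tgt (gp I (tot V) (fst' I W) (prV $ snd' I W)) = src x0" "prU $ snd' I W : arr" "tgt (prU $ snd' I W) = tot U"
  using g(2,3) h(6) q I by simp_all
 note f = fibpair_arr[OF s(3,5) g(1) o(3) o(1,2,4) e, folded generic_el_def]
 show "generic_el : arr" "src generic_el = prod I W" "tgt generic_el = fibO x0"
  "fib1 x0 $ generic_el = gp I (tot V) (fst' I W) (prV $ snd' I W)" "fib2 x0 $ generic_el = prU $ snd' I W"
  using f(1-5) q by simp_all
 show "generic_el $ k = fibpair x0 (gp I (tot V) (fst' I W $ k) (prV $ (snd' I W $ k))) (prU $ (snd' I W $ k))"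
  if k: "k : arr" "tgt k = prod I W"
 proof -
  have a: "(prV $ snd' I W) $ k = prV $ (snd' I W $ k)" "(prU $ snd' I W) $ k = prU $ (snd' I W $ k)" using q k by simp_all
  have "gp I (tot V) (fst' I W) (prV $ snd' I W) $ k = gp I (tot V) (fst' I W $ k) ((prV $ snd' I W) $ k)"
   by (rule g(6)[OF k(1)]) (use k h(6) in simp)
  moreover have "generic_el $ k = fibpair x0 (gp I (tot V) (fst' I W) (prV $ snd' I W) $ k) ((prU $ snd' I W) $ k)"
   by (rule f(6)[OF k(1)]) (use k q in simp)
  ultimately show ?thesis by (simp only: a)
 qed
qed

lemma generic_el_section: "gp I W (e0 $ fib1 x0) (fibW x0) $ generic_el = Idn E (prod I W)"
proof -
 note q = prod_arr[OF I W_arr(7)] and q0 = prod_arr[OF I UV_arr(11)]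
 note ge = generic_el_arr
 have h: "fst' I W : arr" "prV $ snd' I W : arr" "src (fst' I W) = src (prV $ snd' I W)" "tgt (fst' I W) = I"
  "tgt (prV $ snd' I W) = tot V"
  using q by simp_all
 note g = gp_arr[OF I UV_arr(11) h]
 have "gp I W (e0 $ fib1 x0) (fibW x0) $ generic_el =
   gp I W (e0 $ (fib1 x0 $ generic_el)) (pairW (fib2 x0 $ generic_el) (x0 $ (fib1 x0 $ generic_el)))"
  by (rule stage_el(6)[OF I stage0 ge(1,3)])
 also have "\<dots> = gp I W (fst' I W) (pairW (prU $ snd' I W) (prV $ snd' I W))" unfolding ge(4,5) g(4,5) ..
 also have "pairW (prU $ snd' I W) (prV $ snd' I W) = snd' I W"
  by (rule pair_eqI[OF W_sq q(2), symmetric]) (use q in simp_all)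
 also have "gp I W (fst' I W) (snd' I W) = Idn E (prod I W)"
  by (rule gp_eqI[OF I W_arr(7), symmetric]) (use q in simp_all)
 finally show ?thesis .
qed

text \<open>
  The value at the universal stage determines the arrow, since the generic element is a section of
  the evaluation.
\<close>

lemma ix_of_inject:
 assumes w: "v : arr" "tgt v = I" "w : arr" "src w = prod I W" "tgt w = src v" "v $ w = fst' I W"
  and w': "w' : arr" "src w' = prod I W" "tgt w' = src v" "v $ w' = fst' I W"
  and e: "ix_of I v w e0 x0 = ix_of I v w' e0 x0"
 shows "w = w'"
proof -
 note m = ix_of_mid[OF I w stage0] and m' = ix_of_mid[OF I w(1,2) w' stage0]
 note g = stage_el(1-3)[OF I stage0] and ge = generic_el_arr(1-3)
 have "w $ gp I W (e0 $ fib1 x0) (fibW x0) = w' $ gp I W (e0 $ fib1 x0) (fibW x0)"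
 proof -
  have "pair E e0 v (fib1 x0) (w $ gp I W (e0 $ fib1 x0) (fibW x0)) = pair E e0 v (fib1 x0) (w' $ gp I W (e0 $ fib1 x0) (fibW x0))"
   using e unfolding ix_of_def prod.inject by (elim conjE)
  from arg_cong[OF this, of "%z. pb2 E e0 v $ z"] show ?thesis unfolding m(5) m'(5) .
 qed
 then have "(w $ gp I W (e0 $ fib1 x0) (fibW x0)) $ generic_el = (w' $ gp I W (e0 $ fib1 x0) (fibW x0)) $ generic_el" by simp
 moreover have "(u $ gp I W (e0 $ fib1 x0) (fibW x0)) $ generic_el = u" if u: "u : arr" "src u = prod I W" for u
 proof -
  have "tgt (gp I W (e0 $ fib1 x0) (fibW x0)) = src u" "tgt generic_el = src (gp I W (e0 $ fib1 x0) (fibW x0))"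
   unfolding g(2,3) ge(3) u(2) by (rule refl)+
  then have "(u $ gp I W (e0 $ fib1 x0) (fibW x0)) $ generic_el = u $ Idn E (prod I W)"
   unfolding generic_el_section[symmetric] by (intro assoc ge(1) g(1) u(1))
  then show ?thesis using u by (simp only: comp_idn)
 qed
 ultimately show ?thesis using w(3,4) w'(1,2) by simp
qed

text \<open>
  Evaluation of the cocone at the generic element gives the arrow. By compatibility with pullback
  it determines the whole family, and naturality of the cocone makes it respect the relation.
\<close>

lemma ixcocone_representable:
 assumes co: "is_ixcocone E \<A> \<Gamma> I v \<nu>"
 obtains w where "slice_balanced I v w" "!!e x. at_stage I e x ==> \<nu> e x = ix_of I v w e x"
proof -
 have v: "v : arr" "tgt v = I" using co by (auto simp: is_ixcocone_def slice_Obj)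
 have tpe: "\<nu> e x : hom (slice E (src e)) (fib1 x) (pb1 E e v)" if s: "at_stage I e x" for e x
  using co at_stageD[OF s] unfolding is_ixcocone_def Let_def ix_fib_sel by (auto simp: slice_Obj hom_def pull_def)
 have nat: "\<nu> e (pb1 E (anc V) (d1 \<D>) $ k) $\<^bsub>slice E (src e)\<^esub> fAr (ixf \<Gamma> (src e)) k = \<nu> e (act V $ k)"
  if "e : arr" "tgt e = I" "k : arr" "tgt k = pbOb E (anc V) (d1 \<D>)" "src k = src e" for e k
  using co that unfolding is_ixcocone_def Let_def ix_fib_sel by (auto simp: slice_Obj hom_def)
 have cmp: "fAr (pull E h) (\<nu> e x) $\<^bsub>slice E (src h)\<^esub> ixc \<Gamma> h x = pull_comp E e h v $\<^bsub>slice E (src h)\<^esub> \<nu> (e $ h) (x $ h)"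
  if "at_stage I e x" "h : arr" "tgt h = src e" for e x h
  using co that at_stageD[OF that(1)] unfolding is_ixcocone_def Let_def ix_fib_sel by (auto simp: slice_Obj hom_def)
 define \<mu> where "\<mu> e x = fst (snd (\<nu> e x))" for e x
 have \<mu>: "\<nu> e x = (fib1 x, \<mu> e x, pb1 E e v)" "\<mu> e x : arr" "src (\<mu> e x) = fibO x" "tgt (\<mu> e x) = pbOb E e v" "pb1 E e v $ \<mu> e x = fib1 x"
  if s: "at_stage I e x" for e x
 proof -
  note sd = at_stageD[OF s]
  obtain m where m: "\<nu> e x = (fib1 x, m, pb1 E e v)" "m : hom E (src (fib1 x)) (src (pb1 E e v))" "pb1 E e v $ m = fib1 x"
   using tpe[OF s] by (rule slice_homE)
  then show "\<nu> e x = (fib1 x, \<mu> e x, pb1 E e v)" "\<mu> e x : arr" "src (\<mu> e x) = fibO x" "tgt (\<mu> e x) = pbOb E e v" "pb1 E e v $ \<mu> e x = fib1 x"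
   using fib_arr[OF sd(3,5)] pb_arr[of e v] sd v by (auto simp: \<mu>_def hom_def)
 qed
 have pull: "pb2 E e v $ (\<mu> e x $ fibpair x (h $ fib1 (x $ h)) (fib2 (x $ h))) = pb2 E (e $ h) v $ \<mu> (e $ h) (x $ h)"
  if s: "at_stage I e x" and h: "h : arr" "tgt h = src e" for e x h
 proof -
  note sd = at_stageD[OF s]
  have s': "at_stage I (e $ h) (x $ h)" using sd h by (simp add: at_stage_def)
  have mh: "\<mu> e x : hom E (fibO x) (pbOb E e v)" "\<mu> (e $ h) (x $ h) : hom E (fibO (x $ h)) (pbOb E (e $ h) v)"
   using \<mu>[OF s] \<mu>[OF s'] by (simp_all add: hom_def)
  note c = compat_sides[OF s v h mh(1) \<mu>(5)[OF s] mh(2) \<mu>(5)[OF s']]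
  let ?z = "fibpair x (h $ fib1 (x $ h)) (fib2 (x $ h))"
  have "pair E h (pb1 E e v) (fib1 (x $ h)) (\<mu> e x $ ?z) =
    pair E h (pb1 E e v) (fib1 (x $ h)) (pair E e v (h $ fib1 (x $ h)) (pb2 E (e $ h) v $ \<mu> (e $ h) (x $ h)))"
   using cmp[OF s h] unfolding \<mu>(1)[OF s] \<mu>(1)[OF s'] c(1,2) by simp
  then have "\<mu> e x $ ?z = pair E e v (h $ fib1 (x $ h)) (pb2 E (e $ h) v $ \<mu> (e $ h) (x $ h))"
   using c(8,9) by metis
  then show ?thesis using c(10) by simp
 qed
 let ?m0 = "\<mu> e0 x0"
 \<comment> \<open>The arrow that represents the cocone: its value at the universal stage, at the generic element.\<close>
 let ?w = "pb2 E e0 v $ (?m0 $ generic_el)"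
 note s0 = at_stageD[OF stage0] and m0 = \<mu>[OF stage0] and ge = generic_el_arr
 have ev: "e0 : arr" "v : arr" "tgt e0 = tgt v" using s0 v by simp_all
 note p0 = pb_arr[OF ev] and q = prod_arr[OF I W_arr(7)] and q0 = prod_arr[OF I UV_arr(11)]
 have w: "?w : arr" "src ?w = prod I W" "tgt ?w = src v" using p0 m0(2-4) ge(1-3) by simp_all
 have gh: "fst' I W : arr" "prV $ snd' I W : arr" "src (fst' I W) = src (prV $ snd' I W)" "tgt (fst' I W) = I"
  "tgt (prV $ snd' I W) = tot V"
  using q by simp_all
 have vw: "v $ ?w = fst' I W"
 proof -
  have "v $ ?w = e0 $ (pb1 E e0 v $ (?m0 $ generic_el))"
   by (rule pb_sq_comp[OF ev, symmetric]) (use m0(2-4) ge(1-3) in simp_all)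
  also have "pb1 E e0 v $ (?m0 $ generic_el) = fib1 x0 $ generic_el"
   by (rule assoc_eq[OF m0(5)]) (use m0(2-4) ge(1-3) p0 in simp_all)
  also have "e0 $ (fib1 x0 $ generic_el) = fst' I W" unfolding ge(4) by (rule gp_arr(4)[OF I UV_arr(11) gh])
  finally show ?thesis .
 qed
 have rep: "\<mu> e x = pair E e v (fib1 x) (?w $ gp I W (e $ fib1 x) (fibW x))" if s: "at_stage I e x" for e x
 proof (rule pair_eqI)
  note sd = at_stageD[OF s] and m = \<mu>[OF s] and g = stage_el[OF I s]
  note f = fib_arr[OF sd(3,5)] and fw = fibW_arr[OF sd(3,5)]
  let ?h = "gp I (tot V) e x"
  note h = gp_arr[OF I UV_arr(11) sd(1,3) sd(4)[symmetric] sd(2,5)]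
  have sh: "tgt ?h = src e0" using h(3) q0 by simp
  have pw: "prU $ fibW x = fib2 x" "prV $ fibW x = x $ fib1 x"
  proof -
   have "fib2 x : arr" "x $ fib1 x : arr" "src (fib2 x) = src (x $ fib1 x)" "tgt (fib2 x) = src (anc U)"
    "tgt (x $ fib1 x) = src (anc V)" using f(1-6) sd by simp_all
   from pair_arr(4,5)[OF W_sq this f(7)] show "prU $ fibW x = fib2 x" "prV $ fibW x = x $ fib1 x" by (simp_all only: fibW_def)
  qed
  have hf: "?h $ fib1 x = gp I (tot V) (e $ fib1 x) (x $ fib1 x)" by (rule h(6)) (use f(1,5) in simp_all)
  have "?w $ gp I W (e $ fib1 x) (fibW x) = pb2 E e0 v $ (?m0 $ (generic_el $ gp I W (e $ fib1 x) (fibW x)))"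
   using p0 m0(2-4) ge(1-3) g(1-3) by simp
  also have "generic_el $ gp I W (e $ fib1 x) (fibW x) = fibpair x0 (?h $ fib1 x) (fib2 x)"
   unfolding ge(6)[OF g(1,3)] g(4,5) pw hf ..
  also have "pb2 E e0 v $ (?m0 $ fibpair x0 (?h $ fib1 x) (fib2 x)) = pb2 E e v $ \<mu> e x"
   using pull[OF stage0 h(1) sh] unfolding h(4,5) .
  finally show "pb2 E e v $ \<mu> e x = ?w $ gp I W (e $ fib1 x) (fibW x)" by simp
  show "e : arr" "v : arr" "tgt e = tgt v" using sd v by simp_all
  show "\<mu> e x : arr" "tgt (\<mu> e x) = pbOb E e v" "pb1 E e v $ \<mu> e x = fib1 x" by (rule m)+
 qed
 have bal: "?w $ gp I W i (actL x f y) = ?w $ gp I W i (actR x f y)"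
  if i: "i : arr" "tgt i = I" "src i = src f" and t: "triple x f y" for i x f y
 proof -
  note td = tripleD[OF t] and l = actL_arr[OF t] and r = actR_arr[OF t]
  have pd: "anc V : arr" "d1 \<D> : arr" "tgt (anc V) = tgt (d1 \<D>)" by simp_all
  let ?k = "pair E (anc V) (d1 \<D>) y f"
  have yf: "tgt y = src (anc V)" "tgt f = src (d1 \<D>)" using td by simp_all
  note k = pair_arr[OF pd td(3,2,5) yf td(10)]
  note ka = k_arr[OF k(1,3), unfolded k(4,5)] and gk = \<Gamma>_k[OF k(1,3), unfolded k(4,5)]
  let ?x = "act V $ ?k"
  have ks: "src ?k = src i" using k(2) i td(5) by simp
  have sy: "at_stage I i y" using i td by (simp add: at_stage_def)
  have sx: "at_stage I i ?x" using i ka(10-12) ks by (simp add: at_stage_def)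
  note f' = fib_arr[OF ka(10,12)]
  \<comment> \<open>The element \<open>x\<close> of the value of \<open>\<Gamma>\<close> at \<open>y \<cdot> f\<close>.\<close>
  let ?l = "fibpair ?x (Idn E (src f)) x"
  have T: "src f : obj" using td by simp
  have Tx: "src ?x = src f" using ka(11) ks i by simp
  have le: "anc V $ (?x $ Idn E (src f)) = anc U $ x" using ka(9,10) Tx td(9) by simp
  have ls: "src (Idn E (src f)) = src x" "tgt (Idn E (src f)) = src ?x" using T Tx td(4) by simp_all
  note l' = fibpair_arr[OF ka(10,12) idn_arr(1)[OF T] td(1) ls td(6) le]
  have eL: "?w $ gp I W i (actL x f y) = pb2 E i v $ (\<mu> i y $ (fibpair y (fib1 ?x) (actU (fib2 ?x) (f $ fib1 ?x)) $ ?l))"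
  proof -
   have tl: "fibpair y (fib1 ?x) (actU (fib2 ?x) (f $ fib1 ?x)) $ ?l = fibpair y (Idn E (src f)) (actU x f)"
    unfolding gk(10)[OF l'(1,3)] l'(4,5) using td by simp
   note a = actU_arr[OF t]
   have ye: "anc V $ (y $ Idn E (src f)) = anc U $ actU x f" using a(4) td by simp
   have ys: "src (Idn E (src f)) = src (actU x f)" "tgt (Idn E (src f)) = src y" using a(2) T td(5) by simp_all
   note fy = fibpair_arr[OF td(3,8) idn_arr(1)[OF T] a(1) ys a(3) ye]
   note m = ix_of_mid[OF I v w vw sy]
   have "\<mu> i y $ fibpair y (Idn E (src f)) (actU x f) = pair E i v (Idn E (src f)) (?w $ gp I W i (actL x f y))"
    unfolding rep[OF sy] m(6)[OF fy(1,3)] fy(4,5) using i td by (simp add: actL_def)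
   moreover have "pb2 E i v $ pair E i v (Idn E (src f)) (?w $ gp I W i (actL x f y)) = ?w $ gp I W i (actL x f y)"
   proof (rule pair_arr(5))
    have g: "gp I W i (actL x f y) : arr" "src (gp I W i (actL x f y)) = src f" "tgt (gp I W i (actL x f y)) = prod I W" "fst' I W $ gp I W i (actL x f y) = i"
     using gp_arr[OF I W_arr(7) i(1) l(1) _ i(2) l(3)] i(3) l(2) by simp_all
    show "i $ Idn E (src f) = v $ (?w $ gp I W i (actL x f y))"
     using assoc_eq[OF vw w(1) v(1) w(3) g(1)] g w(2) i by simp
    show "?w $ gp I W i (actL x f y) : arr" "src (Idn E (src f)) = src (?w $ gp I W i (actL x f y))"
     "tgt (?w $ gp I W i (actL x f y)) = src v" using comp_arr[OF g(1) w(1)] g w(2,3) T by simp_all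
   qed (use i v T in simp_all)
   ultimately show ?thesis unfolding tl by simp
  qed
  have eR: "?w $ gp I W i (actR x f y) = pb2 E i v $ (\<mu> i ?x $ ?l)"
  proof -
   note m = ix_of_mid[OF I v w vw sx]
   have "\<mu> i ?x $ ?l = pair E i v (Idn E (src f)) (?w $ gp I W i (actR x f y))"
    unfolding rep[OF sx] m(6)[OF l'(1,3)] l'(4,5) using i ka(8,10) Tx by (simp add: actR_def)
   moreover have "pb2 E i v $ pair E i v (Idn E (src f)) (?w $ gp I W i (actR x f y)) = ?w $ gp I W i (actR x f y)"
   proof (rule pair_arr(5))
    have g: "gp I W i (actR x f y) : arr" "src (gp I W i (actR x f y)) = src f" "tgt (gp I W i (actR x f y)) = prod I W" "fst' I W $ gp I W i (actR x f y) = i"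
     using gp_arr[OF I W_arr(7) i(1) r(1) _ i(2) r(3)] i(3) r(2) by simp_all
    show "i $ Idn E (src f) = v $ (?w $ gp I W i (actR x f y))"
     using assoc_eq[OF vw w(1) v(1) w(3) g(1)] g w(2) i by simp
    show "?w $ gp I W i (actR x f y) : arr" "src (Idn E (src f)) = src (?w $ gp I W i (actR x f y))"
     "tgt (?w $ gp I W i (actR x f y)) = src v" using comp_arr[OF g(1) w(1)] g w(2,3) T by simp_all
   qed (use i v T in simp_all)
   ultimately show ?thesis by simp
  qed
  have "\<nu> i y $\<^bsub>slice E (src i)\<^esub> (fib1 ?x, fibpair y (fib1 ?x) (actU (fib2 ?x) (f $ fib1 ?x)), fib1 y) = \<nu> i ?x"
   using nat[OF i(1,2) k(1,3) ks] unfolding k(4) gk(1) .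
  then have "\<mu> i y $ fibpair y (fib1 ?x) (actU (fib2 ?x) (f $ fib1 ?x)) = \<mu> i ?x"
   unfolding \<mu>(1)[OF sy] \<mu>(1)[OF sx] slice_comp by simp
  then have "\<mu> i y $ (fibpair y (fib1 ?x) (actU (fib2 ?x) (f $ fib1 ?x)) $ ?l) = \<mu> i ?x $ ?l"
   by (rule assoc_eq) (use gk(3-5) \<mu>(2-4)[OF sy] l'(1,3) in simp_all)
  then show ?thesis unfolding eL eR by simp
 qed
 have "slice_balanced I v ?w" unfolding slice_balanced_def using I v w vw bal by (simp add: hom_def)
 moreover have "\<nu> e x = ix_of I v ?w e x" if s: "at_stage I e x" for e x
  unfolding \<mu>(1)[OF s] rep[OF s] ix_of_def ..
 ultimately show thesis using that by blast
qed

end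

end

context tensor
begin

text \<open>The product of \<open>I\<close> with a candidate quotient map \<open>q\<close>.\<close>

definition idprod :: "'o => 'o => 'a => 'a" where
 "idprod I Q q = gp I Q (fst' I W) (q $ snd' I W)"

lemma idprod_arr:
 assumes I: "I : obj" and q: "q : hom E W Q"
 shows "idprod I Q q : arr" "src (idprod I Q q) = prod I W" "tgt (idprod I Q q) = prod I Q"
  "fst' I Q $ idprod I Q q = fst' I W" "snd' I Q $ idprod I Q q = q $ snd' I W"
  "k : arr ==> tgt k = prod I W ==> idprod I Q q $ k = gp I Q (fst' I W $ k) (q $ (snd' I W $ k))"
  "a : arr ==> tgt a = I ==> b : arr ==> tgt b = W ==> src a = src b ==> idprod I Q q $ gp I W a b = gp I Q a (q $ b)"
proof -
 have qa: "q : arr" "src q = W" "tgt q = Q" using q by (simp_all add: hom_def)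
 have Q: "Q : obj" using src_tgt_obj(2)[OF qa(1)] qa(3) by simp
 note p = prod_arr[OF I W_arr(7)]
 have qs: "q $ snd' I W : arr" "src (fst' I W) = src (q $ snd' I W)" "tgt (q $ snd' I W) = Q" "src (q $ snd' I W) = prod I W"
  using p qa by simp_all
 note g = gp_arr[OF I Q p(1) qs(1,2) p(5) qs(3)]
 show a: "idprod I Q q : arr" "src (idprod I Q q) = prod I W" "tgt (idprod I Q q) = prod I Q"
  "fst' I Q $ idprod I Q q = fst' I W" "snd' I Q $ idprod I Q q = q $ snd' I W"
  using g(1-5) qs(4) by (simp_all only: idprod_def)
 show c: "idprod I Q q $ k = gp I Q (fst' I W $ k) (q $ (snd' I W $ k))" if k: "k : arr" "tgt k = prod I W" for k
 proof -
  have "(q $ snd' I W) $ k = q $ (snd' I W $ k)" by (rule assoc) (use k p qa in simp_all)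
  then show ?thesis unfolding idprod_def using g(6)[OF k(1)] k(2) qs(4) by (simp only:)
 qed
 show "idprod I Q q $ gp I W a b = gp I Q a (q $ b)" if h: "a : arr" "tgt a = I" "b : arr" "tgt b = W" "src a = src b"
 proof -
  note ab = gp_arr[OF I W_arr(7) h(1,3,5,2,4)]
  show ?thesis unfolding c[OF ab(1,3)] ab(4,5) ..
 qed
qed

text \<open>
  The tensor product is stable under product with \<open>I\<close>: the square formed by \<open>idprod I Q q\<close> and \<open>q\<close>
  is a pullback, and colimits in a topos are stable under pullback.
\<close>

lemma idprod_pullback:
 assumes I: "I : obj" and q: "q : hom E W Q"
 shows "is_pullback E (snd' I Q) q (idprod I Q q) (snd' I W)"
proof (rule pullbackI)
 have qa: "q : arr" "src q = W" "tgt q = Q" using q by (simp_all add: hom_def)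
 have Q: "Q : obj" using src_tgt_obj(2)[OF qa(1)] qa(3) by simp
 note p = prod_arr[OF I W_arr(7)] and pQ = prod_arr[OF I Q] and a = idprod_arr[OF I q]
 show "snd' I Q : arr" "q : arr" "idprod I Q q : arr" "snd' I W : arr" by (fact pQ(2) qa(1) a(1) p(2))+
 show "tgt (snd' I Q) = tgt q" "src (idprod I Q q) = src (snd' I W)" "tgt (idprod I Q q) = src (snd' I Q)"
  "tgt (snd' I W) = src q" "snd' I Q $ idprod I Q q = q $ snd' I W"
  unfolding a(2,3,5) p(4,6) pQ(4,6) qa by (rule refl)+
 fix u v assume u: "u : arr" and v: "v : arr" and s: "src u = src v" "tgt u = src (snd' I Q)" "tgt v = src q"
  and e: "snd' I Q $ u = q $ v"
 have fu: "fst' I Q $ u : arr" "src (fst' I Q $ u) = src v" "tgt (fst' I Q $ u) = I"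
  using u s pQ by simp_all
 note g = gp_arr[OF I W_arr(7) fu(1) v fu(2,3) s(3)[unfolded qa(2)]]
 have "idprod I Q q $ gp I W (fst' I Q $ u) v = gp I Q (fst' I Q $ u) (q $ v)"
  by (rule a(7)[OF fu(1,3) v s(3)[unfolded qa(2)] fu(2)])
 also have "\<dots> = u" by (rule gp_eqI[OF I Q u s(2)[unfolded pQ(4)] refl e, symmetric])
 finally show "EX h : arr. src h = src u & tgt h = src (idprod I Q q) & idprod I Q q $ h = u & snd' I W $ h = v"
  using g(1-3,5) s(1) a(2) by auto
next
 have qa: "q : arr" "src q = W" "tgt q = Q" using q by (simp_all add: hom_def)
 have Q: "Q : obj" using src_tgt_obj(2)[OF qa(1)] qa(3) by simp
 note p = prod_arr[OF I W_arr(7)] and pQ = prod_arr[OF I Q] and a = idprod_arr[OF I q]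
 fix h k assume h: "h : arr" and k: "k : arr" and s: "src h = src k" "tgt h = src (idprod I Q q)" "tgt k = src (idprod I Q q)"
  and e: "idprod I Q q $ h = idprod I Q q $ k" "snd' I W $ h = snd' I W $ k"
 have c: "fst' I Q $ (idprod I Q q $ h) = fst' I W $ h" if "h : arr" "tgt h = src (idprod I Q q)" for h
  by (rule assoc_eq[OF a(4)]) (use that a(1,3) pQ in simp_all)
 have "fst' I W $ h = fst' I W $ k" using c[OF h s(2)] c[OF k s(3)] e(1) by simp
 then have "h = gp I W (fst' I W $ k) (snd' I W $ k)"
  using gp_eqI[OF I W_arr(7) h s(2)[unfolded a(2)] refl e(2)] by simp
 also have "\<dots> = k" by (rule gp_eqI[OF I W_arr(7) k s(3)[unfolded a(2)] refl refl, symmetric])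
 finally show "h = k" .
qed

definition gp_balanced :: "'o => 'o => 'a => bool" where
 "gp_balanced I Y w \<longleftrightarrow> w : hom E (prod I W) Y &
   (ALL i x f y. i : arr & tgt i = I & src i = src f & triple x f y -->
    w $ gp I W i (actL x f y) = w $ gp I W i (actR x f y))"

text \<open>
  A pulled back span has equal first components in \<open>I\<close>, and its second components are a restricted
  triple, so cocones on the pulled back spans are the arrows respecting the relation over \<open>I\<close>.
\<close>

lemma tensor_stable:
 assumes q: "is_tensor Q q" and I: "I : obj" and w: "gp_balanced I Y w"
 shows "EX! m. m : hom E (prod I Q) Y & m $ idprod I Q q = w"
proof -
 have qh: "q : hom E W Q" using q by (simp add: is_tensor_def balanced_def)
 have qa: "q : arr" "src q = W" "tgt q = Q" using qh by (simp_all add: hom_def)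
 have Q: "Q : obj" using src_tgt_obj(2)[OF qa(1)] qa(3) by simp
 note p = prod_arr[OF I W_arr(7)] and pQ = prod_arr[OF I Q] and a = idprod_arr[OF I qh]
 have wa: "w : arr" "src w = prod I W" "tgt w = Y" using w by (simp_all add: gp_balanced_def hom_def)
 have Y: "Y : obj" using src_tgt_obj(2)[OF wa(1)] wa(3) by simp
 \<comment> \<open>The spans that present the product of \<open>I\<close> and \<open>Q\<close>, by stability of gluings under pullback.\<close>
 let ?K = "pull_spans E {undefined :: 'u} tensor_spans (%_. idprod I Q q) (%_. snd' I W)"
 have "is_gluing E {undefined :: 'u} (%_. W) tensor_spans Q (%_. q)" using q by (simp only: is_tensor_gluing)
 then have "is_gluing E {undefined :: 'u} (%i. src ((%_. idprod I Q q) i)) ?K (prod I Q) (%_. idprod I Q q)"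
  by (rule gluing_st[OF tensor_glue_spans, rotated 1]) (use pQ idprod_pullback[OF I qh] in "simp_all add: hom_def")
 then have g: "is_gluing E {undefined :: 'u} (%_. prod I W) ?K (prod I Q) (%_. idprod I Q q)" unfolding a(2) .
 have "w $ u = w $ v" if uv: "(i, u, j, v) : ?K" for i u j v
 proof -
  obtain u1 v1 t where m: "u : arr" "v : arr" "src u = src v" "tgt u = prod I W" "tgt v = prod I W"
   "idprod I Q q $ u = idprod I Q q $ v" "(undefined, u1, undefined, v1) : tensor_spans" "t : hom E (src u) (src u1)"
   "snd' I W $ u = u1 $ t" "snd' I W $ v = v1 $ t"
   using uv unfolding pull_spans_def a(2) by auto
  obtain x f y where tr: "triple x f y" and uv1: "u1 = actL x f y" "v1 = actR x f y"
   using m(7) unfolding tensor_spans_def by auto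
  note l = actL_arr[OF tr] and r = actR_arr[OF tr]
  have t: "t : arr" "src t = src u" "tgt t = src f" using m(8) l(2) uv1 by (auto simp: hom_def)
  have c: "fst' I Q $ (idprod I Q q $ h) = fst' I W $ h" if "h : arr" "tgt h = prod I W" for h
   by (rule assoc_eq[OF a(4)]) (use that a(1,2,3) pQ in simp_all)
  have fe: "fst' I W $ v = fst' I W $ u" using c[OF m(1,4)] c[OF m(2,5)] m(6) by simp
  have fu: "fst' I W $ u : arr" "tgt (fst' I W $ u) = I" "src (fst' I W $ u) = src u" using m(1,4) p by simp_all
  note tt = triple_comp[OF tr t(1,3)]
  have sf: "src (fst' I W $ u) = src (f $ t)" using fu(3) tripleD(2)[OF tr] t by simp
  have "u = gp I W (fst' I W $ u) (actL (x $ t) (f $ t) (y $ t))"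
   by (rule gp_eqI[OF I W_arr(7) m(1,4) refl]) (simp only: m(9) uv1 l(6)[OF t(1,3)])
  moreover have "v = gp I W (fst' I W $ u) (actR (x $ t) (f $ t) (y $ t))"
   by (rule gp_eqI[OF I W_arr(7) m(2,5) fe]) (simp only: m(10) uv1 r(6)[OF t(1,3)])
  moreover have "w $ gp I W (fst' I W $ u) (actL (x $ t) (f $ t) (y $ t)) = w $ gp I W (fst' I W $ u) (actR (x $ t) (f $ t) (y $ t))"
   using w fu(1,2) sf tt unfolding gp_balanced_def by blast
  ultimately show ?thesis by metis
 qed
 then have "glue_cocone E {undefined :: 'u} (%_. prod I W) ?K Y (%_. w)"
  unfolding glue_cocone_def using Y wa by (auto simp: hom_def)
 then have "EX! h. h : hom E (prod I Q) Y & (ALL i : {undefined :: 'u}. h $ idprod I Q q = w)"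
  using g unfolding is_gluing_def by blast
 then show ?thesis by simp
qed

lemma at_stage_ball:
 "(ALL e : Obj (slice E I). ALL x : hom E (src e) (tot V). \<phi> e x) \<longleftrightarrow> (ALL e x. at_stage I e x --> \<phi> e x)"
 by (auto simp: at_stage_def slice_Obj hom_def)

text \<open>
  A map \<open>m\<close> over \<open>I\<close> out of the localization at \<open>I\<close> of the indexed cocone of \<open>q\<close> composes with it to
  the indexed cocone of \<open>m \<cdot> idprod I Q q\<close>.
\<close>

lemma ixcocone_at_comp:
 assumes I: "I : obj" and q: "q : hom E W Q" and s: "at_stage I e x"
  and v: "v : arr" "tgt v = I" and m: "m : hom E (prod I Q) (src v)" "v $ m = fst' I Q"
  and \<mu>: "\<mu> (bang E (src e)) x = ix_of (one E) (bang E Q) (q $ snd' (one E) W) (bang E (src e)) x"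
 shows "fAr (pull E e) (fst' I Q, m, v) $\<^bsub>slice E (src e)\<^esub> ixcocone_at E Q \<mu> I e x = ix_of I v (m $ idprod I Q q) e x"
proof -
 have qa: "q : arr" "src q = W" "tgt q = Q" using q by (simp_all add: hom_def)
 have Q: "Q : obj" using src_tgt_obj(2)[OF qa(1)] qa(3) by simp
 note sd = at_stageD[OF s]
 let ?J = "src e"
 have J: "?J : obj" using sd(1) by simp
 have ma: "m : arr" "src m = prod I Q" "tgt m = src v" using m(1) by (simp_all add: hom_def)
 note pQ = prod_arr[OF I Q] and p1 = prod_arr[OF one_obj W_arr(7)] and a = idprod_arr[OF I q]
 note f = fib_arr[OF sd(3,5)] and fw = fibW_arr[OF sd(3,5)]
 have s1: "at_stage (one E) (bang E ?J) x" using sd J by (simp add: at_stage_def)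
 note st = stage_el[OF one_obj s1] and sI = stage_el[OF I s]
 have qf: "q $ fibW x : arr" "src (q $ fibW x) = fibO x" "tgt (q $ fibW x) = Q" using fw qa by simp_all
 have w1: "(q $ snd' (one E) W) $ gp (one E) W (bang E ?J $ fib1 x) (fibW x) = q $ fibW x"
 proof -
  have "(q $ snd' (one E) W) $ gp (one E) W (bang E ?J $ fib1 x) (fibW x) = q $ (snd' (one E) W $ gp (one E) W (bang E ?J $ fib1 x) (fibW x))"
   by (rule assoc[OF st(1) p1(2) qa(1)]) (simp_all only: st(3) p1(4,6) qa(2))
  then show ?thesis unfolding st(5) .
 qed
 let ?M = "gp ?J Q (fib1 x) (q $ fibW x)"
 have fs: "src (fib1 x) = src (q $ fibW x)" using f(3) qf(2) by simp
 have fJ: "tgt (fib1 x) = ?J" using f(5) sd(4) by simp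
 note M = gp_arr[OF J Q f(1) qf(1) fs fJ qf(3)]
 have bI: "bang E I : arr" "bang E Q : arr" "tgt (bang E I) = tgt (bang E Q)" using I Q by simp_all
 have he: "e : arr" "tgt e = src (bang E I)" using sd I by simp_all
 have be: "bang E I $ e = bang E ?J" using sd I by simp
 note pc = pull_comp_mid[OF bI he, unfolded be, OF M(1,3)]
 let ?N = "gp I Q (e $ fib1 x) (q $ fibW x)"
 have ef: "e $ fib1 x : arr" "src (e $ fib1 x) = src (q $ fibW x)" "tgt (e $ fib1 x) = I" using f(1,3,5) sd qf(2) by simp_all
 note N = gp_arr[OF I Q ef(1) qf(1) ef(2,3) qf(3)]
 have at: "ixcocone_at E Q \<mu> I e x = (fib1 x, pair E e (fst' I Q) (fib1 x) ?N, pb1 E e (fst' I Q))"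
  unfolding ixcocone_at_def be \<mu> ix_of_def w1 pc(1) slice_comp pc(2) M(4,5) ..
 have h: "e : arr" "fst' I Q : arr" "v : arr" "tgt e = tgt (fst' I Q)" "tgt e = tgt v"
  using sd pQ v by simp_all
 have ms: "src m = src (fst' I Q)" using ma pQ by simp
 have fN: "src (fib1 x) = src ?N" "tgt ?N = src (fst' I Q)" "e $ fib1 x = fst' I Q $ ?N"
  using fs N(2,3,4) pQ(3) by simp_all
 have mid: "pair E e v (pb1 E e (fst' I Q)) (m $ pb2 E e (fst' I Q)) $ pair E e (fst' I Q) (fib1 x) ?N = pair E e v (fib1 x) (m $ ?N)"
  by (rule pull_mid[OF h ma(1) ms ma(3) m(2) f(1) N(1) fN(1) fJ fN(2,3)])
 have "(m $ idprod I Q q) $ gp I W (e $ fib1 x) (fibW x) = m $ (idprod I Q q $ gp I W (e $ fib1 x) (fibW x))"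
  by (rule assoc[OF sI(1) a(1) ma(1)]) (simp_all only: sI(3) a(2,3) ma(2))
 also have "idprod I Q q $ gp I W (e $ fib1 x) (fibW x) = ?N"
  by (rule a(7)[OF ef(1,3) fw(1,3)]) (use ef(2) qf(2) fw(2) in simp)
 finally show ?thesis unfolding at ix_of_def by (simp only: pull_def func.simps prod.case slice_comp mid)
qed

lemma one_balanced:
 assumes b: "balanced Y r"
 shows "slice_balanced (one E) (bang E Y) (r $ snd' (one E) W)"
proof -
 have r: "r : arr" "src r = W" "tgt r = Y" "Y : obj" using balanced_arr[OF b] by simp_all
 note p = prod_arr[OF one_obj W_arr(7)]
 have w: "r $ snd' (one E) W : arr" "src (r $ snd' (one E) W) = prod (one E) W" "tgt (r $ snd' (one E) W) = Y"
  using r p by simp_all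
 have "bang E Y $ (r $ snd' (one E) W) = bang E (prod (one E) W)" using bang_comp[OF w(1,3)] w(2) by (simp only:)
 also have "\<dots> = fst' (one E) W" using bang_unique[OF p(1,5)] p(3) by simp
 finally have f: "bang E Y $ (r $ snd' (one E) W) = fst' (one E) W" .
 have "(r $ snd' (one E) W) $ gp (one E) W i (actL x f y) = (r $ snd' (one E) W) $ gp (one E) W i (actR x f y)"
  if i: "i : arr" "tgt i = one E" "src i = src f" and t: "triple x f y" for i x f y
 proof -
  have c: "(r $ snd' (one E) W) $ gp (one E) W i z = r $ z" if z: "z : arr" "src z = src f" "tgt z = W" for z
  proof -
   have iz: "src i = src z" using i z by simp
   note g = gp_arr[OF one_obj W_arr(7) i(1) z(1) iz i(2) z(3)]
   have "(r $ snd' (one E) W) $ gp (one E) W i z = r $ (snd' (one E) W $ gp (one E) W i z)"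
    by (rule assoc[OF g(1) p(2) r(1)]) (simp_all only: g(3) p(4,6) r(2))
   then show ?thesis unfolding g(5) .
  qed
  show ?thesis unfolding c[OF actL_arr(1-3)[OF t]] c[OF actR_arr(1-3)[OF t]] by (rule balancedD[OF b t])
 qed
 then show ?thesis unfolding slice_balanced_def using f w r(4) by (simp add: hom_def)
qed

text \<open>The indexed cocone of an arrow \<open>q\<close> from the fibre product.\<close>

abbreviation ix_tensor :: "'o => 'a => 'a => 'a => 'a \<times> 'a \<times> 'a" where
 "ix_tensor Q q \<equiv> ix_of (one E) (bang E Q) (q $ snd' (one E) W)"

theorem tensor_is_indexed_colim:
 assumes q: "is_tensor Q q"
 shows "is_indexed_colim E \<A> \<Gamma> Q (ix_tensor Q q)"
proof -
 have b: "balanced Q q" and qh: "q : hom E W Q" using q by (simp_all add: is_tensor_def balanced_def)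
 have Q: "Q : obj" using balanced_arr[OF b] by simp
 have "EX! m. m : hom (slice E I) (fst' I Q) v & (ALL e : Obj (slice E I). ALL x : hom E (src e) (tot V).
   \<nu> e x = fAr (pull E e) m $\<^bsub>slice E (src e)\<^esub> ixcocone_at E Q (ix_tensor Q q) I e x)"
  if I: "I : obj" and co: "is_ixcocone E \<A> \<Gamma> I v \<nu>" for I v \<nu>
 proof -
  note p = prod_arr[OF I W_arr(7)] and pQ = prod_arr[OF I Q] and a = idprod_arr[OF I qh]
  obtain w where w: "slice_balanced I v w" "!!e x. at_stage I e x ==> \<nu> e x = ix_of I v w e x"
   by (rule ixcocone_representable[OF I co]) (rule that)
  note wd = slice_balancedD[OF w(1)]
  have wb: "gp_balanced I (src v) w" using w(1) unfolding slice_balanced_def gp_balanced_def by simp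
  from tensor_stable[OF q I wb] obtain m where m: "m : hom E (prod I Q) (src v)" "m $ idprod I Q q = w"
   and mu: "!!m'. m' : hom E (prod I Q) (src v) ==> m' $ idprod I Q q = w ==> m' = m" by blast
  have ma: "m : arr" "src m = prod I Q" "tgt m = src v" using m(1) by (simp_all add: hom_def)
  have vm: "v $ m = fst' I Q"
  proof -
   have "fst' I W $ gp I W i (actL x f y) = fst' I W $ gp I W i (actR x f y)"
    if i: "i : arr" "tgt i = I" "src i = src f" and t: "triple x f y" for i x f y
   proof -
    note l = actL_arr[OF t] and r = actR_arr[OF t]
    have "fst' I W $ gp I W i (actL x f y) = i" by (rule gp_arr(4)[OF I W_arr(7) i(1) l(1) _ i(2) l(3)]) (use i(3) l(2) in simp)
    moreover have "fst' I W $ gp I W i (actR x f y) = i" by (rule gp_arr(4)[OF I W_arr(7) i(1) r(1) _ i(2) r(3)]) (use i(3) r(2) in simp)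
    ultimately show ?thesis by simp
   qed
   then have "gp_balanced I I (fst' I W)" unfolding gp_balanced_def using p by (simp add: hom_def)
   note u = tensor_stable[OF q I this]
   have "(v $ m) $ idprod I Q q = v $ (m $ idprod I Q q)"
    by (rule assoc[OF a(1) ma(1) wd(2)]) (simp_all only: a(3) ma(2,3))
   then have "v $ m : hom E (prod I Q) I & (v $ m) $ idprod I Q q = fst' I W"
    unfolding m(2) wd(7) using comp_arr[OF ma(1) wd(2) ma(3)] ma(2) wd(3) by (simp add: hom_def)
   moreover have "fst' I Q : hom E (prod I Q) I & fst' I Q $ idprod I Q q = fst' I W" using a(4) pQ by (simp add: hom_def)
   ultimately show ?thesis using u by blast
  qed
  have comp: "fAr (pull E e) (fst' I Q, m', v) $\<^bsub>slice E (src e)\<^esub> ixcocone_at E Q (ix_tensor Q q) I e x = ix_of I v (m' $ idprod I Q q) e x"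
   if "at_stage I e x" "m' : hom E (prod I Q) (src v)" "v $ m' = fst' I Q" for e x m'
   by (rule ixcocone_at_comp[OF I qh that(1) wd(2,3) that(2,3)]) (rule refl)
  show ?thesis
  proof (rule ex1I[of _ "(fst' I Q, m, v)"], intro conjI ballI)
   show "(fst' I Q, m, v) : hom (slice E I) (fst' I Q) v"
    unfolding slice_hom using pQ wd(2,3) m(1) vm by simp
   fix e x assume "e : Obj (slice E I)" "x : hom E (src e) (tot V)"
   then have s: "at_stage I e x" by (simp add: at_stage_def slice_Obj hom_def)
   show "\<nu> e x = fAr (pull E e) (fst' I Q, m, v) $\<^bsub>slice E (src e)\<^esub> ixcocone_at E Q (ix_tensor Q q) I e x"
    unfolding comp[OF s m(1) vm] m(2) by (rule w(2)[OF s])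
  next
   fix n assume n: "n : hom (slice E I) (fst' I Q) v & (ALL e : Obj (slice E I). ALL x : hom E (src e) (tot V).
    \<nu> e x = fAr (pull E e) n $\<^bsub>slice E (src e)\<^esub> ixcocone_at E Q (ix_tensor Q q) I e x)"
   then obtain m' where m': "n = (fst' I Q, m', v)" "m' : hom E (src (fst' I Q)) (src v)" "v $ m' = fst' I Q"
    by (blast elim: slice_homE)
   have mh: "m' : hom E (prod I Q) (src v)" using m'(2) unfolding pQ(3) .
   have s: "at_stage I (fst' I (tot V)) (snd' I (tot V))" by (rule stage0[OF I])
   have "fst' I (tot V) : Obj (slice E I)" "snd' I (tot V) : hom E (src (fst' I (tot V))) (tot V)"
    using at_stageD[OF s] by (simp_all add: slice_Obj hom_def)
   then have "ix_of I v (m' $ idprod I Q q) (fst' I (tot V)) (snd' I (tot V)) = ix_of I v w (fst' I (tot V)) (snd' I (tot V))"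
    using n unfolding m'(1) comp[OF s mh m'(3), symmetric] w(2)[OF s, symmetric] by simp
   note ix = this
   have ma': "m' : arr" "src m' = prod I Q" "tgt m' = src v" using mh by (simp_all add: hom_def)
   have sq: "tgt (idprod I Q q) = src m'" by (simp only: a(3) ma'(2))
   have mq: "m' $ idprod I Q q : arr" "src (m' $ idprod I Q q) = prod I W" "tgt (m' $ idprod I Q q) = src v"
    unfolding comp_arr(2,3)[OF a(1) ma'(1) sq] a(2) ma'(3) by (rule comp_arr(1)[OF a(1) ma'(1) sq] refl)+
   have "v $ (m' $ idprod I Q q) = fst' I W"
    unfolding a(4)[symmetric] by (rule assoc_eq[OF m'(3) ma'(1) wd(2) ma'(3) a(1) sq])
   from ix_of_inject[OF I wd(2,3) mq this wd(4-7) ix] have "m' $ idprod I Q q = w" .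
   then show "n = (fst' I Q, m, v)" using mu[OF mh] m'(1) by simp
  qed
 qed
 then show ?thesis
  unfolding is_indexed_colim_def ix_fib_sel using Q ix_of_cocone[OF one_balanced[OF b]] by (simp add: pull_def)
qed

text \<open>
  Universality over the terminal object alone already yields the universal property of the quotient.
\<close>

theorem indexed_colim_is_tensor:
 assumes X: "is_indexed_colim E \<A> \<Gamma> Q \<mu>"
 obtains q where "is_tensor Q q"
  "!!J x. J : obj ==> x : hom E J (tot V) ==> \<mu> (bang E J) x = ix_tensor Q q (bang E J) x"
proof -
 have Q: "Q : obj" and co: "is_ixcocone E \<A> \<Gamma> (one E) (bang E Q) \<mu>"
  and un: "!!v \<nu>. is_ixcocone E \<A> \<Gamma> (one E) v \<nu> ==>
    EX! m. m : hom (slice E (one E)) (fOb (pull E (bang E (one E))) (bang E Q)) v &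
      (ALL e : Obj (slice E (one E)). ALL x : Obj (ixfib \<A> (src e)).
       \<nu> e x = fAr (pull E e) m $\<^bsub>slice E (src e)\<^esub> ixcocone_at E Q \<mu> (one E) e x)"
  using X unfolding is_indexed_colim_def by auto
 obtain w where w: "slice_balanced (one E) (bang E Q) w" "!!e x. at_stage (one E) e x ==> \<mu> e x = ix_of (one E) (bang E Q) w e x"
  by (rule ixcocone_representable[OF one_obj co]) (rule that)
 note wd = slice_balancedD[OF w(1)]
 note p = prod_arr[OF one_obj W_arr(7)] and pQ = prod_arr[OF one_obj Q]
 \<comment> \<open>The inverse of the projection from the product with the terminal object.\<close>
 let ?s = "%X. gp (one E) X (bang E X) (Idn E X)"
 have sec: "?s X : arr" "src (?s X) = X" "tgt (?s X) = prod (one E) X" "snd' (one E) X $ ?s X = Idn E X"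
  "!!k. k : arr ==> tgt k = X ==> ?s X $ k = gp (one E) X (bang E (src k)) k" "?s X $ snd' (one E) X = Idn E (prod (one E) X)"
  if X: "X : obj" for X
 proof -
  have o: "bang E X : arr" "Idn E X : arr" "src (bang E X) = src (Idn E X)" "tgt (bang E X) = one E" "tgt (Idn E X) = X" "src (Idn E X) = X"
   using X by simp_all
  note g = gp_arr[OF one_obj X o(1-5)] and px = prod_arr[OF one_obj X]
  show "?s X : arr" "src (?s X) = X" "tgt (?s X) = prod (one E) X" "snd' (one E) X $ ?s X = Idn E X" using g(1-3,5) o(6) by simp_all
  show c: "?s X $ k = gp (one E) X (bang E (src k)) k" if k: "k : arr" "tgt k = X" for k
  proof -
   have "?s X $ k = gp (one E) X (bang E X $ k) (Idn E X $ k)" by (rule g(6)[OF k(1)]) (use k o(6) in simp)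
   then show ?thesis unfolding bang_comp[OF k] idn_comp[OF k] .
  qed
  have "Idn E (prod (one E) X) = gp (one E) X (fst' (one E) X) (snd' (one E) X)"
   by (rule gp_eqI[OF one_obj X]) (use px in simp_all)
  moreover have "fst' (one E) X = bang E (src (snd' (one E) X))" using bang_unique[OF px(1,5)] px(3,4) by simp
  ultimately show "?s X $ snd' (one E) X = Idn E (prod (one E) X)" using c[OF px(2,6)] by simp
 qed
 note sW = sec[OF W_arr(7)] and sQ = sec[OF Q]
 \<comment> \<open>The cocone over the terminal object is represented by \<open>w\<close>, an arrow from \<open>1 \<times> W \<cong> W\<close>.\<close>
 define q where "q = w $ ?s W"
 have bq: "src (bang E Q) = Q" using Q by simp
 have qa: "q : arr" "src q = W" "tgt q = Q"
  unfolding q_def using comp_arr[OF sW(1) wd(4)] sW(2,3) wd(5,6) bq by simp_all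
 have qh: "q : hom E W Q" using qa by (simp add: hom_def)
 note a = idprod_arr[OF one_obj qh]
 have wq: "q $ snd' (one E) W = w"
 proof -
  have "q $ snd' (one E) W = w $ (?s W $ snd' (one E) W)"
   unfolding q_def by (rule assoc[OF p(2) sW(1) wd(4)]) (simp_all only: p(6) sW(2,3) wd(5))
  then show ?thesis unfolding sW(6) using wd(4,5) by (simp only: comp_idn)
 qed
 have b: "balanced Q q"
 proof -
  have "q $ actL x f y = q $ actR x f y" if t: "triple x f y" for x f y
  proof -
   note l = actL_arr[OF t] and r = actR_arr[OF t]
   have c: "q $ z = w $ gp (one E) W (bang E (src f)) z" if z: "z : arr" "src z = src f" "tgt z = W" for z
   proof -
    have "q $ z = w $ (?s W $ z)" unfolding q_def by (rule assoc[OF z(1) sW(1) wd(4)]) (simp_all only: z(3) sW(2,3) wd(5))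
    then show ?thesis unfolding sW(5)[OF z(1,3)] z(2) .
   qed
   have "src f : obj" using tripleD(2)[OF t] by simp
   then show ?thesis unfolding c[OF l(1-3)] c[OF r(1-3)] by (intro wd(8)[OF _ _ _ t]) simp_all
  qed
  then show ?thesis unfolding balanced_def using qh by simp
 qed
 have \<mu>: "\<mu> (bang E J) x = ix_tensor Q q (bang E J) x" if "J : obj" "x : hom E J (tot V)" for J x
  unfolding wq by (rule w(2)) (use that in "simp add: at_stage_def hom_def")
 have iqs: "idprod (one E) Q q $ ?s W = ?s Q $ q"
 proof -
  have o: "bang E W : arr" "tgt (bang E W) = one E" "Idn E W : arr" "tgt (Idn E W) = W" "src (bang E W) = src (Idn E W)" by simp_all
  show ?thesis unfolding a(7)[OF o] sQ(5)[OF qa(1,3)] qa(2) using comp_idn[OF qa(1,2)] by (simp only:)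
 qed
 have "EX! h. h : hom E Q Y & h $ q = r" if br: "balanced Y r" for Y r
 proof -
  have r: "r : arr" "src r = W" "tgt r = Y" "Y : obj" using balanced_arr[OF br] by simp_all
  note sb = one_balanced[OF br]
  note sd = slice_balancedD[OF sb]
  have bY: "src (bang E Y) = Y" using r(4) by simp
  have comp: "fAr (pull E e) (fst' (one E) Q, m, bang E Y) $\<^bsub>slice E (src e)\<^esub> ixcocone_at E Q \<mu> (one E) e x =
    ix_of (one E) (bang E Y) (m $ idprod (one E) Q q) e x"
   if s: "at_stage (one E) e x" and m: "m : hom E (prod (one E) Q) Y" "bang E Y $ m = fst' (one E) Q" for e x m
  proof (rule ixcocone_at_comp[OF one_obj qh s sd(2,3) _ m(2)])
   show "m : hom E (prod (one E) Q) (src (bang E Y))" using m(1) unfolding bY .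
   show "\<mu> (bang E (src e)) x = ix_tensor Q q (bang E (src e)) x"
    by (rule \<mu>) (use at_stageD[OF s] in "simp_all add: hom_def")
  qed
  have fb: "bang E Y $ m = fst' (one E) Q" if m: "m : hom E (prod (one E) Q) Y" for m
  proof -
   have "m : arr" "tgt m = Y" "src m = prod (one E) Q" using m by (simp_all add: hom_def)
   then have "bang E Y $ m = bang E (prod (one E) Q)" using bang_comp[of m Y] by (simp only:)
   then show ?thesis using bang_unique[OF pQ(1,5)] pQ(3) by simp
  qed
  have pr: "fOb (pull E (bang E (one E))) (bang E Q) = fst' (one E) Q" by (simp add: pull_def)
  let ?ok = "%n. n : hom (slice E (one E)) (fst' (one E) Q) (bang E Y) & (ALL e x. at_stage (one E) e x -->
    ix_tensor Y r e x = fAr (pull E e) n $\<^bsub>slice E (src e)\<^esub> ixcocone_at E Q \<mu> (one E) e x)"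
  have "EX! n. ?ok n" using un[OF ix_of_cocone[OF sb]] unfolding ix_fib_sel pr at_stage_ball .
  then obtain n where ok: "?ok n" and nu: "!!n'. ?ok n' ==> n' = n" by (rule ex1E) blast
  have n: "n : hom (slice E (one E)) (fst' (one E) Q) (bang E Y)"
   "!!e x. at_stage (one E) e x ==> ix_tensor Y r e x = fAr (pull E e) n $\<^bsub>slice E (src e)\<^esub> ixcocone_at E Q \<mu> (one E) e x"
   using ok by (rule conjunct1, use ok in blast)
  obtain m where m: "n = (fst' (one E) Q, m, bang E Y)" "m : hom E (src (fst' (one E) Q)) (src (bang E Y))" "bang E Y $ m = fst' (one E) Q"
   using n(1) by (rule slice_homE)
  have mh: "m : hom E (prod (one E) Q) Y" using m(2) unfolding pQ(3) bY .
  have ma: "m : arr" "src m = prod (one E) Q" "tgt m = Y" using mh by (simp_all add: hom_def)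
  have mq: "m $ idprod (one E) Q q = r $ snd' (one E) W"
  proof (rule ix_of_inject[OF one_obj sd(2,3)])
   note s = stage0[OF one_obj]
   show "ix_of (one E) (bang E Y) (m $ idprod (one E) Q q) (fst' (one E) (tot V)) (snd' (one E) (tot V)) =
     ix_tensor Y r (fst' (one E) (tot V)) (snd' (one E) (tot V))"
    unfolding n(2)[OF s] m(1) by (rule comp[OF s mh m(3), symmetric])
   show "bang E Y $ (m $ idprod (one E) Q q) = fst' (one E) W"
    unfolding a(4)[symmetric] by (rule assoc_eq[OF m(3)]) (use ma a(1,3) r(4) in simp_all)
   show "m $ idprod (one E) Q q : arr" "src (m $ idprod (one E) Q q) = prod (one E) W" "tgt (m $ idprod (one E) Q q) = src (bang E Y)"
    using comp_arr[OF a(1) ma(1)] a(2,3) ma(2,3) bY by simp_all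
  qed (use sd(4-7) in simp_all)
  show ?thesis
  proof (rule ex1I[of _ "m $ ?s Q"], intro conjI)
   show "m $ ?s Q : hom E Q Y" using comp_arr[OF sQ(1) ma(1)] sQ(2,3) ma(2,3) by (simp add: hom_def)
   have "(m $ ?s Q) $ q = m $ (?s Q $ q)" by (rule assoc[OF qa(1) sQ(1) ma(1)]) (simp_all only: qa(3) sQ(2,3) ma(2))
   also have "\<dots> = (m $ idprod (one E) Q q) $ ?s W"
    unfolding iqs[symmetric] by (rule assoc[OF sW(1) a(1) ma(1), symmetric]) (simp_all only: sW(3) a(2,3) ma(2))
   also have "\<dots> = r $ (snd' (one E) W $ ?s W)"
    unfolding mq by (rule assoc[OF sW(1) p(2) r(1)]) (simp_all only: sW(3) p(4,6) r(2))
   finally show "(m $ ?s Q) $ q = r" unfolding sW(4) using comp_idn[OF r(1,2)] by simp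
  next
   fix h assume h: "h : hom E Q Y & h $ q = r"
   then have ha: "h : arr" "src h = Q" "tgt h = Y" by (simp_all add: hom_def)
   let ?m' = "h $ snd' (one E) Q"
   have mh': "?m' : hom E (prod (one E) Q) Y" using comp_arr[OF pQ(2) ha(1)] pQ(4,6) ha by (simp add: hom_def)
   have "?m' $ idprod (one E) Q q = h $ (snd' (one E) Q $ idprod (one E) Q q)"
    by (rule assoc[OF a(1) pQ(2) ha(1)]) (simp_all only: a(3) pQ(4,6) ha(2))
   also have "\<dots> = r $ snd' (one E) W"
    unfolding a(5) by (rule assoc_eq) (use h ha qa p in simp_all)
   finally have mq': "?m' $ idprod (one E) Q q = r $ snd' (one E) W" .
   have "(fst' (one E) Q, ?m', bang E Y) = n"
   proof (rule nu, intro conjI allI impI)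
    show "(fst' (one E) Q, ?m', bang E Y) : hom (slice E (one E)) (fst' (one E) Q) (bang E Y)"
     unfolding slice_hom pQ(3) bY using pQ(1,5) sd(2,3) mh' fb[OF mh'] by simp
    show "ix_tensor Y r e x = fAr (pull E e) (fst' (one E) Q, ?m', bang E Y) $\<^bsub>slice E (src e)\<^esub> ixcocone_at E Q \<mu> (one E) e x"
     if s: "at_stage (one E) e x" for e x
     unfolding comp[OF s mh' fb[OF mh']] mq' ..
   qed
   then have "?m' = m" unfolding m(1) by simp
   then have "m $ ?s Q = h $ (snd' (one E) Q $ ?s Q)"
    using assoc[OF sQ(1) pQ(2) ha(1)] sQ(3) pQ(4,6) ha(2) by simp
   then show "h = m $ ?s Q" unfolding sQ(4) using comp_idn[OF ha(1,2)] by simp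
  qed
 qed
 then have "is_tensor Q q" unfolding is_tensor_def using b by simp
 then show thesis using that \<mu> by blast
qed

end

section \<open>Naturality\<close>

lemma (in internal_image) idiag_map_act:
 assumes D: "is_idiag E \<D> D" "is_idiag E \<D> D'" "is_idiag_map E \<D> D D' h"
  and x: "x : arr" "f : arr" "src x = src f" "tgt x = tot D" "tgt f = fOb L (Arr C)" "anc D $ x = d0 \<D> $ f"
 shows "h $ act_on E \<D> D x f = act_on E \<D> D' (h $ x) f"
proof -
 have A: "anc D : arr" "src (anc D) = tot D" "tgt (anc D) = fOb L (Obj C)"
  "act D : arr" "src (act D) = pbOb E (anc D) (d0 \<D>)" "tgt (act D) = tot D"
  using D(1) by (auto simp: is_idiag_def hom_def carriers)
 have pd: "anc D : arr" "d0 \<D> : arr" "tgt (anc D) = tgt (d0 \<D>)" using A by simp_all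
 note p = pb_arr[OF pd]
 have h: "h : arr" "src h = tot D" "tgt h = tot D'" "anc D' $ h = anc D"
  "h $ act D = act_on E \<D> D' (h $ pb1 E (anc D) (d0 \<D>)) (pb2 E (anc D) (d0 \<D>))"
  using D(3) by (auto simp: is_idiag_map_def hom_def)
 have xf: "tgt x = src (anc D)" "tgt f = src (d0 \<D>)" using x(4,5) A by simp_all
 let ?k = "pair E (anc D) (d0 \<D>) x f"
 note k = pair_arr[OF pd x(1,2,3) xf x(6)]
 have A': "anc D' : arr" "src (anc D') = tot D'" using D(2) by (auto simp: is_idiag_def hom_def)
 have "anc D' $ (h $ pb1 E (anc D) (d0 \<D>)) = anc D $ pb1 E (anc D) (d0 \<D>)"
  by (rule assoc_eq[OF h(4)]) (use h A A' p in simp_all)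
 then have sq: "anc D' $ (h $ pb1 E (anc D) (d0 \<D>)) = d0 \<D> $ pb2 E (anc D) (d0 \<D>)" unfolding pb_sq[OF pd] .
 have g: "h $ pb1 E (anc D) (d0 \<D>) : arr" "src (h $ pb1 E (anc D) (d0 \<D>)) = src (pb2 E (anc D) (d0 \<D>))"
  "tgt (h $ pb1 E (anc D) (d0 \<D>)) = tot D'" "tgt (pb2 E (anc D) (d0 \<D>)) = fOb L (Arr C)"
  using h(1-3) A p by simp_all
 have kp: "tgt ?k = src (pb2 E (anc D) (d0 \<D>))" "tgt ?k = src (pb1 E (anc D) (d0 \<D>))" "tgt (pb1 E (anc D) (d0 \<D>)) = src h"
  using k(3) p(3,4,5) h(2) A(2) by simp_all
 have "h $ act_on E \<D> D x f = (h $ act D) $ ?k"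
  unfolding act_on_def by (rule assoc[OF k(1) A(4) h(1), symmetric]) (simp_all only: k(3) A(5,6) h(2))
 also have "\<dots> = act_on E \<D> D' ((h $ pb1 E (anc D) (d0 \<D>)) $ ?k) (pb2 E (anc D) (d0 \<D>) $ ?k)"
  unfolding h(5) by (rule idiag_act(5)[OF D(2) g(1) p(2) g(2,3,4) sq k(1) kp(1)])
 also have "(h $ pb1 E (anc D) (d0 \<D>)) $ ?k = h $ x"
  unfolding assoc[OF k(1) p(1) h(1) kp(2,3)] k(4) ..
 finally show ?thesis unfolding k(5) .
qed

lemma (in tensor) swap_epi:
 assumes u: "u : arr" "v : arr" "src u = pbOb E (anc V) (anc U)" "src v = pbOb E (anc V) (anc U)" and e: "u $ swap = v $ swap"
 shows "u = v"
proof -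
 interpret T: tensor E L R "op_cat C" "iop \<D>" V U by (rule tensor_op)
 note s = swap_arr and s' = T.swap_arr
 have ss': "swap $ T.swap = Idn E T.W"
  by (rule pb_eqI[OF T.W_sq]) (use s s' assoc_eq[OF s(4), of T.swap] assoc_eq[OF s(5), of T.swap] in simp_all)
 have "(u $ swap) $ T.swap = (v $ swap) $ T.swap" using e by simp
 moreover have "(z $ swap) $ T.swap = z" if z: "z : arr" "src z = T.W" for z
  unfolding assoc[OF s'(1) s(1) z(1) s'(3)[folded s(2)] s(3)[folded z(2)]] ss' using z by (simp only: comp_idn)
 ultimately show ?thesis using u by simp
qed

context functor_tensor
begin

text \<open>
  The four colimits of \<open>s\<close>, each seen as a tensor product, with the isomorphisms between them.
\<close>

definition comparison :: "('u, 'o, 'a) colims => 'a => 'a => 'a => 'a => 'a => bool" where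
 "comparison s r1 r4 t1 t2 t3 \<longleftrightarrow>
   is_tensor (ext_colim s) r1 & (ALL c : Obj C. ALL x : fOb P c. r1 $ leg c x = ext_leg s (c, x)) &
   is_tensor (intF_colim s) (intF_leg s) &
   is_tensor (intP_colim s) (intP_leg s $ swap) & intP_leg s : hom E (pbOb E (anc V) (anc U)) (intP_colim s) &
   is_tensor (ix_colim s) r4 & (ALL J : obj. ALL x : hom E J (tot V). ix_leg s (bang E J) x = ix_tensor (ix_colim s) r4 (bang E J) x) &
   is_iso E (ext_colim s) (intF_colim s) t1 & t1 $ r1 = intF_leg s &
   is_iso E (intF_colim s) (intP_colim s) t2 & t2 $ intF_leg s = intP_leg s $ swap &
   is_iso E (intP_colim s) (ix_colim s) t3 & t3 $ (intP_leg s $ swap) = r4"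

lemma comparison_exists:
 assumes "is_colimit E (op_cat (elements C P)) (fcomp F elements_proj) (ext_colim s) (ext_leg s)"
  and i: "is_internal_colim E (int_f E (iop \<D>) U) (idiag_comp E (int_f E (iop \<D>) U) (iop \<D>) V (proj_f E (iop \<D>) U)) (intF_colim s) (intF_leg s)"
  and j: "is_internal_colim E (int_f E \<D> V) (idiag_comp E (int_f E \<D> V) \<D> U (proj_f E \<D> V)) (intP_colim s) (intP_leg s)"
  and x: "is_indexed_colim E \<A> \<Gamma> (ix_colim s) (ix_leg s)"
 shows "EX r1 r4 t1 t2 t3. comparison s r1 r4 t1 t2 t3"
proof -
 obtain r1 where r1: "is_tensor (ext_colim s) r1" "!!c x. c : Obj C ==> x : fOb P c ==> r1 $ leg c x = ext_leg s (c, x)"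
  by (rule ext_colimit_is_tensor[OF assms(1)]) (rule that)
 obtain r4 where r4: "is_tensor (ix_colim s) r4"
  "!!J x. J : obj ==> x : hom E J (tot V) ==> ix_leg s (bang E J) x = ix_tensor (ix_colim s) r4 (bang E J) x"
  by (rule indexed_colim_is_tensor[OF x]) (rule that)
 have r2: "is_tensor (intF_colim s) (intF_leg s)" using i unfolding intF_tensor .
 note h = intP_hom[OF j]
 have r3: "is_tensor (intP_colim s) (intP_leg s $ swap)" using j unfolding intP_tensor[OF h] .
 obtain t1 where "is_iso E (ext_colim s) (intF_colim s) t1" "t1 $ r1 = intF_leg s" by (rule tensor_unique[OF r1(1) r2])
 moreover obtain t2 where "is_iso E (intF_colim s) (intP_colim s) t2" "t2 $ intF_leg s = intP_leg s $ swap" by (rule tensor_unique[OF r2 r3])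
 moreover obtain t3 where "is_iso E (intP_colim s) (ix_colim s) t3" "t3 $ (intP_leg s $ swap) = r4" by (rule tensor_unique[OF r3 r4(1)])
 ultimately show ?thesis
  unfolding comparison_def using r1 r2 r3 h r4
  by (intro exI[of _ r1] exI[of _ r4] exI[of _ t1] exI[of _ t2] exI[of _ t3] conjI ballI)
qed

lemma all_colims_exist:
 "EX s :: ('u, 'o, 'a) colims. dF s = V & kF s = \<kappa>V & dP s = U & kP s = \<kappa>U &
   is_colimit E (op_cat (elements C P)) (fcomp F elements_proj) (ext_colim s) (ext_leg s) &
   is_internal_colim E (int_f E (iop \<D>) U) (idiag_comp E (int_f E (iop \<D>) U) (iop \<D>) V (proj_f E (iop \<D>) U)) (intF_colim s) (intF_leg s) &
   is_internal_colim E (int_f E \<D> V) (idiag_comp E (int_f E \<D> V) \<D> U (proj_f E \<D> V)) (intP_colim s) (intP_leg s) &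
   is_indexed_colim E \<A> \<Gamma> (ix_colim s) (ix_leg s)"
proof -
 interpret T: tensor E L R "op_cat C" "iop \<D>" V U by (rule tensor_op)
 obtain Q q where q: "is_tensor Q q" using tensor_exists by blast
 obtain Q' q' where q': "T.is_tensor Q' q'" using T.tensor_exists by blast
 have "is_internal_colim E (int_f E \<D> V) (idiag_comp E (int_f E \<D> V) \<D> U (proj_f E \<D> V)) Q' q'"
  using T.intF_tensor[of Q' q'] q' by simp
 then show ?thesis using tensor_is_ext_colimit[OF q] intF_tensor[of Q q] q tensor_is_indexed_colim[OF q]
  by (intro exI[of _ "\<lparr>dF = V, kF = \<kappa>V, dP = U, kP = \<kappa>U, ext_colim = Q, ext_leg = %(c, x). q $ leg c x,
   intF_colim = Q, intF_leg = q, intP_colim = Q', intP_leg = q', ix_colim = Q, ix_leg = ix_tensor Q q\<rparr>"]) simp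
qed

lemma ix_tensor_eq:
 assumes q: "q : hom E W Q" and J: "J : obj" and x: "x : hom E J (tot V)"
 shows "ix_tensor Q q (bang E J) x = (fib1 x, gp J Q (fib1 x) (q $ fibW x), fst' J Q)"
proof -
 have qa: "q : arr" "src q = W" "tgt q = Q" using q by (simp_all add: hom_def)
 have s1: "at_stage (one E) (bang E J) x" using x J by (simp add: at_stage_def hom_def)
 note st = stage_el[OF one_obj s1] and p1 = prod_arr[OF one_obj W_arr(7)]
 have "(q $ snd' (one E) W) $ gp (one E) W (bang E J $ fib1 x) (fibW x) = q $ (snd' (one E) W $ gp (one E) W (bang E J $ fib1 x) (fibW x))"
  by (rule assoc[OF st(1) p1(2) qa(1)]) (simp_all only: st(3) p1(4,6) qa(2))
 then show ?thesis unfolding ix_of_def st(5) by simp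
qed

end

text \<open>
  Two pairs of functors with natural transformations between them, and the corresponding maps of
  internal diagrams.
\<close>

locale tensor_map = internal_image E L R C \<D> + T: functor_tensor E L R C \<D> F P U V \<kappa>U \<kappa>V +
  T': functor_tensor E L R C \<D> F' P' U' V' \<kappa>U' \<kappa>V'
 for E :: "('o, 'a) cat" (structure) and L :: "('u::universe set, 'u fn, 'o, 'a) func" and R and C :: "('u, 'u) cat" and \<D>
  and F P U V \<kappa>U \<kappa>V F' P' U' V' \<kappa>U' \<kappa>V' +
 fixes \<alpha> :: "'u => 'a" and \<beta> :: "'u => 'u fn" and a b :: 'a
 assumes \<alpha>: "is_nat (op_cat C) E F F' \<alpha>" and \<beta>: "is_nat C SetC P P' \<beta>"
  and a: "corresponding_map E (op_cat C) (iop \<D>) \<alpha> V \<kappa>V V' \<kappa>V' a"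
  and b: "corresponding_map E C \<D> (%c. fAr L (\<beta> c)) U \<kappa>U U' \<kappa>U' b"
begin

lemma ab_arr: "a : arr" "src a = tot V" "tgt a = tot V'" "anc V' $ a = anc V"
 "b : arr" "src b = tot U" "tgt b = tot U'" "anc U' $ b = anc U"
 using a b by (auto simp: corresponding_map_def is_idiag_map_def hom_def)

text \<open>
  The map between fibre products that all the induced arrows have in common.
\<close>

definition w :: 'a where "w = pb_map E (anc U) (anc V) (anc U') (anc V') b a"

lemma pairs:
 assumes u: "u : arr" "v : arr" "src u = src v" "tgt u = tot U" "tgt v = tot V" "anc U $ u = anc V $ v"
 shows "b $ u : arr" "a $ v : arr" "src (b $ u) = src (a $ v)" "tgt (b $ u) = src (anc U')" "tgt (a $ v) = src (anc V')"
  "anc U' $ (b $ u) = anc V' $ (a $ v)"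
proof -
 note ab = ab_arr
 have su: "tgt u = src b" "tgt v = src a" using u ab by simp_all
 note cu = comp_arr[OF u(1) ab(5) su(1)] and cv = comp_arr[OF u(2) ab(1) su(2)]
 show "b $ u : arr" "a $ v : arr" by (rule cu cv)+
 show "src (b $ u) = src (a $ v)" "tgt (b $ u) = src (anc U')" "tgt (a $ v) = src (anc V')"
  using cu(2,3) cv(2,3) u(3) ab(3,7) by simp_all
 have "anc U' $ (b $ u) = anc U $ u" by (rule assoc_eq[OF ab(8)]) (use ab su u(1) in simp_all)
 also have "\<dots> = anc V' $ (a $ v)" unfolding u(6) by (rule assoc_eq[OF ab(4), symmetric]) (use ab su u(2) in simp_all)
 finally show "anc U' $ (b $ u) = anc V' $ (a $ v)" .
qed

lemma w_arr: "w : arr" "src w = T.W" "tgt w = T'.W"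
 and w_comp: "z : arr ==> tgt z = T.W ==> T.prU $ z = u ==> T.prV $ z = v ==> w $ z = T'.pairW (b $ u) (a $ v)"
proof -
 note ab = ab_arr
 have sq: "anc U $ T.prU = anc V $ T.prV" by (rule pb_sq[OF T.W_sq])
 have s: "src T.prU = src T.prV" unfolding T.W_arr ..
 note g = pairs[OF T.W_arr(1,2) s T.W_arr(5,6) sq]
 note p = pair_arr[OF T'.W_sq g]
 have S: "src (a $ T.prV) = T.W" by (subst comp_arr(2)) (simp_all add: ab)
 show "w : arr" "src w = T.W" "tgt w = T'.W" unfolding w_def pb_map_def using p(1,3) p(2)[unfolded g(3) S] by simp_all
 assume z: "z : arr" "tgt z = T.W" "T.prU $ z = u" "T.prV $ z = v"
 have "w $ z = T'.pairW ((b $ T.prU) $ z) ((a $ T.prV) $ z)"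
  unfolding w_def pb_map_def by (rule pair_comp(1)[OF T'.W_sq g z(1)]) (use z(2) S g(3) in simp)
 also have "(b $ T.prU) $ z = b $ (T.prU $ z)" by (rule assoc[OF z(1) T.W_arr(1) ab(5)]) (simp_all only: z(2) T.W_arr(3,5) ab(6))
 also have "(a $ T.prV) $ z = a $ (T.prV $ z)" by (rule assoc[OF z(1) T.W_arr(2) ab(1)]) (simp_all only: z(2) T.W_arr(4,6) ab(2))
 finally show "w $ z = T'.pairW (b $ u) (a $ v)" unfolding z(3,4) .
qed

text \<open>
  The map \<open>w\<close> commutes with both actions and so preserves the relation.
\<close>

lemma balanced_pull:
 assumes r: "T'.balanced Y r"
 shows "T.balanced Y (r $ w)"
proof -
 note ab = ab_arr and ra = T'.balanced_arr[OF r]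
 have rw: "tgt w = src r" using ra w_arr by simp
 have "(r $ w) $ T.actL x f y = (r $ w) $ T.actR x f y" if t: "T.triple x f y" for x f y
 proof -
  note td = T.tripleD[OF t] and l = T.actL_arr[OF t] and rr = T.actR_arr[OF t]
  have sx: "tgt x = src b" "tgt y = src a" using td ab by simp_all
  note cx = comp_arr[OF td(1) ab(5) sx(1)] and cy = comp_arr[OF td(3) ab(1) sx(2)]
  have "anc U' $ (b $ x) = anc U $ x" by (rule assoc_eq[OF ab(8)]) (use ab sx td(1) in simp_all)
  moreover have "anc V' $ (a $ y) = anc V $ y" by (rule assoc_eq[OF ab(4)]) (use ab sx td(3) in simp_all)
  ultimately have t': "T'.triple (b $ x) f (a $ y)" unfolding T'.triple_def using cx cy td ab(3,7) by simp
  have bm: "is_idiag_map E \<D> U U' b" and am: "is_idiag_map E (iop \<D>) V V' a" using a b by (simp_all add: corresponding_map_def)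
  have "b $ T.actU x f = T'.actU (b $ x) f" by (rule idiag_map_act[OF T.U T'.U bm td(1,2,4,6,7,9)])
  then have L: "w $ T.actL x f y = T'.actL (b $ x) f (a $ y)" unfolding w_comp[OF l(1,3,4,5)] T'.actL_def by simp
  have yv: "anc V $ y = d0 (iop \<D>) $ f" "tgt f = fOb L (Arr (op_cat C))" using td by simp_all
  have "a $ T.actV y f = T'.actV (a $ y) f" by (rule T.op.idiag_map_act[OF T.V T'.V am td(3,2,5,8) yv(2,1)])
  then have R: "w $ T.actR x f y = T'.actR (b $ x) f (a $ y)" unfolding w_comp[OF rr(1,3,4,5)] T'.actR_def by simp
  have c: "(r $ w) $ z = r $ (w $ z)" if z: "z : arr" "tgt z = T.W" for z
   by (rule assoc[OF z(1) w_arr(1) _ _ rw]) (use z w_arr ra in simp_all)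
  show ?thesis unfolding c[OF l(1,3)] c[OF rr(1,3)] L R by (rule T'.balancedD[OF r t'])
 qed
 moreover have "r $ w : hom E T.W Y" using comp_arr[OF w_arr(1) _ rw] w_arr ra by (simp add: hom_def)
 ultimately show ?thesis by (simp add: T.balanced_def)
qed

lemma tensor_map_exists:
 assumes "T.is_tensor Q q" "T'.is_tensor Q' q'"
 obtains m where "m : hom E Q Q'" "m $ q = q' $ w"
proof -
 have "T'.balanced Q' q'" using assms(2) by (simp add: T'.is_tensor_def)
 then show thesis using T.tensor_factor[OF assms(1) balanced_pull] that by blast
qed

text \<open>
  The two composites agree after the quotient map.
\<close>

lemma comparison_square:
 assumes q: "T.is_tensor Q q" "T.is_tensor X x" "T'.is_tensor Q' q'" "T'.is_tensor X' x'"
  and t: "is_iso E Q X t" "t $ q = x" "is_iso E Q' X' t'" "t' $ q' = x'"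
  and m: "m : hom E Q Q'" "m $ q = q' $ w" "n : hom E X X'" "n $ x = x' $ w"
 shows "t' $ m = n $ t"
proof (rule T.tensor_epi[OF q(1)])
 have qb: "T.balanced Q q" "T'.balanced Q' q'" using q by (simp_all add: T.is_tensor_def T'.is_tensor_def)
 note A = T.balanced_arr[OF qb(1)] T'.balanced_arr[OF qb(2)]
 have ta: "t : arr" "src t = Q" "tgt t = X" "t' : arr" "src t' = Q'" "tgt t' = X'" using is_iso_arr[OF t(1)] is_iso_arr[OF t(3)] by simp_all
 have ma: "m : arr" "src m = Q" "tgt m = Q'" "n : arr" "src n = X" "tgt n = X'" using m by (simp_all add: hom_def)
 show "t' $ m : hom E Q X'" "n $ t : hom E Q X'" using ta ma by (simp_all add: hom_def)
 have "(t' $ m) $ q = t' $ (q' $ w)" unfolding m(2)[symmetric] by (rule assoc) (use A ta ma in simp_all)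
 also have "\<dots> = x' $ w" by (rule assoc_eq[OF t(4)]) (use A ta w_arr in simp_all)
 also have "\<dots> = n $ (t $ q)" unfolding m(4)[symmetric] t(2) ..
 also have "\<dots> = (n $ t) $ q" by (rule assoc[symmetric]) (use A ta ma in simp_all)
 finally show "(t' $ m) $ q = (n $ t) $ q" .
qed

lemma induced_ext_of_tensor:
 assumes q: "T.is_tensor (ext_colim s) q" "T'.is_tensor (ext_colim s') q'"
  and l: "ALL c : Obj C. ALL x : fOb P c. q $ T.leg c x = ext_leg s (c, x)" "ALL c : Obj C. ALL x : fOb P' c. q' $ T'.leg c x = ext_leg s' (c, x)"
  and m: "m : hom E (ext_colim s) (ext_colim s')" "m $ q = q' $ w"
 shows "induced_ext E C P \<alpha> \<beta> s s' m"
proof -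
 have qb: "T.balanced (ext_colim s) q" "T'.balanced (ext_colim s') q'" using q by (simp_all add: T.is_tensor_def T'.is_tensor_def)
 note A = T.balanced_arr[OF qb(1)] T'.balanced_arr[OF qb(2)]
 have ma: "m : arr" "src m = ext_colim s" using m by (simp_all add: hom_def)
 note ab = ab_arr
 have "m $ ext_leg s (c, x) = ext_leg s' (c, app (\<beta> c) x) $ \<alpha> c" if c: "c : Obj C" and x: "x : fOb P c" for c x
 proof -
  have \<beta>c: "\<beta> c : hom SetC (fOb P c) (fOb P' c)" using \<beta> c by (simp add: is_nat_def)
  have x': "app (\<beta> c) x : fOb P' c" by (rule SetC_app_in[OF \<beta>c x])
  have \<alpha>c: "\<alpha> c : arr" "src (\<alpha> c) = fOb F c" "tgt (\<alpha> c) = fOb F' c" using \<alpha> c by (auto simp: is_nat_def hom_def)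
  note g = T.leg_arr[OF c x] and g' = T'.leg_arr[OF c x']
  have Fc: "fOb F c : obj" using c by simp
  have bk: "b $ \<kappa>U c = \<kappa>U' c $ fAr L (\<beta> c)" and ak: "a $ \<kappa>V c = \<kappa>V' c $ \<alpha> c" using a b c by (simp_all add: corresponding_map_def)
  have k1: "cst (fOb P c) x (fOb F c) : arr" "src (cst (fOb P c) x (fOb F c)) = fOb F c" "tgt (cst (fOb P c) x (fOb F c)) = fOb L (fOb P c)"
   by (rule T.cstP(1-3)[OF c x Fc])+
  have "b $ T.point c x (fOb F c) = (\<kappa>U' c $ fAr L (\<beta> c)) $ cst (fOb P c) x (fOb F c)"
   unfolding T.point_def by (rule assoc_eq[OF bk]) (use k1 c ab in simp_all)
  also have "\<dots> = \<kappa>U' c $ (fAr L (\<beta> c) $ cst (fOb P c) x (fOb F c))"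
   by (rule assoc) (use k1 c L_arr[OF \<beta>c] in simp_all)
  also have "\<dots> = T'.point c (app (\<beta> c) x) (fOb F c)" unfolding L_cst[OF \<beta>c x Fc] T'.point_def ..
  finally have bp: "b $ T.point c x (fOb F c) = T'.point c (app (\<beta> c) x) (fOb F c)" .
  have wl: "w $ T.leg c x = T'.leg c (app (\<beta> c) x) $ \<alpha> c"
   unfolding w_comp[OF g(1,3,4,5)] g'(6)[OF \<alpha>c(1,3)] bp ak \<alpha>c(2) ..
  have "m $ ext_leg s (c, x) = m $ (q $ T.leg c x)" using l(1) c x by simp
  also have "\<dots> = (q' $ w) $ T.leg c x" by (rule assoc_eq[OF m(2)]) (use A ma g in simp_all)
  also have "\<dots> = q' $ (w $ T.leg c x)" by (rule assoc) (use A w_arr g in simp_all)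
  also have "\<dots> = (q' $ T'.leg c (app (\<beta> c) x)) $ \<alpha> c" unfolding wl by (rule assoc[symmetric]) (use A \<alpha>c g' in simp_all)
  finally show ?thesis using l(2) c x' by simp
 qed
 then show ?thesis unfolding induced_ext_def using m(1) by (auto simp: elements_def)
qed

text \<open>
  Exchanging the factors is an isomorphism that commutes with the maps of fibre products.
\<close>

lemma induced_intP_of_tensor:
 assumes h: "intP_leg s : hom E (pbOb E (anc V) (anc U)) (intP_colim s)" "intP_leg s' : hom E (pbOb E (anc V') (anc U')) (intP_colim s')"
  and m: "m : hom E (intP_colim s) (intP_colim s')" "m $ (intP_leg s $ T.swap) = (intP_leg s' $ T'.swap) $ w"
  and d: "dF s = V" "dP s = U" "dF s' = V'" "dP s' = U'"
 shows "induced_intP E a b s s' m"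
proof -
 note ab = ab_arr
 let ?w = "pb_map E (anc V) (anc U) (anc V') (anc U') a b"
 let ?p1 = "pb1 E (anc V) (anc U)" and ?p2 = "pb2 E (anc V) (anc U)"
 have pd: "anc V : arr" "anc U : arr" "tgt (anc V) = tgt (anc U)" and pd': "anc V' : arr" "anc U' : arr" "tgt (anc V') = tgt (anc U')"
  by simp_all
 note p = pb_arr[OF pd]
 have o: "?p2 : arr" "?p1 : arr" "src ?p2 = src ?p1" "tgt ?p2 = tot U" "tgt ?p1 = tot V" "anc U $ ?p2 = anc V $ ?p1"
  using p pb_sq[OF pd] by simp_all
 note g = pairs[OF o]
 note pw = pair_arr[OF pd' g(2,1) g(3)[symmetric] g(5,4) g(6)[symmetric]]
  and pc = pair_comp(1)[OF pd' g(2,1) g(3)[symmetric] g(5,4) g(6)[symmetric]]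
 have S: "src (b $ ?p2) = pbOb E (anc V) (anc U)" by (subst comp_arr(2)) (use o p ab in simp_all)
 have wa: "?w : arr" "src ?w = pbOb E (anc V) (anc U)" "tgt ?w = pbOb E (anc V') (anc U')"
  unfolding pb_map_def using pw(1,3) pw(2)[unfolded g(3)[symmetric] S] by simp_all
 note s = T.swap_arr and s' = T'.swap_arr
 have sq: "anc U $ T.prU = anc V $ T.prV" by (rule pb_sq[OF T.W_sq])
 have Ws: "src T.prU = src T.prV" unfolding T.W_arr ..
 note gW = pairs[OF T.W_arr(1,2) Ws T.W_arr(5,6) sq]
 have Tsw: "tgt w = src T'.prV" "tgt w = src T'.prU" "tgt w = src T'.swap" using w_arr(3) s'(2) T'.W_arr by simp_all
 note pW = pair_arr[OF T'.W_sq gW, folded pb_map_def, folded w_def]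
 have "T'.swap $ w = pair E (anc V') (anc U') (a $ T.prV) (b $ T.prU)"
 proof (rule pair_eqI[OF pd'])
  show "T'.swap $ w : arr" "tgt (T'.swap $ w) = pbOb E (anc V') (anc U')"
   using comp_arr[OF w_arr(1) s'(1) Tsw(3)] s'(3) by simp_all
  have "pb1 E (anc V') (anc U') $ (T'.swap $ w) = T'.prV $ w"
   by (rule assoc_eq[OF s'(4) s'(1) _ _ w_arr(1) Tsw(3)]) (use pb_arr[OF pd'] s'(3) in simp_all)
  then show "pb1 E (anc V') (anc U') $ (T'.swap $ w) = a $ T.prV" unfolding pW(5) .
  have "pb2 E (anc V') (anc U') $ (T'.swap $ w) = T'.prU $ w"
   by (rule assoc_eq[OF s'(5) s'(1) _ _ w_arr(1) Tsw(3)]) (use pb_arr[OF pd'] s'(3) in simp_all)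
  then show "pb2 E (anc V') (anc U') $ (T'.swap $ w) = b $ T.prU" unfolding pW(4) .
 qed
 also have "\<dots> = ?w $ T.swap"
 proof -
  have "?w $ T.swap = pair E (anc V') (anc U') ((a $ ?p1) $ T.swap) ((b $ ?p2) $ T.swap)"
   unfolding pb_map_def by (rule pc[OF s(1)]) (use s(3) S g(3) in simp)
  also have "(a $ ?p1) $ T.swap = a $ (?p1 $ T.swap)" by (rule assoc[OF s(1) o(2) ab(1)]) (simp_all only: s(3) p(3) o(5) ab(2))
  also have "(b $ ?p2) $ T.swap = b $ (?p2 $ T.swap)" by (rule assoc[OF s(1) o(1) ab(5)]) (simp_all only: s(3) p(4) o(4) ab(6))
  finally show ?thesis unfolding s(4,5) ..
 qed
 finally have sw: "T'.swap $ w = ?w $ T.swap" .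
 have ha: "intP_leg s : arr" "src (intP_leg s) = pbOb E (anc V) (anc U)" "tgt (intP_leg s) = intP_colim s"
  "intP_leg s' : arr" "src (intP_leg s') = pbOb E (anc V') (anc U')" "m : arr" "src m = intP_colim s"
  using h m by (simp_all add: hom_def)
 have j: "tgt T.swap = src (intP_leg s)" "tgt (intP_leg s) = src m" "tgt T'.swap = src (intP_leg s')" "tgt ?w = src (intP_leg s')" "tgt T.swap = src ?w"
  unfolding s(3) s'(3) ha(2,3,5,7) wa(2,3) by (rule refl)+
 have "m $ intP_leg s = intP_leg s' $ ?w"
 proof (rule T.swap_epi)
  show "m $ intP_leg s : arr" "src (m $ intP_leg s) = pbOb E (anc V) (anc U)"
   using comp_arr[OF ha(1,6) j(2)] ha(2) by simp_all
  show "intP_leg s' $ ?w : arr" "src (intP_leg s' $ ?w) = pbOb E (anc V) (anc U)"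
   using comp_arr[OF wa(1) ha(4) j(4)] wa(2) by simp_all
  have "(m $ intP_leg s) $ T.swap = (intP_leg s' $ T'.swap) $ w" unfolding m(2)[symmetric] by (rule assoc[OF s(1) ha(1,6) j(1,2)])
  also have "\<dots> = intP_leg s' $ (?w $ T.swap)" unfolding sw[symmetric] by (rule assoc[OF w_arr(1) s'(1) ha(4) Tsw(3) j(3)])
  also have "\<dots> = (intP_leg s' $ ?w) $ T.swap" by (rule assoc[OF s(1) wa(1) ha(4) j(5,4), symmetric])
  finally show "(m $ intP_leg s) $ T.swap = (intP_leg s' $ ?w) $ T.swap" .
 qed
 then show ?thesis unfolding induced_intP_def d using m(1) by simp
qed

lemma induced_ix_of_tensor:
 assumes q: "T.is_tensor (ix_colim s) q" "T'.is_tensor (ix_colim s') q'"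
  and l: "ALL J : obj. ALL x : hom E J (tot V). ix_leg s (bang E J) x = T.ix_tensor (ix_colim s) q (bang E J) x"
   "ALL J : obj. ALL x : hom E J (tot V'). ix_leg s' (bang E J) x = T'.ix_tensor (ix_colim s') q' (bang E J) x"
  and m: "m : hom E (ix_colim s) (ix_colim s')" "m $ q = q' $ w"
  and d: "dF s = V" "dP s = U" "dF s' = V'" "dP s' = U'"
 shows "induced_ix E a b s s' m"
proof -
 let ?Q = "ix_colim s" and ?Q' = "ix_colim s'"
 have qb: "T.balanced ?Q q" "T'.balanced ?Q' q'" using q by (simp_all add: T.is_tensor_def T'.is_tensor_def)
 have qa: "q : arr" "src q = T.W" "tgt q = ?Q" "?Q : obj" "q' : arr" "src q' = T'.W" "tgt q' = ?Q'" "?Q' : obj"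
  using T.balanced_arr[OF qb(1)] T'.balanced_arr[OF qb(2)] by simp_all
 have qh: "q : hom E T.W ?Q" "q' : hom E T'.W ?Q'" using qa by (simp_all add: hom_def)
 have ma: "m : arr" "src m = ?Q" "tgt m = ?Q'" using m by (simp_all add: hom_def)
 note ab = ab_arr
 have "fAr (pull E (bang E J)) (bang E ?Q, m, bang E ?Q') $\<^bsub>slice E J\<^esub> ix_leg s (bang E J) x =
   ix_leg s' (bang E J) (a $ x) $\<^bsub>slice E J\<^esub> (T.fib1 x, pb_map E (anc V $ x) (anc U) (anc V' $ (a $ x)) (anc U') (Idn E J) b, T'.fib1 (a $ x))"
  if J: "J : obj" and x: "x : hom E J (tot V)" for J x
 proof -
  have xa: "x : arr" "src x = J" "tgt x = tot V" using x by (simp_all add: hom_def)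
  have xs: "tgt x = src a" using xa ab by simp
  have ax: "a $ x : arr" "tgt (a $ x) = tot V'" "src (a $ x) = J" using comp_arr[OF xa(1) ab(1) xs] xa ab by simp_all
  have ah: "a $ x : hom E J (tot V')" using ax by (simp add: hom_def)
  note f = T.fib_arr[OF xa(1,3)] and fw = T.fibW_arr[OF xa(1,3)]
  note f' = T'.fib_arr[OF ax(1,2)] and fw' = T'.fibW_arr[OF ax(1,2)]
  \<comment> \<open>Both sides are the map to the product of \<open>J\<close> and the colimit with these two components.\<close>
  let ?r = "gp J ?Q' (T.fib1 x) (q' $ (w $ T.fibW x))"
  have qf: "q $ T.fibW x : arr" "src (T.fib1 x) = src (q $ T.fibW x)" "tgt (q $ T.fibW x) = ?Q" using fw qa f by simp_all
  have fJ: "tgt (T.fib1 x) = J" using f(5) xa by simp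
  have L: "fAr (pull E (bang E J)) (bang E ?Q, m, bang E ?Q') $\<^bsub>slice E J\<^esub> ix_leg s (bang E J) x = (T.fib1 x, ?r, fst' J ?Q')"
  proof -
   have i: "ix_leg s (bang E J) x = (T.fib1 x, gp J ?Q (T.fib1 x) (q $ T.fibW x), fst' J ?Q)"
    using l(1) J x T.ix_tensor_eq[OF qh(1) J x] by simp
   have h: "bang E J : arr" "bang E ?Q : arr" "bang E ?Q' : arr" "tgt (bang E J) = tgt (bang E ?Q)" "tgt (bang E J) = tgt (bang E ?Q')"
    using J qa by simp_all
   have mb: "src m = src (bang E ?Q)" "tgt m = src (bang E ?Q')" "bang E ?Q' $ m = bang E ?Q"
    using ma qa bang_comp[OF ma(1,3)] by simp_all
   have bb: "bang E J $ T.fib1 x = bang E ?Q $ (q $ T.fibW x)"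
    unfolding bang_comp[OF f(1) fJ] bang_comp[OF qf(1,3)] qf(2) ..
   have k: "tgt (T.fib1 x) = src (bang E J)" "tgt (q $ T.fibW x) = src (bang E ?Q)" using fJ J qf qa by simp_all
   have "gp J ?Q' (fst' J ?Q) (m $ snd' J ?Q) $ gp J ?Q (T.fib1 x) (q $ T.fibW x) = gp J ?Q' (T.fib1 x) (m $ (q $ T.fibW x))"
    by (rule pull_mid[OF h ma(1) mb f(1) qf(1,2) k bb])
   also have "m $ (q $ T.fibW x) = (q' $ w) $ T.fibW x" by (rule assoc_eq[OF m(2)]) (use qa ma fw in simp_all)
   also have "\<dots> = q' $ (w $ T.fibW x)" by (rule assoc) (use qa w_arr fw in simp_all)
   finally show ?thesis unfolding i by (simp only: pull_def func.simps prod.case slice_comp)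
  qed
  let ?N = "pb_map E (anc V $ x) (anc U) (anc V' $ (a $ x)) (anc U') (Idn E J) b"
  have R: "ix_leg s' (bang E J) (a $ x) $\<^bsub>slice E J\<^esub> (T.fib1 x, ?N, T'.fib1 (a $ x)) = (T.fib1 x, ?r, fst' J ?Q')"
  proof -
   have i: "ix_leg s' (bang E J) (a $ x) = (T'.fib1 (a $ x), gp J ?Q' (T'.fib1 (a $ x)) (q' $ T'.fibW (a $ x)), fst' J ?Q')"
    using l(2) J ah T'.ix_tensor_eq[OF qh(2) J ah] by simp
   have If: "Idn E J $ T.fib1 x = T.fib1 x" by (rule idn_comp[OF f(1) fJ])
   have Nd: "?N = T'.fibpair (a $ x) (T.fib1 x) (b $ T.fib2 x)" unfolding pb_map_def If ..
   have xf: "x $ T.fib1 x : arr" "src (x $ T.fib1 x) = T.fibO x" "tgt (x $ T.fib1 x) = tot V" using f xa by simp_all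
   have o: "src (T.fib2 x) = src (x $ T.fib1 x)" using f(4) xf(2) by simp
   note g = pairs[OF f(2) xf(1) o f(6) xf(3) f(7)]
   have axf: "a $ (x $ T.fib1 x) = (a $ x) $ T.fib1 x"
    by (rule assoc[symmetric]) (use f xa ab in simp_all)
   have e: "anc V' $ ((a $ x) $ T.fib1 x) = anc U' $ (b $ T.fib2 x)" unfolding axf[symmetric] by (rule g(6)[symmetric])
   have bs: "src (b $ T.fib2 x) = T.fibO x" by (subst comp_arr(2)) (use f ab in simp_all)
   have n: "src (T.fib1 x) = src (b $ T.fib2 x)" "tgt (T.fib1 x) = src (a $ x)" "tgt (b $ T.fib2 x) = tot U'"
    using bs f(3) fJ ax(3) g(4) by simp_all
   have e': "anc V' $ ((a $ x) $ T.fib1 x) = anc U' $ (b $ T.fib2 x)" by (rule e)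
   note N = T'.fibpair_arr[OF ax(1,2) f(1) g(1) n e', folded Nd]
   have fs': "src (T'.fib1 (a $ x)) = src (q' $ T'.fibW (a $ x))" "tgt (T'.fib1 (a $ x)) = J" "q' $ T'.fibW (a $ x) : arr"
    "tgt (q' $ T'.fibW (a $ x)) = ?Q'" "src (q' $ T'.fibW (a $ x)) = T'.fibO (a $ x)"
    using f' fw' qa ax by simp_all
   note G = gp_arr[OF J qa(8) f'(1) fs'(3,1,2,4)]
   have "gp J ?Q' (T'.fib1 (a $ x)) (q' $ T'.fibW (a $ x)) $ ?N = gp J ?Q' (T'.fib1 (a $ x) $ ?N) ((q' $ T'.fibW (a $ x)) $ ?N)"
    by (rule G(6)[OF N(1)]) (simp only: N(3) fs'(5))
   also have "(q' $ T'.fibW (a $ x)) $ ?N = q' $ (T'.fibW (a $ x) $ ?N)"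
    by (rule assoc[OF N(1) fw'(1) qa(5)]) (simp_all only: N(3) fw'(2,3) qa(6))
   also have "T'.fibW (a $ x) $ ?N = T'.pairW (b $ T.fib2 x) (a $ (x $ T.fib1 x))"
    unfolding fw'(4)[OF N(1,3)] N(4,5) axf ..
   also have "\<dots> = w $ T.fibW x"
   proof (rule w_comp[OF fw(1,3), symmetric])
    have h: "tgt (T.fib2 x) = src (anc U)" "tgt (x $ T.fib1 x) = src (anc V)" using f xf by simp_all
    show "T.prU $ T.fibW x = T.fib2 x" "T.prV $ T.fibW x = x $ T.fib1 x"
     unfolding T.fibW_def by (rule pair_arr(4,5)[OF T.W_sq f(2) xf(1) o h f(7)])+
   qed
   finally show ?thesis unfolding i slice_comp N(4) by simp
  qed
  show ?thesis unfolding L R ..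
 qed
 then show ?thesis unfolding induced_ix_def Let_def d using m(1) by simp
qed

end

lemma (in topos) functor_tensor_of_colims:
 assumes C: "small_category C" and F: "is_functor (op_cat C) E F" and P: "is_functor C SetC P"
  and "corresponds E L (op_cat C) (iop (icat_image L (internal_of C))) F V \<kappa>V"
  and "corresponds E L C (icat_image L (internal_of C)) (fcomp L P) U \<kappa>U"
 shows "functor_tensor E L R C (icat_image L (internal_of C)) F P U V \<kappa>U \<kappa>V"
proof -
 interpret internal_image E L R C "icat_image L (internal_of C)" by (rule internal_image_of[OF C])
 show ?thesis by unfold_locales (rule assms)+
qed

theorem theorem2p5:
  fixes C :: "('u::universe, 'u) cat"
    and E :: "('o, 'a) cat"
    and L :: "('u set, 'u fn, 'o, 'a) func"
    and R :: "('o, 'a, 'u set, 'u fn) func"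
  assumes "small_category C"
    and "grothendieck_topos TYPE('u) E"
    and "geometric_morphism E SetC L R"
  shows "(\<forall>F P. is_functor (op_cat C) E F \<and> is_functor C SetC P \<longrightarrow>
            (\<exists>s. are_colims E L C F P s)) \<and>
         (\<exists>\<theta>1 \<theta>2 \<theta>3.
            (\<forall>F P s.
               is_functor (op_cat C) E F \<and> is_functor C SetC P \<and> are_colims E L C F P s \<longrightarrow>
               is_iso E (ext_colim s) (intF_colim s) (\<theta>1 F P s) \<and>
               is_iso E (intF_colim s) (intP_colim s) (\<theta>2 F P s) \<and>
               is_iso E (intP_colim s) (ix_colim s) (\<theta>3 F P s)) \<and>
            (\<forall>F P s F' P' s' \<alpha> \<beta>.
               is_functor (op_cat C) E F \<and> is_functor C SetC P \<and> are_colims E L C F P s \<and>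
               is_functor (op_cat C) E F' \<and> is_functor C SetC P' \<and> are_colims E L C F' P' s' \<and>
               is_nat (op_cat C) E F F' \<alpha> \<and> is_nat C SetC P P' \<beta> \<longrightarrow>
               (\<exists>a b m1 m2 m3 m4.
                  corresponding_map E (op_cat C) (iop (icat_image L (internal_of C)))
                    \<alpha> (dF s) (kF s) (dF s') (kF s') a \<and>
                  corresponding_map E C (icat_image L (internal_of C))
                    (\<lambda>c. fAr L (\<beta> c)) (dP s) (kP s) (dP s') (kP s') b \<and>
                  induced_ext E C P \<alpha> \<beta> s s' m1 \<and> induced_intF E a b s s' m2 \<and>
                  induced_intP E a b s s' m3 \<and> induced_ix E a b s s' m4 \<and>
                  \<theta>1 F' P' s' \<cdot>\<^bsub>E\<^esub> m1 = m2 \<cdot>\<^bsub>E\<^esub> \<theta>1 F P s \<and>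
                  \<theta>2 F' P' s' \<cdot>\<^bsub>E\<^esub> m2 = m3 \<cdot>\<^bsub>E\<^esub> \<theta>2 F P s \<and>
                  \<theta>3 F' P' s' \<cdot>\<^bsub>E\<^esub> m3 = m4 \<cdot>\<^bsub>E\<^esub> \<theta>3 F P s)))" (is "_ \<and> ?G")
proof -
 interpret topos E L R by (rule topos_of_grothendieck[OF assms(2,3)])
 let ?D = "icat_image L (internal_of C)"
 interpret I: internal_image E L R C ?D by (rule internal_image_of[OF assms(1)])
 interpret O: internal_image E L R "op_cat C" "iop ?D" by (rule I.internal_image_op)
 have ex: "EX s. are_colims E L C F P s" if F: "is_functor (op_cat C) E F" and P: "is_functor C SetC P" for F and P :: "('u, 'u, 'u set, 'u fn) func"
 proof -
  obtain U \<kappa>U where cU: "corresponds E L C ?D (fcomp L P) U \<kappa>U" using I.diagram_exists[OF fcomp_L_functor[OF P]] by blast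
  obtain V \<kappa>V where cV: "corresponds E L (op_cat C) (iop ?D) F V \<kappa>V" using O.diagram_exists[OF F] by blast
  interpret functor_tensor E L R C ?D F P U V \<kappa>U \<kappa>V by (rule functor_tensor_of_colims[OF assms(1) F P cV cU])
  obtain s :: "('u, 'o, 'a) colims" where s: "dF s = V" "kF s = \<kappa>V" "dP s = U" "kP s = \<kappa>U"
   "is_colimit E (op_cat (elements C P)) (fcomp F elements_proj) (ext_colim s) (ext_leg s)"
   "is_internal_colim E (int_f E (iop ?D) U) (idiag_comp E (int_f E (iop ?D) U) (iop ?D) V (proj_f E (iop ?D) U)) (intF_colim s) (intF_leg s)"
   "is_internal_colim E (int_f E ?D V) (idiag_comp E (int_f E ?D V) ?D U (proj_f E ?D V)) (intP_colim s) (intP_leg s)"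
   "is_indexed_colim E \<A> \<Gamma> (ix_colim s) (ix_leg s)"
   using all_colims_exist by blast
  then have "are_colims E L C F P s" unfolding are_colims_def Let_def s(1-4) using cU cV by (intro conjI)
  then show ?thesis by blast
 qed
 let ?cmp = "%F P s. functor_tensor.comparison E L C ?D F P (dP s) (dF s) (kP s) (kF s) s"
 let ?ok = "%F (P :: ('u, 'u, 'u set, 'u fn) func) s. is_functor (op_cat C) E F & is_functor C SetC P & are_colims E L C F P s"
 have ft: "functor_tensor E L R C ?D F P (dP s) (dF s) (kP s) (kF s)" if "?ok F P s" for F P s
  using that functor_tensor_of_colims[OF assms(1)] unfolding are_colims_def Let_def by blast
 have cmp: "EX r1 r4 t1 t2 t3. ?cmp F P s r1 r4 t1 t2 t3" if ok: "?ok F P s" for F P s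
  using ok unfolding are_colims_def Let_def by (intro functor_tensor.comparison_exists[OF ft[OF ok]]) blast+
 have "EX t. ?ok F P s --> (EX r1 r4. ?cmp F P s r1 r4 (fst t) (fst (snd t)) (snd (snd t)))" for F P s
 proof (cases "?ok F P s")
  case True
  then obtain r1 r4 t1 t2 t3 where "?cmp F P s r1 r4 t1 t2 t3" using cmp by blast
  then show ?thesis by (intro exI[of _ "(t1, t2, t3)"]) auto
 next
  case False
  then show ?thesis by (intro exI impI) (rule notE)
 qed
 then obtain t where t: "!!F P s. ?ok F P s ==> EX r1 r4. ?cmp F P s r1 r4 (fst (t F P s)) (fst (snd (t F P s))) (snd (snd (t F P s)))"
  by metis
 let ?t1 = "%F P s. fst (t F P s)" and ?t2 = "%F P s. fst (snd (t F P s))" and ?t3 = "%F P s. snd (snd (t F P s))"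
 have iso: "is_iso E (ext_colim s) (intF_colim s) (?t1 F P s) & is_iso E (intF_colim s) (intP_colim s) (?t2 F P s) &
   is_iso E (intP_colim s) (ix_colim s) (?t3 F P s)" if ok: "?ok F P s" for F P s
  using t[OF ok] unfolding functor_tensor.comparison_def[OF ft[OF ok]] by blast
 have nat: "EX a b m1 m2 m3 m4.
   corresponding_map E (op_cat C) (iop ?D) \<alpha> (dF s) (kF s) (dF s') (kF s') a &
   corresponding_map E C ?D (%c. fAr L (\<beta> c)) (dP s) (kP s) (dP s') (kP s') b &
   induced_ext E C P \<alpha> \<beta> s s' m1 & induced_intF E a b s s' m2 & induced_intP E a b s s' m3 & induced_ix E a b s s' m4 &
   ?t1 F' P' s' $\<^bsub>E\<^esub> m1 = m2 $\<^bsub>E\<^esub> ?t1 F P s & ?t2 F' P' s' $\<^bsub>E\<^esub> m2 = m3 $\<^bsub>E\<^esub> ?t2 F P s & ?t3 F' P' s' $\<^bsub>E\<^esub> m3 = m4 $\<^bsub>E\<^esub> ?t3 F P s"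
  if ok: "?ok F P s" and ok': "?ok F' P' s'" and \<alpha>: "is_nat (op_cat C) E F F' \<alpha>" and \<beta>: "is_nat C SetC P P' \<beta>" for F P s F' P' s' \<alpha> \<beta>
 proof -
  interpret T: functor_tensor E L R C ?D F P "dP s" "dF s" "kP s" "kF s" by (rule ft[OF ok])
  interpret T': functor_tensor E L R C ?D F' P' "dP s'" "dF s'" "kP s'" "kF s'" by (rule ft[OF ok'])
  have "\<beta> c : hom SetC (fOb P c) (fOb P' c)" if "c : Obj C" for c using \<beta> that by (simp add: is_nat_def)
  note \<beta>h = this
  have L\<beta>: "is_nat C E (fcomp L P) (fcomp L P') (%c. fAr L (\<beta> c))"
   unfolding is_nat_def fcomp_def func.simps
  proof (intro conjI ballI)
   show "fAr L (\<beta> c) : hom E (fOb L (fOb P c)) (fOb L (fOb P' c))" if "c : Obj C" for c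
    using L_arr[OF \<beta>h[OF that]] by (simp add: hom_def)
   fix f assume f: "f : Arr C"
   then have o: "Src C f : Obj C" "Tgt C f : Obj C" by simp_all
   have e: "\<beta> (Tgt C f) $\<^bsub>SetC\<^esub> fAr P f = fAr P' f $\<^bsub>SetC\<^esub> \<beta> (Src C f)" using \<beta> f by (simp add: is_nat_def)
   show "fAr L (\<beta> (Tgt C f)) $\<^bsub>E\<^esub> fAr L (fAr P f) = fAr L (fAr P' f) $\<^bsub>E\<^esub> fAr L (\<beta> (Src C f))"
    using L_comp[OF T.P_hom[OF f] \<beta>h[OF o(2)]] L_comp[OF \<beta>h[OF o(1)] T'.P_hom[OF f]] e by simp
  qed
  obtain b where b: "corresponding_map E C ?D (%c. fAr L (\<beta> c)) (dP s) (kP s) (dP s') (kP s') b"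
   using I.diagram_map_exists[OF T.LP T'.LP T.corrU T'.corrU L\<beta>] by blast
  obtain a where a: "corresponding_map E (op_cat C) (iop ?D) \<alpha> (dF s) (kF s) (dF s') (kF s') a"
   using O.diagram_map_exists[OF T.F T'.F T.corrV T'.corrV \<alpha>] by blast
  interpret M: tensor_map E L R C ?D F P "dP s" "dF s" "kP s" "kF s" F' P' "dP s'" "dF s'" "kP s'" "kF s'" \<alpha> \<beta> a b
   by unfold_locales (rule \<alpha> \<beta> a b)+
  obtain r1 r4 where c: "T.comparison s r1 r4 (?t1 F P s) (?t2 F P s) (?t3 F P s)" using t[OF ok] by blast
  obtain r1' r4' where c': "T'.comparison s' r1' r4' (?t1 F' P' s') (?t2 F' P' s') (?t3 F' P' s')" using t[OF ok'] by blast
  note k = c[unfolded T.comparison_def] and k' = c'[unfolded T'.comparison_def]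
  note q = k[THEN conjunct1] k[THEN conjunct2, THEN conjunct2, THEN conjunct1]
  from k have q: "T.is_tensor (ext_colim s) r1" "T.is_tensor (intF_colim s) (intF_leg s)" "T.is_tensor (intP_colim s) (intP_leg s $\<^bsub>E\<^esub> T.swap)"
    "T.is_tensor (ix_colim s) r4"
   and l1: "ALL c : Obj C. ALL x : fOb P c. r1 $\<^bsub>E\<^esub> T.leg c x = ext_leg s (c, x)"
   and l3: "intP_leg s : hom E (pbOb E (anc (dF s)) (anc (dP s))) (intP_colim s)"
   and l4: "ALL J : Obj E. ALL x : hom E J (tot (dF s)). ix_leg s (bang E J) x = T.ix_tensor (ix_colim s) r4 (bang E J) x"
   and th: "is_iso E (ext_colim s) (intF_colim s) (?t1 F P s)" "?t1 F P s $\<^bsub>E\<^esub> r1 = intF_leg s"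
    "is_iso E (intF_colim s) (intP_colim s) (?t2 F P s)" "?t2 F P s $\<^bsub>E\<^esub> intF_leg s = intP_leg s $\<^bsub>E\<^esub> T.swap"
    "is_iso E (intP_colim s) (ix_colim s) (?t3 F P s)" "?t3 F P s $\<^bsub>E\<^esub> (intP_leg s $\<^bsub>E\<^esub> T.swap) = r4"
   by blast+
  from k' have q': "T'.is_tensor (ext_colim s') r1'" "T'.is_tensor (intF_colim s') (intF_leg s')" "T'.is_tensor (intP_colim s') (intP_leg s' $\<^bsub>E\<^esub> T'.swap)"
    "T'.is_tensor (ix_colim s') r4'"
   and l1': "ALL c : Obj C. ALL x : fOb P' c. r1' $\<^bsub>E\<^esub> T'.leg c x = ext_leg s' (c, x)"
   and l3': "intP_leg s' : hom E (pbOb E (anc (dF s')) (anc (dP s'))) (intP_colim s')"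
   and l4': "ALL J : Obj E. ALL x : hom E J (tot (dF s')). ix_leg s' (bang E J) x = T'.ix_tensor (ix_colim s') r4' (bang E J) x"
   and th': "is_iso E (ext_colim s') (intF_colim s') (?t1 F' P' s')" "?t1 F' P' s' $\<^bsub>E\<^esub> r1' = intF_leg s'"
    "is_iso E (intF_colim s') (intP_colim s') (?t2 F' P' s')" "?t2 F' P' s' $\<^bsub>E\<^esub> intF_leg s' = intP_leg s' $\<^bsub>E\<^esub> T'.swap"
    "is_iso E (intP_colim s') (ix_colim s') (?t3 F' P' s')" "?t3 F' P' s' $\<^bsub>E\<^esub> (intP_leg s' $\<^bsub>E\<^esub> T'.swap) = r4'"
   by blast+
  obtain m1 where m1: "m1 : hom E (ext_colim s) (ext_colim s')" "m1 $\<^bsub>E\<^esub> r1 = r1' $\<^bsub>E\<^esub> M.w" by (rule M.tensor_map_exists[OF q(1) q'(1)])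
  obtain m2 where m2: "m2 : hom E (intF_colim s) (intF_colim s')" "m2 $\<^bsub>E\<^esub> intF_leg s = intF_leg s' $\<^bsub>E\<^esub> M.w" by (rule M.tensor_map_exists[OF q(2) q'(2)])
  obtain m3 where m3: "m3 : hom E (intP_colim s) (intP_colim s')" "m3 $\<^bsub>E\<^esub> (intP_leg s $\<^bsub>E\<^esub> T.swap) = (intP_leg s' $\<^bsub>E\<^esub> T'.swap) $\<^bsub>E\<^esub> M.w"
   by (rule M.tensor_map_exists[OF q(3) q'(3)])
  obtain m4 where m4: "m4 : hom E (ix_colim s) (ix_colim s')" "m4 $\<^bsub>E\<^esub> r4 = r4' $\<^bsub>E\<^esub> M.w" by (rule M.tensor_map_exists[OF q(4) q'(4)])
  have "induced_ext E C P \<alpha> \<beta> s s' m1" by (rule M.induced_ext_of_tensor[OF q(1) q'(1) l1 l1' m1])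
  moreover have "induced_intF E a b s s' m2" unfolding induced_intF_def using m2 by (simp only: M.w_def simp_thms)
  moreover have "induced_intP E a b s s' m3" by (rule M.induced_intP_of_tensor[OF l3 l3' m3 refl refl refl refl])
  moreover have "induced_ix E a b s s' m4" by (rule M.induced_ix_of_tensor[OF q(4) q'(4) l4 l4' m4 refl refl refl refl])
  moreover have "?t1 F' P' s' $\<^bsub>E\<^esub> m1 = m2 $\<^bsub>E\<^esub> ?t1 F P s" by (rule M.comparison_square[OF q(1,2) q'(1,2) th(1,2) th'(1,2) m1 m2])
  moreover have "?t2 F' P' s' $\<^bsub>E\<^esub> m2 = m3 $\<^bsub>E\<^esub> ?t2 F P s" by (rule M.comparison_square[OF q(2,3) q'(2,3) th(3,4) th'(3,4) m2 m3])
  moreover have "?t3 F' P' s' $\<^bsub>E\<^esub> m3 = m4 $\<^bsub>E\<^esub> ?t3 F P s" by (rule M.comparison_square[OF q(3,4) q'(3,4) th(5,6) th'(5,6) m3 m4])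
  ultimately show ?thesis using a b by (intro exI conjI)
 qed
 have "(ALL F P s. ?ok F P s --> is_iso E (ext_colim s) (intF_colim s) (?t1 F P s) &
   is_iso E (intF_colim s) (intP_colim s) (?t2 F P s) & is_iso E (intP_colim s) (ix_colim s) (?t3 F P s))"
  using iso by blast
 note isos = this
 show ?thesis
 proof (rule conjI)
  show "ALL F P. is_functor (op_cat C) E F & is_functor C SetC P --> (EX s. are_colims E L C F P s)" using ex by blast
 next
  show "?G" by (rule exI[of _ ?t1], rule exI[of _ ?t2], rule exI[of _ ?t3], rule conjI, rule isos)
    (intro allI impI nat; elim conjE; (intro conjI)?; assumption)
 qed
qed

end
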